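(* Let $I=[\eta,\xi]\subset\mathbb{R}$ be a compact interval, let $0<c_1\le c_2$, and let $f\in\mathcal{F}(I;c_1,c_2)$ have a Lipschitz continuous second derivative. Consider the finite family of real numbers $u=qf(a/q)$ indexed by pairs $(a,q)\in\mathbb{Z}\times\mathbb{N}$ with $q\le Q$ and $a/q\in I$ (with $a,q$ not necessarily coprime), and let $N=N(Q)$ be the number of such pairs. For $\alpha<\beta<\alpha+1$ let $Z(N;\alpha,\beta)$ be the number of these pairs for which $qf(a/q)\in(\alpha,\beta)\pmod 1$, let $D(N;\alpha,\beta)=Z(N;\alpha,\beta)-(\beta-\alpha)N$ and $D(N)=\sup_{\alpha,\beta}|D(N;\alpha,\beta)|$. Then for any $\varepsilon>0$, uniformly in $Q>1$ and $\alpha<\beta<\alpha+1$, $$D(N;\alpha,\beta)\ll (\beta-\alpha)^{1/2}\log\left((\beta-\alpha)^{-1}\right)N^{3/4}+N^{1/2+\varepsilon},$$ and $$D(N)\ll N^{3/4},$$ where the implied constants depend only on $I$, $c_1$, $c_2$, $\varepsilon$ and the Lipschitz constant of $f''$.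
   Context: $\mathcal{F}(I;c_1,c_2)$ denotes the set of $C^2$ functions $f:I\to\mathbb{R}$ with $c_1\le |f''(x)|\le c_2$ for all $x\in I$.
   Formalization: The factor log((β−α)^{-1}) is replaced by max(1, log((β−α)^{-1})), because the printed bound fails as β−α→1 (e.g. f(x)=x² on [0,1]); the interval I is taken with η<ξ, since f'' has no meaning on a single point. *)

theory Defs
  imports "HOL-Analysis.Analysis"
begin

text \<open>Derivatives are taken within the set, hence one-sided at the endpoints of a compact interval.
  \<open>deriv_on S f x\<close> is only meaningful where \<open>f\<close> is differentiable within \<open>S\<close> and \<open>x\<close> is a
  limit point of \<open>S\<close>.\<close>

definition deriv_on :: "real set \<Rightarrow> (real \<Rightarrow> real) \<Rightarrow> real \<Rightarrow> real" where
  "deriv_on S f x = vector_derivative f (at x within S)"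

abbreviation second_deriv_on :: "real set \<Rightarrow> (real \<Rightarrow> real) \<Rightarrow> real \<Rightarrow> real" where
  "second_deriv_on S f \<equiv> deriv_on S (deriv_on S f)"

definition C2_on :: "real set \<Rightarrow> (real \<Rightarrow> real) \<Rightarrow> bool" where
  "C2_on S f \<longleftrightarrow>
     f differentiable_on S \<and> deriv_on S f differentiable_on S \<and>
     continuous_on S (second_deriv_on S f)"

definition F_class :: "real set \<Rightarrow> real \<Rightarrow> real \<Rightarrow> (real \<Rightarrow> real) set" where
  "F_class S c1 c2 =
     {f. C2_on S f \<and>
         (\<forall>x\<in>S. c1 \<le> \<bar>second_deriv_on S f x\<bar> \<and> \<bar>second_deriv_on S f x\<bar> \<le> c2)}"

definition frac_pairs :: "real set \<Rightarrow> real \<Rightarrow> (int \<times> nat) set" where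
  "frac_pairs S Q = {(a, q). 1 \<le> q \<and> real q \<le> Q \<and> real_of_int a / real q \<in> S}"

definition N_pairs :: "real set \<Rightarrow> real \<Rightarrow> nat" where
  "N_pairs S Q = card (frac_pairs S Q)"

definition in_interval_mod1 :: "real \<Rightarrow> real \<Rightarrow> real \<Rightarrow> bool" where
  "in_interval_mod1 \<alpha> \<beta> u \<longleftrightarrow> (\<exists>k::int. u + real_of_int k \<in> {\<alpha><..<\<beta>})"

definition Z_count :: "real set \<Rightarrow> (real \<Rightarrow> real) \<Rightarrow> real \<Rightarrow> real \<Rightarrow> real \<Rightarrow> nat" where
  "Z_count S f Q \<alpha> \<beta> =
     card {(a, q) \<in> frac_pairs S Q.
             in_interval_mod1 \<alpha> \<beta> (real q * f (real_of_int a / real q))}"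

definition discr :: "real set \<Rightarrow> (real \<Rightarrow> real) \<Rightarrow> real \<Rightarrow> real \<Rightarrow> real \<Rightarrow> real" where
  "discr S f Q \<alpha> \<beta> = real (Z_count S f Q \<alpha> \<beta>) - (\<beta> - \<alpha>) * real (N_pairs S Q)"

definition discr_sup :: "real set \<Rightarrow> (real \<Rightarrow> real) \<Rightarrow> real \<Rightarrow> real" where
  "discr_sup S f Q =
     (SUP (\<alpha>, \<beta>) \<in> {(\<alpha>, \<beta>). \<alpha> < \<beta> \<and> \<beta> < \<alpha> + 1}. \<bar>discr S f Q \<alpha> \<beta>\<bar>)"

text \<open>The logarithm of an asymptotic bound, with the usual convention that it is at least \<open>1\<close>.
  The truncation only matters for intervals of length \<open>\<delta> > exp (-1)\<close> and only changes the bound by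
  more than a constant factor as \<open>\<delta>\<close> tends to \<open>1\<close>.  There the untruncated \<open>ln (1 / \<delta>)\<close> tends
  to \<open>0\<close> and would give a false bound: the discrepancy of an interval is, up to sign, that of its
  complement mod 1, and for \<open>f x = x\<^sup>2\<close> on \<open>[0,1]\<close> and arcs of length \<open>\<delta>'\<close> it is not
  \<open>O(\<delta>' * N powr (3/4) + N powr (1/2 + \<epsilon>))\<close> uniformly in the arc.\<close>

definition log_bound :: "real \<Rightarrow> real" where
  "log_bound \<delta> = max 1 (ln (1 / \<delta>))"

text \<open>Neither \<open>card\<close> nor the real-valued supremum takes its default value here.\<close>

lemma finite_frac_pairs:
  assumes "bounded S"
  shows "finite (frac_pairs S Q)"
proof -
  obtain B where B: "\<And>x. x \<in> S \<Longrightarrow> \<bar>x\<bar> \<le> B"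
    using assms by (auto simp: bounded_iff)
  have "frac_pairs S Q \<subseteq> {-\<lceil>\<bar>B\<bar> * \<bar>Q\<bar>\<rceil>..\<lceil>\<bar>B\<bar> * \<bar>Q\<bar>\<rceil>} \<times> {..nat \<lfloor>\<bar>Q\<bar>\<rfloor>}"
  proof
    fix p assume p: "p \<in> frac_pairs S Q"
    obtain a q where [simp]: "p = (a, q)" by (cases p)
    have q: "1 \<le> q" "real q \<le> Q" and "real_of_int a / real q \<in> S"
      using p by (auto simp: frac_pairs_def)
    then have "\<bar>real_of_int a / real q\<bar> \<le> \<bar>B\<bar>" using B by fastforce
    then have "\<bar>real_of_int a\<bar> \<le> \<bar>B\<bar> * real q" using q by (simp add: abs_divide field_simps)
    also have "\<dots> \<le> \<bar>B\<bar> * \<bar>Q\<bar>" using q by (intro mult_left_mono) auto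
    finally have "\<bar>real_of_int a\<bar> \<le> real_of_int \<lceil>\<bar>B\<bar> * \<bar>Q\<bar>\<rceil>" by linarith
    then have "\<bar>a\<bar> \<le> \<lceil>\<bar>B\<bar> * \<bar>Q\<bar>\<rceil>" by linarith
    moreover have "q \<le> nat \<lfloor>\<bar>Q\<bar>\<rfloor>" using q by linarith
    ultimately show "p \<in> {-\<lceil>\<bar>B\<bar> * \<bar>Q\<bar>\<rceil>..\<lceil>\<bar>B\<bar> * \<bar>Q\<bar>\<rceil>} \<times> {..nat \<lfloor>\<bar>Q\<bar>\<rfloor>}" by auto
  qed
  then show ?thesis by (rule finite_subset) simp
qed

lemma bdd_above_discr:
  assumes "bounded S"
  shows "bdd_above ((\<lambda>(\<alpha>, \<beta>). \<bar>discr S f Q \<alpha> \<beta>\<bar>) ` {(\<alpha>, \<beta>). \<alpha> < \<beta> \<and> \<beta> < \<alpha> + 1})"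
proof (rule bdd_aboveI2)
  fix p :: "real \<times> real" assume p: "p \<in> {(\<alpha>, \<beta>). \<alpha> < \<beta> \<and> \<beta> < \<alpha> + 1}"
  obtain \<alpha> \<beta> where [simp]: "p = (\<alpha>, \<beta>)" by (cases p)
  have "Z_count S f Q \<alpha> \<beta> \<le> N_pairs S Q"
    unfolding Z_count_def N_pairs_def by (rule card_mono[OF finite_frac_pairs[OF assms]]) auto
  moreover have "0 \<le> (\<beta> - \<alpha>) * real (N_pairs S Q)" using p by auto
  moreover have "(\<beta> - \<alpha>) * real (N_pairs S Q) \<le> 1 * real (N_pairs S Q)"
    using p by (intro mult_right_mono) auto
  ultimately have "\<bar>discr S f Q \<alpha> \<beta>\<bar> \<le> real (N_pairs S Q)"
    unfolding discr_def by linarith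
  then show "(case p of (\<alpha>, \<beta>) \<Rightarrow> \<bar>discr S f Q \<alpha> \<beta>\<bar>) \<le> real (N_pairs S Q)" by simp
qed

end

theory Submission
  imports Defs "HOL-Real_Asymp.Real_Asymp"
begin

text \<open>An Erdos-Turan inequality reduces the discrepancy to the sums of \<open>e(k q f(a/q))\<close> over all
  fractions \<open>a/q\<close>.  Truncated Poisson summation in \<open>a\<close> and stationary phase turn such a sum into one over
  \<open>\<nu>/k\<close> with phase \<open>- q (k g(\<nu>/k))\<close>, where \<open>g\<close> is the Legendre transform of \<open>f\<close> (after \<open>f\<close> has been extended
  to the line and made convex).  The phase is linear in \<open>q\<close>, so the sum over \<open>q\<close> is geometric and bounded by
  \<open>min(n, 1/\<parallel>k g(\<nu>/k)\<parallel>)\<close>.  It remains to count the fractions \<open>\<nu>/k\<close>, \<open>k \<le> K\<close>, with \<open>k g(\<nu>/k)\<close> within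
  \<open>\<delta>\<close> of an integer; the claim is \<open>O(K\<^sup>\<epsilon> (\<delta> K\<^sup>2 + K))\<close>.  For \<open>\<delta>\<close> a little larger than \<open>1/K\<close> this follows by induction
  on \<open>K\<close> from the same duality, which brings back \<open>f\<close> with denominators up to \<open>1/\<delta>\<close>.  For
  \<open>\<delta> = K powr (-1 - \<kappa>)\<close>, where no power of \<open>K\<close> may be lost, it is elementary: the points near a short arc of
  the curve lie on a line, and the lines containing many of them are nearly tangent, so they are rational
  points very close to the dual curve, with smaller denominators.\<close>

subsection \<open>Exponential sums\<close>

text \<open>The weights decide what the counting problem has to deliver. With n the integer part of
  Q, the exponential sum of frequency h carries the factor sqrt (n/h) from stationary phase, and a
  dual fraction for which h g(\<nu>/h) is practically an integer contributes the full n. If there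
  are O(J log J) such fractions with denominators up to J, the Erdos-Turan weights min(\<delta>,
  1/h) turn them into n^(3/2) sqrt \<delta> log(1/\<delta>), which is the main term because N is of
  order n^2. A loss of J^\<epsilon> in this count would survive as a power of 1/\<delta>. Fractions
  farther from the integers contribute only n^(1+\<epsilon>) in the end, and there such a loss is
  harmless. Hence the two counts by different methods. Both are inductions that pass from f to its
  transform g, so their constants may depend on the function only through data that the Legendre
  transform preserves: the two-sided bound B for the second derivative, its Lipschitz constant L,
  and the lengths of the windows.\<close>

definition ee :: "real \<Rightarrow> complex" where
  "ee x = cis (2 * pi * x)"

definition int_dist :: "real \<Rightarrow> real" where
  "int_dist x = \<bar>x - of_int (round x)\<bar>"

text \<open>For \<open>x\<close> \<ge> 0 this is min(Q, 1/x), written with a case distinction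
  because \<open>1 / 0 = 0\<close> would make the minimum vanish at \<open>x = 0\<close>, where the
  value has to be \<open>Q\<close>.\<close>

definition trunc_recip :: "real \<Rightarrow> real \<Rightarrow> real" where
  "trunc_recip Q x = (if Q * x \<le> 1 then Q else 1 / x)"

lemma ee_0 [simp]: "ee 0 = 1"
  by (simp add: ee_def)

lemma ee_add: "ee (x + y) = ee x * ee y"
  by (simp add: ee_def cis_mult distrib_left)

lemma cnj_ee: "cnj (ee x) = ee (- x)"
  by (simp add: ee_def cis_cnj)

lemma norm_ee [simp]: "norm (ee x) = 1"
  by (simp add: ee_def)

lemma ee_of_int [simp]: "ee (of_int n) = 1"
  by (simp add: ee_def cis_multiple_2pi)

lemma ee_mult_of_nat: "ee (of_nat n * x) = ee x ^ n"
  by (simp add: ee_def Complex.DeMoivre mult.left_commute)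

lemma ee_half [simp]: "ee (1/2) = -1"
  by (simp add: ee_def)

lemma ee_eq_exp: "ee x = exp (complex_of_real (2 * pi * x) * \<i>)"
  by (simp add: ee_def cis_conv_exp mult.commute)

lemma has_vector_derivative_ee [derivative_intros]:
  assumes "(F has_real_derivative F') (at x within S)"
  shows "((\<lambda>t. ee (F t)) has_vector_derivative (2 * pi * \<i> * F' * ee (F x))) (at x within S)"
proof -
  have F: "(F has_derivative (\<lambda>h. F' * h)) (at x within S)"
    using assms by (simp add: has_field_derivative_def)
  have "((\<lambda>t. cis (2 * pi * F t)) has_derivative (\<lambda>h. (2 * pi * (F' * h)) *\<^sub>R (\<i> * cis (2 * pi * F x)))) (at x within S)"
    by (rule has_derivative_cis) (intro has_derivative_mult_right F)
  then show ?thesis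
    unfolding ee_def has_vector_derivative_def by (simp add: scaleR_conv_of_real mult_ac)
qed

lemma continuous_on_ee [continuous_intros]:
  "continuous_on S F \<Longrightarrow> continuous_on S (\<lambda>x. ee (F x))"
  unfolding ee_def by (intro continuous_intros)

lemma norm_ee_diff_le: "norm (ee x - ee y) \<le> 2 * pi * \<bar>x - y\<bar>"
proof -
  have "norm (ee x - ee y) = norm (ee y * (ee (x - y) - 1))"
    by (simp add: ring_distribs flip: ee_add)
  also have "\<dots> = 2 * \<bar>sin ((2 * pi * x - 2 * pi * y) / 2)\<bar>"
  proof -
    have "norm (ee (x - y) - 1) = 2 * \<bar>sin ((2 * pi * x - 2 * pi * y) / 2)\<bar>"
      using dist_exp_i_1[of "2 * pi * (x - y)"] unfolding ee_eq_exp right_diff_distrib[symmetric]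
      by (simp add: mult.commute)
    then show ?thesis by (simp add: norm_mult)
  qed
  also have "\<dots> \<le> 2 * \<bar>(2 * pi * x - 2 * pi * y) / 2\<bar>"
    by (intro mult_left_mono abs_sin_x_le_abs_x) auto
  also have "\<dots> = 2 * pi * \<bar>x - y\<bar>" 
    by (simp add: abs_mult flip: right_diff_distrib)
  finally show ?thesis .
qed

lemma norm_one_minus_ee: "norm (1 - ee x) = 2 * \<bar>sin (pi * x)\<bar>"
  using dist_exp_i_1[of "2 * pi * x"] by (simp add: ee_eq_exp mult.commute norm_minus_commute)

text \<open>Jordan's inequality: sine is concave on [0, pi], so it lies above its chord from 0 to
  pi/2.\<close>

lemma sin_ge_Jordan:
  assumes "\<bar>x\<bar> \<le> 1/2"
  shows "2 * \<bar>x\<bar> \<le> \<bar>sin (pi * x)\<bar>"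
proof -
  have *: "2 * y \<le> sin (pi * y)" if "0 \<le> y" "y \<le> 1/2" for y :: real
  proof -
    have "concave_on {0..pi} sin"
    proof (rule f''_le0_imp_concave[where f' = cos and f'' = "\<lambda>x. - sin x"])
      show "- sin x \<le> 0" if "x \<in> {0..pi}" for x :: real using that by (simp add: sin_ge_zero)
    qed (auto intro!: derivative_eq_intros)
    then have "(1 - 2*y) * sin 0 + (2*y) * sin (pi/2) \<le> sin ((1 - 2*y) *\<^sub>R 0 + (2*y) *\<^sub>R (pi/2))"
      using that by (intro concave_onD) (auto)
    then show ?thesis by (simp add: mult_ac)
  qed
  show ?thesis
  proof (cases "0 \<le> x")
    case True
    then show ?thesis using *[of x] assms by (simp add: abs_if)
  next
    case False
    then show ?thesis using *[of "-x"] assms by (simp add: abs_if)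
  qed
qed

lemma int_dist_nonneg [simp]: "0 \<le> int_dist x"
  by (simp add: int_dist_def)

lemma int_dist_le_half: "int_dist x \<le> 1/2"
  unfolding int_dist_def using of_int_round_abs_le[of x] by (simp add: abs_minus_commute)

lemma abs_sin_minus_int: "\<bar>sin (pi * (x - of_int n))\<bar> = \<bar>sin (pi * x)\<bar>"
proof -
  have "sin (pi * (x - of_int n)) = sin (pi * x) * cos (pi * of_int n) - cos (pi * x) * sin (pi * of_int n)"
    by (simp add: sin_diff right_diff_distrib)
  moreover have "sin (pi * of_int n) = 0" using sin_zero_iff_int2 by (metis mult.commute)
  moreover have "\<bar>cos (pi * of_int n)\<bar> = 1" by (metis calculation(2) cos_zero_iff_int2 sin_zero_abs_cos_one)
  ultimately show ?thesis by (simp add: abs_mult)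
qed

lemma sin_ge_int_dist: "2 * int_dist x \<le> \<bar>sin (pi * x)\<bar>"
  using sin_ge_Jordan[of "x - of_int (round x)"] int_dist_le_half[of x] abs_sin_minus_int[of x "round x"]
  by (simp add: int_dist_def)

text \<open>The trivial bound serves when \<open>int_dist x\<close> is at most 1/n. Otherwise the
  closed form has numerator at most 2 and denominator |1 - e(x)| = 2 |sin(pi x)|, which is at least
  4 \<open>int_dist x\<close>.\<close>

lemma norm_geometric_ee_le:
  "norm (\<Sum>q=1..n. ee (of_nat q * x)) \<le> trunc_recip (real n) (int_dist x)"
proof (cases "real n * int_dist x \<le> 1")
  case True
  have "norm (\<Sum>q=1..n. ee (of_nat q * x)) \<le> (\<Sum>q=1..n. norm (ee (of_nat q * x)))" by (rule norm_sum)
  then show ?thesis using True by (simp add: trunc_recip_def)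
next
  case False
  then have pos: "int_dist x > 0" by (cases "int_dist x = 0") (auto simp: less_le)
  then have s: "4 * int_dist x \<le> norm (1 - ee x)" using sin_ge_int_dist[of x] by (simp add: norm_one_minus_ee)
  then have ne: "ee x \<noteq> 1" using pos by auto
  have "(\<Sum>q=1..n. ee (of_nat q * x)) = (\<Sum>q=1..n. ee x ^ q)" by (simp add: ee_mult_of_nat)
  also have "\<dots> = ee x * (\<Sum>q<n. ee x ^ q)"
    by (simp add: sum_distrib_left sum.atLeast1_atMost_eq)
  also have "\<dots> = ee x * ((1 - ee x ^ n) / (1 - ee x))" using ne by (simp add: sum_gp_strict)
  finally have "norm (\<Sum>q=1..n. ee (of_nat q * x)) = norm (1 - ee x ^ n) / norm (1 - ee x)"
    by (simp add: norm_mult norm_divide)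
  also have "\<dots> \<le> 2 / norm (1 - ee x)"
    using norm_triangle_ineq4[of 1 "ee x ^ n"] by (intro divide_right_mono) (auto simp: norm_power)
  also have "\<dots> \<le> 2 / (4 * int_dist x)" using s pos by (intro divide_left_mono mult_pos_pos) auto
  also have "\<dots> \<le> 1 / int_dist x" using pos by (simp add: field_simps)
  finally show ?thesis using False by (simp add: trunc_recip_def)
qed

lemma trunc_recip_mono: "0 \<le> m \<Longrightarrow> m \<le> n \<Longrightarrow> 0 \<le> x \<Longrightarrow> trunc_recip m x \<le> trunc_recip n x"
proof (unfold trunc_recip_def, goal_cases)
  case 1
  have "m * x \<le> n * x" using 1 by (intro mult_right_mono)
  moreover have "m \<le> 1 / x" if "m * x \<le> 1" "x > 0" using that by (simp add: field_simps)
  moreover have "x > 0" if "\<not> n * x \<le> 1" using 1 that by (cases "x = 0") auto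
  ultimately show ?case using 1 by auto
qed

lemma trunc_recip_nonneg: "0 \<le> n \<Longrightarrow> 0 \<le> x \<Longrightarrow> 0 \<le> trunc_recip n x"
  by (auto simp: trunc_recip_def)

text \<open>Partial summation with increasing weights. It is applied to \<open>sqrt q\<close>, the
  amplitude that stationary phase attaches to the denominator q.\<close>

lemma Abel_summation_norm_le:
  fixes z :: "nat \<Rightarrow> complex" and w :: "nat \<Rightarrow> real"
  assumes mono: "\<And>i j. i \<le> j \<Longrightarrow> w i \<le> w j" and w0: "0 \<le> w 1" and n: "1 \<le> n"
    and G: "\<And>m. m \<le> n \<Longrightarrow> norm (\<Sum>q=1..m. z q) \<le> G"
  shows "norm (\<Sum>q=1..n. w q *\<^sub>R z q) \<le> 2 * w n * G"
proof -
  have "(\<Sum>q=1..n. w q *\<^sub>R z q) = w n *\<^sub>R (\<Sum>q=1..n. z q) - (\<Sum>q=1..<n. (w (Suc q) - w q) *\<^sub>R (\<Sum>i=1..q. z i))"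
    using n
  proof (induction n rule: dec_induct)
    case base
    then show ?case by simp
  next
    case (step n)
    then show ?case by (simp add: algebra_simps)
  qed
  also have "norm \<dots> \<le> norm (w n *\<^sub>R (\<Sum>q=1..n. z q)) + norm (\<Sum>q=1..<n. (w (Suc q) - w q) *\<^sub>R (\<Sum>i=1..q. z i))"
    by (rule norm_triangle_ineq4)
  also have "norm (w n *\<^sub>R (\<Sum>q=1..n. z q)) \<le> w n * G"
    using G[of n] mono[OF n] w0 by (simp add: mult_left_mono)
  also have "norm (\<Sum>q=1..<n. (w (Suc q) - w q) *\<^sub>R (\<Sum>i=1..q. z i)) \<le> (\<Sum>q=1..<n. (w (Suc q) - w q) * G)"
    by (intro sum_norm_le) (use G mono in \<open>auto intro!: mult_mono\<close>)
  also have "(\<Sum>q=1..<n. (w (Suc q) - w q) * G) = (w n - w 1) * G"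
    using sum_Suc_diff'[OF n, of w] by (simp flip: sum_distrib_right)
  also have "w n * G + (w n - w 1) * G \<le> 2 * w n * G"
    using w0 G[of 0] by (simp add: algebra_simps)
  finally show ?thesis by simp
qed

lemma norm_sqrt_ee_sum_le:
  "norm (\<Sum>q=1..n. sqrt (real q) *\<^sub>R ee (of_nat q * x)) \<le> 2 * sqrt (real n) * trunc_recip (real n) (int_dist x)"
proof (cases "n = 0")
  case False
  show ?thesis
  proof (rule Abel_summation_norm_le)
    fix m assume "m \<le> n"
    have "norm (\<Sum>q=1..m. ee (of_nat q * x)) \<le> trunc_recip (real m) (int_dist x)" by (rule norm_geometric_ee_le)
    also have "\<dots> \<le> trunc_recip (real n) (int_dist x)" using \<open>m \<le> n\<close> by (intro trunc_recip_mono) auto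
    finally show "norm (\<Sum>q=1..m. ee (of_nat q * x)) \<le> trunc_recip (real n) (int_dist x)" .
  qed (use False in auto)
qed (simp add: trunc_recip_def)

subsection \<open>Oscillatory integrals\<close>

text \<open>One integration by parts, with the boundary terms kept as a main term instead of being
  estimated: in \<open>osc_tail\<close> they are summed over many frequencies and cancel by
  alternation of signs. For nonnegative \<open>F''\<close> the majorant of the remainder has the
  explicit primitive \<open>- 1 / (2 * pi * F')\<close>.\<close>

lemma first_derivative_test_exact:
  fixes F F' F'' :: "real \<Rightarrow> real"
  assumes ab: "a \<le> b"
    and d1: "\<And>x. x \<in> {a..b} \<Longrightarrow> (F has_real_derivative F' x) (at x within {a..b})"
    and d2: "\<And>x. x \<in> {a..b} \<Longrightarrow> (F' has_real_derivative F'' x) (at x within {a..b})"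
    and nonneg: "\<And>x. x \<in> {a..b} \<Longrightarrow> 0 \<le> F'' x"
    and nz: "\<And>x. x \<in> {a..b} \<Longrightarrow> F' x \<noteq> 0"
  shows "norm (integral {a..b} (\<lambda>x. ee (F x)) -
               (ee (F b) / (2 * pi * \<i> * F' b) - ee (F a) / (2 * pi * \<i> * F' a)))
         \<le> (1 / F' a - 1 / F' b) / (2 * pi)"
proof -
  define G where "G x = ee (F x) / (2 * pi * \<i> * F' x)" for x
  define r where "r x = ee (F x) * (F'' x / (2 * pi * (F' x)\<^sup>2)) / \<i>" for x
  have contF: "continuous_on {a..b} F" using d1 by (rule DERIV_continuous_on)
  have Gd: "(G has_vector_derivative (ee (F x) - r x)) (at x within {a..b})" if "x \<in> {a..b}" for x
  proof -
    have inv: "((\<lambda>t. 1 / (2 * pi * F' t)) has_real_derivative - (F'' x / (2 * pi * (F' x)\<^sup>2))) (at x within {a..b})"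
      using nz[OF that] d2[OF that]
      by (auto intro!: derivative_eq_intros simp: power2_eq_square field_simps)
    have "((\<lambda>t. (1 / (2 * pi * F' t)) *\<^sub>R (ee (F t) / \<i>)) has_vector_derivative
       ((1 / (2 * pi * F' x)) *\<^sub>R (2 * pi * \<i> * F' x * ee (F x) / \<i>) + (- (F'' x / (2 * pi * (F' x)\<^sup>2))) *\<^sub>R (ee (F x) / \<i>))) (at x within {a..b})"
      by (rule has_vector_derivative_scaleR[OF inv])
         (intro has_vector_derivative_divide has_vector_derivative_ee d1[OF that])
    moreover have "(\<lambda>t. (1 / (2 * pi * F' t)) *\<^sub>R (ee (F t) / \<i>)) = G"
      unfolding G_def scaleR_conv_of_real
      by (rule ext) (simp only: of_real_divide of_real_mult of_real_1 times_divide_times_eq mult_1_left mult_ac)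
    moreover have "(1 / (2 * pi * F' x)) *\<^sub>R (2 * pi * \<i> * F' x * ee (F x) / \<i>) + (- (F'' x / (2 * pi * (F' x)\<^sup>2))) *\<^sub>R (ee (F x) / \<i>) = ee (F x) - r x"
      using nz[OF that] by (simp add: r_def scaleR_conv_of_real field_simps)
    ultimately show ?thesis by simp
  qed
  have I1: "((\<lambda>x. ee (F x) - r x) has_integral (G b - G a)) {a..b}"
    using fundamental_theorem_of_calculus[OF ab Gd] .
  have I2: "(\<lambda>x. ee (F x)) integrable_on {a..b}"
    using contF by (intro integrable_continuous_interval continuous_intros)
  have I3: "(r has_integral (integral {a..b} (\<lambda>x. ee (F x)) - (G b - G a))) {a..b}"
    using has_integral_diff[OF integrable_integral[OF I2] I1] by simp
  have I4: "((\<lambda>x. F'' x / (2 * pi * (F' x)\<^sup>2)) has_integral (1 / F' a - 1 / F' b) / (2 * pi)) {a..b}"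
  proof -
    have "((\<lambda>t. - 1 / (2 * pi * F' t)) has_vector_derivative F'' x / (2 * pi * (F' x)\<^sup>2)) (at x within {a..b})"
      if "x \<in> {a..b}" for x
      unfolding has_real_derivative_iff_has_vector_derivative[symmetric]
      using nz[OF that] d2[OF that]
      by (auto intro!: derivative_eq_intros simp: power2_eq_square field_simps)
    from fundamental_theorem_of_calculus[OF ab this] show ?thesis
      by (simp add: diff_divide_distrib mult.commute)
  qed
  have "norm (integral {a..b} r) \<le> integral {a..b} (\<lambda>x. F'' x / (2 * pi * (F' x)\<^sup>2))"
    using I3 I4 nonneg
    by (intro integral_norm_bound_integral) (auto simp: integrable_on_def r_def norm_mult norm_divide simp del: of_real_divide of_real_mult of_real_power)
  then show ?thesis
    using integral_unique[OF I3] integral_unique[OF I4] by (simp add: G_def)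
qed

text \<open>As \<open>F'\<close> increases, a bound at one suitable end keeps it away from 0 on the
  whole interval; boundary terms and remainder then combine to 2/m before the division by 2
  pi.\<close>

lemma first_derivative_test:
  fixes F F' F'' :: "real \<Rightarrow> real"
  assumes ab: "a \<le> b" and m: "0 < m"
    and d1: "\<And>x. (F has_real_derivative F' x) (at x)"
    and d2: "\<And>x. (F' has_real_derivative F'' x) (at x)"
    and nonneg: "\<And>x. 0 \<le> F'' x"
    and F': "m \<le> F' a \<or> F' b \<le> - m"
  shows "norm (integral {a..b} (\<lambda>x. ee (F x))) \<le> 1 / (pi * m)"
proof -
  have mono: "F' x \<le> F' y" if "x \<le> y" for x y
    using that by (rule DERIV_nonneg_imp_nondecreasing) (use d2 nonneg in auto)
  have nz: "F' x \<noteq> 0" if "x \<in> {a..b}" for x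
    using F' m mono[of a x] mono[of x b] that by auto
  define E where "E = ee (F b) / (2 * pi * \<i> * F' b) - ee (F a) / (2 * pi * \<i> * F' a)"
  have 1: "norm (integral {a..b} (\<lambda>x. ee (F x)) - E) \<le> (1 / F' a - 1 / F' b) / (2 * pi)"
    unfolding E_def
    by (rule first_derivative_test_exact[where F'' = F''])
       (use ab d1 d2 nonneg nz in \<open>auto intro: has_field_derivative_at_within\<close>)
  have "norm E \<le> norm (ee (F b) / (2 * pi * \<i> * F' b)) + norm (ee (F a) / (2 * pi * \<i> * F' a))"
    unfolding E_def by (rule norm_triangle_ineq4)
  also have "\<dots> = (1 / \<bar>F' b\<bar> + 1 / \<bar>F' a\<bar>) / (2 * pi)"
    by (simp add: norm_divide norm_mult add_divide_distrib mult.commute)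
  finally have 2: "norm E \<le> (1 / \<bar>F' b\<bar> + 1 / \<bar>F' a\<bar>) / (2 * pi)" .
  have "norm (integral {a..b} (\<lambda>x. ee (F x))) \<le> norm (integral {a..b} (\<lambda>x. ee (F x)) - E) + norm E"
    using norm_triangle_ineq[of "integral {a..b} (\<lambda>x. ee (F x)) - E" E] by simp
  also have "\<dots> \<le> (1 / F' a - 1 / F' b) / (2 * pi) + (1 / \<bar>F' b\<bar> + 1 / \<bar>F' a\<bar>) / (2 * pi)"
    using 1 2 by linarith
  also have "\<dots> = (1 / F' a - 1 / F' b + 1 / \<bar>F' b\<bar> + 1 / \<bar>F' a\<bar>) / (2 * pi)"
    by (simp add: add_divide_distrib diff_divide_distrib)
  also have "\<dots> \<le> (2 / m) / (2 * pi)"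
  proof (rule divide_right_mono)
    show "1 / F' a - 1 / F' b + 1 / \<bar>F' b\<bar> + 1 / \<bar>F' a\<bar> \<le> 2 / m"
    proof (cases "m \<le> F' a")
      case True
      then have "F' b \<ge> m" using mono[OF ab] by simp
      then have "\<bar>F' a\<bar> = F' a" "\<bar>F' b\<bar> = F' b" "1 / F' a \<le> 1 / m" using True m by (auto intro!: divide_left_mono)
      then show ?thesis by simp
    next
      case False
      then have b: "F' b \<le> - m" using F' by simp
      then have a: "F' a \<le> - m" using mono[OF ab] by simp
      have "1 / (- F' b) \<le> 1 / m" using b m by (intro divide_left_mono mult_pos_pos) auto
      moreover have "\<bar>F' a\<bar> = - F' a" "\<bar>F' b\<bar> = - F' b" using a b m by auto
      ultimately show ?thesis by simp
    qed
  qed simp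
  finally show ?thesis by (simp add: mult.commute)
qed

lemma ee_comp_integrable:
  assumes "\<And>x. (F has_real_derivative F' x) (at x)"
  shows "(\<lambda>x. ee (F x)) integrable_on {a..b}"
proof -
  have "continuous_on {a..b} F" using assms DERIV_isCont by (intro continuous_at_imp_continuous_on) blast
  then show ?thesis by (intro integrable_continuous_interval continuous_intros)
qed

lemma norm_integral_le_length:
  fixes f :: "real \<Rightarrow> complex"
  assumes "a \<le> b" "f integrable_on {a..b}" "\<And>x. x \<in> {a..b} \<Longrightarrow> norm (f x) \<le> M"
  shows "norm (integral {a..b} f) \<le> M * (b - a)"
proof -
  have "norm (integral {a..b} f) \<le> integral {a..b} (\<lambda>x. M)"
    using assms by (intro integral_norm_bound_integral) auto
  then show ?thesis using assms(1) by (simp add: mult.commute)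
qed

text \<open>Van der Corput's test. The interval is cut into a piece where \<open>F'\<close> is at
  most -sqrt m, a short middle piece, and a piece where \<open>F'\<close> is at least sqrt m; each
  of them may be degenerate.\<close>

lemma second_derivative_test:
  fixes F F' F'' :: "real \<Rightarrow> real"
  assumes m: "0 < m"
    and d1: "\<And>x. (F has_real_derivative F' x) (at x)"
    and d2: "\<And>x. (F' has_real_derivative F'' x) (at x)"
    and lower: "\<And>x. m \<le> F'' x"
  shows "norm (integral {a..b} (\<lambda>x. ee (F x))) \<le> 4 / sqrt m"
proof (cases "a \<le> b")
  case ab: True
  \<comment> \<open>This balances the two estimates: the trivial one on a middle piece of length
    \<open>2 * s\<close>, and 1/(pi m s) from the first derivative test outside, where |F'| \<ge> m
    s = sqrt m.\<close>
  define s where "s = 1 / sqrt m"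
  have s: "s > 0" and ms: "m * s = 1 / s" "1 / s = sqrt m" using m by (auto simp: s_def real_div_sqrt)
  have nonneg: "0 \<le> F'' x" for x using lower[of x] m by simp
  have int: "(\<lambda>x. ee (F x)) integrable_on {u..v}" for u v using d1 by (rule ee_comp_integrable)
  have grow: "m * (y - x) \<le> F' y - F' x" if "x \<le> y" for x y
  proof -
    have "F' x - m * x \<le> F' y - m * y" 
      by (rule DERIV_nonneg_imp_nondecreasing[OF that, where f = "\<lambda>t. F' t - m * t"])
         (use lower in \<open>auto intro!: exI derivative_eq_intros d2\<close>)
    then show ?thesis by (simp add: algebra_simps)
  qed
  have cut: "norm (integral {u..v} (\<lambda>x. ee (F x))) \<le> s" if "u \<le> v" "m * s \<le> F' u \<or> F' v \<le> - (m * s)" for u v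
  proof -
    have "norm (integral {u..v} (\<lambda>x. ee (F x))) \<le> 1 / (pi * (m * s))"
      by (rule first_derivative_test[OF that(1) _ d1 d2 nonneg that(2)]) (use m s in simp)
    also have "\<dots> = s / pi" using s by (simp add: ms(1))
    also have "\<dots> \<le> s" using s pi_ge_two by (simp add: field_simps)
    finally show ?thesis .
  qed
  have short: "norm (integral {u..v} (\<lambda>x. ee (F x))) \<le> v - u" if "u \<le> v" for u v
    using norm_integral_le_length[OF that int[of u v], of 1] by simp
  \<comment> \<open>the part of \<open>[a,b]\<close> where \<open>F'\<close> is small has length at most \<open>2 / sqrt m\<close>\<close>
  have cont: "isCont F' x" for x using d2 DERIV_isCont by blast
  obtain c where c: "a \<le> c" "c \<le> b" "c = a \<or> F' c \<le> - (m * s)" "c = b \<or> F' c \<ge> - (m * s)"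
  proof (cases "F' a \<ge> - (m * s) \<or> F' b \<le> - (m * s)")
    case True
    then show ?thesis using that[of a] that[of b] ab by auto
  next
    case False
    then obtain c where "a \<le> c" "c \<le> b" "F' c = - (m * s)"
      using IVT[of F' a "- (m * s)" b] ab cont by force
    then show ?thesis using that[of c] by auto
  qed
  define d where "d = min b (c + 2 * s)"
  have d: "c \<le> d" "d \<le> b" "d \<le> c + 2 * s" using c s by (auto simp: d_def)
  have d': "d = b \<or> F' d \<ge> m * s"
  proof (cases "d = b")
    case False
    then have "d = c + 2 * s" "c \<noteq> b" using d s by (auto simp: d_def min_def split: if_splits)
    then have "F' c \<ge> - (m * s)" "m * (2 * s) \<le> F' d - F' c" using c grow[OF d(1)] by auto
    then show ?thesis by simp
  qed simp
  have 1: "norm (integral {a..c} (\<lambda>x. ee (F x))) \<le> s"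
    using c(3) cut[OF c(1)] s by auto
  have 2: "norm (integral {c..d} (\<lambda>x. ee (F x))) \<le> 2 * s"
    using short[OF d(1)] d(3) by linarith
  have 3: "norm (integral {d..b} (\<lambda>x. ee (F x))) \<le> s"
    using d' cut[OF d(2)] s by auto
  have "integral {a..b} (\<lambda>x. ee (F x)) = integral {a..c} (\<lambda>x. ee (F x)) + integral {c..d} (\<lambda>x. ee (F x)) + integral {d..b} (\<lambda>x. ee (F x))"
    using Henstock_Kurzweil_Integration.integral_combine[OF c(1) c(2) int] Henstock_Kurzweil_Integration.integral_combine[OF d(1) d(2) int] by (simp add: add.assoc)
  also have "norm \<dots> \<le> s + 2 * s + s"
    by (intro norm_triangle_mono 1 2 3)
  finally show ?thesis by (simp add: s_def)
qed (use m in auto)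

text \<open>\<open>H x\<close> is the integral of e(t^2) from x to infinity. It converges only
  conditionally and is therefore obtained as a limit, with the first derivative test bounding the
  tails.\<close>

lemma Fresnel_exists:
  obtains H :: "real \<Rightarrow> complex" where
    "\<And>x. (H has_vector_derivative - ee (x\<^sup>2)) (at x)"
    "\<And>u. u > 0 \<Longrightarrow> norm (H u) \<le> 1 / u"
proof -
  define I where "I x = integral {0..x} (\<lambda>t. ee (t\<^sup>2))" for x
  have d: "((\<lambda>t. t\<^sup>2) has_real_derivative 2 * x) (at x)" "((*) 2 has_real_derivative 2) (at x)" for x :: real
    by (auto intro!: derivative_eq_intros)
  have int: "(\<lambda>x. ee (x\<^sup>2)) integrable_on {u..v}" for u v
    using d(1) by (rule ee_comp_integrable)
  have diff: "norm (I b - I a) \<le> 1 / (2 * a)" if "0 < a" "a \<le> b" for a b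
  proof -
    have "I b = I a + integral {a..b} (\<lambda>t. ee (t\<^sup>2))"
      unfolding I_def using Henstock_Kurzweil_Integration.integral_combine[OF _ _ int, of 0 a b] that by simp
    moreover have "norm (integral {a..b} (\<lambda>t. ee (t\<^sup>2))) \<le> 1 / (pi * (2 * a))"
      by (rule first_derivative_test[OF that(2) _ d]) (use that in auto)
    moreover have "\<dots> \<le> 1 / (1 * (2 * a))"
      using that pi_ge_two by (intro divide_left_mono mult_right_mono mult_pos_pos) auto
    ultimately show ?thesis by simp
  qed
  have "Cauchy (\<lambda>n. I (real n))"
  proof (rule CauchyI)
    fix e :: real assume "e > 0"
    then obtain M :: nat where M: "real M > 1 / e" using reals_Archimedean2 by blast
    then have M0: "real M > 0" using \<open>e > 0\<close> by (smt (verit) divide_nonneg_pos)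
    have *: "norm (I (real n) - I (real m)) < e" if "M \<le> m" "m \<le> n" for m n
    proof -
      have "norm (I (real n) - I (real m)) \<le> 1 / (2 * real m)" using diff[of "real m" "real n"] that M0 by simp
      also have "\<dots> \<le> 1 / (2 * real M)" using that M0 by (intro divide_left_mono) auto
      also have "\<dots> < e" using M M0 \<open>e > 0\<close> by (simp add: field_simps)
      finally show ?thesis .
    qed
    show "\<exists>M. \<forall>m\<ge>M. \<forall>n\<ge>M. norm (I (real m) - I (real n)) < e"
      using * by (metis nat_le_linear norm_minus_commute)
  qed
  then obtain l where l: "(\<lambda>n. I (real n)) \<longlonglongrightarrow> l" using Cauchy_convergent_iff convergent_def by blast
  have bound: "norm (l - I u) \<le> 1 / u" if "u > 0" for u
  proof -
    have "(\<lambda>n. norm (I (real n) - I u)) \<longlonglongrightarrow> norm (l - I u)"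
      by (intro tendsto_intros l)
    moreover have "\<forall>\<^sub>F n in sequentially. norm (I (real n) - I u) \<le> 1 / (2 * u)"
      using eventually_ge_at_top[of "nat \<lceil>u\<rceil>"] by eventually_elim (use diff[OF that] in \<open>auto simp: nat_le_iff ceiling_le_iff\<close>)
    ultimately have "norm (l - I u) \<le> 1 / (2 * u)" by (intro tendsto_upperbound) auto
    also have "\<dots> \<le> 1 / u" using that by (simp add: field_simps)
    finally show ?thesis .
  qed
  \<comment> \<open>For negative \<open>x\<close> the set \<open>{0..x}\<close> is empty and the
    integral over it is 0, so the primitive has to be continued to the left of 0 separately.\<close>
  define P where "P x = (if 0 \<le> x then I x else - integral {x..0} (\<lambda>t. ee (t\<^sup>2)))" for x
  have P: "P x = integral {a..x} (\<lambda>t. ee (t\<^sup>2)) - integral {a..0} (\<lambda>t. ee (t\<^sup>2))" if "a \<le> x" "a \<le> 0" for a x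
  proof (cases "0 \<le> x")
    case True
    then show ?thesis using Henstock_Kurzweil_Integration.integral_combine[OF _ _ int, of a 0 x] that by (simp add: P_def I_def eq_diff_eq add.commute)
  next
    case False
    then show ?thesis using Henstock_Kurzweil_Integration.integral_combine[OF _ _ int, of a x 0] that by (simp add: P_def algebra_simps)
  qed
  have Pd: "(P has_vector_derivative ee (x\<^sup>2)) (at x)" for x
  proof -
    define a b where "a = - \<bar>x\<bar> - 1" and "b = \<bar>x\<bar> + 1"
    have "((\<lambda>u. integral {a..u} (\<lambda>t. ee (t\<^sup>2))) has_vector_derivative ee (x\<^sup>2)) (at x within {a..b})"
      by (rule integral_has_vector_derivative) (auto intro!: continuous_intros simp: a_def b_def)
    then have "((\<lambda>u. integral {a..u} (\<lambda>t. ee (t\<^sup>2)) - integral {a..0} (\<lambda>t. ee (t\<^sup>2))) has_vector_derivative ee (x\<^sup>2)) (at x within {a<..<b})"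
      by (auto intro!: derivative_eq_intros elim: has_vector_derivative_within_subset)
    then have "(P has_vector_derivative ee (x\<^sup>2)) (at x within {a<..<b})"
      by (rule has_vector_derivative_transform[rotated 2]) (auto simp: P a_def b_def)
    moreover have "x \<in> {a<..<b}" by (auto simp: a_def b_def)
    ultimately show ?thesis by (metis at_within_open open_greaterThanLessThan)
  qed
  show ?thesis
  proof
    show "((\<lambda>x. l - P x) has_vector_derivative - ee (x\<^sup>2)) (at x)" for x
      by (auto intro!: derivative_eq_intros Pd)
    show "norm (l - P u) \<le> 1 / u" if "u > 0" for u
      using bound[OF that] that by (simp add: P_def)
  qed
qed

lemma nonneg_of_deriv_nonneg:
  fixes g g' :: "real \<Rightarrow> real"
  assumes "0 \<le> s" "g 0 = 0" "\<And>x. (g has_real_derivative g' x) (at x)" "\<And>x. 0 \<le> x \<Longrightarrow> 0 \<le> g' x"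
  shows "0 \<le> g s"
  using DERIV_nonneg_imp_nondecreasing[of 0 s g] assms by auto

lemma norm_add_diff_le:
  fixes a b c :: "'a::real_normed_vector"
  assumes "norm a \<le> A" "norm b \<le> B" "norm c \<le> C"
  shows "norm (a + b - c) \<le> A + B + C"
  using norm_triangle_ineq4[of "a + b" c] norm_triangle_ineq[of a b] assms by linarith

text \<open>For an exactly quadratic phase the integral is a Fresnel integral. In general the phase
  is compared with that case through \<open>y s = sqrt (2 * c * \<psi> s)\<close>: up to the factor
  \<open>\<psi>' / y\<close> the integrand is the derivative of a multiple of
  \<open>H (sqrt (\<mu> * \<psi>))\<close>, and this factor is 1 + O(s). As only a Lipschitz bound
  for \<open>\<psi>''\<close> is available, the derivative of the correction is O(1/s), which puts a
  logarithm into the error.\<close>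

lemma stationary_phase_half:
  fixes \<psi> \<psi>' \<psi>'' :: "real \<Rightarrow> real" and H :: "real \<Rightarrow> complex"
  assumes H1: "\<And>x. (H has_vector_derivative - ee (x\<^sup>2)) (at x)"
    and H2: "\<And>u. u > 0 \<Longrightarrow> norm (H u) \<le> 1 / u"
    and B: "1 \<le> B" and L: "0 \<le> L" and lam: "0 < \<mu>" and r: "0 < r"
    and d1: "\<And>x. (\<psi> has_real_derivative \<psi>' x) (at x)"
    and d2: "\<And>x. (\<psi>' has_real_derivative \<psi>'' x) (at x)"
    and lower: "\<And>x. 1 / B \<le> \<psi>'' x" and upper: "\<And>x. \<psi>'' x \<le> B"
    and lip: "\<And>x. \<bar>\<psi>'' x - \<psi>'' 0\<bar> \<le> L * \<bar>x\<bar>"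
    and z: "\<psi> 0 = 0" "\<psi>' 0 = 0"
  shows "norm (integral {0..r} (\<lambda>x. ee (\<mu> * \<psi> x)) - H 0 / sqrt (\<mu> * \<psi>'' 0 / 2))
    \<le> (6 * B ^ 10 * L + 2 * B) * ((1 + ln (1 + r * sqrt \<mu>)) / \<mu> + 1 / (\<mu> * r))"
proof -

  \<comment> \<open>Quadratic bounds for the phase\<close>
  define c where "c = \<psi>'' 0"
  have B0: "0 < B" using B by simp
  have c: "1 / B \<le> c" "c \<le> B" using lower upper by (auto simp: c_def)
  then have c0: "0 < c" using B0 by (smt (verit) divide_pos_pos)
  have lo1: "s / B \<le> \<psi>' s" and up1: "\<psi>' s \<le> B * s" and lo0: "s\<^sup>2 / (2 * B) \<le> \<psi> s" and up0: "\<psi> s \<le> B * s\<^sup>2 / 2"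
    if s: "0 \<le> s" for s
  proof -
    have a: "0 \<le> \<psi>' s - s / B" if "0 \<le> s" for s
      by (rule nonneg_of_deriv_nonneg[OF that, where g' = "\<lambda>x. \<psi>'' x - 1 / B"])
         (use z lower B0 in \<open>auto intro!: derivative_eq_intros d2\<close>)
    have b: "0 \<le> B * s - \<psi>' s" if "0 \<le> s" for s
      by (rule nonneg_of_deriv_nonneg[OF that, where g' = "\<lambda>x. B - \<psi>'' x"])
         (use z upper B0 in \<open>auto intro!: derivative_eq_intros d2\<close>)
    have a': "0 \<le> \<psi> s - s\<^sup>2 / (2 * B)"
      by (rule nonneg_of_deriv_nonneg[OF s, where g' = "\<lambda>x. \<psi>' x - x / B"])
         (use z a B0 in \<open>auto intro!: derivative_eq_intros d1\<close>)
    have b': "0 \<le> B * s\<^sup>2 / 2 - \<psi> s"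
      by (rule nonneg_of_deriv_nonneg[OF s, where g' = "\<lambda>x. B * x - \<psi>' x"])
         (use z b B0 in \<open>auto intro!: derivative_eq_intros d1\<close>)
    show "s / B \<le> \<psi>' s" "\<psi>' s \<le> B * s" "s\<^sup>2 / (2 * B) \<le> \<psi> s" "\<psi> s \<le> B * s\<^sup>2 / 2"
      using a[OF s] b[OF s] a' b' by auto
  qed
  \<comment> \<open>\<open>D\<close> vanishes identically for a quadratic phase. Its derivative is
    \<open>2 * \<psi>' * (\<psi>'' - c)\<close>, so the Lipschitz bound makes it of third
    order.\<close>
  define D where "D s = (\<psi>' s)\<^sup>2 - 2 * c * \<psi> s" for s
  have D: "\<bar>D s\<bar> \<le> B * L * s ^ 3" if s: "0 \<le> s" for s
  proof -
    have D': "(D has_real_derivative 2 * \<psi>' x * (\<psi>'' x - c)) (at x)" for x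
      unfolding D_def by (auto intro!: derivative_eq_intros d1 d2 simp: algebra_simps)
    have bd: "\<bar>2 * \<psi>' x * (\<psi>'' x - c)\<bar> \<le> 3 * B * L * x\<^sup>2" if "0 \<le> x" for x
    proof -
      have "\<bar>\<psi>' x\<bar> \<le> B * x" using lo1[OF that] up1[OF that] that B0 by (smt (verit) divide_nonneg_pos)
      moreover have "\<bar>\<psi>'' x - c\<bar> \<le> L * x" using lip[of x] that by (simp add: c_def)
      ultimately have "\<bar>\<psi>' x\<bar> * \<bar>\<psi>'' x - c\<bar> \<le> (B * x) * (L * x)" using that B0 by (intro mult_mono) auto
      moreover have "0 \<le> B * L * x\<^sup>2" using B0 L by simp
      moreover have "\<bar>2 * \<psi>' x * (\<psi>'' x - c)\<bar> = 2 * (\<bar>\<psi>' x\<bar> * \<bar>\<psi>'' x - c\<bar>)"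
        by (simp add: abs_mult)
      moreover have "(B * x) * (L * x) = B * L * x\<^sup>2" "3 * B * L * x\<^sup>2 = 3 * (B * L * x\<^sup>2)"
        by (simp_all add: power2_eq_square)
      ultimately show ?thesis by linarith
    qed
    have D0: "D 0 = 0" by (simp add: D_def z)
    have 3: "((\<lambda>s. B * L * s ^ 3) has_real_derivative 3 * B * L * x\<^sup>2) (at x)" for x
      by (auto intro!: derivative_eq_intros)
    have nn: "0 \<le> 3 * B * L * x\<^sup>2 + 2 * \<psi>' x * (\<psi>'' x - c)" if "0 \<le> x" for x
      using bd[OF that] by linarith
    have "0 \<le> B * L * s ^ 3 - D s"
      by (rule nonneg_of_deriv_nonneg[OF s _ DERIV_diff[OF 3 D']]) (use D0 bd in \<open>auto simp: abs_le_iff\<close>)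
    moreover have "0 \<le> B * L * s ^ 3 + D s"
      by (rule nonneg_of_deriv_nonneg[OF s _ DERIV_add[OF 3 D']]) (use D0 nn in auto)
    ultimately show ?thesis by auto
  qed

  \<comment> \<open>Comparison with an exactly quadratic phase\<close>
  define y where "y s = sqrt (2 * c * \<psi> s)" for s
  have psi_pos: "0 < \<psi> s" if "0 < s" for s
    using lo0[of s] that B0 by (smt (verit) divide_pos_pos zero_less_power)
  have y2: "(y s)\<^sup>2 = 2 * c * \<psi> s" if "0 < s" for s using psi_pos[OF that] c0 by (simp add: y_def)
  have ylo: "s / B \<le> y s" and yup: "y s \<le> B * s" and plo: "s / B \<le> \<psi>' s" and pup: "\<psi>' s \<le> B * s"
    and sB: "0 < s / B" if s: "0 < s" for s
  proof -
    have "(s / B)\<^sup>2 = 2 * (1 / B) * (s\<^sup>2 / (2 * B))" using B0 by (simp add: power2_eq_square)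
    also have "\<dots> \<le> 2 * c * \<psi> s" using c lo0[of s] s B0 c0 by (intro mult_mono) auto
    finally show "s / B \<le> y s" unfolding y_def by (rule real_le_rsqrt)
    have "2 * c * \<psi> s \<le> 2 * B * (B * s\<^sup>2 / 2)"
      using c up0[of s] s B0 c0 psi_pos[OF s] by (intro mult_mono) auto
    also have "\<dots> = (B * s)\<^sup>2" by (simp add: power2_eq_square)
    finally show "y s \<le> B * s" unfolding y_def using s B0 by (intro real_le_lsqrt) auto
  qed (use lo1[of s] up1[of s] that B0 in auto)
  \<comment> \<open>\<open>w\<close> measures the deviation from the quadratic case, as
    \<open>\<psi>' / y = 1 + w * \<psi>'\<close>. The function \<open>w'\<close> defined next is its
    derivative, with \<open>y' = c * \<psi>' / y\<close> inserted.\<close>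
  define w where "w s = 1 / y s - 1 / \<psi>' s" for s
  define w' where "w' s = \<psi>'' s / (\<psi>' s)\<^sup>2 - c * \<psi>' s / (y s) ^ 3" for s
  have diff: "\<bar>\<psi>' s - y s\<bar> \<le> B\<^sup>2 * L * s\<^sup>2 / 2" if s: "0 < s" for s
  proof -
    have pos: "0 < \<psi>' s + y s" "2 * (s / B) \<le> \<psi>' s + y s" using ylo[OF s] plo[OF s] sB[OF s] by auto
    have "\<bar>\<psi>' s - y s\<bar> * (2 * (s / B)) \<le> \<bar>\<psi>' s - y s\<bar> * (\<psi>' s + y s)" using pos by (intro mult_left_mono) auto
    also have "\<dots> = \<bar>(\<psi>' s - y s) * (\<psi>' s + y s)\<bar>" using pos by (simp add: abs_mult)
    also have "(\<psi>' s - y s) * (\<psi>' s + y s) = D s" using y2[OF s] by (simp add: D_def algebra_simps power2_eq_square)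
    also have "\<bar>D s\<bar> \<le> B * L * s ^ 3" using D[of s] s by simp
    also have "\<dots> = (B\<^sup>2 * L * s\<^sup>2 / 2) * (2 * (s / B))" using B0 by (simp add: power2_eq_square power3_eq_cube)
    finally show ?thesis by (rule mult_right_le_imp_le) (use sB[OF s] in simp)
  qed
  have wb: "\<bar>w s\<bar> \<le> B ^ 4 * L / 2" if s: "0 < s" for s
  proof -
    have pos: "0 < y s" "0 < \<psi>' s" using ylo[OF s] plo[OF s] sB[OF s] by auto
    have "\<bar>w s\<bar> = \<bar>\<psi>' s - y s\<bar> / (y s * \<psi>' s)" using pos by (simp add: w_def field_simps)
    also have "\<dots> \<le> (B\<^sup>2 * L * s\<^sup>2 / 2) / ((s / B) * (s / B))"
      using diff[OF s] ylo[OF s] plo[OF s] sB[OF s] pos B0 L by (intro frac_le mult_mono mult_pos_pos) auto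
    also have "\<dots> = B ^ 4 * L / 2" using s B0 by (simp add: field_simps power2_eq_square power4_eq_xxxx)
    finally show ?thesis .
  qed
  have w'b: "\<bar>w' s\<bar> \<le> (3 * B ^ 10 * L) * (1 / s)" if s: "0 < s" for s
  proof -
    have pos: "0 < y s" "0 < \<psi>' s" using ylo[OF s] plo[OF s] sB[OF s] by auto
    \<comment> \<open>The first summand is controlled by the Lipschitz bound; the second contains
      \<open>y ^ 3 - \<psi>' ^ 3\<close> in factored form, so that the bound \<open>diff\<close> for
      \<open>\<psi>' - y\<close> applies.\<close>
    have eq: "w' s = (\<psi>'' s - c) / (\<psi>' s)\<^sup>2 + c * ((y s - \<psi>' s) * ((y s)\<^sup>2 + y s * \<psi>' s + (\<psi>' s)\<^sup>2)) / ((\<psi>' s)\<^sup>2 * (y s) ^ 3)"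
      using pos by (simp add: w'_def field_simps power2_eq_square power3_eq_cube)
    have "\<bar>(\<psi>'' s - c) / (\<psi>' s)\<^sup>2\<bar> = \<bar>\<psi>'' s - c\<bar> / (\<psi>' s)\<^sup>2" by simp
    also have "\<dots> \<le> (L * s) / (s / B)\<^sup>2"
      using lip[of s] s L plo[OF s] sB[OF s] by (intro frac_le power_mono zero_less_power) (auto simp: c_def)
    also have "\<dots> = B\<^sup>2 * L * (1 / s)" using s B0 by (simp add: field_simps power2_eq_square)
    also have "\<dots> \<le> B ^ 10 * L * (1 / s)" using s B L by (intro mult_right_mono power_increasing) auto
    finally have 1: "\<bar>(\<psi>'' s - c) / (\<psi>' s)\<^sup>2\<bar> \<le> B ^ 10 * L * (1 / s)" .
    have q: "(y s)\<^sup>2 + y s * \<psi>' s + (\<psi>' s)\<^sup>2 \<le> 3 * (B * s)\<^sup>2"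
    proof -
      have "(y s)\<^sup>2 \<le> (B * s)\<^sup>2" "(\<psi>' s)\<^sup>2 \<le> (B * s)\<^sup>2" using yup[OF s] pup[OF s] pos by (auto intro!: power_mono)
      moreover have "y s * \<psi>' s \<le> (B * s) * (B * s)" using yup[OF s] pup[OF s] pos by (intro mult_mono) auto
      ultimately show ?thesis by (simp add: power2_eq_square)
    qed
    have "\<bar>c * ((y s - \<psi>' s) * ((y s)\<^sup>2 + y s * \<psi>' s + (\<psi>' s)\<^sup>2)) / ((\<psi>' s)\<^sup>2 * (y s) ^ 3)\<bar>
       = c * (\<bar>\<psi>' s - y s\<bar> * ((y s)\<^sup>2 + y s * \<psi>' s + (\<psi>' s)\<^sup>2)) / ((\<psi>' s)\<^sup>2 * (y s) ^ 3)"
      using pos c0 by (simp add: abs_mult abs_minus_commute)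
    also have "\<dots> \<le> B * ((B\<^sup>2 * L * s\<^sup>2 / 2) * (3 * (B * s)\<^sup>2)) / ((s / B)\<^sup>2 * (s / B) ^ 3)"
      using diff[OF s] q c c0 pos ylo[OF s] plo[OF s] sB[OF s] B0 L
      by (intro frac_le mult_mono mult_pos_pos zero_less_power power_mono) auto
    also have "\<dots> = 3 / 2 * B ^ 10 * L * (1 / s)"
      using s B0 by (simp add: field_simps power2_eq_square power3_eq_cube power4_eq_xxxx eval_nat_numeral)
    finally have 2: "\<bar>c * ((y s - \<psi>' s) * ((y s)\<^sup>2 + y s * \<psi>' s + (\<psi>' s)\<^sup>2)) / ((\<psi>' s)\<^sup>2 * (y s) ^ 3)\<bar> \<le> 3 / 2 * B ^ 10 * L * (1 / s)" .
    have "\<bar>w' s\<bar> \<le> B ^ 10 * L * (1 / s) + 3 / 2 * B ^ 10 * L * (1 / s)"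
      unfolding eq using 1 2 by (intro order_trans[OF abs_triangle_ineq] add_mono)
    also have "\<dots> = 5 / 2 * (B ^ 10 * L * (1 / s))" by simp
    also have "\<dots> \<le> 3 * (B ^ 10 * L * (1 / s))" using s B0 L by (intro mult_right_mono) auto
    also have "\<dots> = (3 * B ^ 10 * L) * (1 / s)" by simp
    finally show ?thesis .
  qed

  \<comment> \<open>The primitive built from \<open>H\<close>\<close>
  define \<gamma> where "\<gamma> = 1 / sqrt (\<mu> * c / 2)"
  have g0: "0 < \<gamma>" using lam c0 by (simp add: \<gamma>_def)
  define P where "P s = - (\<gamma> *\<^sub>R H (sqrt (\<mu> * \<psi> s)))" for s
  have contH: "isCont H x" for x using H1 has_vector_derivative_continuous by blast
  have contpsi: "isCont \<psi> x" for x using d1 DERIV_isCont by blast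
  have contP: "continuous_on S P" for S
  proof (intro continuous_at_imp_continuous_on ballI)
    fix x
    have "isCont (\<lambda>s. sqrt (\<mu> * \<psi> s)) x" by (intro continuous_intros contpsi)
    from isCont_o2[OF this contH] show "isCont P x" unfolding P_def by (intro continuous_intros)
  qed
  have mupsi: "0 < \<mu> * \<psi> s" if "0 < s" for s using psi_pos[OF that] lam by simp
  have dP: "(P has_vector_derivative ((\<psi>' s / y s) *\<^sub>R ee (\<mu> * \<psi> s))) (at s)" if s: "0 < s" for s
  proof -
    have "((\<lambda>t. sqrt (\<mu> * \<psi> t)) has_real_derivative \<mu> * \<psi>' s / (2 * sqrt (\<mu> * \<psi> s))) (at s)"
      using mupsi[OF s] by (auto intro!: derivative_eq_intros d1 simp: field_simps)
    from vector_diff_chain_at[OF this[unfolded has_real_derivative_iff_has_vector_derivative] H1]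
    have "((\<lambda>t. H (sqrt (\<mu> * \<psi> t))) has_vector_derivative (\<mu> * \<psi>' s / (2 * sqrt (\<mu> * \<psi> s))) *\<^sub>R - ee (\<mu> * \<psi> s)) (at s)"
      using mupsi[OF s] by (simp add: o_def less_imp_le)
    then have "(P has_vector_derivative (- (\<gamma> *\<^sub>R ((\<mu> * \<psi>' s / (2 * sqrt (\<mu> * \<psi> s))) *\<^sub>R - ee (\<mu> * \<psi> s))))) (at s)"
      unfolding P_def by (auto intro!: derivative_eq_intros)
    moreover have "\<gamma> * (\<mu> * \<psi>' s / (2 * sqrt (\<mu> * \<psi> s))) = \<psi>' s / y s"
    proof -
      have "sqrt (\<mu> * c / 2) * (2 * sqrt (\<mu> * \<psi> s)) = sqrt (\<mu>\<^sup>2 * (2 * c * \<psi> s))"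
      proof -
        have "sqrt (\<mu> * c / 2) * (2 * sqrt (\<mu> * \<psi> s)) = sqrt (\<mu> * c / 2) * (sqrt 4 * sqrt (\<mu> * \<psi> s))" by simp
        also have "\<dots> = sqrt (\<mu> * c / 2 * (4 * (\<mu> * \<psi> s)))" by (simp only: real_sqrt_mult)
        also have "\<mu> * c / 2 * (4 * (\<mu> * \<psi> s)) = \<mu>\<^sup>2 * (2 * c * \<psi> s)" by (simp add: power2_eq_square)
        finally show ?thesis .
      qed
      also have "\<dots> = \<mu> * y s" using lam by (simp add: real_sqrt_mult y_def)
      finally have *: "sqrt (\<mu> * c / 2) * (2 * sqrt (\<mu> * \<psi> s)) = \<mu> * y s" .
      have "\<gamma> * (\<mu> * \<psi>' s / (2 * sqrt (\<mu> * \<psi> s))) = \<mu> * \<psi>' s / (sqrt (\<mu> * c / 2) * (2 * sqrt (\<mu> * \<psi> s)))"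
        unfolding \<gamma>_def by simp
      then show ?thesis unfolding * using lam by simp
    qed
    ultimately show ?thesis by simp
  qed
  have rho: "\<psi>' s / y s = 1 + w s * \<psi>' s" if s: "0 < s" for s
    using ylo[OF s] plo[OF s] sB[OF s] by (simp add: w_def field_simps)
  have rho_b: "\<bar>w s * \<psi>' s\<bar> \<le> B ^ 5 * L / 2 * s" if s: "0 < s" for s
  proof -
    have "\<bar>w s * \<psi>' s\<bar> \<le> (B ^ 4 * L / 2) * (B * s)"
      unfolding abs_mult using wb[OF s] pup[OF s] plo[OF s] sB[OF s] B0 L by (intro mult_mono) auto
    then show ?thesis by (simp add: eval_nat_numeral mult_ac)
  qed

  \<comment> \<open>The error integral near the stationary point and away from it\<close>
  have intee: "(\<lambda>x. ee (\<mu> * \<psi> x)) integrable_on {u..v}" for u v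
    by (intro integrable_continuous_interval continuous_intros continuous_at_imp_continuous_on ballI contpsi)
  have near: "norm (integral {0..v} (\<lambda>x. ee (\<mu> * \<psi> x)) - (P v - P 0)) \<le> B ^ 5 * L / 2 * v\<^sup>2" if v: "0 < v" for v
  proof -
    have "((\<lambda>s. (\<psi>' s / y s) *\<^sub>R ee (\<mu> * \<psi> s)) has_integral (P v - P 0)) {0..v}"
    \<comment> \<open>\<open>dP\<close> is available only for s > 0, because the square root inside
      \<open>P\<close> is not differentiable at 0; continuity of \<open>P\<close> covers the end
      point, which is removed below as a finite spike.\<close>
    proof (rule fundamental_theorem_of_calculus_interior)
      show "(P has_vector_derivative (\<psi>' s / y s) *\<^sub>R ee (\<mu> * \<psi> s)) (at s)" if "s \<in> {0<..<v}" for s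
        using dP[of s] that by simp
    qed (use v contP in auto)
    from has_integral_diff[OF integrable_integral[OF intee] this]
    have I: "((\<lambda>s. ee (\<mu> * \<psi> s) - (\<psi>' s / y s) *\<^sub>R ee (\<mu> * \<psi> s)) has_integral (integral {0..v} (\<lambda>x. ee (\<mu> * \<psi> x)) - (P v - P 0))) {0..v}" .
    have "norm (integral {0..v} (\<lambda>x. ee (\<mu> * \<psi> x)) - (P v - P 0)) \<le> (B ^ 5 * L / 2 * v) * measure lborel (cbox 0 v)"
    proof (rule has_integral_bound_spike_finite[where S = "{0}" and f = "\<lambda>s. ee (\<mu> * \<psi> s) - (\<psi>' s / y s) *\<^sub>R ee (\<mu> * \<psi> s)"])
      show "((\<lambda>s. ee (\<mu> * \<psi> s) - (\<psi>' s / y s) *\<^sub>R ee (\<mu> * \<psi> s)) has_integral (integral {0..v} (\<lambda>x. ee (\<mu> * \<psi> x)) - (P v - P 0))) (cbox 0 v)"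
        using I by simp
      fix s assume "s \<in> cbox 0 v - {0}"
      then have s: "0 < s" "s \<le> v" by auto
      have "ee (\<mu> * \<psi> s) - (\<psi>' s / y s) *\<^sub>R ee (\<mu> * \<psi> s) = - ((w s * \<psi>' s) *\<^sub>R ee (\<mu> * \<psi> s))"
        unfolding rho[OF s(1)] scaleR_add_left by simp
      then have "norm (ee (\<mu> * \<psi> s) - (\<psi>' s / y s) *\<^sub>R ee (\<mu> * \<psi> s)) = \<bar>w s * \<psi>' s\<bar>"
        by (simp only: norm_minus_cancel norm_scaleR norm_ee mult_1_right)
      also have "\<dots> \<le> B ^ 5 * L / 2 * s" by (rule rho_b[OF s(1)])
      also have "\<dots> \<le> B ^ 5 * L / 2 * v" using s B0 L by (intro mult_left_mono) auto
      finally show "norm (ee (\<mu> * \<psi> s) - (\<psi>' s / y s) *\<^sub>R ee (\<mu> * \<psi> s)) \<le> B ^ 5 * L / 2 * v" .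
    qed (use v B0 L in auto)
    also have "\<dots> = B ^ 5 * L / 2 * v\<^sup>2" using v by (simp add: power2_eq_square)
    finally show ?thesis .
  qed
  \<comment> \<open>\<open>J\<close> comes from integrating
    \<open>w * \<psi>' * ee (\<mu> * \<psi>)\<close> by parts:
    \<open>\<psi>' * ee (\<mu> * \<psi>)\<close> has the primitive
    \<open>ee (\<mu> * \<psi>) / (2 * pi * \<i> * \<mu>)\<close>. Away from 0 this gains a factor
    1/\<mu> at the price of \<open>w'\<close>.\<close>
  define J where "J s = (w s / (2 * pi * \<mu>)) *\<^sub>R (ee (\<mu> * \<psi> s) / \<i>)" for s
  have dw: "(w has_real_derivative w' s) (at s)" if s: "0 < s" for s
  proof -
    have pos: "0 < y s" "0 < \<psi>' s" using ylo[OF s] plo[OF s] sB[OF s] by auto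
    have dy: "(y has_real_derivative c * \<psi>' s / y s) (at s)"
    proof -
      have "((\<lambda>t. 2 * c * \<psi> t) has_real_derivative 2 * c * \<psi>' s) (at s)" by (intro DERIV_cmult d1)
      from DERIV_chain2[OF DERIV_real_sqrt this] have "((\<lambda>t. sqrt (2 * c * \<psi> t)) has_real_derivative inverse (sqrt (2 * c * \<psi> s)) / 2 * (2 * c * \<psi>' s)) (at s)"
        using c0 psi_pos[OF s] by simp
      then have "(y has_real_derivative inverse (y s) / 2 * (2 * c * \<psi>' s)) (at s)" unfolding y_def .
      moreover have "inverse (y s) / 2 * (2 * c * \<psi>' s) = c * \<psi>' s / y s" by (simp add: inverse_eq_divide)
      ultimately show ?thesis by (simp only:)
    qed
    have "(w has_real_derivative (0 * y s - 1 * (c * \<psi>' s / y s)) / (y s * y s) - (0 * \<psi>' s - 1 * \<psi>'' s) / (\<psi>' s * \<psi>' s)) (at s)"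
      unfolding w_def by (rule DERIV_diff[OF DERIV_divide[OF DERIV_const dy] DERIV_divide[OF DERIV_const d2]]) (use pos in simp_all)
    moreover have "(0 * y s - 1 * (c * \<psi>' s / y s)) / (y s * y s) - (0 * \<psi>' s - 1 * \<psi>'' s) / (\<psi>' s * \<psi>' s) = w' s"
      by (simp add: w'_def power2_eq_square power3_eq_cube mult_ac)
    ultimately show ?thesis by simp
  qed
  have dJ: "(J has_vector_derivative ((w s * \<psi>' s) *\<^sub>R ee (\<mu> * \<psi> s) + (w' s / (2 * pi * \<mu>)) *\<^sub>R (ee (\<mu> * \<psi> s) / \<i>))) (at s)"
    if s: "0 < s" for s
  proof -
    have 1: "((\<lambda>s. w s / (2 * pi * \<mu>)) has_real_derivative w' s / (2 * pi * \<mu>)) (at s)"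
      using dw[OF s] by (rule DERIV_cdivide)
    have 2: "((\<lambda>s. \<mu> * \<psi> s) has_real_derivative \<mu> * \<psi>' s) (at s)" by (intro DERIV_cmult d1)
    have "(J has_vector_derivative ((w s / (2 * pi * \<mu>)) *\<^sub>R (2 * pi * \<i> * complex_of_real (\<mu> * \<psi>' s) * ee (\<mu> * \<psi> s) / \<i>) + (w' s / (2 * pi * \<mu>)) *\<^sub>R (ee (\<mu> * \<psi> s) / \<i>))) (at s)"
      unfolding J_def by (rule has_vector_derivative_scaleR[OF 1 has_vector_derivative_divide[OF has_vector_derivative_ee[OF 2]]])
    moreover have "(w s / (2 * pi * \<mu>)) *\<^sub>R (2 * pi * \<i> * complex_of_real (\<mu> * \<psi>' s) * ee (\<mu> * \<psi> s) / \<i>) = (w s * \<psi>' s) *\<^sub>R ee (\<mu> * \<psi> s)"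
      using lam by (simp add: scaleR_conv_of_real)
    ultimately show ?thesis by simp
  qed
  have Jb: "norm (J s) \<le> B ^ 4 * L / (4 * pi * \<mu>)" if "0 < s" for s
  proof -
    have "norm (J s) = \<bar>w s\<bar> / (2 * pi * \<mu>)" using lam by (simp add: J_def norm_divide norm_mult)
    also have "\<dots> \<le> (B ^ 4 * L / 2) / (2 * pi * \<mu>)" using wb[OF that] lam by (intro divide_right_mono) auto
    also have "\<dots> = B ^ 4 * L / (4 * pi * \<mu>)" by simp
    finally show ?thesis .
  qed
  have far: "norm (integral {u..v} (\<lambda>x. ee (\<mu> * \<psi> x)) - (P v - P u)) \<le> (B ^ 4 * L + 3 * B ^ 10 * L * ln (v / u)) / (2 * pi * \<mu>)"
    if uv: "0 < u" "u \<le> v" for u v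
  proof -
    have "((\<lambda>s. (\<psi>' s / y s) *\<^sub>R ee (\<mu> * \<psi> s) - ((w s * \<psi>' s) *\<^sub>R ee (\<mu> * \<psi> s) + (w' s / (2 * pi * \<mu>)) *\<^sub>R (ee (\<mu> * \<psi> s) / \<i>)))
      has_integral ((P v - J v) - (P u - J u))) {u..v}"
      using uv dP dJ by (intro fundamental_theorem_of_calculus has_vector_derivative_diff) (auto intro: has_vector_derivative_at_within)
    from has_integral_diff[OF integrable_integral[OF intee] this]
    have I: "((\<lambda>s. (w' s / (2 * pi * \<mu>)) *\<^sub>R (ee (\<mu> * \<psi> s) / \<i>)) has_integral (integral {u..v} (\<lambda>x. ee (\<mu> * \<psi> x)) - ((P v - J v) - (P u - J u)))) {u..v}"
    proof (rule has_integral_eq[rotated])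
      fix s assume "s \<in> {u..v}"
      then have "0 < s" using uv by simp
      from rho[OF this] show "ee (\<mu> * \<psi> s) - ((\<psi>' s / y s) *\<^sub>R ee (\<mu> * \<psi> s) - ((w s * \<psi>' s) *\<^sub>R ee (\<mu> * \<psi> s) + (w' s / (2 * pi * \<mu>)) *\<^sub>R (ee (\<mu> * \<psi> s) / \<i>)))
          = (w' s / (2 * pi * \<mu>)) *\<^sub>R (ee (\<mu> * \<psi> s) / \<i>)"
        by (simp only: scaleR_add_left scaleR_one) simp
    qed
    have I1: "((\<lambda>s. (3 * B ^ 10 * L / (2 * pi * \<mu>)) * (1 / s)) has_integral (3 * B ^ 10 * L / (2 * pi * \<mu>)) * (ln v - ln u)) {u..v}"
      by (rule has_integral_mult_right[OF fundamental_theorem_of_calculus[OF uv(2)]])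
         (use uv in \<open>auto intro!: derivative_eq_intros simp flip: has_real_derivative_iff_has_vector_derivative\<close>)
    have "norm (integral {u..v} (\<lambda>s. (w' s / (2 * pi * \<mu>)) *\<^sub>R (ee (\<mu> * \<psi> s) / \<i>))) \<le> integral {u..v} (\<lambda>s. (3 * B ^ 10 * L / (2 * pi * \<mu>)) * (1 / s))"
    proof (intro integral_norm_bound_integral)
      fix s assume "s \<in> {u..v}"
      then have s: "0 < s" using uv by auto
      have "norm ((w' s / (2 * pi * \<mu>)) *\<^sub>R (ee (\<mu> * \<psi> s) / \<i>)) = \<bar>w' s\<bar> / (2 * pi * \<mu>)" using lam by (simp add: norm_divide norm_mult)
      also have "\<dots> \<le> ((3 * B ^ 10 * L) * (1 / s)) / (2 * pi * \<mu>)" using w'b[OF s] lam by (intro divide_right_mono) auto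
      also have "\<dots> = (3 * B ^ 10 * L / (2 * pi * \<mu>)) * (1 / s)" by (simp add: mult_ac)
      finally show "norm ((w' s / (2 * pi * \<mu>)) *\<^sub>R (ee (\<mu> * \<psi> s) / \<i>)) \<le> (3 * B ^ 10 * L / (2 * pi * \<mu>)) * (1 / s)" .
    qed (use I I1 in \<open>auto simp: integrable_on_def\<close>)
    then have 1: "norm (integral {u..v} (\<lambda>x. ee (\<mu> * \<psi> x)) - ((P v - J v) - (P u - J u))) \<le> 3 * B ^ 10 * L / (2 * pi * \<mu>) * ln (v / u)"
      unfolding integral_unique[OF I] integral_unique[OF I1] using uv by (simp add: ln_div)
    have "integral {u..v} (\<lambda>x. ee (\<mu> * \<psi> x)) - (P v - P u) = (integral {u..v} (\<lambda>x. ee (\<mu> * \<psi> x)) - ((P v - J v) - (P u - J u))) + J u - J v"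
      by simp
    also have "norm \<dots> \<le> 3 * B ^ 10 * L / (2 * pi * \<mu>) * ln (v / u) + B ^ 4 * L / (4 * pi * \<mu>) + B ^ 4 * L / (4 * pi * \<mu>)"
      by (rule norm_add_diff_le[OF 1 Jb Jb]) (use uv in auto)
    also have "\<dots> = (B ^ 4 * L + 3 * B ^ 10 * L * ln (v / u)) / (2 * pi * \<mu>)"
      using lam by (simp add: field_simps)
    finally show ?thesis .
  qed

  \<comment> \<open>The far boundary term and the assembly\<close>
  have Pr: "norm (P r) \<le> 2 * B * (1 / (\<mu> * r))"
  proof -
    define X where "X = \<mu> * c / 2 * (\<mu> * \<psi> r)"
    have pr: "0 < \<mu> * \<psi> r" using mupsi[OF r] .
    have "(\<mu> * r / (2 * B))\<^sup>2 = (\<mu> * (1 / B) / 2) * (\<mu> * (r\<^sup>2 / (2 * B)))" using B0 by (simp add: power2_eq_square)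
    also have "\<dots> \<le> (\<mu> * c / 2) * (\<mu> * \<psi> r)"
    proof (rule mult_mono)
      show "\<mu> * (1 / B) / 2 \<le> \<mu> * c / 2" using mult_left_mono[OF c(1), of \<mu>] lam by simp
      show "\<mu> * (r\<^sup>2 / (2 * B)) \<le> \<mu> * \<psi> r" using lo0[of r] r lam by (intro mult_left_mono) auto
    qed (use lam c0 B0 in auto)
    finally have X: "\<mu> * r / (2 * B) \<le> sqrt X" unfolding X_def by (rule real_le_rsqrt)
    have pos: "0 < \<mu> * r / (2 * B)" using lam r B0 by simp
    have "norm (P r) = \<gamma> * norm (H (sqrt (\<mu> * \<psi> r)))" using g0 by (simp add: P_def)
    also have "\<dots> \<le> \<gamma> * (1 / sqrt (\<mu> * \<psi> r))" 
      using g0 H2[of "sqrt (\<mu> * \<psi> r)"] pr by (intro mult_left_mono) (simp_all only: real_sqrt_gt_0_iff less_imp_le)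
    also have "\<dots> = 1 / sqrt X"
      unfolding \<gamma>_def X_def real_sqrt_mult by simp
    also have "\<dots> \<le> 1 / (\<mu> * r / (2 * B))"
      using X pos by (intro divide_left_mono mult_pos_pos) linarith+
    also have "\<dots> = 2 * B * (1 / (\<mu> * r))" by simp
    finally show ?thesis .
  qed
  have P0: "- P 0 = H 0 / sqrt (\<mu> * \<psi>'' 0 / 2)"
    by (simp add: P_def z \<gamma>_def c_def scaleR_conv_of_real)
  \<comment> \<open>Up to 1/sqrt \<mu> the trivial estimate \<open>near\<close> costs O(\<sigma>^2)
    = O(1/\<mu>); beyond that point \<open>far\<close> costs O((1 + log(r/\<sigma>))/\<mu>).\<close>
  define \<sigma> where "\<sigma> = min r (1 / sqrt \<mu>)"
  have sg: "0 < \<sigma>" "\<sigma> \<le> r" using r lam by (auto simp: \<sigma>_def)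
  have sg2: "\<sigma>\<^sup>2 \<le> 1 / \<mu>"
  proof -
    have "\<sigma>\<^sup>2 \<le> (1 / sqrt \<mu>)\<^sup>2" using sg by (intro power_mono) (auto simp: \<sigma>_def)
    then show ?thesis using lam by (simp add: power_divide)
  qed
  have lnb: "ln (r / \<sigma>) \<le> ln (1 + r * sqrt \<mu>)"
    using r lam sg by (intro ln_mono) (auto simp: \<sigma>_def min_def field_simps)
  have ln0: "0 \<le> ln (1 + r * sqrt \<mu>)" using r lam by simp
  have "integral {0..r} (\<lambda>x. ee (\<mu> * \<psi> x)) = integral {0..\<sigma>} (\<lambda>x. ee (\<mu> * \<psi> x)) + integral {\<sigma>..r} (\<lambda>x. ee (\<mu> * \<psi> x))"
    using sg by (intro Henstock_Kurzweil_Integration.integral_combine[symmetric] intee) auto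
  then have "integral {0..r} (\<lambda>x. ee (\<mu> * \<psi> x)) - H 0 / sqrt (\<mu> * \<psi>'' 0 / 2)
     = (integral {0..\<sigma>} (\<lambda>x. ee (\<mu> * \<psi> x)) - (P \<sigma> - P 0)) + (integral {\<sigma>..r} (\<lambda>x. ee (\<mu> * \<psi> x)) - (P r - P \<sigma>)) + P r"
    unfolding P0[symmetric] by simp
  also have "norm \<dots> \<le> B ^ 5 * L / 2 * \<sigma>\<^sup>2 + (B ^ 4 * L + 3 * B ^ 10 * L * ln (r / \<sigma>)) / (2 * pi * \<mu>) + 2 * B * (1 / (\<mu> * r))"
    by (rule norm_triangle_mono[OF norm_triangle_mono[OF near[OF sg(1)] far[OF sg]] Pr])
  also have "B ^ 5 * L / 2 * \<sigma>\<^sup>2 \<le> B ^ 10 * L * (1 / \<mu>)"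
  proof -
    have "B ^ 5 * L / 2 * \<sigma>\<^sup>2 \<le> B ^ 5 * L * (1 / \<mu>)" using B0 L sg2 by (intro mult_mono) auto
    also have "\<dots> \<le> B ^ 10 * L * (1 / \<mu>)" using B L lam by (intro mult_right_mono power_increasing) auto
    finally show ?thesis .
  qed
  also have "(B ^ 4 * L + 3 * B ^ 10 * L * ln (r / \<sigma>)) / (2 * pi * \<mu>) \<le> (B ^ 10 * L + 3 * B ^ 10 * L * ln (1 + r * sqrt \<mu>)) / (1 * \<mu>)"
  proof (rule frac_le)
    have "B ^ 4 * L \<le> B ^ 10 * L" using B L by (intro mult_right_mono power_increasing) auto
    moreover have "3 * B ^ 10 * L * ln (r / \<sigma>) \<le> 3 * B ^ 10 * L * ln (1 + r * sqrt \<mu>)"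
      using B0 L lnb by (intro mult_left_mono) auto
    ultimately show "B ^ 4 * L + 3 * B ^ 10 * L * ln (r / \<sigma>) \<le> B ^ 10 * L + 3 * B ^ 10 * L * ln (1 + r * sqrt \<mu>)"
      by (rule add_mono)
    show "0 \<le> B ^ 10 * L + 3 * B ^ 10 * L * ln (1 + r * sqrt \<mu>)" using B0 L ln0 by simp
    show "1 * \<mu> \<le> 2 * pi * \<mu>" using lam pi_ge_two by (intro mult_right_mono) auto
  qed (use lam in auto)
  also have "B ^ 10 * L * (1 / \<mu>) + (B ^ 10 * L + 3 * B ^ 10 * L * ln (1 + r * sqrt \<mu>)) / (1 * \<mu>) + 2 * B * (1 / (\<mu> * r))
     = (B ^ 10 * L) * ((2 + 3 * ln (1 + r * sqrt \<mu>)) / \<mu>) + 2 * B * (1 / (\<mu> * r))"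
    using lam by (simp add: field_simps)
  also have "\<dots> \<le> (B ^ 10 * L) * (6 * ((1 + ln (1 + r * sqrt \<mu>)) / \<mu> + 1 / (\<mu> * r))) + 2 * B * ((1 + ln (1 + r * sqrt \<mu>)) / \<mu> + 1 / (\<mu> * r))"
  proof (intro add_mono mult_left_mono)
    have p: "0 \<le> 1 / (\<mu> * r)" "0 \<le> (1 + ln (1 + r * sqrt \<mu>)) / \<mu>" using lam r ln0 by auto
    then show "1 / (\<mu> * r) \<le> (1 + ln (1 + r * sqrt \<mu>)) / \<mu> + 1 / (\<mu> * r)" by simp
    have "(2 + 3 * ln (1 + r * sqrt \<mu>)) / \<mu> \<le> 6 * ((1 + ln (1 + r * sqrt \<mu>)) / \<mu>)"
      unfolding times_divide_eq_right using lam ln0 by (intro divide_right_mono) auto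
    then show "(2 + 3 * ln (1 + r * sqrt \<mu>)) / \<mu> \<le> 6 * ((1 + ln (1 + r * sqrt \<mu>)) / \<mu> + 1 / (\<mu> * r))"
      by (rule order_trans) (use p in \<open>intro mult_left_mono; simp\<close>)
  qed (use B0 L in auto)
  also have "\<dots> = (6 * B ^ 10 * L + 2 * B) * ((1 + ln (1 + r * sqrt \<mu>)) / \<mu> + 1 / (\<mu> * r))"
    by (simp add: algebra_simps)
  finally show ?thesis by simp
qed

lemma integral_affine:
  fixes g :: "real \<Rightarrow> complex"
  assumes "continuous_on UNIV g" "0 < m" "a \<le> b"
  shows "integral {a..b} (\<lambda>x. g (m * x + c)) = (1 / m) *\<^sub>R integral {m * a + c..m * b + c} g"
proof -
  have "((\<lambda>x. m *\<^sub>R g (m * x + c)) has_integral integral {m * a + c..m * b + c} g) {a..b}"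
    using assms
    by (intro has_integral_substitution[where c = "m * a + c" and d = "m * b + c"])
       (auto intro!: derivative_eq_intros continuous_on_subset[OF assms(1)])
  then have "integral {a..b} (\<lambda>x. m *\<^sub>R g (m * x + c)) = integral {m * a + c..m * b + c} g"
    by (rule integral_unique)
  from this[symmetric] show ?thesis using assms(2) by simp
qed

text \<open>Split at \<open>t0\<close> and reflect the left part. Both halves then start at the
  stationary point with the same second derivative, so each contributes the same term, whence the
  factor 2 in front of \<open>H 0\<close>.\<close>

lemma stationary_phase:
  fixes \<phi> \<phi>' \<phi>'' :: "real \<Rightarrow> real" and H :: "real \<Rightarrow> complex"
  assumes H1: "\<And>x. (H has_vector_derivative - ee (x\<^sup>2)) (at x)"
    and H2: "\<And>u. u > 0 \<Longrightarrow> norm (H u) \<le> 1 / u"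
    and B: "1 \<le> B" and L: "0 \<le> L" and lam: "0 < \<mu>" and t: "t1 < t0" "t0 < t2"
    and d1: "\<And>x. (\<phi> has_real_derivative \<phi>' x) (at x)"
    and d2: "\<And>x. (\<phi>' has_real_derivative \<phi>'' x) (at x)"
    and lower: "\<And>x. 1 / B \<le> \<phi>'' x" and upper: "\<And>x. \<phi>'' x \<le> B"
    and lip: "\<And>x y. \<bar>\<phi>'' x - \<phi>'' y\<bar> \<le> L * \<bar>x - y\<bar>"
    and z: "\<phi>' t0 = 0"
  shows "norm (integral {t1..t2} (\<lambda>x. ee (\<mu> * \<phi> x)) - ee (\<mu> * \<phi> t0) * (2 * H 0 / sqrt (\<mu> * \<phi>'' t0 / 2)))
    \<le> (6 * B ^ 10 * L + 2 * B) * (2 * (1 + ln (1 + (t2 - t1) * sqrt \<mu>)) / \<mu> + 1 / (\<mu> * (t0 - t1)) + 1 / (\<mu> * (t2 - t0)))"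
proof -
  define K where "K = 6 * B ^ 10 * L + 2 * B"
  define M where "M = H 0 / complex_of_real (sqrt (\<mu> * \<phi>'' t0 / 2))"
  have K0: "0 \<le> K" using B L by (simp add: K_def)
  have contphi: "isCont \<phi> x" for x using d1 DERIV_isCont by blast
  have cont: "continuous_on UNIV (\<lambda>x. ee (\<mu> * \<phi> x))"
    by (intro continuous_intros continuous_at_imp_continuous_on ballI contphi)
  have shift: "((\<lambda>x. f (x + c)) has_real_derivative f' (x + c)) (at x)" 
    if "\<And>x. (f has_real_derivative f' x) (at x)" for f f' :: "real \<Rightarrow> real" and c x
    using that DERIV_shift by blast
  have mirror: "((\<lambda>x. f (t0 - x)) has_real_derivative - f' (t0 - x)) (at x)" 
    if "\<And>x. (f has_real_derivative f' x) (at x)" for f f' :: "real \<Rightarrow> real" and x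
  proof -
    have "((\<lambda>x. t0 - x) has_real_derivative -1) (at x)" by (auto intro!: derivative_eq_intros)
    from DERIV_chain2[OF that this] show ?thesis by simp
  qed
  have ln_mono': "ln (1 + r * sqrt \<mu>) \<le> ln (1 + (t2 - t1) * sqrt \<mu>)" if "0 < r" "r \<le> t2 - t1" for r
    using that lam by (subst ln_le_cancel_iff) (auto intro!: mult_right_mono add_pos_pos)
  have right: "norm (integral {0..t2 - t0} (\<lambda>x. ee (\<mu> * (\<phi> (x + t0) - \<phi> t0))) - M) \<le> K * ((1 + ln (1 + (t2 - t0) * sqrt \<mu>)) / \<mu> + 1 / (\<mu> * (t2 - t0)))"
  proof -
    have "norm (integral {0..t2 - t0} (\<lambda>x. ee (\<mu> * (\<phi> (x + t0) - \<phi> t0))) - H 0 / complex_of_real (sqrt (\<mu> * \<phi>'' (0 + t0) / 2))) \<le> K * ((1 + ln (1 + (t2 - t0) * sqrt \<mu>)) / \<mu> + 1 / (\<mu> * (t2 - t0)))"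
      unfolding K_def
    proof (rule stationary_phase_half[OF H1 H2 B L lam])
      show "((\<lambda>x. \<phi> (x + t0) - \<phi> t0) has_real_derivative \<phi>' (x + t0)) (at x)" for x
        using shift[OF d1, where c = t0 and x = x] by (auto intro!: derivative_eq_intros)
      show "((\<lambda>x. \<phi>' (x + t0)) has_real_derivative \<phi>'' (x + t0)) (at x)" for x
        using shift[OF d2] by simp
      show "\<bar>\<phi>'' (x + t0) - \<phi>'' (0 + t0)\<bar> \<le> L * \<bar>x\<bar>" for x using lip[of "x + t0" t0] by simp
    qed (use t z lower upper in auto)
    then show ?thesis by (simp add: M_def)
  qed
  have left: "norm (integral {0..t0 - t1} (\<lambda>x. ee (\<mu> * (\<phi> (t0 - x) - \<phi> t0))) - M) \<le> K * ((1 + ln (1 + (t0 - t1) * sqrt \<mu>)) / \<mu> + 1 / (\<mu> * (t0 - t1)))"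
  proof -
    have "norm (integral {0..t0 - t1} (\<lambda>x. ee (\<mu> * (\<phi> (t0 - x) - \<phi> t0))) - H 0 / complex_of_real (sqrt (\<mu> * \<phi>'' (t0 - 0) / 2))) \<le> K * ((1 + ln (1 + (t0 - t1) * sqrt \<mu>)) / \<mu> + 1 / (\<mu> * (t0 - t1)))"
      unfolding K_def
    proof (rule stationary_phase_half[OF H1 H2 B L lam])
      show "((\<lambda>x. \<phi> (t0 - x) - \<phi> t0) has_real_derivative - \<phi>' (t0 - x)) (at x)" for x
        using mirror[OF d1, where x = x] by (auto intro!: derivative_eq_intros)
      show "((\<lambda>x. - \<phi>' (t0 - x)) has_real_derivative \<phi>'' (t0 - x)) (at x)" for x
        using DERIV_minus[OF mirror[OF d2]] by simp
      show "\<bar>\<phi>'' (t0 - x) - \<phi>'' (t0 - 0)\<bar> \<le> L * \<bar>x\<bar>" for x using lip[of "t0 - x" t0] by simp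
    qed (use t z lower upper in auto)
    then show ?thesis by (simp add: M_def)
  qed
  have I1: "integral {t0..t2} (\<lambda>x. ee (\<mu> * \<phi> x)) = ee (\<mu> * \<phi> t0) * integral {0..t2 - t0} (\<lambda>x. ee (\<mu> * (\<phi> (x + t0) - \<phi> t0)))"
  proof -
    have "integral {t0..t2} (\<lambda>x. ee (\<mu> * \<phi> x)) = integral {0..t2 - t0} (\<lambda>x. ee (\<mu> * \<phi> (x + t0)))"
      using integral_affine[OF cont, of 1 0 "t2 - t0" t0] t by simp
    also have "\<dots> = integral {0..t2 - t0} (\<lambda>x. ee (\<mu> * \<phi> t0) * ee (\<mu> * (\<phi> (x + t0) - \<phi> t0)))"
      by (simp add: right_diff_distrib flip: ee_add)
    finally show ?thesis by simp
  qed
  have I2: "integral {t1..t0} (\<lambda>x. ee (\<mu> * \<phi> x)) = ee (\<mu> * \<phi> t0) * integral {0..t0 - t1} (\<lambda>x. ee (\<mu> * (\<phi> (t0 - x) - \<phi> t0)))"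
  proof -
    have "integral {t1..t0} (\<lambda>x. ee (\<mu> * \<phi> x)) = integral {t1 - t0..0} (\<lambda>x. ee (\<mu> * \<phi> (x + t0)))"
      using integral_affine[OF cont, of 1 "t1 - t0" 0 t0] t by simp
    also have "\<dots> = integral {0..t0 - t1} (\<lambda>x. ee (\<mu> * \<phi> (t0 - x)))"
      using Henstock_Kurzweil_Integration.integral_reflect_real[of "t0 - t1" 0 "\<lambda>x. ee (\<mu> * \<phi> (t0 - x))"] by (simp add: add.commute)
    also have "\<dots> = integral {0..t0 - t1} (\<lambda>x. ee (\<mu> * \<phi> t0) * ee (\<mu> * (\<phi> (t0 - x) - \<phi> t0)))"
      by (simp add: right_diff_distrib flip: ee_add)
    finally show ?thesis by simp
  qed
  have int: "(\<lambda>x. ee (\<mu> * \<phi> x)) integrable_on {t1..t2}"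
    using cont by (intro integrable_continuous_interval) (auto intro: continuous_on_subset)
  have "integral {t1..t2} (\<lambda>x. ee (\<mu> * \<phi> x)) = integral {t1..t0} (\<lambda>x. ee (\<mu> * \<phi> x)) + integral {t0..t2} (\<lambda>x. ee (\<mu> * \<phi> x))"
    using Henstock_Kurzweil_Integration.integral_combine[OF _ _ int, of t0] t by simp
  then have "integral {t1..t2} (\<lambda>x. ee (\<mu> * \<phi> x)) - ee (\<mu> * \<phi> t0) * (2 * M)
    = ee (\<mu> * \<phi> t0) * ((integral {0..t0 - t1} (\<lambda>x. ee (\<mu> * (\<phi> (t0 - x) - \<phi> t0))) - M) + (integral {0..t2 - t0} (\<lambda>x. ee (\<mu> * (\<phi> (x + t0) - \<phi> t0))) - M))"
    unfolding I1 I2 by (simp add: ring_distribs)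
  then have "norm (integral {t1..t2} (\<lambda>x. ee (\<mu> * \<phi> x)) - ee (\<mu> * \<phi> t0) * (2 * M))
    = norm ((integral {0..t0 - t1} (\<lambda>x. ee (\<mu> * (\<phi> (t0 - x) - \<phi> t0))) - M) + (integral {0..t2 - t0} (\<lambda>x. ee (\<mu> * (\<phi> (x + t0) - \<phi> t0))) - M))"
    by (simp only: norm_mult norm_ee mult_1_left)
  also have "\<dots> \<le> K * ((1 + ln (1 + (t0 - t1) * sqrt \<mu>)) / \<mu> + 1 / (\<mu> * (t0 - t1))) + K * ((1 + ln (1 + (t2 - t0) * sqrt \<mu>)) / \<mu> + 1 / (\<mu> * (t2 - t0)))"
    by (rule norm_triangle_mono[OF left right])
  also have "\<dots> \<le> K * ((1 + ln (1 + (t2 - t1) * sqrt \<mu>)) / \<mu> + 1 / (\<mu> * (t0 - t1))) + K * ((1 + ln (1 + (t2 - t1) * sqrt \<mu>)) / \<mu> + 1 / (\<mu> * (t2 - t0)))"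
    using ln_mono'[of "t0 - t1"] ln_mono'[of "t2 - t0"] t lam K0
    by (intro add_mono mult_left_mono divide_right_mono order_refl) auto
  also have "\<dots> = K * (2 * (1 + ln (1 + (t2 - t1) * sqrt \<mu>)) / \<mu> + 1 / (\<mu> * (t0 - t1)) + 1 / (\<mu> * (t2 - t0)))"
    by (simp only: distrib_left[symmetric] times_divide_eq_right[symmetric]) simp
  finally show ?thesis by (simp add: M_def K_def)
qed

subsection \<open>Truncated Poisson summation\<close>

text \<open>This is \<open>V\<close> times the classical Fejer kernel. In this normalisation the
  Fourier coefficients are numbers of pairs (i, j) with a given difference, and the integral over a
  period is \<open>V\<close>.\<close>

definition fejer :: "nat \<Rightarrow> real \<Rightarrow> real" where
  "fejer V x = (norm (\<Sum>j<V. ee (of_nat j * x)))\<^sup>2"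

lemma fejer_nonneg [simp]: "0 \<le> fejer V x"
  by (simp add: fejer_def)

lemma of_real_fejer: "complex_of_real (fejer V x) = (\<Sum>i<V. \<Sum>j<V. ee (of_int (int i - int j) * x))"
proof -
  have "complex_of_real (fejer V x) = (\<Sum>i<V. ee (of_nat i * x)) * (\<Sum>j<V. ee (- (of_nat j * x)))"
    unfolding fejer_def complex_norm_square cnj_sum cnj_ee ..
  also have "\<dots> = (\<Sum>i<V. \<Sum>j<V. ee (of_nat i * x) * ee (- (of_nat j * x)))"
    by (simp add: sum_product)
  also have "\<dots> = (\<Sum>i<V. \<Sum>j<V. ee (of_int (int i - int j) * x))"
    by (simp add: left_diff_distrib flip: ee_add)
  finally show ?thesis .
qed

text \<open>The closed form is multiplied out so that it also holds at the integers.\<close>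

lemma fejer_sin: "fejer V x * (sin (pi * x))\<^sup>2 = (sin (pi * (real V * x)))\<^sup>2"
proof -
  have "(1 - ee x) * (\<Sum>j<V. ee (of_nat j * x)) = 1 - ee (of_nat V * x)"
    by (simp add: ee_mult_of_nat one_diff_power_eq)
  then have "norm (1 - ee x) * norm (\<Sum>j<V. ee (of_nat j * x)) = norm (1 - ee (of_nat V * x))"
    by (simp flip: norm_mult)
  then have "\<bar>sin (pi * x)\<bar> * norm (\<Sum>j<V. ee (of_nat j * x)) = \<bar>sin (pi * (real V * x))\<bar>"
    by (simp add: norm_one_minus_ee)
  then have "(\<bar>sin (pi * x)\<bar> * norm (\<Sum>j<V. ee (of_nat j * x)))\<^sup>2 = \<bar>sin (pi * (real V * x))\<bar>\<^sup>2"
    by (simp only:)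
  then show ?thesis by (simp add: fejer_def power_mult_distrib mult.commute)
qed

lemma continuous_on_fejer: "continuous_on S (fejer V)"
  unfolding fejer_def by (intro continuous_intros)

lemma integral_ee_int:
  "integral {c..c + 1} (\<lambda>x. ee (of_int k * x)) = (if k = 0 then 1 else 0)"
proof (cases "k = 0")
  case False
  have "((\<lambda>x. ee (of_int k * x)) has_integral (ee (of_int k * (c + 1)) / (2 * pi * \<i> * complex_of_real (of_int k)) - ee (of_int k * c) / (2 * pi * \<i> * complex_of_real (of_int k)))) {c..c + 1}"
  proof (rule fundamental_theorem_of_calculus)
    fix x assume "x \<in> {c..c + 1}"
    have "((\<lambda>x. of_int k * x) has_real_derivative of_int k) (at x within {c..c + 1})"
      by (auto intro!: derivative_eq_intros)
    from has_vector_derivative_divide[OF has_vector_derivative_ee[OF this]]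
    have "((\<lambda>x. ee (of_int k * x) / (2 * pi * \<i> * complex_of_real (of_int k))) has_vector_derivative
      2 * pi * \<i> * complex_of_real (of_int k) * ee (of_int k * x) / (2 * pi * \<i> * complex_of_real (of_int k))) (at x within {c..c + 1})" .
    moreover have "2 * pi * \<i> * complex_of_real (of_int k) * ee (of_int k * x) / (2 * pi * \<i> * complex_of_real (of_int k)) = ee (of_int k * x)"
      using False by simp
    ultimately show "((\<lambda>x. ee (of_int k * x) / (2 * pi * \<i> * complex_of_real (of_int k))) has_vector_derivative ee (of_int k * x)) (at x within {c..c + 1})"
      by (simp only:)
  qed simp
  moreover have "ee (of_int k * (c + 1)) = ee (of_int k * c)"
    by (simp add: distrib_left ee_add)
  ultimately show ?thesis using False by (simp add: integral_unique)
qed simp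

lemma integral_fejer: "integral {c..c + 1} (fejer V) = real V"
proof -
  have "(fejer V) integrable_on {c..c + 1}"
    by (intro integrable_continuous_interval continuous_on_fejer)
  then have "complex_of_real (integral {c..c + 1} (fejer V)) = integral {c..c + 1} (\<lambda>x. complex_of_real (fejer V x))"
    by (metis has_integral_of_real integrable_integral integral_unique)
  also have "\<dots> = (\<Sum>i<V. \<Sum>j<V. integral {c..c + 1} (\<lambda>x. ee (of_int (int i - int j) * x)))"
    unfolding of_real_fejer
    by (subst integral_sum; (intro integrable_sum integrable_continuous_interval continuous_intros | simp))+
  also have "\<dots> = (\<Sum>i<V. \<Sum>j<V. if i = j then 1 else 0)"
    unfolding integral_ee_int by (intro sum.cong) auto
  also have "\<dots> = complex_of_real (real V)" by simp
  finally show ?thesis by (simp only: of_real_eq_iff)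
qed

text \<open>Around an integer the kernel acts like a point mass \<open>V\<close>. Since
  \<open>fejer V x * (x - c)^2\<close> is at most 1, the product |x - c| \<open>fejer V x\<close> is
  at most t \<open>fejer V x\<close> + 1/t, and t = 1/sqrt V balances the integrals of the two
  terms. The resulting error O(sqrt V) disappears in the limit taken in
  \<open>truncated_Poisson\<close>.\<close>

lemma fejer_cell:
  fixes F :: "real \<Rightarrow> real"
  assumes V: "0 < V" and cont: "continuous_on {c - 1/2..c + 1/2} F" and c: "c = of_int n"
    and lip: "\<And>x. x \<in> {c - 1/2..c + 1/2} \<Longrightarrow> \<bar>F x - F c\<bar> \<le> K * \<bar>x - c\<bar>" and K: "0 \<le> K"
  shows "norm (integral {c - 1/2..c + 1/2} (\<lambda>x. ee (F x) * complex_of_real (fejer V x)) - real V * ee (F c))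
     \<le> 4 * pi * K * sqrt (real V)"
proof -
  define t where "t = 1 / sqrt (real V)"
  have t: "0 < t" using V by (simp add: t_def)
  have c1: "c + 1/2 = (c - 1/2) + 1" by simp
  have i0: "(fejer V) integrable_on {c - 1/2..c + 1/2}"
    by (intro integrable_continuous_interval continuous_on_fejer)
  have hf: "((fejer V) has_integral real V) {c - 1/2..c + 1/2}"
    using integrable_integral[OF i0] unfolding c1 integral_fejer .
  have hfc: "((\<lambda>x. complex_of_real (fejer V x)) has_integral complex_of_real (real V)) {c - 1/2..c + 1/2}"
    using has_integral_of_real[OF hf] .
  have i1: "(\<lambda>x. ee (F x) * complex_of_real (fejer V x)) integrable_on {c - 1/2..c + 1/2}"
    by (intro integrable_continuous_interval continuous_intros cont continuous_on_fejer)
  have h1: "((\<lambda>x. ee (F x) * complex_of_real (fejer V x) - ee (F c) * complex_of_real (fejer V x)) has_integral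
     (integral {c - 1/2..c + 1/2} (\<lambda>x. ee (F x) * complex_of_real (fejer V x)) - ee (F c) * complex_of_real (real V))) {c - 1/2..c + 1/2}"
    by (intro has_integral_diff integrable_integral[OF i1] has_integral_mult_right hfc)
  have h2: "((\<lambda>x. 2 * pi * K * (t * fejer V x + 1 / t)) has_integral (2 * pi * K * (t * real V + 1 / t))) {c - 1/2..c + 1/2}"
    using has_integral_mult_right[OF has_integral_add[OF has_integral_mult_right[OF hf, of t] has_integral_const_real[of "1 / t" "c - 1/2" "c + 1/2"]], of "2 * pi * K"] by simp
  have "norm (integral {c - 1/2..c + 1/2} (\<lambda>x. ee (F x) * complex_of_real (fejer V x) - ee (F c) * complex_of_real (fejer V x)))
      \<le> integral {c - 1/2..c + 1/2} (\<lambda>x. 2 * pi * K * (t * fejer V x + 1 / t))"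
  proof (rule integral_norm_bound_integral)
    fix x assume x: "x \<in> {c - 1/2..c + 1/2}"
    define s where "s = \<bar>x - c\<bar>"
    have s: "0 \<le> s" "s \<le> 1/2" using x unfolding s_def atLeastAtMost_iff by linarith+
    have "2 * s \<le> \<bar>sin (pi * x)\<bar>"
      using sin_ge_Jordan[of "x - c"] s abs_sin_minus_int[of x n] by (simp add: s_def c)
    then have "(2 * s)\<^sup>2 \<le> (sin (pi * x))\<^sup>2" using s by (metis abs_ge_zero mult_nonneg_nonneg power2_abs power_mono zero_le_numeral)
    then have "fejer V x * (2 * s)\<^sup>2 \<le> fejer V x * (sin (pi * x))\<^sup>2" by (intro mult_left_mono) auto
    also have "\<dots> \<le> 1" unfolding fejer_sin by (simp add: abs_square_le_1)
    finally have f: "fejer V x * s\<^sup>2 \<le> 1" using fejer_nonneg[of V x] by (simp add: power_mult_distrib)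
    have "s * fejer V x \<le> t * fejer V x + 1 / t"
    proof -
      have "2 * (s * t) \<le> s\<^sup>2 + t\<^sup>2" using sum_squares_bound[of s t] by simp
      then have "s * t \<le> s\<^sup>2 + t\<^sup>2" using mult_nonneg_nonneg[of s t] s t by linarith
      then have "fejer V x * (s * t) \<le> fejer V x * (s\<^sup>2 + t\<^sup>2)" by (intro mult_left_mono) auto
      also have "\<dots> \<le> 1 + fejer V x * t\<^sup>2" using f by (simp add: distrib_left)
      finally have "(s * fejer V x) * t \<le> (t * fejer V x + 1 / t) * t" using t by (simp add: algebra_simps power2_eq_square)
      then show ?thesis using t by (rule mult_right_le_imp_le)
    qed
    then have "(2 * pi * K) * (s * fejer V x) \<le> (2 * pi * K) * (t * fejer V x + 1 / t)" using K by (intro mult_left_mono) auto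
    moreover have "norm (ee (F x) * complex_of_real (fejer V x) - ee (F c) * complex_of_real (fejer V x)) \<le> (2 * pi * K) * (s * fejer V x)"
    proof -
      have "norm (ee (F x) * complex_of_real (fejer V x) - ee (F c) * complex_of_real (fejer V x)) = norm (ee (F x) - ee (F c)) * fejer V x"
        by (simp add: norm_mult flip: left_diff_distrib)
      also have "\<dots> \<le> (2 * pi * (K * s)) * fejer V x"
        using norm_ee_diff_le[of "F x" "F c"] lip[OF x]
        by (intro mult_right_mono order_trans[OF norm_ee_diff_le] mult_left_mono) (auto simp: s_def)
      finally show ?thesis by (simp add: mult.assoc)
    qed
    ultimately show "norm (ee (F x) * complex_of_real (fejer V x) - ee (F c) * complex_of_real (fejer V x)) \<le> 2 * pi * K * (t * fejer V x + 1 / t)"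
      by linarith
  qed (use h1 h2 in \<open>auto simp: integrable_on_def\<close>)
  then have "norm (integral {c - 1/2..c + 1/2} (\<lambda>x. ee (F x) * complex_of_real (fejer V x)) - ee (F c) * complex_of_real (real V)) \<le> 2 * pi * K * (t * real V + 1 / t)"
    unfolding integral_unique[OF h1] integral_unique[OF h2] .
  moreover have "t * real V + 1 / t = 2 * sqrt (real V)" using V by (simp add: t_def real_div_sqrt)
  ultimately show ?thesis by (simp add: mult.commute mult.left_commute)
qed

section \<open>Summation of boundary terms and remainders over the frequencies\<close>

lemma alternating_sum_bounds:
  fixes c :: "nat \<Rightarrow> real"
  assumes "\<And>i. 0 \<le> c i" "\<And>i. c (Suc i) \<le> c i"
  shows "0 \<le> (\<Sum>i<n. (-1) ^ i * c i) \<and> (\<Sum>i<n. (-1) ^ i * c i) \<le> c 0"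
  using assms
proof (induction n arbitrary: c)
  case (Suc n)
  have "(\<Sum>i<Suc n. (-1) ^ i * c i) = c 0 - (\<Sum>i<n. (-1) ^ i * c (Suc i))"
    by (simp add: sum.lessThan_Suc_shift sum_negf del: sum.lessThan_Suc)
  moreover have "0 \<le> (\<Sum>i<n. (-1) ^ i * c (Suc i)) \<and> (\<Sum>i<n. (-1) ^ i * c (Suc i)) \<le> c (Suc 0)"
    using Suc.prems by (intro Suc.IH)
  ultimately show ?case using Suc.prems(2)[of 0] by linarith
qed simp

text \<open>Apart from the first term, which is at most 1, the summands are compared with the
  telescoping differences of ln(x + D) - ln x. This adds up the remainders of
  \<open>first_derivative_test_exact\<close> over arbitrarily many frequencies.\<close>

lemma sum_reciprocal_diff_le:
  fixes m D :: real
  assumes "1 \<le> m" "0 \<le> D"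
  shows "(\<Sum>i<n. 1 / (m + real i) - 1 / (m + real i + D)) \<le> 1 + ln (1 + D)"
proof -
  define h where "h x = ln (x + D) - ln x" for x
  have step: "1 / (x + 1) - 1 / (x + 1 + D) \<le> h x - h (x + 1)" if x: "1 \<le> x" for x
  proof -
    have "(1 / (x + 1) - 1 / (x + 1 + D)) * ((x + 1) - x) \<le> - h (x + 1) - (- h x)"
    proof -
      have der: "((\<lambda>x. - h x) has_real_derivative (1 / y - 1 / (y + D))) (at y)" if "0 < y" for y
        unfolding h_def using that assms(2) by (auto intro!: derivative_eq_intros simp: field_simps)
      obtain y where y: "x < y" "y < x + 1" "- h (x + 1) - (- h x) = (x + 1 - x) * (1 / y - 1 / (y + D))"
        using MVT2[of x "x + 1" "\<lambda>x. - h x" "\<lambda>y. 1 / y - 1 / (y + D)"] der x by auto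
      have "1 / (x + 1) - 1 / (x + 1 + D) = D / ((x + 1) * (x + 1 + D))" using x assms(2) by (simp add: field_simps)
      also have "\<dots> \<le> D / (y * (y + D))" using y x assms(2) by (intro divide_left_mono mult_mono mult_pos_pos) auto
      also have "\<dots> = 1 / y - 1 / (y + D)" using y x assms(2) by (simp add: field_simps)
      finally show ?thesis using y(3) by simp
    qed
    then show ?thesis by simp
  qed
  have h0: "0 \<le> h x" "h x \<le> ln (1 + D)" if "1 \<le> x" for x
  proof -
    show "0 \<le> h x" using that assms(2) by (simp add: h_def)
    have "h x = ln ((x + D) / x)" using that assms(2) by (simp add: h_def ln_div)
    also have "\<dots> \<le> ln (1 + D)"
      using that assms(2) mult_left_mono[of 1 x D]
      by (subst ln_le_cancel_iff) (auto simp: field_simps add_pos_nonneg)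
    finally show "h x \<le> ln (1 + D)" .
  qed
  have "(\<Sum>i<Suc k. 1 / (m + real i) - 1 / (m + real i + D)) \<le> 1 + h m - h (m + real k)" for k
  proof (induction k)
    case 0
    have "1 / m \<le> 1" using assms by simp
    moreover have "0 \<le> 1 / (m + D)" using assms by simp
    ultimately have "1 / m - 1 / (m + D) \<le> 1" by linarith
    then show ?case by simp
  next
    case (Suc k)
    have "1 / (m + real (Suc k)) - 1 / (m + real (Suc k) + D) \<le> h (m + real k) - h (m + real (Suc k))"
      using step[of "m + real k"] assms by (simp add: ac_simps)
    then show ?case using Suc by simp
  qed
  moreover have "1 + h m - h (m + real k) \<le> 1 + ln (1 + D)" for k
    using h0(1)[of "m + real k"] h0(2)[of m] assms by simp
  ultimately have *: "(\<Sum>i<Suc k. 1 / (m + real i) - 1 / (m + real i + D)) \<le> 1 + ln (1 + D)" for k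
    by (meson order_trans)
  show ?thesis
  proof (cases n)
    case 0
    have "0 \<le> ln (1 + D)" using assms(2) by simp
    then show ?thesis using 0 by simp
  qed (use * in simp)
qed

text \<open>This is why the intervals of integration end at half-integers: changing the frequency by
  1 reverses the sign of the boundary term.\<close>

lemma ee_half_integer_progression:
  assumes "s = 1 \<or> s = (-1::int)"
  shows "ee (- (of_int (s * int i) * (of_int e + 1/2))) = (-1) ^ i"
proof -
  have "ee (- (of_int (s * int i) * (of_int e + 1/2))) = ee (of_int (- (s * int i * e)) + of_nat i * (- (of_int s / 2)))"
    by (rule arg_cong[where f = ee]) (simp add: algebra_simps)
  also have "\<dots> = ee (- (of_int s / 2)) ^ i"
    unfolding ee_add ee_mult_of_nat ee_of_int by simp
  also have "ee (- (of_int s / 2)) = -1"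
    using assms cnj_ee[of "1/2"] by auto
  finally show ?thesis .
qed

text \<open>Up to a constant factor of modulus 1/(2 pi) the sum alternates with decreasing
  coefficients 1/(d + i), and is bounded by its first term.\<close>

lemma boundary_sum_le:
  fixes p u t :: real
  assumes s: "s = 1 \<or> s = (-1::int)" and t: "t = of_int e + 1/2" and d: "1 \<le> of_int s * (of_int \<nu> - p)"
  shows "norm (\<Sum>i<n. ee (u - of_int (\<nu> + s * int i) * t) / (2 * pi * \<i> * complex_of_real (p - of_int (\<nu> + s * int i)))) \<le> 1 / (2 * pi)"
proof -
  define d where "d = of_int s * (of_int \<nu> - p)"
  define c where "c i = 1 / (d + real i)" for i
  define C where "C = ee (u - of_int \<nu> * t) * (- of_int s / (2 * pi * \<i>))"
  have d1: "1 \<le> d" using assms by (simp add: d_def)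
  have trm: "ee (u - of_int (\<nu> + s * int i) * t) / (2 * pi * \<i> * complex_of_real (p - of_int (\<nu> + s * int i))) = C * complex_of_real ((-1) ^ i * c i)" for i
  proof -
    have "ee (u - of_int (\<nu> + s * int i) * t) = ee ((u - of_int \<nu> * t) + - (of_int (s * int i) * (of_int e + 1/2)))"
      unfolding t by (rule arg_cong[where f = ee]) (simp add: algebra_simps)
    also have "\<dots> = ee (u - of_int \<nu> * t) * (-1) ^ i"
      unfolding ee_add ee_half_integer_progression[OF s] ..
    finally have 1: "ee (u - of_int (\<nu> + s * int i) * t) = ee (u - of_int \<nu> * t) * (-1) ^ i" .
    have 2: "p - of_int (\<nu> + s * int i) = - of_int s * (d + real i)"
      using s by (auto simp: d_def algebra_simps)
    have "d + real i \<noteq> 0" using d1 by linarith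
    define X where "X = complex_of_real (d + real i)"
    have X: "complex_of_real (- of_int s * (d + real i)) = - of_int s * X" by (simp add: X_def)
    have c: "complex_of_real ((-1) ^ i * (1 / (d + real i))) = (-1) ^ i * (1 / X)"
      by (simp only: X_def of_real_mult of_real_divide of_real_power of_real_minus of_real_1)
    show ?thesis
      unfolding 1 2 X C_def c_def c using s by (elim disjE) simp_all
  qed
  have "(\<Sum>i<n. ee (u - of_int (\<nu> + s * int i) * t) / (2 * pi * \<i> * complex_of_real (p - of_int (\<nu> + s * int i)))) = C * complex_of_real (\<Sum>i<n. (-1) ^ i * c i)"
    unfolding trm by (simp only: sum_distrib_left of_real_sum)
  then have eq: "norm (\<Sum>i<n. ee (u - of_int (\<nu> + s * int i) * t) / (2 * pi * \<i> * complex_of_real (p - of_int (\<nu> + s * int i)))) = norm C * \<bar>\<Sum>i<n. (-1) ^ i * c i\<bar>"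
    by (simp only: norm_mult norm_of_real)
  have nc: "norm C = 1 / (2 * pi)"
    using s by (auto simp: C_def norm_mult norm_divide)
  have "\<bar>\<Sum>i<n. (-1) ^ i * c i\<bar> \<le> 1"
  proof -
    have "0 \<le> (\<Sum>i<n. (-1) ^ i * c i) \<and> (\<Sum>i<n. (-1) ^ i * c i) \<le> c 0"
      using d1 by (intro alternating_sum_bounds) (auto simp: c_def intro!: divide_left_mono mult_pos_pos)
    moreover have "c 0 \<le> 1" using d1 by (simp add: c_def)
    ultimately show ?thesis by simp
  qed
  then have "1 / (2 * pi) * \<bar>\<Sum>i<n. (-1) ^ i * c i\<bar> \<le> 1 / (2 * pi) * 1" by (intro mult_left_mono) auto
  then show ?thesis unfolding eq nc by (simp only: mult_1_right)
qed

locale convex_phase =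
  fixes F F' F'' :: "real \<Rightarrow> real"
  assumes d1: "\<And>x. (F has_real_derivative F' x) (at x)"
    and d2: "\<And>x. (F' has_real_derivative F'' x) (at x)"
    and nonneg: "\<And>x. 0 \<le> F'' x"
begin

text \<open>The interval consists of the \<open>k\<close> unit cells centred at the integers from
  \<open>a\<close> to \<open>a + k - 1\<close>.\<close>

definition osc :: "int \<Rightarrow> nat \<Rightarrow> int \<Rightarrow> complex" where
  "osc a k \<nu> = integral {of_int a - 1/2..of_int a - 1/2 + real k} (\<lambda>x. ee (F x - of_int \<nu> * x))"

lemma F'_mono: "x \<le> y \<Longrightarrow> F' x \<le> F' y"
  by (rule DERIV_nonneg_imp_nondecreasing) (use d2 nonneg in auto)

lemma contF: "continuous_on S F"
  using d1 DERIV_isCont by (intro continuous_at_imp_continuous_on) blast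

text \<open>At frequencies at distance 1 or more from the range of \<open>F'\<close> there is no
  stationary point. The boundary terms alternate and the remainders are nearly telescoping, so the
  bound does not depend on the number \<open>n\<close> of frequencies.\<close>

lemma osc_tail:
  fixes a :: int and k :: nat
  defines "A \<equiv> of_int a - 1/2" and "D \<equiv> of_int a - 1/2 + real k"
  assumes s: "s = 1 \<or> s = (-1::int)"
    and dA: "1 \<le> of_int s * (of_int \<nu> - F' A)" and dD: "1 \<le> of_int s * (of_int \<nu> - F' D)"
  shows "norm (\<Sum>i<n. osc a k (\<nu> + s * int i)) \<le> 1 + ln (1 + (F' D - F' A))"
proof -
  define E where "E t i = ee (F t - of_int (\<nu> + s * int i) * t) / (2 * pi * \<i> * complex_of_real (F' t - of_int (\<nu> + s * int i)))" for t i
  \<comment> \<open>\<open>m\<close> is the distance from \<open>\<nu>\<close> to the nearer end of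
    the range of \<open>F'\<close> on the interval; the distance to the other end is
    \<open>m + Dl\<close>.\<close>
  define m where "m = (if s = 1 then of_int \<nu> - F' D else F' A - of_int \<nu>)"
  define Dl where "Dl = F' D - F' A"
  have AD: "A \<le> D" by (simp add: A_def D_def)
  have Dl: "0 \<le> Dl" using F'_mono[OF AD] by (simp add: Dl_def)
  have m: "1 \<le> m" using s dA dD by (auto simp: m_def)
  have err: "norm (osc a k (\<nu> + s * int i) - (E D i - E A i)) \<le> (1 / (m + real i) - 1 / (m + real i + Dl)) / (2 * pi)" for i
  proof -
    have "norm (integral {A..D} (\<lambda>x. ee (F x - of_int (\<nu> + s * int i) * x)) - (E D i - E A i))
       \<le> (1 / (F' A - of_int (\<nu> + s * int i)) - 1 / (F' D - of_int (\<nu> + s * int i))) / (2 * pi)"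
      unfolding E_def
    proof (rule first_derivative_test_exact[where F'' = F''])
      fix x assume x: "x \<in> {A..D}"
      have 1: "((\<lambda>x. of_int (\<nu> + s * int i) * x) has_real_derivative of_int (\<nu> + s * int i)) (at x)"
        using DERIV_cmult_Id .
      show "((\<lambda>x. F x - of_int (\<nu> + s * int i) * x) has_real_derivative F' x - of_int (\<nu> + s * int i)) (at x within {A..D})"
        by (rule has_field_derivative_at_within[OF DERIV_diff[OF d1 1]])
      show "((\<lambda>x. F' x - of_int (\<nu> + s * int i)) has_real_derivative F'' x) (at x within {A..D})"
        using has_field_derivative_at_within[OF DERIV_diff[OF d2 DERIV_const]] by simp
      show "0 \<le> F'' x" by (rule nonneg)
      have "F' A \<le> F' x" "F' x \<le> F' D" using x F'_mono by auto
      then show "F' x - of_int (\<nu> + s * int i) \<noteq> 0" using s dA dD by auto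
    qed (rule AD)
    also have "1 / (F' A - of_int (\<nu> + s * int i)) - 1 / (F' D - of_int (\<nu> + s * int i)) = 1 / (m + real i) - 1 / (m + real i + Dl)"
    proof (cases "s = 1")
      case True
      have e: "F' A - of_int (\<nu> + s * int i) = - (m + real i + Dl)" "F' D - of_int (\<nu> + s * int i) = - (m + real i)"
        using True by (auto simp: m_def Dl_def)
      show ?thesis unfolding e divide_minus_right by simp
    next
      case False
      then have e: "F' A - of_int (\<nu> + s * int i) = m + real i" "F' D - of_int (\<nu> + s * int i) = m + real i + Dl"
        using s by (auto simp: m_def Dl_def)
      show ?thesis unfolding e by simp
    qed
    finally show ?thesis by (simp add: osc_def A_def D_def)
  qed
  have bD: "norm (\<Sum>i<n. E D i) \<le> 1 / (2 * pi)"
    unfolding E_def by (rule boundary_sum_le[OF s _ dD, of _ "a + int k - 1"]) (simp add: D_def)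
  have bA: "norm (\<Sum>i<n. E A i) \<le> 1 / (2 * pi)"
    unfolding E_def by (rule boundary_sum_le[OF s _ dA, of _ "a - 1"]) (simp add: A_def)
  have "norm (\<Sum>i<n. osc a k (\<nu> + s * int i) - (E D i - E A i)) \<le> (\<Sum>i<n. (1 / (m + real i) - 1 / (m + real i + Dl)) / (2 * pi))"
    by (intro sum_norm_le err)
  also have "\<dots> = (\<Sum>i<n. 1 / (m + real i) - 1 / (m + real i + Dl)) / (2 * pi)"
    by (rule sum_divide_distrib[symmetric])
  also have "\<dots> \<le> (1 + ln (1 + Dl)) / (2 * pi)"
    by (intro divide_right_mono sum_reciprocal_diff_le m Dl) simp
  finally have e: "norm (\<Sum>i<n. osc a k (\<nu> + s * int i) - (E D i - E A i)) \<le> (1 + ln (1 + Dl)) / (2 * pi)" .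
  have "(\<Sum>i<n. osc a k (\<nu> + s * int i)) = (\<Sum>i<n. osc a k (\<nu> + s * int i) - (E D i - E A i)) + (\<Sum>i<n. E D i) - (\<Sum>i<n. E A i)"
    by (simp add: sum_subtractf)
  also have "norm \<dots> \<le> (1 + ln (1 + Dl)) / (2 * pi) + 1 / (2 * pi) + 1 / (2 * pi)"
    by (rule norm_add_diff_le[OF e bD bA])
  also have "\<dots> = (3 + ln (1 + Dl)) / (2 * pi)" by (simp add: add_divide_distrib)
  also have "\<dots> \<le> (3 + ln (1 + Dl)) / 3" using pi_gt3 Dl by (intro divide_left_mono) auto
  also have "\<dots> \<le> 1 + ln (1 + Dl)" using Dl by (simp add: field_simps)
  finally show ?thesis by (simp add: Dl_def)
qed

text \<open>The frequencies outside \<open>{lo..hi}\<close> form at most two tails as in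
  \<open>osc_tail\<close>. Uniformity in \<open>x\<close> and \<open>y\<close> is what the sliding
  windows of \<open>truncated_Poisson\<close> require.\<close>

lemma sum_osc_range:
  fixes a :: int and k :: nat
  defines "A \<equiv> of_int a - 1/2" and "D \<equiv> of_int a - 1/2 + real k"
  defines "lo \<equiv> \<lceil>F' A\<rceil> - 1" and "hi \<equiv> \<lfloor>F' D\<rfloor> + 1"
  shows "norm (sum (osc a k) {x..y} - sum (osc a k) ({x..y} \<inter> {lo..hi})) \<le> 2 * (1 + ln (1 + (F' D - F' A)))"
proof -
  have AD: "F' A \<le> F' D" by (intro F'_mono) (simp add: A_def D_def)
  have lohi: "lo \<le> hi" using AD unfolding lo_def hi_def by linarith
  have up: "norm (sum (osc a k) {u..y}) \<le> 1 + ln (1 + (F' D - F' A))" if u: "hi < u" for u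
  proof -
    have "sum (osc a k) {u..y} = (\<Sum>i<nat (y - u + 1). osc a k (u + 1 * int i))"
      by (rule sum.reindex_bij_witness[of _ "\<lambda>i. u + int i" "\<lambda>v. nat (v - u)"]) auto
    also have "norm \<dots> \<le> 1 + ln (1 + (F' D - F' A))"
      unfolding A_def D_def
    proof (rule osc_tail)
      have "F' D + 1 \<le> of_int u" using u unfolding hi_def by linarith
      then show "1 \<le> of_int 1 * (of_int u - F' (of_int a - 1/2))" "1 \<le> of_int 1 * (of_int u - F' (of_int a - 1/2 + real k))"
        using AD by (auto simp: A_def D_def)
    qed simp
    finally show ?thesis .
  qed
  have down: "norm (sum (osc a k) {x..u}) \<le> 1 + ln (1 + (F' D - F' A))" if u: "u < lo" for u
  proof -
    have "sum (osc a k) {x..u} = (\<Sum>i<nat (u - x + 1). osc a k (u + (-1) * int i))"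
      by (rule sum.reindex_bij_witness[of _ "\<lambda>i. u - int i" "\<lambda>v. nat (u - v)"]) auto
    also have "norm \<dots> \<le> 1 + ln (1 + (F' D - F' A))"
      unfolding A_def D_def
    proof (rule osc_tail)
      have "of_int u \<le> F' A - 1" using u unfolding lo_def by linarith
      then show "1 \<le> of_int (-1) * (of_int u - F' (of_int a - 1/2))" "1 \<le> of_int (-1) * (of_int u - F' (of_int a - 1/2 + real k))"
        using AD by (auto simp: A_def D_def)
    qed simp
    finally show ?thesis .
  qed
  have split: "{x..y} = ({x..y} \<inter> {lo..hi}) \<union> {max x (hi + 1)..y} \<union> {x..min y (lo - 1)}"
    using lohi by auto
  have "sum (osc a k) {x..y} = sum (osc a k) ({x..y} \<inter> {lo..hi}) + sum (osc a k) {max x (hi + 1)..y} + sum (osc a k) {x..min y (lo - 1)}"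
    by (subst split, subst sum.union_disjoint, use lohi in auto)+ (subst sum.union_disjoint, auto)
  then have "sum (osc a k) {x..y} - sum (osc a k) ({x..y} \<inter> {lo..hi}) = sum (osc a k) {max x (hi + 1)..y} + sum (osc a k) {x..min y (lo - 1)}"
    by simp
  also have "norm \<dots> \<le> (1 + ln (1 + (F' D - F' A))) + (1 + ln (1 + (F' D - F' A)))"
    by (intro norm_triangle_mono up down) auto
  finally show ?thesis by simp
qed

lemma integral_cells:
  fixes g :: "real \<Rightarrow> complex"
  assumes "continuous_on UNIV g"
  shows "integral {c..c + real k} g = (\<Sum>i<k. integral {c + real i..c + real i + 1} g)"
proof (induction k)
  case (Suc k)
  have int: "g integrable_on {u..v}" for u v using assms by (intro integrable_continuous_interval) (auto intro: continuous_on_subset)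
  have "integral {c..c + real k} g + integral {c + real k..c + real (Suc k)} g = integral {c..c + real (Suc k)} g"
    by (intro Henstock_Kurzweil_Integration.integral_combine int) auto
  then show ?case using Suc by (simp add: ac_simps)
qed simp

text \<open>The integral of \<open>ee (F x)\<close> against \<open>fejer V\<close> is evaluated
  twice. Cell by cell it is \<open>V\<close> times the exponential sum up to o(V); expanded into
  frequencies it is a sum over \<open>V\<close> windows of frequencies, all but boundedly many of
  which contain the main range. Division by \<open>V\<close> and the limit leave only the uniform
  tail bound.\<close>

theorem truncated_Poisson:
  fixes a :: int and k :: nat
  defines "A \<equiv> of_int a - 1/2" and "D \<equiv> of_int a - 1/2 + real k"
  shows "norm ((\<Sum>i<k. ee (F (of_int (a + int i)))) - sum (osc a k) {\<lceil>F' A\<rceil> - 1..\<lfloor>F' D\<rfloor> + 1}) \<le> 2 * (1 + ln (1 + (F' D - F' A)))"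
proof -
  define N0 where "N0 = {\<lceil>F' A\<rceil> - 1..\<lfloor>F' D\<rfloor> + 1}"
  define T where "T = 2 * (1 + ln (1 + (F' D - F' A)))"
  define M where "M = (\<Sum>\<nu>\<in>N0. norm (osc a k \<nu>))"
  define Main where "Main = sum (osc a k) N0"
  define S where "S = (\<Sum>i<k. ee (F (of_int (a + int i))))"
  define K where "K = max \<bar>F' A\<bar> \<bar>F' D\<bar>"
  \<comment> \<open>For v0 \<le> j < V - v0 the window \<open>{- j..V - 1 - j}\<close> contains all
    of \<open>N0\<close>, so at most \<open>2 * v0\<close> windows are incomplete.\<close>
  define v0 where "v0 = nat (\<bar>\<lceil>F' A\<rceil> - 1\<bar> + \<bar>\<lfloor>F' D\<rfloor> + 1\<bar>)"
  have AD: "A \<le> D" by (simp add: A_def D_def)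
  have M0: "0 \<le> M" by (simp add: M_def sum_nonneg)
  have K0: "0 \<le> K" by (simp add: K_def)
  have range: "norm (sum (osc a k) {x..y} - Main) \<le> T + (if N0 \<subseteq> {x..y} then 0 else M)" for x y
  proof -
    have 1: "norm (sum (osc a k) {x..y} - sum (osc a k) ({x..y} \<inter> N0)) \<le> T"
      using sum_osc_range[of a k x y] by (simp add: N0_def T_def A_def D_def)
    have fin: "finite N0" by (simp add: N0_def)
    have "Main - sum (osc a k) ({x..y} \<inter> N0) = sum (osc a k) (N0 - {x..y})"
      unfolding Main_def using fin by (subst sum.Int_Diff[of N0 _ "{x..y}"]) (auto simp: Int_commute)
    moreover have "norm (sum (osc a k) (N0 - {x..y})) \<le> (if N0 \<subseteq> {x..y} then 0 else M)"
    proof (cases "N0 \<subseteq> {x..y}")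
      case True
      then have e: "N0 - {x..y} = {}" by auto
      show ?thesis unfolding e using True by simp
    next
      case False
      have "norm (sum (osc a k) (N0 - {x..y})) \<le> (\<Sum>\<nu>\<in>N0 - {x..y}. norm (osc a k \<nu>))" by (rule norm_sum)
      also have "\<dots> \<le> M" unfolding M_def using fin by (intro sum_mono2) auto
      finally show ?thesis using False by simp
    qed
    ultimately have 2: "norm (Main - sum (osc a k) ({x..y} \<inter> N0)) \<le> (if N0 \<subseteq> {x..y} then 0 else M)" by simp
    have "sum (osc a k) {x..y} - Main = (sum (osc a k) {x..y} - sum (osc a k) ({x..y} \<inter> N0)) - (Main - sum (osc a k) ({x..y} \<inter> N0))"
      by simp
    also have "norm \<dots> \<le> T + (if N0 \<subseteq> {x..y} then 0 else M)"
      using norm_triangle_ineq4 1 2 by (rule order_trans[OF _ add_mono])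
    finally show ?thesis .
  qed
  have bound: "norm (S - Main) \<le> T + (2 * real v0 * M + 4 * pi * K * real k * sqrt (real V)) / real V" if V: "0 < V" for V :: nat
  proof -
    define W where "W = (\<Sum>j<V. \<Sum>i<V. osc a k (int i - int j))"
    have inner: "(\<Sum>i<V. osc a k (int i - int j)) = sum (osc a k) {- int j..int V - 1 - int j}" for j
      by (rule sum.reindex_bij_witness[of _ "\<lambda>v. nat (v + int j)" "\<lambda>i. int i - int j"]) auto
    have "norm (W - of_nat V * Main) = norm (\<Sum>j<V. (\<Sum>i<V. osc a k (int i - int j)) - Main)"
      by (simp add: W_def sum_subtractf)
    also have "\<dots> \<le> (\<Sum>j<V. T + (if N0 \<subseteq> {- int j..int V - 1 - int j} then 0 else M))"
      unfolding inner by (intro sum_norm_le range)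
    also have "\<dots> = real V * T + (\<Sum>j<V. if N0 \<subseteq> {- int j..int V - 1 - int j} then 0 else M)"
      by (simp add: sum.distrib)
    also have "(\<Sum>j<V. if N0 \<subseteq> {- int j..int V - 1 - int j} then 0 else M) \<le> (\<Sum>j<V. if j \<in> {..<v0} \<union> {V - v0..<V} then M else 0)"
    proof (intro sum_mono)
      fix j assume j: "j \<in> {..<V}"
      have "N0 \<subseteq> {- int j..int V - 1 - int j}" if "j \<notin> {..<v0} \<union> {V - v0..<V}"
        using that j unfolding N0_def v0_def by auto
      then show "(if N0 \<subseteq> {- int j..int V - 1 - int j} then 0 else M) \<le> (if j \<in> {..<v0} \<union> {V - v0..<V} then M else 0)"
        using M0 by auto
    qed
    also have "\<dots> = real (card ({..<V} \<inter> ({..<v0} \<union> {V - v0..<V}))) * M"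
      by (simp only: sum.inter_restrict[symmetric, OF finite_lessThan] sum_constant)
    also have "\<dots> \<le> (2 * real v0) * M"
    proof (rule mult_right_mono[OF _ M0])
      have "card ({..<V} \<inter> ({..<v0} \<union> {V - v0..<V})) \<le> card ({..<v0} \<union> {V - v0..<V})" by (intro card_mono) auto
      also have "\<dots> \<le> card {..<v0} + card {V - v0..<V}" by (rule card_Un_le)
      also have "\<dots> \<le> 2 * v0" by simp
      finally show "real (card ({..<V} \<inter> ({..<v0} \<union> {V - v0..<V}))) \<le> 2 * real v0" by linarith
    qed
    finally have W1: "norm (W - of_nat V * Main) \<le> real V * T + 2 * real v0 * M" by simp
    have cont1: "continuous_on UNIV (\<lambda>x. ee (F x) * complex_of_real (fejer V x))"
      by (intro continuous_intros contF continuous_on_fejer)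
    have intF: "(\<lambda>x. ee (F x - of_int \<nu> * x)) integrable_on {A..D}" for \<nu>
      by (intro integrable_continuous_interval continuous_intros contF)
    have "W = integral {A..D} (\<lambda>x. \<Sum>j<V. \<Sum>i<V. ee (F x - of_int (int i - int j) * x))"
    proof -
      have "W = (\<Sum>j<V. \<Sum>i<V. integral {A..D} (\<lambda>x. ee (F x - of_int (int i - int j) * x)))"
        by (simp add: W_def osc_def A_def D_def)
      also have "\<dots> = (\<Sum>j<V. integral {A..D} (\<lambda>x. \<Sum>i<V. ee (F x - of_int (int i - int j) * x)))"
        by (intro sum.cong refl integral_sum[symmetric] intF) auto
      also have "\<dots> = integral {A..D} (\<lambda>x. \<Sum>j<V. \<Sum>i<V. ee (F x - of_int (int i - int j) * x))"
        by (intro integral_sum[symmetric] integrable_sum intF) auto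
      finally show ?thesis .
    qed
    also have "(\<lambda>x. \<Sum>j<V. \<Sum>i<V. ee (F x - of_int (int i - int j) * x)) = (\<lambda>x. ee (F x) * complex_of_real (fejer V x))"
    proof
      fix x
      have "ee (F x - of_int (int i - int j) * x) = ee (F x) * ee (of_int (int j - int i) * x)" for i j
        unfolding ee_add[symmetric] by (rule arg_cong[where f = ee]) (simp add: algebra_simps)
      then show "(\<Sum>j<V. \<Sum>i<V. ee (F x - of_int (int i - int j) * x)) = ee (F x) * complex_of_real (fejer V x)"
        unfolding of_real_fejer by (simp only: sum_distrib_left)
    qed
    also have "integral {A..D} (\<lambda>x. ee (F x) * complex_of_real (fejer V x)) = (\<Sum>i<k. integral {A + real i..A + real i + 1} (\<lambda>x. ee (F x) * complex_of_real (fejer V x)))"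
      using integral_cells[OF cont1, of A k] by (simp add: A_def D_def)
    finally have W2: "W = (\<Sum>i<k. integral {A + real i..A + real i + 1} (\<lambda>x. ee (F x) * complex_of_real (fejer V x)))" .
    have "norm (W - of_nat V * S) = norm (\<Sum>i<k. integral {A + real i..A + real i + 1} (\<lambda>x. ee (F x) * complex_of_real (fejer V x)) - of_nat V * ee (F (of_int (a + int i))))"
      by (simp only: W2 S_def sum_subtractf sum_distrib_left)
    also have "\<dots> \<le> (\<Sum>i<k. 4 * pi * K * sqrt (real V))"
    proof (intro sum_norm_le)
      fix i assume i: "i \<in> {..<k}"
      define c where "c = real_of_int (a + int i)"
      have e: "A + real i = c - 1/2" "A + real i + 1 = c + 1/2" by (auto simp: c_def A_def)
      have sub: "A \<le> c - 1/2" "c + 1/2 \<le> D" using i by (auto simp: c_def A_def D_def)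
      have lip: "\<bar>F x - F c\<bar> \<le> K * \<bar>x - c\<bar>" if x: "x \<in> {c - 1/2..c + 1/2}" for x
      proof -
        have "norm (F x - F c) \<le> K * norm (x - c)"
        proof (rule field_differentiable_bound[where S = "{A..D}" and f' = F'])
          fix z assume z: "z \<in> {A..D}"
          then show "norm (F' z) \<le> K" using F'_mono[of A z] F'_mono[of z D] by (auto simp: K_def)
          show "(F has_field_derivative F' z) (at z within {A..D})" by (rule has_field_derivative_at_within[OF d1])
        qed (use x sub in auto)
        then show ?thesis by simp
      qed
      have "norm (integral {c - 1/2..c + 1/2} (\<lambda>x. ee (F x) * complex_of_real (fejer V x)) - real V * ee (F c)) \<le> 4 * pi * K * sqrt (real V)"
        by (rule fejer_cell[OF V contF c_def lip K0])
      then show "norm (integral {A + real i..A + real i + 1} (\<lambda>x. ee (F x) * complex_of_real (fejer V x)) - of_nat V * ee (F (of_int (a + int i)))) \<le> 4 * pi * K * sqrt (real V)"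
        unfolding e(2) unfolding e(1) by (simp only: c_def[symmetric] of_real_of_nat_eq)
    qed
    finally have W3: "norm (W - of_nat V * S) \<le> 4 * pi * K * real k * sqrt (real V)" by (simp add: mult_ac)
    have "real V * norm (S - Main) = norm (of_nat V * (S - Main))" by (simp add: norm_mult)
    also have "of_nat V * (S - Main) = (W - of_nat V * Main) - (W - of_nat V * S)" by (simp add: algebra_simps)
    also have "norm \<dots> \<le> (real V * T + 2 * real v0 * M) + 4 * pi * K * real k * sqrt (real V)"
      by (rule order_trans[OF norm_triangle_ineq4 add_mono[OF W1 W3]])
    finally show ?thesis using V by (simp add: field_simps)
  qed
  have "(\<lambda>V. T + (2 * real v0 * M + 4 * pi * K * real k * sqrt (real V)) / real V) \<longlonglongrightarrow> T"
    by real_asymp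
  then have "norm (S - Main) \<le> T"
    by (rule tendsto_lowerbound) (use bound in \<open>auto intro!: eventually_sequentiallyI[of 1]\<close>)
  then show ?thesis by (simp add: S_def Main_def N0_def T_def)
qed

end

subsection \<open>The exponential sums over fractions and their dual sums\<close>

lemma sum_inverse_le_ln: "1 \<le> n \<Longrightarrow> (\<Sum>j=1..n. 1 / real j) \<le> 1 + ln (real n)"
proof (induction n rule: dec_induct)
  case (step n)
  have n: "0 < real n" using step by simp
  have "ln (real n / real (Suc n)) \<le> real n / real (Suc n) - 1"
    using n by (intro ln_le_minus_one) simp
  also have "\<dots> = - (1 / real (Suc n))" by (simp add: field_simps)
  finally have "1 / real (Suc n) \<le> ln (real (Suc n)) - ln (real n)" using n by (simp add: ln_div)
  then show ?case using step by simp
qed simp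

lemma sum_inverse_int_shift_le:
  fixes S :: "int set" and x y X :: real
  assumes fin: "finite S" and X: "1 \<le> X" and S: "\<And>\<nu>. \<nu> \<in> S \<Longrightarrow> 1 \<le> of_int \<nu> - x \<and> of_int \<nu> - x \<le> X"
  shows "(\<Sum>\<nu>\<in>S. 1 / (of_int \<nu> - x)) \<le> 1 + ln X"
proof -
  define j where "j \<nu> = nat \<lfloor>of_int \<nu> - x\<rfloor>" for \<nu> :: int
  have j: "1 \<le> j \<nu>" "real (j \<nu>) \<le> of_int \<nu> - x" if "\<nu> \<in> S" for \<nu>
  proof -
    have "1 \<le> \<lfloor>of_int \<nu> - x\<rfloor>" using S[OF that] by linarith
    then show "1 \<le> j \<nu>" "real (j \<nu>) \<le> of_int \<nu> - x" unfolding j_def by linarith+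
  qed
  have inj: "inj_on j S"
  proof (rule inj_onI)
    fix u v assume "u \<in> S" "v \<in> S" "j u = j v"
    moreover have "0 \<le> \<lfloor>of_int u - x\<rfloor>" "0 \<le> \<lfloor>of_int v - x\<rfloor>" using S[of u] S[of v] calculation by linarith+
    ultimately have "\<lfloor>of_int u - x\<rfloor> = \<lfloor>of_int v - x\<rfloor>" unfolding j_def using eq_nat_nat_iff by blast
    then show "u = v" by linarith
  qed
  have nX: "1 \<le> nat \<lfloor>X\<rfloor>" using X by linarith
  have "(\<Sum>\<nu>\<in>S. 1 / (of_int \<nu> - x)) \<le> (\<Sum>\<nu>\<in>S. 1 / real (j \<nu>))"
    using j S by (intro sum_mono divide_left_mono mult_pos_pos) (force simp: Suc_le_eq)+
  also have "\<dots> = (\<Sum>i\<in>j ` S. 1 / real i)" by (simp add: sum.reindex[OF inj])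
  also have "\<dots> \<le> (\<Sum>i=1..nat \<lfloor>X\<rfloor>. 1 / real i)"
  proof (intro sum_mono2)
    show "j ` S \<subseteq> {1..nat \<lfloor>X\<rfloor>}"
    proof
      fix i assume "i \<in> j ` S"
      then obtain \<nu> where \<nu>: "\<nu> \<in> S" "i = j \<nu>" by auto
      have "real i \<le> X" using j(2)[OF \<nu>(1)] S[OF \<nu>(1)] \<nu>(2) by linarith
      then have "i \<le> nat \<lfloor>X\<rfloor>" by linarith
      then show "i \<in> {1..nat \<lfloor>X\<rfloor>}" using j(1)[OF \<nu>(1)] \<nu>(2) by simp
    qed
  qed auto
  also have "\<dots> \<le> 1 + ln (real (nat \<lfloor>X\<rfloor>))" by (rule sum_inverse_le_ln[OF nX])
  also have "\<dots> \<le> 1 + ln X"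
  proof -
    have "real (nat \<lfloor>X\<rfloor>) \<le> X" "0 < real (nat \<lfloor>X\<rfloor>)" using X nX by linarith+
    then show ?thesis using X by simp
  qed
  finally show ?thesis .
qed

lemma sum_inverse_int_shift_le':
  fixes S :: "int set" and x y X :: real
  assumes fin: "finite S" and X: "1 \<le> X" and S: "\<And>\<nu>. \<nu> \<in> S \<Longrightarrow> 1 \<le> y - of_int \<nu> \<and> y - of_int \<nu> \<le> X"
  shows "(\<Sum>\<nu>\<in>S. 1 / (y - of_int \<nu>)) \<le> 1 + ln X"
proof -
  have "(\<Sum>\<nu>\<in>S. 1 / (y - of_int \<nu>)) = (\<Sum>\<nu>\<in>uminus ` S. 1 / (of_int \<nu> - (- y)))"
    by (subst sum.reindex) (auto simp: inj_on_def)
  also have "\<dots> \<le> 1 + ln X" using assms by (intro sum_inverse_int_shift_le) auto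
  finally show ?thesis .
qed

lemma sum_inverse_sqrt_le: "(\<Sum>q=1..n. 1 / sqrt (real q)) \<le> 2 * sqrt (real n)"
proof (induction n)
  case (Suc n)
  define a b where "a = sqrt (real n)" and "b = sqrt (real (Suc n))"
  have ab: "0 \<le> a" "0 < b" "a \<le> b" "b * b - a * a = 1" by (auto simp: a_def b_def)
  have "(b - a) * (b + a) = 1" using ab by (simp add: algebra_simps)
  moreover have "(b - a) * (b + a) \<le> (b - a) * (2 * b)" using ab by (intro mult_left_mono) auto
  ultimately have "1 \<le> (2 * b - 2 * a) * b" by (simp add: algebra_simps)
  then have "1 / b \<le> 2 * b - 2 * a" using ab by (simp add: field_simps)
  then show ?case using Suc by (simp add: a_def b_def)
qed simp

text \<open>Complete Fresnel integrals are only needed through a primitive that decays at infinity.\<close>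

definition fresnel :: "real \<Rightarrow> complex" where
  "fresnel = (SOME H. (\<forall>x. (H has_vector_derivative - ee (x\<^sup>2)) (at x)) \<and> (\<forall>u>0. norm (H u) \<le> 1 / u))"

lemma fresnel:
  "(fresnel has_vector_derivative - ee (x\<^sup>2)) (at x)" "u > 0 \<Longrightarrow> norm (fresnel u) \<le> 1 / u"
proof -
  have "\<exists>H. (\<forall>x. (H has_vector_derivative - ee (x\<^sup>2)) (at x)) \<and> (\<forall>u>0. norm (H u) \<le> 1 / u)"
    using Fresnel_exists by metis
  from someI_ex[OF this] show "(fresnel has_vector_derivative - ee (x\<^sup>2)) (at x)" "u > 0 \<Longrightarrow> norm (fresnel u) \<le> 1 / u"
    unfolding fresnel_def by auto
qed

text \<open>All conditions are symmetric in \<open>f\<close> and \<open>g\<close>, so every estimate may be applied to the dual function.\<close>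

locale legendre_pair =
  fixes B L :: real and f fd fdd g gd gdd :: "real \<Rightarrow> real"
  assumes B: "1 \<le> B" and L: "0 \<le> L"
    and f1: "(f has_real_derivative fd x) (at x)" and f2: "(fd has_real_derivative fdd x) (at x)"
    and f3: "1 / B \<le> fdd x" and f4: "fdd x \<le> B" and f5: "\<bar>fdd x - fdd y\<bar> \<le> L * \<bar>x - y\<bar>"
    and g1: "(g has_real_derivative gd x) (at x)" and g2: "(gd has_real_derivative gdd x) (at x)"
    and g3: "1 / B \<le> gdd x" and g4: "gdd x \<le> B" and g5: "\<bar>gdd x - gdd y\<bar> \<le> L * \<bar>x - y\<bar>"
    and fg: "fd (gd x) = x" and gf: "gd (fd x) = x" and leg: "g x = x * gd x - f (gd x)"
begin

lemma swap: "legendre_pair B L g gd gdd f fd fdd"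
  by unfold_locales (use B L f1 f2 f3 f4 f5 g1 g2 g3 g4 g5 fg gf leg in \<open>auto simp: mult.commute\<close>)

lemma B0: "0 < B"
  using B by simp

lemma fdd_pos: "0 < fdd x"
  using f3[of x] B0 by (smt (verit) divide_pos_pos)

lemma fd_diff:
  assumes "x \<le> y"
  shows "(y - x) / B \<le> fd y - fd x" "fd y - fd x \<le> B * (y - x)"
proof -
  have "fd x - x / B \<le> fd y - y / B"
    by (rule DERIV_nonneg_imp_nondecreasing[OF assms, where f = "\<lambda>x. fd x - x / B"])
       (use f3 B0 in \<open>auto intro!: exI derivative_eq_intros f2\<close>)
  then show "(y - x) / B \<le> fd y - fd x" by (simp add: diff_divide_distrib)
  have "B * x - fd x \<le> B * y - fd y"
    by (rule DERIV_nonneg_imp_nondecreasing[OF assms, where f = "\<lambda>x. B * x - fd x"])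
       (use f4 B0 in \<open>auto intro!: exI derivative_eq_intros f2\<close>)
  then show "fd y - fd x \<le> B * (y - x)" by (simp add: algebra_simps)
qed

lemma fd_mono: "x \<le> y \<Longrightarrow> fd x \<le> fd y"
  using fd_diff(1)[of x y] B0 by (smt (verit) divide_nonneg_pos)

definition phase :: "nat \<Rightarrow> nat \<Rightarrow> real \<Rightarrow> real" where
  "phase k q x = real k * real q * f (x / real q)"

definition phase' :: "nat \<Rightarrow> nat \<Rightarrow> real \<Rightarrow> real" where
  "phase' k q x = real k * fd (x / real q)"

definition phase'' :: "nat \<Rightarrow> nat \<Rightarrow> real \<Rightarrow> real" where
  "phase'' k q x = real k / real q * fdd (x / real q)"

lemma phase_derivs:
  assumes "0 < q"
  shows "(phase k q has_real_derivative phase' k q x) (at x)" "(phase' k q has_real_derivative phase'' k q x) (at x)"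
proof -
  have c: "((\<lambda>x. x / real q) has_real_derivative 1 / real q) (at x)" by (rule DERIV_cdivide[OF DERIV_ident])
  show "(phase k q has_real_derivative phase' k q x) (at x)"
    using DERIV_cmult[OF DERIV_chain2[OF f1 c], of "real k * real q"] assms
    by (simp add: phase_def[abs_def] phase'_def)
  show "(phase' k q has_real_derivative phase'' k q x) (at x)"
    using DERIV_cmult[OF DERIV_chain2[OF f2 c], of "real k"] assms
    by (simp add: phase'_def[abs_def] phase''_def)
qed

lemma phase''_ge: "0 < q \<Longrightarrow> real k / (real q * B) \<le> phase'' k q x"
  using mult_left_mono[OF f3[of "x / real q"], of "real k / real q"] by (simp add: phase''_def)

lemma convex_phase:
  assumes "0 < q"
  shows "convex_phase (phase k q) (phase' k q) (phase'' k q)"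
proof
  show "0 \<le> phase'' k q x" for x
    using fdd_pos[of "x / real q"] by (simp add: phase''_def less_imp_le)
qed (use phase_derivs[OF assms] in auto)

text \<open>The part of the stationary phase amplitude that does not depend on q;
  \<open>gd (\<nu>/k)\<close> is the stationary point in the scaled variable x/q, where
  \<open>k * fd\<close> equals \<open>\<nu>\<close>.\<close>

definition dual_coeff :: "nat \<Rightarrow> int \<Rightarrow> complex" where
  "dual_coeff k \<nu> = 2 * fresnel 0 / complex_of_real (sqrt (real k * fdd (gd (of_int \<nu> / real k)) / 2))"

text \<open>By the Legendre relation \<open>leg\<close> the value of the phase at the stationary
  point is \<open>- q * k * g (\<nu>/k)\<close>.\<close>

definition dual_term :: "nat \<Rightarrow> nat \<Rightarrow> int \<Rightarrow> complex" where
  "dual_term k q \<nu> = dual_coeff k \<nu> * (sqrt (real q) *\<^sub>R ee (- (real q * (real k * g (of_int \<nu> / real k)))))"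

lemma norm_dual_coeff:
  assumes "0 < k"
  shows "norm (dual_coeff k \<nu>) \<le> 2 * norm (fresnel 0) * sqrt (2 * B) / sqrt (real k)"
proof -
  define r where "r = sqrt (real k * fdd (gd (of_int \<nu> / real k)) / 2)"
  have "real k / (2 * B) \<le> real k * fdd (gd (of_int \<nu> / real k)) / 2"
    using mult_left_mono[OF f3[of "gd (of_int \<nu> / real k)"], of "real k / 2"] assms by simp
  then have s: "sqrt (real k) / sqrt (2 * B) \<le> r"
    unfolding r_def real_sqrt_divide[symmetric] by (rule real_sqrt_le_mono)
  have p: "0 < sqrt (real k) / sqrt (2 * B)" using assms B0 by simp
  then have r: "0 < r" using s by linarith
  have "norm (dual_coeff k \<nu>) = 2 * norm (fresnel 0) / r"
    unfolding dual_coeff_def r_def[symmetric] using r by (simp add: norm_divide norm_mult)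
  also have "\<dots> \<le> 2 * norm (fresnel 0) / (sqrt (real k) / sqrt (2 * B))"
    using p s r by (intro divide_left_mono mult_pos_pos) auto
  finally show ?thesis by simp
qed

lemma norm_dual_term:
  assumes "0 < k"
  shows "norm (dual_term k q \<nu>) \<le> 2 * norm (fresnel 0) * sqrt (2 * B) * sqrt (real q / real k)"
proof -
  have "norm (dual_term k q \<nu>) = norm (dual_coeff k \<nu>) * sqrt (real q)"
    by (simp add: dual_term_def norm_mult)
  also have "\<dots> \<le> 2 * norm (fresnel 0) * sqrt (2 * B) / sqrt (real k) * sqrt (real q)"
    by (intro mult_right_mono norm_dual_coeff assms) simp
  finally show ?thesis by (simp add: real_sqrt_divide)
qed

text \<open>Used for the frequencies near or beyond the ends of the dual range, where the bound of
  \<open>osc_stationary\<close> blows up or does not apply.\<close>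

lemma norm_osc_le:
  assumes "0 < k" "0 < q"
  shows "norm (convex_phase.osc (phase k q) a m \<nu>) \<le> 4 * sqrt B * sqrt (real q / real k)"
proof -
  interpret convex_phase "phase k q" "phase' k q" "phase'' k q" using assms by (intro convex_phase)
  have "norm (osc a m \<nu>) \<le> 4 / sqrt (real k / (real q * B))"
    unfolding osc_def
  proof (rule second_derivative_test)
    fix x
    show "((\<lambda>x. phase k q x - of_int \<nu> * x) has_real_derivative phase' k q x - of_int \<nu>) (at x)"
      by (rule DERIV_diff[OF d1 DERIV_cmult_Id])
    show "((\<lambda>x. phase' k q x - of_int \<nu>) has_real_derivative phase'' k q x) (at x)"
      using DERIV_diff[OF d2 DERIV_const] by simp
    show "real k / (real q * B) \<le> phase'' k q x" using assms by (intro phase''_ge)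
  qed (use assms B0 in auto)
  also have "\<dots> = 4 * sqrt B * sqrt (real q / real k)"
    by (simp add: real_sqrt_divide real_sqrt_mult)
  finally show ?thesis .
qed

text \<open>After the substitution x = q t the large parameter is \<open>k * q\<close>. The
  distances from the stationary point to the ends are converted by \<open>fd_diff\<close> into
  distances between \<open>\<nu>\<close> and the end values of \<open>phase'\<close>, because
  reciprocals of the latter can be summed over \<open>\<nu>\<close>.\<close>

lemma osc_stationary:
  fixes a :: int and m :: nat
  assumes k: "0 < k" and q: "0 < q"
  defines "A \<equiv> of_int a - 1/2" and "D \<equiv> of_int a - 1/2 + real m"
  assumes u: "0 < of_int \<nu> - phase' k q A" and v: "0 < phase' k q D - of_int \<nu>" and X: "real m / real q \<le> X"
  shows "norm (convex_phase.osc (phase k q) a m \<nu> - dual_term k q \<nu>)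
    \<le> (6 * B ^ 10 * L + 2 * B) * (2 * (1 + ln (1 + X * sqrt (real k * real q))) / real k
        + B / (of_int \<nu> - phase' k q A) + B / (phase' k q D - of_int \<nu>))"
proof -
  interpret convex_phase "phase k q" "phase' k q" "phase'' k q" using q by (intro convex_phase)
  define p where "p = of_int \<nu> / real k"
  define t0 where "t0 = gd p"
  define t1 t2 where "t1 = A / real q" and "t2 = D / real q"
  define \<mu> where "\<mu> = real k * real q"
  define \<phi> where "\<phi> t = f t - p * t" for t
  define K where "K = 6 * B ^ 10 * L + 2 * B"
  have K0: "0 \<le> K" using B L by (simp add: K_def)
  have mu: "0 < \<mu>" using k q by (simp add: \<mu>_def)
  have fdt0: "fd t0 = p" by (simp add: t0_def fg)
  have A': "phase' k q A = real k * fd t1" and D': "phase' k q D = real k * fd t2"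
    by (simp_all add: phase'_def t1_def t2_def)
  have nu: "of_int \<nu> = real k * fd t0" using k by (simp add: fdt0 p_def)
  have u': "fd t1 < fd t0" using u k unfolding A' nu by (simp flip: right_diff_distrib add: zero_less_mult_iff)
  have v': "fd t0 < fd t2" using v k unfolding D' nu by (simp flip: right_diff_distrib add: zero_less_mult_iff)
  have t: "t1 < t0" "t0 < t2" using u' v' fd_mono by (meson linorder_not_le)+
  have cont: "continuous_on UNIV (\<lambda>t. ee (phase k q t - of_int \<nu> * t))"
    by (intro continuous_intros contF)
  have osc: "osc a m \<nu> = real q *\<^sub>R integral {t1..t2} (\<lambda>t. ee (\<mu> * \<phi> t))"
  proof -
    have "integral {t1..t2} (\<lambda>t. ee (phase k q (real q * t + 0) - of_int \<nu> * (real q * t + 0))) = (1 / real q) *\<^sub>R integral {real q * t1 + 0..real q * t2 + 0} (\<lambda>t. ee (phase k q t - of_int \<nu> * t))"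
      using q t by (intro integral_affine[OF cont]) auto
    moreover have "phase k q (real q * t + 0) - of_int \<nu> * (real q * t + 0) = \<mu> * \<phi> t" for t
      using k q by (simp add: phase_def \<mu>_def \<phi>_def p_def algebra_simps)
    moreover have "real q * t1 + 0 = A" "real q * t2 + 0 = D" using q by (simp_all add: t1_def t2_def)
    ultimately show ?thesis using q by (simp add: osc_def A_def D_def)
  qed
  have main: "norm (integral {t1..t2} (\<lambda>x. ee (\<mu> * \<phi> x)) - ee (\<mu> * \<phi> t0) * (2 * fresnel 0 / sqrt (\<mu> * fdd t0 / 2)))
    \<le> K * (2 * (1 + ln (1 + (t2 - t1) * sqrt \<mu>)) / \<mu> + 1 / (\<mu> * (t0 - t1)) + 1 / (\<mu> * (t2 - t0)))"
    unfolding K_def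
  proof (rule stationary_phase[OF fresnel B L mu t, where \<phi>' = "\<lambda>t. fd t - p"])
    show "(\<phi> has_real_derivative fd x - p) (at x)" for x
      unfolding \<phi>_def[abs_def] by (rule DERIV_diff[OF f1 DERIV_cmult_Id])
    show "((\<lambda>t. fd t - p) has_real_derivative fdd x) (at x)" for x
      using DERIV_diff[OF f2 DERIV_const] by simp
  qed (use f3 f4 f5 fdt0 in auto)
  have dual: "dual_term k q \<nu> = real q *\<^sub>R (ee (\<mu> * \<phi> t0) * (2 * fresnel 0 / sqrt (\<mu> * fdd t0 / 2)))"
  proof -
    have 1: "\<mu> * \<phi> t0 = - (real q * (real k * g p))"
      by (simp add: \<mu>_def \<phi>_def leg t0_def algebra_simps)
    have 2: "sqrt (\<mu> * fdd t0 / 2) = sqrt (real q) * sqrt (real k * fdd t0 / 2)"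
      by (simp add: \<mu>_def mult_ac flip: real_sqrt_mult)
    define b where "b = complex_of_real (sqrt (real q))"
    define r where "r = complex_of_real (sqrt (real k * fdd t0 / 2))"
    have b: "b \<noteq> 0" "complex_of_real (real q) = b * b"
      using q by (simp_all add: b_def flip: of_real_mult)
    have r: "r \<noteq> 0" using fdd_pos[of t0] k by (simp add: r_def)
    show ?thesis
      unfolding dual_term_def dual_coeff_def p_def[symmetric] t0_def[symmetric] 1 2 scaleR_conv_of_real of_real_mult
        b_def[symmetric] r_def[symmetric] b(2)
      using b(1) r by (simp add: field_simps)
  qed
  have e1: "of_int \<nu> - phase' k q A \<le> real k * (B * (t0 - t1))"
    unfolding A' nu using fd_diff(2)[of t1 t0] t k by (simp flip: right_diff_distrib)
  have e2: "phase' k q D - of_int \<nu> \<le> real k * (B * (t2 - t0))"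
    unfolding D' nu using fd_diff(2)[of t0 t2] t k by (simp flip: right_diff_distrib)
  have r1: "real q * (1 / (\<mu> * (t0 - t1))) \<le> B / (of_int \<nu> - phase' k q A)"
  proof -
    have "real q * (1 / (\<mu> * (t0 - t1))) = B / (real k * (B * (t0 - t1)))" using k q B0 by (simp add: \<mu>_def)
    also have "\<dots> \<le> B / (of_int \<nu> - phase' k q A)" using e1 u t k B0 by (intro divide_left_mono mult_pos_pos) auto
    finally show ?thesis .
  qed
  have r2: "real q * (1 / (\<mu> * (t2 - t0))) \<le> B / (phase' k q D - of_int \<nu>)"
  proof -
    have "real q * (1 / (\<mu> * (t2 - t0))) = B / (real k * (B * (t2 - t0)))" using k q B0 by (simp add: \<mu>_def)
    also have "\<dots> \<le> B / (phase' k q D - of_int \<nu>)" using e2 v t k B0 by (intro divide_left_mono mult_pos_pos) auto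
    finally show ?thesis .
  qed
  have r3: "real q * (2 * (1 + ln (1 + (t2 - t1) * sqrt \<mu>)) / \<mu>) \<le> 2 * (1 + ln (1 + X * sqrt \<mu>)) / real k"
  proof -
    have "t2 - t1 = real m / real q" by (simp add: t1_def t2_def A_def D_def flip: diff_divide_distrib)
    then have "(t2 - t1) * sqrt \<mu> \<le> X * sqrt \<mu>" using X mu by (intro mult_right_mono) auto
    moreover have "0 \<le> (t2 - t1) * sqrt \<mu>" using mu t by simp
    ultimately
    have "ln (1 + (t2 - t1) * sqrt \<mu>) \<le> ln (1 + X * sqrt \<mu>)" by (subst ln_le_cancel_iff) auto
    then have "2 * (1 + ln (1 + (t2 - t1) * sqrt \<mu>)) / real k \<le> 2 * (1 + ln (1 + X * sqrt \<mu>)) / real k"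
      using k by (intro divide_right_mono) auto
    moreover have "real q * (2 * (1 + ln (1 + (t2 - t1) * sqrt \<mu>)) / \<mu>) = 2 * (1 + ln (1 + (t2 - t1) * sqrt \<mu>)) / real k"
      using q by (simp add: \<mu>_def)
    ultimately show ?thesis by simp
  qed
  have "norm (osc a m \<nu> - dual_term k q \<nu>) = real q * norm (integral {t1..t2} (\<lambda>x. ee (\<mu> * \<phi> x)) - ee (\<mu> * \<phi> t0) * (2 * fresnel 0 / sqrt (\<mu> * fdd t0 / 2)))"
    unfolding osc dual scaleR_diff_right[symmetric] by simp
  also have "\<dots> \<le> real q * (K * (2 * (1 + ln (1 + (t2 - t1) * sqrt \<mu>)) / \<mu> + 1 / (\<mu> * (t0 - t1)) + 1 / (\<mu> * (t2 - t0))))"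
    by (rule mult_left_mono[OF main]) simp
  also have "\<dots> = K * (real q * (2 * (1 + ln (1 + (t2 - t1) * sqrt \<mu>)) / \<mu>) + real q * (1 / (\<mu> * (t0 - t1))) + real q * (1 / (\<mu> * (t2 - t0))))"
    by (simp only: distrib_left mult.left_commute[of "real q" K])
  also have "\<dots> \<le> K * (2 * (1 + ln (1 + X * sqrt \<mu>)) / real k + B / (of_int \<nu> - phase' k q A) + B / (phase' k q D - of_int \<nu>))"
    using r1 r2 r3 by (intro mult_left_mono[OF _ K0] add_mono)
  finally show ?thesis by (simp add: K_def \<mu>_def)
qed

end

section \<open>The errors for one denominator and their sum\<close>

definition frac_range :: "real \<Rightarrow> real \<Rightarrow> nat \<Rightarrow> int set" where
  "frac_range a b q = {\<lceil>real q * a\<rceil>..\<lfloor>real q * b\<rfloor>}"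

lemma finite_frac_range [simp]: "finite (frac_range a b q)"
  by (simp add: frac_range_def)

lemma mem_frac_range: "n \<in> frac_range a b q \<longleftrightarrow> real q * a \<le> of_int n \<and> of_int n \<le> real q * b"
  by (auto simp: frac_range_def ceiling_le_iff le_floor_iff)

definition const_K :: "real \<Rightarrow> real \<Rightarrow> real" where
  "const_K B L = 6 * B ^ 10 * L + 2 * B"

text \<open>The constants of \<open>norm_osc_le\<close> and \<open>norm_dual_term\<close> added: for
  a frequency too close to an end the integral and its dual term are estimated separately.\<close>

definition const_near :: "real \<Rightarrow> real" where
  "const_near B = 4 * sqrt B + 2 * norm (fresnel 0) * sqrt (2 * B)"

definition const_per :: "real \<Rightarrow> real \<Rightarrow> real \<Rightarrow> real" where
  "const_per B L R = (4 + 2 * const_K B L * (B * (R + 3)) + 2 * const_K B L * B) * (1 + ln (1 + B * (R + 3)))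
     + 16 * sqrt B + 2 * const_near B + 12 * B * sqrt B"

definition const_sum :: "real \<Rightarrow> real \<Rightarrow> real \<Rightarrow> real" where
  "const_sum B L R = 4 * norm (fresnel 0) * sqrt (2 * B) + 3 * const_per B L R"

context legendre_pair
begin

text \<open>Five comparisons, with errors \<open>e2\<close>, \<open>e1\<close>, \<open>e3\<close>,
  \<open>e4\<close>, \<open>e5\<close> in this order: padding the range of summation, the Poisson
  tails, Poisson frequencies outside the dual range, the at most two dual frequencies within
  distance 1 of an end, and stationary phase for the others, whose errors of size 1/distance sum to
  logarithms.\<close>

lemma per_denominator_raw:
  assumes k: "0 < k" and q: "0 < q" and ab: "a0 \<le> b0" "b0 - a0 \<le> R"
  defines "Y \<equiv> B * (R + 3)" and "K \<equiv> const_K B L" and "s \<equiv> sqrt (real q / real k)"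
  shows "norm ((\<Sum>a\<in>frac_range a0 b0 q. ee (phase k q (of_int a))) - (\<Sum>\<nu>\<in>frac_range (fd a0) (fd b0) k. dual_term k q \<nu>))
    \<le> 2 + 2 * (1 + ln (1 + real k * Y)) + (3 * real k * B / real q + 4) * (4 * sqrt B * s) + 2 * (const_near B * s)
      + K * (2 * Y * (1 + ln (1 + (R + 3) * sqrt (real k * real q))) + 2 * (B * (1 + ln (real k * Y))))"
proof -
  interpret convex_phase "phase k q" "phase' k q" "phase'' k q" using q by (intro convex_phase)
  \<comment> \<open>One extra integer on each side guarantees \<open>A\<close> \<le> q a0 and q b0
    \<le> \<open>D\<close>, so that every dual frequency lies in the Poisson range
    \<open>N0\<close>.\<close>
  define a where "a = \<lceil>real q * a0\<rceil> - 1"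
  define b where "b = \<lfloor>real q * b0\<rfloor> + 1"
  define m where "m = nat (b - a + 1)"
  define A where "A = real_of_int a - 1/2"
  define D where "D = real_of_int a - 1/2 + real m"
  define p r where "p = phase' k q A" and "r = phase' k q D"
  define N0 where "N0 = {\<lceil>p\<rceil> - 1..\<lfloor>r\<rfloor> + 1}"
  define M where "M = frac_range (fd a0) (fd b0) k"
  have R: "0 \<le> R" using ab by simp
  have K0: "0 \<le> K" using B L by (simp add: K_def const_K_def)
  have Y1: "1 \<le> Y" using mult_mono[of 1 B 1 "R + 3"] B R by (simp add: Y_def)
  have kY: "1 \<le> real k * Y" using mult_mono[of 1 "real k" 1 Y] k Y1 by simp
  have s0: "0 \<le> s" by (simp add: s_def)
  have qab: "real q * a0 \<le> real q * b0" using ab by (intro mult_left_mono) auto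
  have ab': "a \<le> b" using qab unfolding a_def b_def by linarith
  have rm: "real m = of_int b - of_int a + 1" using ab' by (simp add: m_def)
  have D_eq: "D = of_int b + 1/2" by (simp add: D_def rm)
  have A1: "A \<le> real q * a0" "real q * a0 - 3/2 \<le> A" unfolding A_def a_def by linarith+
  have D1: "real q * b0 \<le> D" "D \<le> real q * b0 + 3/2" unfolding D_eq b_def by linarith+
  have qR: "real q * b0 - real q * a0 \<le> real q * R" using mult_left_mono[OF ab(2), of "real q"] by (simp add: right_diff_distrib)
  have m_le: "real m \<le> (R + 3) * real q"
  proof -
    have "real m = D - A" by (simp add: A_def D_def)
    also have "\<dots> \<le> real q * R + 3" using A1 D1 qR by linarith
    also have "\<dots> \<le> (R + 3) * real q" using q R by (simp add: algebra_simps Suc_le_eq)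
    finally show ?thesis .
  qed
  have mX: "real m / real q \<le> R + 3" using m_le q by (simp add: divide_le_eq)
  have AD: "A \<le> D" by (simp add: A_def D_def)
  have grow: "phase' k q y - phase' k q x \<le> real k * B * ((y - x) / real q)" if "x \<le> y" for x y
  proof -
    have "x / real q \<le> y / real q" using that q by (simp add: divide_right_mono)
    from mult_left_mono[OF fd_diff(2)[OF this], of "real k"]
    show ?thesis by (simp add: phase'_def right_diff_distrib diff_divide_distrib mult.assoc)
  qed
  have rp: "r - p \<le> real k * Y" "0 \<le> r - p"
  proof -
    have "r - p \<le> real k * B * ((D - A) / real q)" unfolding r_def p_def by (rule grow[OF AD])
    also have "\<dots> \<le> real k * B * (R + 3)" using mX B0 by (intro mult_left_mono) (auto simp: A_def D_def)
    finally show "r - p \<le> real k * Y" by (simp add: Y_def mult.assoc)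
    show "0 \<le> r - p" unfolding r_def p_def using F'_mono[OF AD] by simp
  qed
  have pa: "p \<le> real k * fd a0" "real k * fd a0 - p \<le> 3 * real k * B / (2 * real q)"
  proof -
    have "phase' k q (real q * a0) = real k * fd a0" using q by (simp add: phase'_def)
    then show "p \<le> real k * fd a0" using F'_mono[OF A1(1)] by (simp add: p_def)
    have "real k * fd a0 - p \<le> real k * B * ((real q * a0 - A) / real q)"
      using grow[OF A1(1)] \<open>phase' k q (real q * a0) = real k * fd a0\<close> by (simp add: p_def)
    also have "\<dots> \<le> real k * B * ((3/2) / real q)" using A1 B0 by (intro mult_left_mono divide_right_mono) auto
    finally show "real k * fd a0 - p \<le> 3 * real k * B / (2 * real q)" by simp
  qed
  have rb: "real k * fd b0 \<le> r" "r - real k * fd b0 \<le> 3 * real k * B / (2 * real q)"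
  proof -
    have "phase' k q (real q * b0) = real k * fd b0" using q by (simp add: phase'_def)
    then show "real k * fd b0 \<le> r" using F'_mono[OF D1(1)] by (simp add: r_def)
    have "r - real k * fd b0 \<le> real k * B * ((D - real q * b0) / real q)"
      using grow[OF D1(1)] \<open>phase' k q (real q * b0) = real k * fd b0\<close> by (simp add: r_def)
    also have "\<dots> \<le> real k * B * ((3/2) / real q)" using D1 B0 by (intro mult_left_mono divide_right_mono) auto
    finally show "r - real k * fd b0 \<le> 3 * real k * B / (2 * real q)" by simp
  qed
  have e1: "norm ((\<Sum>i<m. ee (phase k q (of_int (a + int i)))) - sum (osc a m) N0) \<le> 2 * (1 + ln (1 + real k * Y))"
  proof -
    have "norm ((\<Sum>i<m. ee (phase k q (of_int (a + int i)))) - sum (osc a m) N0) \<le> 2 * (1 + ln (1 + (r - p)))"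
      using truncated_Poisson[of a m] by (simp add: N0_def p_def r_def A_def D_def)
    also have "\<dots> \<le> 2 * (1 + ln (1 + real k * Y))" using rp by simp
    finally show ?thesis .
  qed
  have e2: "norm ((\<Sum>a\<in>frac_range a0 b0 q. ee (phase k q (of_int a))) - (\<Sum>i<m. ee (phase k q (of_int (a + int i))))) \<le> 2"
  proof -
    have 1: "(\<Sum>i<m. ee (phase k q (of_int (a + int i)))) = (\<Sum>n\<in>{a..b}. ee (phase k q (of_int n)))"
      by (rule sum.reindex_bij_witness[of _ "\<lambda>n. nat (n - a)" "\<lambda>i. a + int i"]) (use ab' in \<open>auto simp: m_def\<close>)
    have 2: "{a..b} - frac_range a0 b0 q \<subseteq> {a, b}" "frac_range a0 b0 q \<subseteq> {a..b}" by (auto simp: frac_range_def a_def b_def)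
    have "(\<Sum>n\<in>{a..b}. ee (phase k q (of_int n))) - (\<Sum>a\<in>frac_range a0 b0 q. ee (phase k q (of_int a))) = (\<Sum>n\<in>{a..b} - frac_range a0 b0 q. ee (phase k q (of_int n)))"
      using 2 by (subst sum_diff) auto
    also have "norm \<dots> \<le> (\<Sum>n\<in>{a..b} - frac_range a0 b0 q. 1)" by (intro sum_norm_le) auto
    also have "\<dots> = real (card ({a..b} - frac_range a0 b0 q))" by simp
    also have "card ({a..b} - frac_range a0 b0 q) \<le> card {a, b}" using 2 by (intro card_mono) auto
    also have "card {a, b} \<le> 2" by (simp add: card_insert_if)
    finally show ?thesis unfolding 1 by (simp add: norm_minus_commute)
  qed
  have MN: "M \<subseteq> N0" unfolding M_def frac_range_def N0_def using pa(1) rb(1)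
    by (auto simp: ceiling_le_iff le_floor_iff) linarith+
  have e3: "norm (sum (osc a m) N0 - sum (osc a m) M) \<le> (3 * real k * B / real q + 4) * (4 * sqrt B * s)"
  proof -
    have "sum (osc a m) N0 - sum (osc a m) M = sum (osc a m) (N0 - M)"
      using MN by (subst sum_diff) (auto simp: N0_def)
    also have "norm \<dots> \<le> (\<Sum>\<nu>\<in>N0 - M. 4 * sqrt B * s)"
      unfolding s_def by (intro sum_norm_le norm_osc_le k q)
    also have "\<dots> = real (card (N0 - M)) * (4 * sqrt B * s)" by simp
    also have "\<dots> \<le> (3 * real k * B / real q + 4) * (4 * sqrt B * s)"
    proof (rule mult_right_mono)
      have "N0 - M \<subseteq> {\<lceil>p\<rceil> - 1..\<lceil>real k * fd a0\<rceil> - 1} \<union> {\<lfloor>real k * fd b0\<rfloor> + 1..\<lfloor>r\<rfloor> + 1}"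
        by (auto simp: N0_def M_def frac_range_def)
      then have "card (N0 - M) \<le> card ({\<lceil>p\<rceil> - 1..\<lceil>real k * fd a0\<rceil> - 1} \<union> {\<lfloor>real k * fd b0\<rfloor> + 1..\<lfloor>r\<rfloor> + 1})"
        by (intro card_mono) auto
      also have "\<dots> \<le> nat (\<lceil>real k * fd a0\<rceil> - \<lceil>p\<rceil> + 1) + nat (\<lfloor>r\<rfloor> - \<lfloor>real k * fd b0\<rfloor> + 1)"
        using card_Un_le[of "{\<lceil>p\<rceil> - 1..\<lceil>real k * fd a0\<rceil> - 1}" "{\<lfloor>real k * fd b0\<rfloor> + 1..\<lfloor>r\<rfloor> + 1}"] by simp
      finally have "real (card (N0 - M)) \<le> of_int (\<lceil>real k * fd a0\<rceil> - \<lceil>p\<rceil> + 1) + of_int (\<lfloor>r\<rfloor> - \<lfloor>real k * fd b0\<rfloor> + 1)"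
        using ceiling_mono[OF pa(1)] floor_mono[OF rb(1)] by linarith
      also have "\<dots> \<le> (real k * fd a0 - p + 2) + (r - real k * fd b0 + 2)"
        by (intro add_mono) linarith+
      also have "\<dots> \<le> 3 * real k * B / real q + 4"
      proof -
        have "x + 2 + (y + 2) \<le> 2 * w + 4" if "x \<le> w" "y \<le> w" for x y w :: real using that by linarith
        from this[OF pa(2) rb(2)] show ?thesis by (simp add: ac_simps)
      qed
      finally show "real (card (N0 - M)) \<le> 3 * real k * B / real q + 4" .
    qed (use s0 B0 in simp)
    finally show ?thesis .
  qed
  define near where "near = {\<nu>\<in>M. of_int \<nu> - p < 1 \<or> r - of_int \<nu> < 1}"
  have Mp: "p \<le> of_int \<nu>" "of_int \<nu> \<le> r" if "\<nu> \<in> M" for \<nu>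
    using that pa(1) rb(1) by (auto simp: M_def mem_frac_range)
  have finM: "finite M" by (simp add: M_def)
  have e4: "norm (\<Sum>\<nu>\<in>near. osc a m \<nu> - dual_term k q \<nu>) \<le> 2 * (const_near B * s)"
  proof -
    have "norm (\<Sum>\<nu>\<in>near. osc a m \<nu> - dual_term k q \<nu>) \<le> (\<Sum>\<nu>\<in>near. const_near B * s)"
    proof (intro sum_norm_le)
      fix \<nu>
      have "norm (osc a m \<nu> - dual_term k q \<nu>) \<le> norm (osc a m \<nu>) + norm (dual_term k q \<nu>)" by (rule norm_triangle_ineq4)
      also have "\<dots> \<le> 4 * sqrt B * s + 2 * norm (fresnel 0) * sqrt (2 * B) * s"
        unfolding s_def by (intro add_mono norm_osc_le norm_dual_term k q)
      finally show "norm (osc a m \<nu> - dual_term k q \<nu>) \<le> const_near B * s" by (simp add: const_near_def distrib_right)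
    qed
    also have "\<dots> = real (card near) * (const_near B * s)" by simp
    also have "\<dots> \<le> 2 * (const_near B * s)"
    proof (rule mult_right_mono)
      have "near \<subseteq> {\<lceil>p\<rceil>, \<lfloor>r\<rfloor>}"
      proof
        fix \<nu> assume \<nu>: "\<nu> \<in> near"
        then have "p \<le> of_int \<nu>" "of_int \<nu> \<le> r" "of_int \<nu> - p < 1 \<or> r - of_int \<nu> < 1" using Mp by (auto simp: near_def)
        then have "\<nu> = \<lceil>p\<rceil> \<or> \<nu> = \<lfloor>r\<rfloor>" by linarith
        then show "\<nu> \<in> {\<lceil>p\<rceil>, \<lfloor>r\<rfloor>}" by simp
      qed
      then have "card near \<le> card {\<lceil>p\<rceil>, \<lfloor>r\<rfloor>}" by (intro card_mono) auto
      also have "\<dots> \<le> 2" by (simp add: card_insert_if)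
      finally show "real (card near) \<le> 2" by simp
    qed (use s0 B0 in \<open>simp add: const_near_def\<close>)
    finally show ?thesis .
  qed
  have e5: "norm (\<Sum>\<nu>\<in>M - near. osc a m \<nu> - dual_term k q \<nu>) \<le> K * (2 * Y * (1 + ln (1 + (R + 3) * sqrt (real k * real q))) + 2 * (B * (1 + ln (real k * Y))))"
  proof -
    define W where "W = 2 * (1 + ln (1 + (R + 3) * sqrt (real k * real q)))"
    have W0: "0 \<le> W" using R by (simp add: W_def)
    have good: "1 \<le> of_int \<nu> - p" "1 \<le> r - of_int \<nu>" if "\<nu> \<in> M - near" for \<nu> using that by (auto simp: near_def)
    have "norm (\<Sum>\<nu>\<in>M - near. osc a m \<nu> - dual_term k q \<nu>) \<le> (\<Sum>\<nu>\<in>M - near. K * (W / real k + B / (of_int \<nu> - p) + B / (r - of_int \<nu>)))"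
    proof (intro sum_norm_le)
      fix \<nu> assume "\<nu> \<in> M - near"
      then have "0 < of_int \<nu> - p" "0 < r - of_int \<nu>" using good[of \<nu>] by auto
      then show "norm (osc a m \<nu> - dual_term k q \<nu>) \<le> K * (W / real k + B / (of_int \<nu> - p) + B / (r - of_int \<nu>))"
        unfolding W_def K_def const_K_def p_def r_def A_def D_def
        by (intro osc_stationary k q mX)
    qed
    also have "\<dots> = K * (real (card (M - near)) * (W / real k) + B * (\<Sum>\<nu>\<in>M - near. 1 / (of_int \<nu> - p)) + B * (\<Sum>\<nu>\<in>M - near. 1 / (r - of_int \<nu>)))"
      by (simp add: sum.distrib flip: sum_distrib_left)
         (simp add: sum_distrib_left)
    also have "\<dots> \<le> K * ((real k * Y) * (W / real k) + B * (1 + ln (real k * Y)) + B * (1 + ln (real k * Y)))"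
    proof (intro mult_left_mono add_mono mult_right_mono)
      have "M - near \<subseteq> {\<lceil>p + 1\<rceil>..\<lfloor>r - 1\<rfloor>}"
      proof
        fix \<nu> assume "\<nu> \<in> M - near"
        from good[OF this] have "p + 1 \<le> of_int \<nu>" "of_int \<nu> \<le> r - 1" by linarith+
        then show "\<nu> \<in> {\<lceil>p + 1\<rceil>..\<lfloor>r - 1\<rfloor>}" unfolding atLeastAtMost_iff ceiling_le_iff le_floor_iff by simp
      qed
      then have "card (M - near) \<le> card {\<lceil>p + 1\<rceil>..\<lfloor>r - 1\<rfloor>}" by (intro card_mono) auto
      then have "real (card (M - near)) \<le> real (nat (\<lfloor>r - 1\<rfloor> + 1 - \<lceil>p + 1\<rceil>))" by simp
      also have "\<dots> \<le> r - p" using rp(2) by linarith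
      finally show "real (card (M - near)) \<le> real k * Y" using rp(1) by simp
      show "(\<Sum>\<nu>\<in>M - near. 1 / (of_int \<nu> - p)) \<le> 1 + ln (real k * Y)"
        using finM kY good rp(1) by (intro sum_inverse_int_shift_le) fastforce+
      show "(\<Sum>\<nu>\<in>M - near. 1 / (r - of_int \<nu>)) \<le> 1 + ln (real k * Y)"
        using finM kY good rp(1) by (intro sum_inverse_int_shift_le') fastforce+
    qed (use B0 K0 W0 in auto)
    also have "(real k * Y) * (W / real k) = Y * W" using k by simp
    also have "K * (Y * W + B * (1 + ln (real k * Y)) + B * (1 + ln (real k * Y))) = K * (2 * Y * (1 + ln (1 + (R + 3) * sqrt (real k * real q))) + 2 * (B * (1 + ln (real k * Y))))"
      by (simp add: W_def)
    finally show ?thesis .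
  qed
  have split: "sum (osc a m) M - (\<Sum>\<nu>\<in>M. dual_term k q \<nu>) = (\<Sum>\<nu>\<in>near. osc a m \<nu> - dual_term k q \<nu>) + (\<Sum>\<nu>\<in>M - near. osc a m \<nu> - dual_term k q \<nu>)"
    unfolding sum_subtractf[symmetric] using sum.subset_diff[of near M] finM by (simp add: near_def add.commute)
  have "(\<Sum>a\<in>frac_range a0 b0 q. ee (phase k q (of_int a))) - (\<Sum>\<nu>\<in>M. dual_term k q \<nu>)
     = ((\<Sum>a\<in>frac_range a0 b0 q. ee (phase k q (of_int a))) - (\<Sum>i<m. ee (phase k q (of_int (a + int i)))))
      + ((\<Sum>i<m. ee (phase k q (of_int (a + int i)))) - sum (osc a m) N0)
      + (sum (osc a m) N0 - sum (osc a m) M)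
      + (\<Sum>\<nu>\<in>near. osc a m \<nu> - dual_term k q \<nu>) + (\<Sum>\<nu>\<in>M - near. osc a m \<nu> - dual_term k q \<nu>)"
    using split by (simp add: algebra_simps)
  also have "norm \<dots> \<le> 2 + 2 * (1 + ln (1 + real k * Y)) + (3 * real k * B / real q + 4) * (4 * sqrt B * s) + 2 * (const_near B * s)
      + K * (2 * Y * (1 + ln (1 + (R + 3) * sqrt (real k * real q))) + 2 * (B * (1 + ln (real k * Y))))"
    by (rule norm_triangle_mono[OF norm_triangle_mono[OF norm_triangle_mono[OF norm_triangle_mono[OF e2 e1] e3] e4] e5])
  finally show ?thesis by (simp add: M_def)
qed

text \<open>The raw bound is brought into a form that can be summed over q. The term sqrt (k/q)
  stems from the Poisson frequencies beyond the dual range: there are O(k/q + 1) of them, each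
  costing sqrt (q/k).\<close>

lemma per_denominator:
  assumes k: "0 < k" "k \<le> n" and q: "0 < q" "q \<le> n" and ab: "a0 \<le> b0" "b0 - a0 \<le> R"
  shows "norm ((\<Sum>a\<in>frac_range a0 b0 q. ee (phase k q (of_int a))) - (\<Sum>\<nu>\<in>frac_range (fd a0) (fd b0) k. dual_term k q \<nu>))
    \<le> const_per B L R * (1 + ln (real n) + sqrt (real q / real k) + sqrt (real k / real q))"
proof -
  define Y where "Y = B * (R + 3)"
  define K where "K = const_K B L"
  define s t where "s = sqrt (real q / real k)" and "t = sqrt (real k / real q)"
  define l where "l = 1 + ln (real n)"
  define lY where "lY = 1 + ln (1 + Y)"
  have R: "0 \<le> R" using ab by simp
  have K0: "0 \<le> K" using B L by (simp add: K_def const_K_def)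
  have YR: "R + 3 \<le> Y" using mult_right_mono[of 1 B "R + 3"] B R by (simp add: Y_def)
  have Y1: "1 \<le> Y" using YR R by simp
  have kY: "1 \<le> real k * Y" using mult_mono[of 1 "real k" 1 Y] k Y1 by simp
  have n1: "1 \<le> real n" using k by simp
  have l1: "1 \<le> l" using n1 by (simp add: l_def)
  have lY1: "1 \<le> lY" using Y1 by (simp add: lY_def)
  have st0: "0 \<le> s" "0 \<le> t" by (simp_all add: s_def t_def)
  have lnb: "1 + ln z \<le> lY * l" if z: "0 < z" "z \<le> real n * (1 + Y)" for z
  proof -
    have "ln z \<le> ln (real n * (1 + Y))" using z by simp
    also have "\<dots> = ln (real n) + ln (1 + Y)" using n1 Y1 by (simp add: ln_mult)
    finally have "1 + ln z \<le> 1 + ln (1 + Y) + ln (real n)" by simp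
    also have "\<dots> \<le> lY * l" using n1 Y1 by (simp add: lY_def l_def algebra_simps)
    finally show ?thesis .
  qed
  have nk: "real k * Y \<le> real n * Y" using k Y1 by (intro mult_right_mono) auto
  have l_a: "1 + ln (1 + real k * Y) \<le> lY * l"
    by (rule lnb) (use nk kY n1 in \<open>auto simp: algebra_simps\<close>)
  have l_b: "1 + ln (real k * Y) \<le> lY * l"
    by (rule lnb) (use nk kY n1 in \<open>auto simp: algebra_simps\<close>)
  have l_c: "1 + ln (1 + (R + 3) * sqrt (real k * real q)) \<le> lY * l"
  proof (rule lnb)
    have "sqrt (real k * real q) \<le> sqrt (real n * real n)"
      using k q by (intro real_sqrt_le_mono mult_mono) auto
    then have "(R + 3) * sqrt (real k * real q) \<le> Y * real n" using YR R by (intro mult_mono) auto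
    then show "1 + (R + 3) * sqrt (real k * real q) \<le> real n * (1 + Y)" using n1 by (simp add: algebra_simps)
    show "0 < 1 + (R + 3) * sqrt (real k * real q)" using R by (intro add_pos_nonneg mult_nonneg_nonneg) auto
  qed
  have kqs: "real k / real q * s = t"
  proof -
    have "real k / real q = t * t" by (simp add: t_def)
    moreover have "t * s = 1" using k q by (simp add: t_def s_def flip: real_sqrt_mult)
    ultimately show ?thesis by (simp add: mult.assoc)
  qed
  have "norm ((\<Sum>a\<in>frac_range a0 b0 q. ee (phase k q (of_int a))) - (\<Sum>\<nu>\<in>frac_range (fd a0) (fd b0) k. dual_term k q \<nu>))
    \<le> 2 + 2 * (1 + ln (1 + real k * Y)) + (3 * real k * B / real q + 4) * (4 * sqrt B * s) + 2 * (const_near B * s)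
      + K * (2 * Y * (1 + ln (1 + (R + 3) * sqrt (real k * real q))) + 2 * (B * (1 + ln (real k * Y))))"
    unfolding Y_def K_def s_def by (rule per_denominator_raw[OF k(1) q(1) ab])
  also have "\<dots> \<le> 2 * (lY * l) + 2 * (lY * l) + (12 * B * sqrt B * (real k / real q * s) + 16 * sqrt B * s) + 2 * (const_near B * s)
      + K * (2 * Y * (lY * l) + 2 * (B * (lY * l)))"
  proof (intro add_mono order_refl)
    show "2 \<le> 2 * (lY * l)" using mult_mono[of 1 lY 1 l] l1 lY1 by simp
    show "2 * (1 + ln (1 + real k * Y)) \<le> 2 * (lY * l)" using l_a by simp
    show "(3 * real k * B / real q + 4) * (4 * sqrt B * s) \<le> 12 * B * sqrt B * (real k / real q * s) + 16 * sqrt B * s"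
      by (simp add: algebra_simps)
    show "K * (2 * Y * (1 + ln (1 + (R + 3) * sqrt (real k * real q))) + 2 * (B * (1 + ln (real k * Y)))) \<le> K * (2 * Y * (lY * l) + 2 * (B * (lY * l)))"
      using l_b l_c Y1 B0 by (intro mult_left_mono[OF _ K0] add_mono mult_left_mono) auto
  qed
  also have "\<dots> = ((4 + 2 * K * Y + 2 * K * B) * lY) * l + (16 * sqrt B + 2 * const_near B) * s + (12 * B * sqrt B) * t"
    unfolding kqs by (simp add: algebra_simps)
  also have "\<dots> \<le> const_per B L R * l + const_per B L R * s + const_per B L R * t"
  proof (intro add_mono mult_right_mono)
    have p: "0 \<le> (4 + 2 * K * Y + 2 * K * B) * lY" "0 \<le> 16 * sqrt B" "0 \<le> 2 * const_near B" "0 \<le> 12 * B * sqrt B"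
      using K0 Y1 B0 lY1 by (auto simp: const_near_def)
    have c: "const_per B L R = (4 + 2 * K * Y + 2 * K * B) * lY + 16 * sqrt B + 2 * const_near B + 12 * B * sqrt B"
      by (simp add: const_per_def K_def Y_def lY_def)
    show "(4 + 2 * K * Y + 2 * K * B) * lY \<le> const_per B L R" "16 * sqrt B + 2 * const_near B \<le> const_per B L R" "12 * B * sqrt B \<le> const_per B L R"
      unfolding c using p by linarith+
  qed (use l1 st0 in auto)
  finally show ?thesis by (simp add: l_def s_def t_def algebra_simps)
qed

lemma const_per_nonneg: "0 \<le> R \<Longrightarrow> 0 \<le> const_per B L R"
  using B L by (simp add: const_per_def const_K_def const_near_def)

text \<open>After an interchange of summation, the sum over q is geometric with weight sqrt q, and
  its coefficient is of size 1/sqrt k. Among the errors, sqrt (k/q) sums to 2 sqrt (k n), and k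
  \<le> n turns this into at most 2 n sqrt (n/k).\<close>

theorem exp_sum_bound:
  assumes k: "0 < k" "k \<le> n" and ab: "a0 \<le> b0" "b0 - a0 \<le> R"
  shows "norm (\<Sum>q=1..n. \<Sum>a\<in>frac_range a0 b0 q. ee (real k * real q * f (of_int a / real q)))
    \<le> const_sum B L R * (sqrt (real n / real k) * ((\<Sum>\<nu>\<in>frac_range (fd a0) (fd b0) k. trunc_recip (real n) (int_dist (real k * g (of_int \<nu> / real k)))) + real n)
        + real n * (1 + ln (real n)))"
proof -
  define M where "M = frac_range (fd a0) (fd b0) k"
  define E where "E = const_per B L R"
  define T where "T = (\<Sum>\<nu>\<in>M. trunc_recip (real n) (int_dist (real k * g (of_int \<nu> / real k))))"
  define h where "h = norm (fresnel 0) * sqrt (2 * B)"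
  have E0: "0 \<le> E" unfolding E_def using ab by (intro const_per_nonneg) simp
  have T0: "0 \<le> T" unfolding T_def by (intro sum_nonneg trunc_recip_nonneg) auto
  have h0: "0 \<le> h" using B0 by (simp add: h_def)
  have n1: "1 \<le> real n" using k by simp
  have 1: "norm ((\<Sum>q=1..n. \<Sum>a\<in>frac_range a0 b0 q. ee (phase k q (of_int a))) - (\<Sum>q=1..n. \<Sum>\<nu>\<in>M. dual_term k q \<nu>))
    \<le> E * (real n * (1 + ln (real n)) + 3 * (sqrt (real n / real k) * real n))"
  proof -
    have "norm ((\<Sum>q=1..n. \<Sum>a\<in>frac_range a0 b0 q. ee (phase k q (of_int a))) - (\<Sum>q=1..n. \<Sum>\<nu>\<in>M. dual_term k q \<nu>))
      \<le> (\<Sum>q=1..n. E * (1 + ln (real n) + sqrt (real q / real k) + sqrt (real k / real q)))"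
      unfolding sum_subtractf[symmetric] M_def E_def
      by (intro sum_norm_le per_denominator k ab) auto
    also have "\<dots> = E * (real n * (1 + ln (real n)) + (\<Sum>q=1..n. sqrt (real q / real k)) + (\<Sum>q=1..n. sqrt (real k / real q)))"
      by (simp add: sum.distrib flip: sum_distrib_left)
    also have "\<dots> \<le> E * (real n * (1 + ln (real n)) + sqrt (real n / real k) * real n + 2 * (sqrt (real n / real k) * real n))"
    proof (intro mult_left_mono[OF _ E0] add_mono order_refl)
      have "(\<Sum>q=1..n. sqrt (real q / real k)) \<le> (\<Sum>q=1..n. sqrt (real n / real k))"
        by (intro sum_mono real_sqrt_le_mono divide_right_mono) auto
      then show "(\<Sum>q=1..n. sqrt (real q / real k)) \<le> sqrt (real n / real k) * real n" by (simp add: mult.commute)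
      have "(\<Sum>q=1..n. sqrt (real k / real q)) = sqrt (real k) * (\<Sum>q=1..n. 1 / sqrt (real q))"
        by (simp add: sum_distrib_left real_sqrt_divide)
      also have "\<dots> \<le> sqrt (real k) * (2 * sqrt (real n))" by (intro mult_left_mono sum_inverse_sqrt_le) simp
      also have "\<dots> = 2 * (sqrt (real n / real k) * real k)"
      proof -
        define b where "b = sqrt (real k)"
        have b: "real k = b * b" "b \<noteq> 0" using k by (simp_all add: b_def)
        show ?thesis unfolding real_sqrt_divide b_def[symmetric] using b by simp
      qed
      also have "\<dots> \<le> 2 * (sqrt (real n / real k) * real n)" using k by (intro mult_left_mono) auto
      finally show "(\<Sum>q=1..n. sqrt (real k / real q)) \<le> 2 * (sqrt (real n / real k) * real n)" .
    qed
    finally show ?thesis by (simp add: algebra_simps)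
  qed
  have 2: "norm (\<Sum>q=1..n. \<Sum>\<nu>\<in>M. dual_term k q \<nu>) \<le> 4 * h * (sqrt (real n / real k) * T)"
  proof -
    define S where "S \<nu> = (\<Sum>q=1..n. sqrt (real q) *\<^sub>R ee (of_nat q * (real k * g (of_int \<nu> / real k))))" for \<nu>
    have S: "(\<Sum>q=1..n. dual_term k q \<nu>) = dual_coeff k \<nu> * cnj (S \<nu>)" for \<nu>
      by (simp add: dual_term_def S_def sum_distrib_left cnj_ee scaleR_conv_of_real)
    have "norm (\<Sum>q=1..n. \<Sum>\<nu>\<in>M. dual_term k q \<nu>) = norm (\<Sum>\<nu>\<in>M. dual_coeff k \<nu> * cnj (S \<nu>))"
      by (subst sum.swap) (simp only: S)
    also have "\<dots> \<le> (\<Sum>\<nu>\<in>M. (2 * h / sqrt (real k)) * (2 * sqrt (real n) * trunc_recip (real n) (int_dist (real k * g (of_int \<nu> / real k)))))"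
    proof (intro sum_norm_le)
      fix \<nu>
      have "norm (dual_coeff k \<nu> * cnj (S \<nu>)) = norm (dual_coeff k \<nu>) * norm (S \<nu>)" by (simp add: norm_mult)
      also have "\<dots> \<le> (2 * h / sqrt (real k)) * (2 * sqrt (real n) * trunc_recip (real n) (int_dist (real k * g (of_int \<nu> / real k))))"
        using norm_dual_coeff[OF k(1), of \<nu>] norm_sqrt_ee_sum_le[where n = n and x = "real k * g (of_int \<nu> / real k)"] h0
        by (intro mult_mono) (auto simp: h_def S_def)
      finally show "norm (dual_coeff k \<nu> * cnj (S \<nu>)) \<le> (2 * h / sqrt (real k)) * (2 * sqrt (real n) * trunc_recip (real n) (int_dist (real k * g (of_int \<nu> / real k))))" .
    qed
    also have "\<dots> = 4 * h * (sqrt (real n / real k) * T)"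
      unfolding T_def by (simp add: sum_distrib_left real_sqrt_divide mult.assoc)
    finally show ?thesis .
  qed
  have "norm (\<Sum>q=1..n. \<Sum>a\<in>frac_range a0 b0 q. ee (phase k q (of_int a))) \<le> E * (real n * (1 + ln (real n)) + 3 * (sqrt (real n / real k) * real n)) + 4 * h * (sqrt (real n / real k) * T)"
    using norm_triangle_mono[OF 1 2] by simp
  also have "\<dots> = E * (real n * (1 + ln (real n))) + 3 * E * (sqrt (real n / real k) * real n) + 4 * h * (sqrt (real n / real k) * T)"
    by (simp add: algebra_simps)
  also have "\<dots> \<le> const_sum B L R * (real n * (1 + ln (real n))) + const_sum B L R * (sqrt (real n / real k) * real n) + const_sum B L R * (sqrt (real n / real k) * T)"
  proof (intro add_mono mult_right_mono)
    have c: "const_sum B L R = 4 * h + 3 * E" by (simp add: const_sum_def h_def E_def)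
    show "E \<le> const_sum B L R" "3 * E \<le> const_sum B L R" "4 * h \<le> const_sum B L R" unfolding c using E0 h0 by auto
  qed (use n1 T0 in auto)
  finally show ?thesis by (simp add: phase_def T_def M_def algebra_simps)
qed

lemma const_sum_nonneg: "0 \<le> R \<Longrightarrow> 0 \<le> const_sum B L R"
  using const_per_nonneg[of R] B0 by (simp add: const_sum_def)

end

subsection \<open>Rational points very close to a curve\<close>

text \<open>A triple \<open>(\<nu>, m, k)\<close> stands for the point \<open>(\<nu>/k, m/k)\<close> in homogeneous coordinates, a triple \<open>(P, r, U)\<close> for
  the line \<open>y = (P x - r)/U\<close>.\<close>

definition pts :: "(real \<Rightarrow> real) \<Rightarrow> real \<Rightarrow> real \<Rightarrow> nat \<Rightarrow> real \<Rightarrow> (int \<times> int \<times> int) set" where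
  "pts f a b j \<Delta> = {(\<nu>, m, k). gcd \<nu> (gcd m k) = 1 \<and> 2 ^ j < 2 * k \<and> k \<le> 2 ^ j \<and>
     a * of_int k \<le> of_int \<nu> \<and> of_int \<nu> \<le> b * of_int k \<and> \<bar>of_int k * f (of_int \<nu> / of_int k) - of_int m\<bar> \<le> \<Delta>}"

definition incident :: "int \<times> int \<times> int \<Rightarrow> int \<times> int \<times> int \<Rightarrow> bool" where
  "incident u v = (case u of (P, r, U) \<Rightarrow> case v of (\<nu>, m, k) \<Rightarrow> U * m + k * r = P * \<nu>)"

definition slope :: "int \<times> int \<times> int \<Rightarrow> real" where
  "slope v = (case v of (\<nu>, m, k) \<Rightarrow> of_int \<nu> / of_int k)"

lemma card_spaced_le:
  fixes X :: "real set"
  assumes fin: "finite X" and \<delta>: "0 < \<delta>" and l: "0 \<le> l"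
    and space: "\<And>x y. x \<in> X \<Longrightarrow> y \<in> X \<Longrightarrow> x < y \<Longrightarrow> \<delta> \<le> y - x"
    and diam: "\<And>x y. x \<in> X \<Longrightarrow> y \<in> X \<Longrightarrow> y - x \<le> l"
  shows "real (card X) \<le> l / \<delta> + 1"
proof (cases "X = {}")
  case False
  define c where "c = Min X"
  have c: "c \<in> X" "\<And>x. x \<in> X \<Longrightarrow> c \<le> x" using fin False by (auto simp: c_def)
  define \<phi> where "\<phi> x = nat \<lfloor>(x - c) / \<delta>\<rfloor>" for x
  have ne: "\<phi> x \<noteq> \<phi> y" if "x \<in> X" "y \<in> X" "x < y" for x y
  proof -
    have "(y - c) / \<delta> - (x - c) / \<delta> = (y - x) / \<delta>" by (simp add: diff_divide_distrib)
    moreover have "1 \<le> (y - x) / \<delta>" using space[OF that] \<delta> by simp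
    moreover have "0 \<le> (x - c) / \<delta>" using c(2)[OF that(1)] \<delta> by simp
    ultimately show ?thesis unfolding \<phi>_def by linarith
  qed
  have inj: "inj_on \<phi> X" using ne by (metis inj_onI linorder_neqE_linordered_idom)
  have "\<phi> ` X \<subseteq> {..nat \<lfloor>l / \<delta>\<rfloor>}"
  proof
    fix i assume "i \<in> \<phi> ` X"
    then obtain x where x: "x \<in> X" "i = \<phi> x" by auto
    have "(x - c) / \<delta> \<le> l / \<delta>" using diam[OF c(1) x(1)] \<delta> by (intro divide_right_mono) auto
    then show "i \<in> {..nat \<lfloor>l / \<delta>\<rfloor>}" unfolding x(2) \<phi>_def by (simp add: nat_mono floor_mono)
  qed
  then have "card X \<le> card {..nat \<lfloor>l / \<delta>\<rfloor>}" using card_inj_on_le[OF inj] by blast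
  moreover have "real (nat \<lfloor>l / \<delta>\<rfloor>) \<le> l / \<delta>" using l \<delta> by simp
  ultimately show ?thesis by simp
qed (use l \<delta> in auto)

lemma finite_pts: "finite (pts f a b j \<Delta>)"
proof -
  define h where "h \<nu> k = of_int k * f (of_int \<nu> / of_int k)" for \<nu> k :: int
  have "pts f a b j \<Delta> \<subseteq> (\<Union>k\<in>{0..2 ^ j}. \<Union>\<nu>\<in>{\<lceil>a * of_int k\<rceil>..\<lfloor>b * of_int k\<rfloor>}. (\<lambda>m. (\<nu>, m, k)) ` {\<lceil>h \<nu> k - \<Delta>\<rceil>..\<lfloor>h \<nu> k + \<Delta>\<rfloor>})"
  proof
    fix v assume "v \<in> pts f a b j \<Delta>"
    then obtain \<nu> m k where v: "v = (\<nu>, m, k)" "2 ^ j < 2 * k" "k \<le> 2 ^ j" "a * of_int k \<le> of_int \<nu>" "of_int \<nu> \<le> b * of_int k"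
      "\<bar>h \<nu> k - of_int m\<bar> \<le> \<Delta>" by (auto simp: pts_def h_def)
    have "k \<in> {0..2 ^ j}" using v(2,3) zero_less_power[of "2::int" j] unfolding atLeastAtMost_iff by linarith
    moreover have "\<nu> \<in> {\<lceil>a * of_int k\<rceil>..\<lfloor>b * of_int k\<rfloor>}" using v by (simp add: ceiling_le_iff le_floor_iff)
    moreover have "m \<in> {\<lceil>h \<nu> k - \<Delta>\<rceil>..\<lfloor>h \<nu> k + \<Delta>\<rfloor>}"
      unfolding atLeastAtMost_iff ceiling_le_iff le_floor_iff using v(6) by linarith
    ultimately show "v \<in> (\<Union>k\<in>{0..2 ^ j}. \<Union>\<nu>\<in>{\<lceil>a * of_int k\<rceil>..\<lfloor>b * of_int k\<rfloor>}. (\<lambda>m. (\<nu>, m, k)) ` {\<lceil>h \<nu> k - \<Delta>\<rceil>..\<lfloor>h \<nu> k + \<Delta>\<rfloor>})"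
      using v(1) by blast
  qed
  then show ?thesis by (rule finite_subset) auto
qed

lemma ptsD:
  assumes "(\<nu>, m, k) \<in> pts f a b j \<Delta>"
  shows "gcd \<nu> (gcd m k) = 1" "0 < k" "real_of_int k \<le> 2 ^ j" "2 ^ j < 2 * real_of_int k"
    "a \<le> of_int \<nu> / of_int k" "of_int \<nu> / of_int k \<le> b" "\<bar>of_int k * f (of_int \<nu> / of_int k) - of_int m\<bar> \<le> \<Delta>"
proof -
  have k: "2 ^ j < 2 * k" "k \<le> 2 ^ j" using assms by (auto simp: pts_def)
  have "(0::int) < 2 ^ j" by simp
  then show k0: "0 < k" using k by linarith
  have "real_of_int k \<le> real_of_int (2 ^ j)" "real_of_int (2 ^ j) < real_of_int (2 * k)" using k by (simp_all only: of_int_le_iff of_int_less_iff)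
  then show "real_of_int k \<le> 2 ^ j" "2 ^ j < 2 * real_of_int k" by simp_all
  show "gcd \<nu> (gcd m k) = 1" "a \<le> of_int \<nu> / of_int k" "of_int \<nu> / of_int k \<le> b" "\<bar>of_int k * f (of_int \<nu> / of_int k) - of_int m\<bar> \<le> \<Delta>"
    using assms k0 by (auto simp: pts_def field_simps)
qed

lemma primitive_parallel:
  fixes \<nu> m k \<nu>' m' k' :: int
  assumes g: "gcd \<nu> (gcd m k) = 1" "gcd \<nu>' (gcd m' k') = 1" and k: "0 < k" "0 < k'"
    and e: "\<nu> * k' = \<nu>' * k" "m * k' = m' * k"
  shows "(\<nu>, m, k) = (\<nu>', m', k')"
proof -
  have "k' dvd k * gcd \<nu>' (gcd m' k')"
  proof -
    have "k' dvd k * \<nu>'" "k' dvd k * m'" "k' dvd k * k'" using e by (metis dvd_triv_right mult.commute)+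
    then show ?thesis by (metis gcd_greatest gcd_mult_distrib_int abs_of_pos k(1))
  qed
  moreover have "k dvd k' * gcd \<nu> (gcd m k)"
  proof -
    have "k dvd k' * \<nu>" "k dvd k' * m" "k dvd k' * k" using e by (metis dvd_triv_right mult.commute)+
    then show ?thesis by (metis gcd_greatest gcd_mult_distrib_int abs_of_pos k(2))
  qed
  ultimately have "k' dvd k" "k dvd k'" using g by auto
  then have "k = k'" using k by (simp add: zdvd_antisym_nonneg)
  then show ?thesis using e k by simp
qed

text \<open>Two points over the same abscissa have both errors at most \<open>\<Delta>\<close>,
  which makes the integer m k' - m' k smaller than 1 in modulus. So the triples are parallel, and
  primitive parallel triples with positive last entry agree.\<close>

lemma slope_inj:
  assumes v: "v \<in> pts f a b j \<Delta>" "v' \<in> pts f a b j \<Delta>" and \<Delta>: "2 * \<Delta> * 2 ^ j < 1" "0 \<le> \<Delta>" and s: "slope v = slope v'"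
  shows "v = v'"
proof -
  obtain \<nu> m k \<nu>' m' k' where e: "v = (\<nu>, m, k)" "v' = (\<nu>', m', k')" by (metis prod_cases3)
  note D = ptsD[OF v(1)[unfolded e]] and D' = ptsD[OF v(2)[unfolded e]]
  define y where "y = f (of_int \<nu> / of_int k)"
  have x: "of_int \<nu> / of_int k = (of_int \<nu>' / of_int k' :: real)" using s by (simp add: slope_def e)
  have "of_int \<nu> * of_int k' = (of_int \<nu>' * of_int k :: real)" using x D(2) D'(2) by (simp add: field_simps)
  then have 1: "\<nu> * k' = \<nu>' * k" by (simp only: of_int_mult[symmetric] of_int_eq_iff)
  have a: "\<bar>of_int k * y - of_int m\<bar> \<le> \<Delta>" "\<bar>of_int k' * y - of_int m'\<bar> \<le> \<Delta>" using D(7) D'(7) x by (auto simp: y_def)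
  have "real_of_int (m * k' - m' * k) = of_int k * (of_int k' * y - of_int m') - of_int k' * (of_int k * y - of_int m)"
    by (simp add: algebra_simps)
  also have "\<bar>\<dots>\<bar> \<le> \<bar>of_int k * (of_int k' * y - of_int m')\<bar> + \<bar>of_int k' * (of_int k * y - of_int m)\<bar>" by (rule abs_triangle_ineq4)
  also have "\<dots> = of_int k * \<bar>of_int k' * y - of_int m'\<bar> + of_int k' * \<bar>of_int k * y - of_int m\<bar>" using D(2) D'(2) by (simp add: abs_mult)
  also have "\<dots> \<le> 2 ^ j * \<Delta> + 2 ^ j * \<Delta>" using a D D' \<Delta> by (intro add_mono mult_mono) auto
  also have "\<dots> < 1" using \<Delta> by (simp add: mult_ac)
  finally have "\<bar>m * k' - m' * k\<bar> < 1" by linarith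
  then have 2: "m * k' = m' * k" by simp
  show ?thesis unfolding e by (rule primitive_parallel[OF D(1) D'(1) D(2) D'(2) 1 2])
qed

text \<open>For two points on the line put t = \<nu>' k - \<nu> k'. Incidence gives that
  \<open>U\<close> divides t P and t r, hence t itself because the line is primitive. So t \<ge> U,
  and the slopes differ by t/(k k').\<close>

lemma collinear_spacing:
  assumes u: "gcd P (gcd r U) = 1" "0 < U"
    and v: "v \<in> pts f a b j \<Delta>" "v' \<in> pts f a b j \<Delta>" and i: "incident (P, r, U) v" "incident (P, r, U) v'"
    and lt: "slope v < slope v'"
  shows "of_int U / (2 ^ j)\<^sup>2 \<le> slope v' - slope v"
proof -
  obtain \<nu> m k \<nu>' m' k' where e: "v = (\<nu>, m, k)" "v' = (\<nu>', m', k')" by (metis prod_cases3)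
  note D = ptsD[OF v(1)[unfolded e]] and D' = ptsD[OF v(2)[unfolded e]]
  define t where "t = \<nu>' * k - \<nu> * k'"
  have i1: "U * m + k * r = P * \<nu>" "U * m' + k' * r = P * \<nu>'" using i by (auto simp: incident_def e)
  have a: "t * P = U * (m' * k - m * k')"
  proof -
    have "t * P = (P * \<nu>') * k - (P * \<nu>) * k'" by (simp add: t_def algebra_simps)
    also have "\<dots> = U * (m' * k - m * k')" unfolding i1[symmetric] by (simp add: algebra_simps)
    finally show ?thesis .
  qed
  have b: "t * r = U * (m' * \<nu> - m * \<nu>')"
  proof -
    have kr: "k * r = P * \<nu> - U * m" "k' * r = P * \<nu>' - U * m'" using i1 by auto
    have "t * r = (k * r) * \<nu>' - (k' * r) * \<nu>" by (simp add: t_def algebra_simps)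
    also have "\<dots> = U * (m' * \<nu> - m * \<nu>')" unfolding kr by (simp add: algebra_simps)
    finally show ?thesis .
  qed
  have "U dvd gcd (t * r) (t * U)" by (simp add: b)
  then have "U dvd \<bar>t\<bar> * gcd r U" by (simp only: gcd_mult_distrib_int)
  then have "U dvd t * gcd r U" by (simp add: abs_if split: if_splits)
  then have "U dvd gcd (t * P) (t * gcd r U)" by (simp add: a)
  then have "U dvd \<bar>t\<bar> * gcd P (gcd r U)" by (simp only: gcd_mult_distrib_int)
  then have dv: "U dvd t" using u(1) by simp
  have diff: "slope v' - slope v = of_int t / (of_int k * of_int k')"
    using D(2) D'(2) by (simp add: slope_def e t_def field_simps)
  have "real_of_int t = (slope v' - slope v) * (of_int k * of_int k')" unfolding diff using D(2) D'(2) by simp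
  also have "\<dots> > 0" using lt D(2) D'(2) by (intro mult_pos_pos) auto
  finally have "0 < t" by simp
  then have "U \<le> t" using dv by (simp add: zdvd_imp_le)
  then have Ut: "real_of_int U \<le> of_int t" by simp
  have "of_int U / (2 ^ j)\<^sup>2 \<le> of_int U / (of_int k * of_int k' :: real)"
    using D(2,3) D'(2,3) u(2) unfolding power2_eq_square by (intro divide_left_mono mult_mono mult_pos_pos) auto
  also have "\<dots> \<le> of_int t / (of_int k * of_int k')" using Ut D(2) D'(2) by (intro divide_right_mono) auto
  finally show ?thesis using diff by simp
qed

context legendre_pair
begin

lemma tangent_remainder: "\<bar>f y - f x - fd x * (y - x)\<bar> \<le> B / 2 * (y - x)\<^sup>2"
proof -
  have up: "f y - f x - fd x * (y - x) \<le> B / 2 * (y - x)\<^sup>2 \<and> 0 \<le> f y - f x - fd x * (y - x)" if xy: "x \<le> y" for x y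
  proof -
    have "B / 2 * (x - x)\<^sup>2 - (f x - fd x * (x - x)) \<le> B / 2 * (y - x)\<^sup>2 - (f y - fd x * (y - x))"
    proof (rule DERIV_nonneg_imp_nondecreasing[OF xy, where f = "\<lambda>z. B / 2 * (z - x)\<^sup>2 - (f z - fd x * (z - x))"])
      fix z assume z: "x \<le> z" "z \<le> y"
      have "((\<lambda>z. B / 2 * (z - x)\<^sup>2 - (f z - fd x * (z - x))) has_real_derivative B * (z - x) - (fd z - fd x)) (at z)"
        by (auto intro!: derivative_eq_intros f1)
      then show "\<exists>y. ((\<lambda>z. B / 2 * (z - x)\<^sup>2 - (f z - fd x * (z - x))) has_real_derivative y) (at z) \<and> 0 \<le> y"
        using fd_diff(2)[OF z(1)] by auto
    qed
    moreover have "f x - fd x * (x - x) \<le> f y - fd x * (y - x)"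
    proof (rule DERIV_nonneg_imp_nondecreasing[OF xy, where f = "\<lambda>z. f z - fd x * (z - x)"])
      fix z assume z: "x \<le> z" "z \<le> y"
      have "((\<lambda>z. f z - fd x * (z - x)) has_real_derivative fd z - fd x) (at z)"
        by (auto intro!: derivative_eq_intros f1)
      then show "\<exists>y. ((\<lambda>z. f z - fd x * (z - x)) has_real_derivative y) (at z) \<and> 0 \<le> y"
        using fd_mono[OF z(1)] by auto
    qed
    ultimately show ?thesis by simp
  qed
  have down: "f y - f x - fd x * (y - x) \<le> B / 2 * (y - x)\<^sup>2 \<and> 0 \<le> f y - f x - fd x * (y - x)" if xy: "y \<le> x" for x y
  proof -
    have "B / 2 * (x - x)\<^sup>2 - (f x - fd x * (x - x)) \<le> B / 2 * (y - x)\<^sup>2 - (f y - fd x * (y - x))"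
    proof (rule DERIV_nonpos_imp_nonincreasing[OF xy, where f = "\<lambda>z. B / 2 * (z - x)\<^sup>2 - (f z - fd x * (z - x))"])
      fix z assume z: "y \<le> z" "z \<le> x"
      have "((\<lambda>z. B / 2 * (z - x)\<^sup>2 - (f z - fd x * (z - x))) has_real_derivative B * (z - x) - (fd z - fd x)) (at z)"
        by (auto intro!: derivative_eq_intros f1)
      moreover have "B * (z - x) - (fd z - fd x) \<le> 0" using fd_diff(2)[OF z(2)] by (simp add: algebra_simps)
      ultimately show "\<exists>y. ((\<lambda>z. B / 2 * (z - x)\<^sup>2 - (f z - fd x * (z - x))) has_real_derivative y) (at z) \<and> y \<le> 0" by blast
    qed
    moreover have "f x - fd x * (x - x) \<le> f y - fd x * (y - x)"
    proof (rule DERIV_nonpos_imp_nonincreasing[OF xy, where f = "\<lambda>z. f z - fd x * (z - x)"])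
      fix z assume z: "y \<le> z" "z \<le> x"
      have "((\<lambda>z. f z - fd x * (z - x)) has_real_derivative fd z - fd x) (at z)"
        by (auto intro!: derivative_eq_intros f1)
      then show "\<exists>y. ((\<lambda>z. f z - fd x * (z - x)) has_real_derivative y) (at z) \<and> y \<le> 0"
        using fd_mono[OF z(2)] by auto
    qed
    ultimately show ?thesis by simp
  qed
  show ?thesis using up[of x y] down[of y x] by (cases "x \<le> y") auto
qed

text \<open>Three lattice points over a short arc span a parallelepiped of volume less than 1.\<close>

lemma short_arc_collinear:
  assumes v: "(\<nu>1, m1, k1) \<in> pts f a b j \<Delta>" "(\<nu>2, m2, k2) \<in> pts f a b j \<Delta>" "(\<nu>3, m3, k3) \<in> pts f a b j \<Delta>"
    and \<Delta>: "0 \<le> \<Delta>" "2 * \<Delta> * 2 ^ j < 1"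
    and s: "\<bar>of_int \<nu>2 / of_int k2 - of_int \<nu>1 / of_int k1\<bar> \<le> 1 / (8 * B * 2 ^ j)"
      "\<bar>of_int \<nu>3 / of_int k3 - of_int \<nu>1 / of_int k1\<bar> \<le> 1 / (8 * B * 2 ^ j)"
  shows "(m1 * k2 - k1 * m2) * \<nu>3 + (k1 * \<nu>2 - \<nu>1 * k2) * m3 + (\<nu>1 * m2 - m1 * \<nu>2) * k3 = 0"
proof -
  note D1 = ptsD[OF v(1)] and D2 = ptsD[OF v(2)] and D3 = ptsD[OF v(3)]
  define M :: real where "M = 2 ^ j"
  define w where "w = 1 / (8 * B * M)"
  define K1 K2 K3 where "K1 = real_of_int k1" and "K2 = real_of_int k2" and "K3 = real_of_int k3"
  define x1 x2 x3 where "x1 = of_int \<nu>1 / K1" and "x2 = of_int \<nu>2 / K2" and "x3 = of_int \<nu>3 / K3"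
  define e1 e2 e3 where "e1 = of_int m1 - K1 * f x1" and "e2 = of_int m2 - K2 * f x2" and "e3 = of_int m3 - K3 * f x3"
  define R2 R3 where "R2 = f x2 - f x1 - fd x1 * (x2 - x1)" and "R3 = f x3 - f x1 - fd x1 * (x3 - x1)"
  have M: "0 < M" by (simp add: M_def)
  have w: "0 < w" using M B0 by (simp add: w_def)
  have K: "0 < K1" "0 < K2" "0 < K3" "K1 \<le> M" "K2 \<le> M" "K3 \<le> M"
    using D1(2,3) D2(2,3) D3(2,3) by (auto simp: K1_def K2_def K3_def M_def)
  have nu: "of_int \<nu>1 = K1 * x1" "of_int \<nu>2 = K2 * x2" "of_int \<nu>3 = K3 * x3"
    using K by (auto simp: x1_def x2_def x3_def)
  have m: "of_int m1 = K1 * f x1 + e1" "of_int m2 = K2 * f x2 + e2" "of_int m3 = K3 * f x3 + e3"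
    by (auto simp: e1_def e2_def e3_def)
  have e: "\<bar>e1\<bar> \<le> \<Delta>" "\<bar>e2\<bar> \<le> \<Delta>" "\<bar>e3\<bar> \<le> \<Delta>"
    using D1(7) D2(7) D3(7) by (auto simp: e1_def e2_def e3_def K1_def K2_def K3_def x1_def x2_def x3_def abs_minus_commute)
  have xs: "\<bar>x2 - x1\<bar> \<le> w" "\<bar>x3 - x1\<bar> \<le> w"
    using s by (auto simp: x1_def x2_def x3_def K1_def K2_def K3_def w_def M_def)
  have xs23: "\<bar>x3 - x2\<bar> \<le> 2 * w" using xs by linarith
  have R: "\<bar>R2\<bar> \<le> B / 2 * w\<^sup>2" "\<bar>R3\<bar> \<le> B / 2 * w\<^sup>2"
  proof -
    have "(x2 - x1)\<^sup>2 \<le> w\<^sup>2" "(x3 - x1)\<^sup>2 \<le> w\<^sup>2" using xs w by (auto simp: abs_le_square_iff[symmetric])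
    then have "B / 2 * (x2 - x1)\<^sup>2 \<le> B / 2 * w\<^sup>2" "B / 2 * (x3 - x1)\<^sup>2 \<le> B / 2 * w\<^sup>2"
      using B0 by (auto intro!: mult_left_mono)
    then show "\<bar>R2\<bar> \<le> B / 2 * w\<^sup>2" "\<bar>R3\<bar> \<le> B / 2 * w\<^sup>2"
      using tangent_remainder[of x2 x1] tangent_remainder[of x3 x1] unfolding R2_def R3_def by linarith+
  qed
  \<comment> \<open>In the determinant the affine part of the curve at \<open>x1\<close> drops out;
    what survives are the curvature terms \<open>R2\<close>, \<open>R3\<close> and the approximation
    errors \<open>e1\<close>, \<open>e2\<close>, \<open>e3\<close>.\<close>
  have "real_of_int ((m1 * k2 - k1 * m2) * \<nu>3 + (k1 * \<nu>2 - \<nu>1 * k2) * m3 + (\<nu>1 * m2 - m1 * \<nu>2) * k3)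
    = K1 * K2 * K3 * ((x2 - x1) * R3 - (x3 - x1) * R2) + (K1 * K2 * (x2 - x1) * e3 - K1 * K3 * (x3 - x1) * e2 + K2 * K3 * (x3 - x2) * e1)"
    unfolding R2_def R3_def
    by (simp add: K1_def[symmetric] K2_def[symmetric] K3_def[symmetric] nu m) (simp add: algebra_simps)
  also have "\<bar>\<dots>\<bar> \<le> M * M * M * (w * (B / 2 * w\<^sup>2) + w * (B / 2 * w\<^sup>2)) + (M * M * w * \<Delta> + M * M * w * \<Delta> + M * M * (2 * w) * \<Delta>)"
  proof -
    have a: "\<bar>x + (y - z + t)\<bar> \<le> X + (Y + Z + T)" if "\<bar>x\<bar> \<le> X" "\<bar>y\<bar> \<le> Y" "\<bar>z\<bar> \<le> Z" "\<bar>t\<bar> \<le> T" for x y z t X Y Z T :: real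
      using that by linarith
    have b: "\<bar>K * K' * d * e\<bar> \<le> M * M * W * \<Delta>" if "0 < K" "K \<le> M" "0 < K'" "K' \<le> M" "\<bar>d\<bar> \<le> W" "\<bar>e\<bar> \<le> \<Delta>" for K K' d e W
      unfolding abs_mult using that M \<Delta> by (intro mult_mono mult_nonneg_nonneg) auto
    have c: "\<bar>(x2 - x1) * R3 - (x3 - x1) * R2\<bar> \<le> w * (B / 2 * w\<^sup>2) + w * (B / 2 * w\<^sup>2)"
    proof -
      have "\<bar>(x2 - x1) * R3\<bar> \<le> w * (B / 2 * w\<^sup>2)" "\<bar>(x3 - x1) * R2\<bar> \<le> w * (B / 2 * w\<^sup>2)"
        unfolding abs_mult by (rule mult_mono[OF xs(1) R(2)] mult_mono[OF xs(2) R(1)]; use w B0 in simp)+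
      then show ?thesis by linarith
    qed
    have d: "\<bar>K1 * K2 * K3 * ((x2 - x1) * R3 - (x3 - x1) * R2)\<bar> \<le> M * M * M * (w * (B / 2 * w\<^sup>2) + w * (B / 2 * w\<^sup>2))"
      unfolding abs_mult[of "K1 * K2 * K3"] using K M c by (intro mult_mono) (auto intro!: mult_mono)
    show ?thesis by (intro a b d) (use K xs xs23 e in auto)
  qed
  also have "\<dots> = B * (M * w) ^ 3 + 4 * (M * w) * (\<Delta> * M)"
    by (simp add: power2_eq_square power3_eq_cube)
  also have "M * w = 1 / (8 * B)" using M by (simp add: w_def)
  \<comment> \<open>The factor 8 in the arc length keeps both parts small: at most 1/512 from the
    curvature and at most 1/4 from \<open>\<Delta>\<close>.\<close>
  also have "B * (1 / (8 * B)) ^ 3 + 4 * (1 / (8 * B)) * (\<Delta> * M) < 1"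
  proof -
    have "B * (1 / (8 * B)) ^ 3 = (1 / 8) ^ 3 * (1 / B)\<^sup>2" using B0 by (simp add: field_simps power3_eq_cube power2_eq_square)
    also have "\<dots> \<le> (1 / 8) ^ 3 * 1" using B by (intro mult_left_mono) (auto simp: power_le_one)
    finally have "B * (1 / (8 * B)) ^ 3 \<le> 1 / 512" by (simp add: power3_eq_cube)
    moreover have "4 * (1 / (8 * B)) * (\<Delta> * M) \<le> 1 / 2 * (1 / 2)"
    proof (rule mult_mono)
      show "4 * (1 / (8 * B)) \<le> 1 / 2" using B by (simp add: field_simps)
      show "\<Delta> * M \<le> 1 / 2" using \<Delta> by (simp add: M_def)
    qed (use \<Delta> M in auto)
    ultimately show ?thesis by (rule le_less_trans[OF add_mono]) simp
  qed
  finally have "\<bar>(m1 * k2 - k1 * m2) * \<nu>3 + (k1 * \<nu>2 - \<nu>1 * k2) * m3 + (\<nu>1 * m2 - m1 * \<nu>2) * k3\<bar> < 1"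
    by linarith
  then show ?thesis by simp
qed

end

text \<open>The factor \<open>c\<close> may be negative, which allows the last coordinate to be
  normalised to \<open>0 < U\<close>.\<close>

lemma primitive_multiple:
  fixes P0 r0 U0 :: int
  assumes "U0 \<noteq> 0"
  obtains c P r U where "c \<noteq> 0" "P0 = c * P" "r0 = c * r" "U0 = c * U" "gcd P (gcd r U) = 1" "0 < U"
proof -
  define d where "d = gcd P0 (gcd r0 U0)"
  have d: "0 < d" using assms by (simp add: d_def)
  have "d dvd P0" "d dvd r0" "d dvd U0" by (auto simp: d_def intro: dvd_trans[OF gcd_dvd2])
  then obtain P r U where e: "P0 = d * P" "r0 = d * r" "U0 = d * U" by (auto elim!: dvdE)
  have "d * gcd P (gcd r U) = d * 1"
  proof -
    have "d * gcd P (gcd r U) = gcd (d * P) (d * gcd r U)" using gcd_mult_distrib_int[of d P "gcd r U"] d by simp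
    also have "d * gcd r U = gcd (d * r) (d * U)" using gcd_mult_distrib_int[of d r U] d by simp
    finally show ?thesis using d_def unfolding e by simp
  qed
  then have g: "gcd P (gcd r U) = 1" using d by simp
  have U: "U \<noteq> 0" using assms e by auto
  show ?thesis
  proof (cases "0 < U")
    case True
    then show ?thesis using that[of d P r U] d e g by simp
  next
    case False
    have "gcd (- P) (gcd (- r) (- U)) = 1" using g by (simp only: gcd_neg1_int gcd_neg2_int)
    then show ?thesis using that[of "- d" "- P" "- r" "- U"] d e False U by simp
  qed
qed

section \<open>Lines that contain several points\<close>

context legendre_pair
begin

lemma tangent_lower: "(y - x)\<^sup>2 / (2 * B) \<le> f y - f x - fd x * (y - x)"
proof (cases "x \<le> y")
  case True
  have "f x - fd x * (x - x) - (x - x)\<^sup>2 / (2 * B) \<le> f y - fd x * (y - x) - (y - x)\<^sup>2 / (2 * B)"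
  proof (rule DERIV_nonneg_imp_nondecreasing[OF True, where f = "\<lambda>z. f z - fd x * (z - x) - (z - x)\<^sup>2 / (2 * B)"])
    fix z assume z: "x \<le> z" "z \<le> y"
    have "((\<lambda>z. f z - fd x * (z - x) - (z - x)\<^sup>2 / (2 * B)) has_real_derivative fd z - fd x - (z - x) / B) (at z)"
      using B0 by (auto intro!: derivative_eq_intros f1 simp: field_simps)
    then show "\<exists>y. ((\<lambda>z. f z - fd x * (z - x) - (z - x)\<^sup>2 / (2 * B)) has_real_derivative y) (at z) \<and> 0 \<le> y"
      using fd_diff(1)[OF z(1)] by auto
  qed
  then show ?thesis by simp
next
  case False
  then have yx: "y \<le> x" by simp
  have "f x - fd x * (x - x) - (x - x)\<^sup>2 / (2 * B) \<le> f y - fd x * (y - x) - (y - x)\<^sup>2 / (2 * B)"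
  proof (rule DERIV_nonpos_imp_nonincreasing[OF yx, where f = "\<lambda>z. f z - fd x * (z - x) - (z - x)\<^sup>2 / (2 * B)"])
    fix z assume z: "y \<le> z" "z \<le> x"
    have "((\<lambda>z. f z - fd x * (z - x) - (z - x)\<^sup>2 / (2 * B)) has_real_derivative fd z - fd x - (z - x) / B) (at z)"
      using B0 by (auto intro!: derivative_eq_intros f1 simp: field_simps)
    moreover have "fd z - fd x - (z - x) / B \<le> 0"
      using fd_diff(1)[OF z(2)] minus_divide_left[of "x - z" B] by simp
    ultimately show "\<exists>y. ((\<lambda>z. f z - fd x * (z - x) - (z - x)\<^sup>2 / (2 * B)) has_real_derivative y) (at z) \<and> y \<le> 0" by blast
  qed
  then show ?thesis by simp
qed

text \<open>At \<open>x0\<close> the curve is parallel to the line. On either side of it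
  \<open>h\<close> is monotone, and by strong convexity it changes between \<open>x\<close> and
  \<open>y\<close> by at least (y - x)^2/(2 B) plus |z - x0| (y - x)/B, where z is the end nearer to
  \<open>x0\<close>. Since both values are at most \<open>\<tau>\<close> in modulus, each of the two
  terms is at most 2 \<tau>.\<close>

lemma line_near_curve:
  fixes P r U :: int
  assumes U: "0 < U" and x0: "x0 = gd (of_int P / of_int U)"
    and h: "h = (\<lambda>x. f x - of_int P / of_int U * x + of_int r / of_int U)"
    and near: "\<bar>h x\<bar> \<le> \<tau>" "\<bar>h y\<bar> \<le> \<tau>" and xy: "x < y" "x0 \<le> x \<or> y \<le> x0"
  shows "(y - x)\<^sup>2 \<le> 4 * B * \<tau>" "\<exists>z\<in>{x, y}. \<bar>z - x0\<bar> * (y - x) \<le> 2 * B * \<tau>"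
proof -
  define p where "p = real_of_int P / of_int U"
  have p: "fd x0 = p" by (simp add: x0 p_def fg)
  have hd: "h v - h u = f v - f u - p * (v - u)" for u v unfolding h p_def by (simp add: algebra_simps diff_divide_distrib)
  obtain z where z: "z \<in> {x, y}" and ineq: "(y - x)\<^sup>2 / (2 * B) + \<bar>z - x0\<bar> / B * (y - x) \<le> 2 * \<tau>"
  proof (cases "x0 \<le> x")
    case True
    have "(x - x0) / B * (y - x) \<le> (fd x - p) * (y - x)"
      using fd_diff(1)[OF True] xy p by (intro mult_right_mono) auto
    then have "(y - x)\<^sup>2 / (2 * B) + (x - x0) / B * (y - x) \<le> h y - h x"
      using tangent_lower[of y x] unfolding hd by (simp add: algebra_simps)
    then have "(y - x)\<^sup>2 / (2 * B) + \<bar>x - x0\<bar> / B * (y - x) \<le> 2 * \<tau>" using near True by auto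
    then show ?thesis using that[of x] by simp
  next
    case False
    then have y: "y \<le> x0" using xy by simp
    have "(x0 - y) / B * (y - x) \<le> (p - fd y) * (y - x)"
      using fd_diff(1)[OF y] xy p by (intro mult_right_mono) auto
    then have "(x - y)\<^sup>2 / (2 * B) + (x0 - y) / B * (y - x) \<le> h x - h y"
      using tangent_lower[of x y] unfolding hd by (simp add: algebra_simps)
    then have "(y - x)\<^sup>2 / (2 * B) + \<bar>y - x0\<bar> / B * (y - x) \<le> 2 * \<tau>" using near y by (auto simp: power2_commute)
    then show ?thesis using that[of y] by simp
  qed
  have nn: "0 \<le> (y - x)\<^sup>2 / (2 * B)" "0 \<le> \<bar>z - x0\<bar> / B * (y - x)" using B0 xy by auto
  have "(y - x)\<^sup>2 / (2 * B) \<le> 2 * \<tau>" using ineq nn by linarith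
  then show "(y - x)\<^sup>2 \<le> 4 * B * \<tau>" using B0 by (simp add: field_simps)
  have "\<bar>z - x0\<bar> / B * (y - x) \<le> 2 * \<tau>" using ineq nn by linarith
  then have "\<bar>z - x0\<bar> * (y - x) \<le> 2 * B * \<tau>" using B0 by (simp add: field_simps)
  then show "\<exists>z\<in>{x, y}. \<bar>z - x0\<bar> * (y - x) \<le> 2 * B * \<tau>" using z by blast
qed

text \<open>The third bound says that \<open>(P/U, r/U)\<close> is again a rational point close to the dual curve.\<close>

lemma line_count:
  fixes P r U :: int and j :: nat and \<Delta> :: real
  defines "M \<equiv> (2::real) ^ j"
  defines "\<tau> \<equiv> 2 * \<Delta> / M"
  defines "l \<equiv> sqrt (4 * B * \<tau>)" and "\<delta> \<equiv> of_int U / M\<^sup>2"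
  assumes u: "gcd P (gcd r U) = 1" "0 < U" and \<Delta>: "2 * \<Delta> * M < 1" "0 \<le> \<Delta>"
    and Q: "Q = {v \<in> pts f a b j \<Delta>. incident (P, r, U) v}" and c3: "3 \<le> card Q"
  shows "\<delta> \<le> l" "real (card Q) \<le> 4 * l / \<delta>"
    "\<bar>of_int U * g (of_int P / of_int U) - of_int r\<bar> \<le> 24 * B ^ 3 * (\<Delta> * M)\<^sup>2 / of_int U"
    "\<exists>z\<in>{a..b}. \<bar>z - gd (of_int P / of_int U)\<bar> \<le> 4 * B * (\<Delta> * M)"
proof -
  define x0 where "x0 = gd (of_int P / of_int U)"
  define h where "h x = f x - of_int P / of_int U * x + of_int r / of_int U" for x
  define X where "X = slope ` Q"
  have M: "0 < M" by (simp add: M_def)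
  have \<tau>0: "0 \<le> \<tau>" using \<Delta> M by (simp add: \<tau>_def)
  have l0: "0 \<le> l" using \<tau>0 B0 by (simp add: l_def)
  have l2: "l\<^sup>2 = 4 * B * \<tau>" using \<tau>0 B0 by (simp add: l_def)
  have \<delta>0: "0 < \<delta>" using u M by (simp add: \<delta>_def)
  have finQ: "finite Q" unfolding Q using finite_pts by simp
  have inj: "inj_on slope Q"
    using slope_inj[of _ f a b j \<Delta>] \<Delta> unfolding Q M_def by (auto intro!: inj_onI)
  have cX: "card X = card Q" unfolding X_def by (rule card_image[OF inj])
  have finX: "finite X" using finQ by (simp add: X_def)
  have space: "\<delta> \<le> y - x" if "x \<in> X" "y \<in> X" "x < y" for x y
    using that collinear_spacing[OF u] unfolding X_def Q \<delta>_def M_def by auto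
  have near: "\<bar>h x\<bar> \<le> \<tau>" "x \<in> {a..b}" if x: "x \<in> X" for x
  proof -
    obtain \<nu> m k where v: "(\<nu>, m, k) \<in> pts f a b j \<Delta>" "incident (P, r, U) (\<nu>, m, k)" "x = of_int \<nu> / of_int k"
      using x unfolding X_def Q slope_def by auto
    note D = ptsD[OF v(1)]
    have "U * m + k * r = P * \<nu>" using v(2) by (simp add: incident_def)
    then have "real_of_int (U * m + k * r) = real_of_int (P * \<nu>)" by simp
    then have i: "of_int U * of_int m + of_int k * of_int r = (of_int P * of_int \<nu> :: real)" by simp
    have "of_int U * (of_int k * h x) = of_int U * (of_int k * f x) - of_int P * of_int \<nu> + of_int k * of_int r"
      using u D(2) by (simp add: h_def v(3) algebra_simps)
    also have "\<dots> = of_int U * (of_int k * f x - of_int m)" unfolding i[symmetric] by (simp add: algebra_simps)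
    finally have "of_int k * h x = of_int k * f x - of_int m" using u by simp
    then have "of_int k * \<bar>h x\<bar> \<le> \<Delta>" using D(2,7) v(3) by (metis abs_mult abs_of_pos of_int_0_less_iff)
    moreover have "M / 2 * \<bar>h x\<bar> \<le> of_int k * \<bar>h x\<bar>" using D(4) by (intro mult_right_mono) (auto simp: M_def)
    ultimately have "M / 2 * \<bar>h x\<bar> \<le> \<Delta>" by linarith
    then show "\<bar>h x\<bar> \<le> \<tau>" using M by (simp add: \<tau>_def field_simps)
    show "x \<in> {a..b}" using D(5,6) v(3) by simp
  qed
  have hfun: "h = (\<lambda>x. f x - of_int P / of_int U * x + of_int r / of_int U)" by (simp add: h_def[abs_def])
  note lnc = line_near_curve[OF u(2) x0_def hfun near(1) near(1)]
  \<comment> \<open>The points are treated separately on the two sides of \<open>x0\<close>, because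
    \<open>line_near_curve\<close> needs both points on the same side. Any two of them there are at
    least \<open>\<delta>\<close> and at most \<open>l\<close> apart.\<close>
  have side: "real (card S) \<le> l / \<delta> + 1 \<and> (2 \<le> card S \<longrightarrow> \<delta> \<le> l \<and> (\<exists>z\<in>X. \<bar>z - x0\<bar> * \<delta> \<le> 2 * B * \<tau>))"
    if S: "S = {x \<in> X. x0 \<le> x} \<or> S = {x \<in> X. x < x0}" for S
  proof -
    have SX: "S \<subseteq> X" and finS: "finite S" using S finX by auto
    have diam: "y - x \<le> l" if "x \<in> S" "y \<in> S" for x y
    proof (cases "x < y")
      case True
      have "x0 \<le> x \<or> y \<le> x0" using S that by auto
      then have "(y - x)\<^sup>2 \<le> l\<^sup>2" using lnc(1)[of x y] SX that True l2 by auto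
      then show ?thesis using l0 by (rule power2_le_imp_le)
    qed (use l0 in simp)
    have 1: "real (card S) \<le> l / \<delta> + 1"
      by (rule card_spaced_le[OF finS \<delta>0 l0]) (use space SX diam in auto)
    moreover have "\<delta> \<le> l \<and> (\<exists>z\<in>X. \<bar>z - x0\<bar> * \<delta> \<le> 2 * B * \<tau>)" if c: "2 \<le> card S"
    proof -
      obtain x y where xy: "x \<in> S" "y \<in> S" "x < y"
      proof -
        obtain x y where "x \<in> S" "y \<in> S" "x \<noteq> y" using c by (metis card_le_Suc0_iff_eq finS not_less_eq_eq numeral_2_eq_2)
        then show ?thesis using that[of x y] that[of y x] by linarith
      qed
      have "x0 \<le> x \<or> y \<le> x0" using S xy by auto
      then obtain z where z: "z \<in> {x, y}" "\<bar>z - x0\<bar> * (y - x) \<le> 2 * B * \<tau>" using lnc(2)[of x y] SX xy by auto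
      have sp: "\<delta> \<le> y - x" using space SX xy by auto
      then have "\<bar>z - x0\<bar> * \<delta> \<le> \<bar>z - x0\<bar> * (y - x)" by (intro mult_left_mono) auto
      then show ?thesis using z SX xy sp diam[OF xy(1,2)] by (auto intro: order_trans)
    qed
    ultimately show ?thesis by blast
  qed
  define XR XL where "XR = {x \<in> X. x0 \<le> x}" and "XL = {x \<in> X. x < x0}"
  have "X = XR \<union> XL" "XR \<inter> XL = {}" by (auto simp: XR_def XL_def)
  then have cc: "card Q = card XR + card XL" using finX cX card_Un_disjoint[of XR XL] by auto
  have sR: "real (card XR) \<le> l / \<delta> + 1" and sR2: "2 \<le> card XR \<Longrightarrow> \<delta> \<le> l \<and> (\<exists>z\<in>X. \<bar>z - x0\<bar> * \<delta> \<le> 2 * B * \<tau>)"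
    using side[of XR] by (auto simp: XR_def)
  have sL: "real (card XL) \<le> l / \<delta> + 1" and sL2: "2 \<le> card XL \<Longrightarrow> \<delta> \<le> l \<and> (\<exists>z\<in>X. \<bar>z - x0\<bar> * \<delta> \<le> 2 * B * \<tau>)"
    using side[of XL] by (auto simp: XL_def)
  \<comment> \<open>Of three points two lie on the same side of \<open>x0\<close>; this is where
    \<open>c3\<close> enters.\<close>
  have "2 \<le> card XR \<or> 2 \<le> card XL" using c3 cc by linarith
  then have both: "\<delta> \<le> l" "\<exists>z\<in>X. \<bar>z - x0\<bar> * \<delta> \<le> 2 * B * \<tau>" using sR2 sL2 by auto
  show "\<delta> \<le> l" by (rule both)
  have "1 \<le> l / \<delta>" using both(1) \<delta>0 by simp
  then have "real (card Q) \<le> 4 * (l / \<delta>)" using sR sL cc by simp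
  then show "real (card Q) \<le> 4 * l / \<delta>" by simp
  obtain z where z: "z \<in> X" "\<bar>z - x0\<bar> * \<delta> \<le> 2 * B * \<tau>" using both(2) by blast
  have zd: "\<bar>z - x0\<bar> \<le> 2 * B * \<tau> / \<delta>" using z(2) \<delta>0 by (simp add: le_divide_eq)
  have e1: "\<tau> / \<delta> = 2 * (\<Delta> * M) / of_int U" using M u by (simp add: \<tau>_def \<delta>_def power2_eq_square)
  show "\<exists>z\<in>{a..b}. \<bar>z - gd (of_int P / of_int U)\<bar> \<le> 4 * B * (\<Delta> * M)"
  proof (intro bexI)
    have "2 * B * \<tau> / \<delta> = 2 * B * (\<tau> / \<delta>)" by simp
    also have "\<dots> = 4 * B * (\<Delta> * M) / of_int U" unfolding e1 by simp
    also have "\<dots> \<le> 4 * B * (\<Delta> * M) / 1" using u \<Delta> M B0 by (intro divide_left_mono) auto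
    finally show "\<bar>z - gd (of_int P / of_int U)\<bar> \<le> 4 * B * (\<Delta> * M)" using zd by (simp add: x0_def)
    show "z \<in> {a..b}" using near(2)[OF z(1)] .
  qed
  have fdx0: "fd x0 = of_int P / of_int U" by (simp add: x0_def fg)
  have "\<bar>h z - h x0\<bar> \<le> B / 2 * (z - x0)\<^sup>2"
    using tangent_remainder[of z x0] unfolding fdx0 h_def by (simp add: algebra_simps diff_divide_distrib)
  also have "\<dots> \<le> B / 2 * (2 * B * \<tau> / \<delta>)\<^sup>2"
    using power_mono[OF zd, of 2] B0 by (intro mult_left_mono) auto
  also have "\<dots> = 2 * B ^ 3 * (\<tau> / \<delta>)\<^sup>2" by (simp add: power2_eq_square power3_eq_cube)
  finally have hz: "\<bar>h z - h x0\<bar> \<le> 2 * B ^ 3 * (\<tau> / \<delta>)\<^sup>2" .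
  \<comment> \<open>\<open>\<delta> \<le> l\<close> means that \<open>\<tau>\<close> itself is
    dominated by (\<tau>/\<delta>)^2. Hence the error at the nearby point \<open>z\<close> and the
    change of \<open>h\<close> from \<open>z\<close> to \<open>x0\<close> have the same
    shape.\<close>
  have "\<tau> \<le> 4 * B * (\<tau> / \<delta>)\<^sup>2"
  proof -
    have "\<delta>\<^sup>2 \<le> 4 * B * \<tau>" using power_mono[OF both(1), of 2] \<delta>0 l2 by simp
    then have "\<tau> * \<delta>\<^sup>2 \<le> \<tau> * (4 * B * \<tau>)" by (intro mult_left_mono \<tau>0)
    then show ?thesis using \<delta>0 by (simp add: power_divide field_simps power2_eq_square)
  qed
  also have "\<dots> \<le> 4 * B ^ 3 * (\<tau> / \<delta>)\<^sup>2"
    using power_increasing[of 1 3 B] B by (intro mult_right_mono) auto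
  finally have "\<bar>h x0\<bar> \<le> 6 * B ^ 3 * (\<tau> / \<delta>)\<^sup>2" using near(1)[OF z(1)] hz by linarith
  then have "of_int U * \<bar>h x0\<bar> \<le> of_int U * (6 * B ^ 3 * (\<tau> / \<delta>)\<^sup>2)" using u by (intro mult_left_mono) auto
  also have "\<dots> = 24 * B ^ 3 * (\<Delta> * M)\<^sup>2 / of_int U" unfolding e1 using u by (simp add: power2_eq_square)
  finally have fin: "of_int U * \<bar>h x0\<bar> \<le> 24 * B ^ 3 * (\<Delta> * M)\<^sup>2 / of_int U" .
  \<comment> \<open>By the Legendre relation, the vertical distance between line and curve at the
    point of parallelism is the error of the dual rational point, up to the factor -U.\<close>
  have "of_int U * g (of_int P / of_int U) - of_int r = - (of_int U * h x0)"
    using u by (simp add: leg h_def x0_def algebra_simps)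
  then have "\<bar>of_int U * g (of_int P / of_int U) - of_int r\<bar> = of_int U * \<bar>h x0\<bar>" using u by (simp add: abs_mult)
  then show "\<bar>of_int U * g (of_int P / of_int U) - of_int r\<bar> \<le> 24 * B ^ 3 * (\<Delta> * M)\<^sup>2 / of_int U" using fin by simp
qed

end

lemma exists_shell:
  fixes U :: int
  assumes "0 < U"
  obtains i :: nat where "2 ^ i < 2 * U" "U \<le> 2 ^ i"
proof -
  define i where "i = (LEAST i. U \<le> 2 ^ i)"
  have "\<exists>i. U \<le> 2 ^ i"
  proof
    have "int (nat U) < int (2 ^ nat U)" by (simp only: of_nat_less_iff less_exp)
    then show "U \<le> 2 ^ nat U" using assms by simp
  qed
  then have 1: "U \<le> 2 ^ i" unfolding i_def by (rule LeastI_ex)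
  have "2 ^ i < 2 * U"
  proof (cases i)
    case (Suc k)
    have "\<not> U \<le> 2 ^ k" using not_less_Least[of k "\<lambda>i. U \<le> 2 ^ i"] Suc unfolding i_def by simp
    then show ?thesis using Suc by simp
  qed (use assms in simp)
  then show ?thesis using that 1 by blast
qed

lemma card_frac_range_le:
  assumes "a \<le> b" "0 < k"
  shows "real (card (frac_range a b k)) \<le> real k * (b - a) + 1"
proof -
  have "real k * a \<le> real k * b" using assms by (intro mult_left_mono) auto
  then have "real (nat (\<lfloor>real k * b\<rfloor> + 1 - \<lceil>real k * a\<rceil>)) \<le> real k * b - real k * a + 1" by linarith
  then show ?thesis by (simp add: frac_range_def right_diff_distrib)
qed

lemma card_pts_trivial:
  assumes ab: "a \<le> b" and \<Delta>: "0 \<le> \<Delta>" "\<Delta> \<le> 1"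
  shows "real (card (pts f a b j \<Delta>)) \<le> 3 * 2 ^ j * ((b - a + 1) * 2 ^ j)"
proof -
  define h where "h \<nu> k = real k * f (of_int \<nu> / real k)" for \<nu> :: int and k :: nat
  define I where "I \<nu> k = {\<lceil>h \<nu> k - \<Delta>\<rceil>..\<lfloor>h \<nu> k + \<Delta>\<rfloor>}" for \<nu> k
  have "pts f a b j \<Delta> \<subseteq> (\<Union>k\<in>{1..2 ^ j}. \<Union>\<nu>\<in>frac_range a b k. (\<lambda>m. (\<nu>, m, int k)) ` I \<nu> k)"
  proof
    fix v assume v: "v \<in> pts f a b j \<Delta>"
    obtain \<nu> m k where e: "v = (\<nu>, m, k)" by (metis prod_cases3)
    note D = ptsD[OF v[unfolded e]]
    define k' where "k' = nat k"
    have k: "k = int k'" using D(2) by (simp add: k'_def)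
    have "k' \<in> {1..2 ^ j}" using D(2,3) by (simp add: k flip: of_nat_le_iff)
    moreover have "\<nu> \<in> frac_range a b k'" using D(2,5,6) by (simp add: mem_frac_range k field_simps)
    moreover have "m \<in> I \<nu> k'"
      using D(7) unfolding I_def h_def atLeastAtMost_iff ceiling_le_iff le_floor_iff k by simp linarith
    ultimately show "v \<in> (\<Union>k\<in>{1..2 ^ j}. \<Union>\<nu>\<in>frac_range a b k. (\<lambda>m. (\<nu>, m, int k)) ` I \<nu> k)"
      using e k by blast
  qed
  then have "card (pts f a b j \<Delta>) \<le> card (\<Union>k\<in>{1..2 ^ j}. \<Union>\<nu>\<in>frac_range a b k. (\<lambda>m. (\<nu>, m, int k)) ` I \<nu> k)"
    by (intro card_mono) (auto simp: I_def)
  also have "\<dots> \<le> (\<Sum>k\<in>{1..2 ^ j}. card (\<Union>\<nu>\<in>frac_range a b k. (\<lambda>m. (\<nu>, m, int k)) ` I \<nu> k))"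
    by (intro card_UN_le) simp
  also have "\<dots> \<le> (\<Sum>k\<in>{1..2 ^ j}. \<Sum>\<nu>\<in>frac_range a b k. card ((\<lambda>m. (\<nu>, m, int k)) ` I \<nu> k))"
    by (intro sum_mono card_UN_le) simp
  also have "\<dots> \<le> (\<Sum>k\<in>{1..(2::nat) ^ j}. \<Sum>\<nu>\<in>frac_range a b k. 3)"
  proof (intro sum_mono)
    fix k \<nu>
    have "card ((\<lambda>m. (\<nu>, m, int k)) ` I \<nu> k) \<le> card (I \<nu> k)" by (intro card_image_le) (simp add: I_def)
    also have "card (I \<nu> k) \<le> 3" using \<Delta> unfolding I_def card_atLeastAtMost_int by linarith
    finally show "card ((\<lambda>m. (\<nu>, m, int k)) ` I \<nu> k) \<le> 3" .
  qed
  finally have "real (card (pts f a b j \<Delta>)) \<le> real (\<Sum>k\<in>{1..(2::nat) ^ j}. \<Sum>\<nu>\<in>frac_range a b k. 3)" by (simp only: of_nat_le_iff)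
  also have "\<dots> = (\<Sum>k\<in>{1..(2::nat) ^ j}. real (card (frac_range a b k)) * 3)" by simp
  also have "\<dots> \<le> (\<Sum>k\<in>{1..(2::nat) ^ j}. ((b - a + 1) * 2 ^ j) * 3)"
  proof (intro sum_mono mult_right_mono)
    fix k assume k: "k \<in> {1..(2::nat) ^ j}"
    have "real k \<le> real (2 ^ j)" using k by (simp only: of_nat_le_iff atLeastAtMost_iff)
    then have k2: "real k \<le> 2 ^ j" by simp
    have "real (card (frac_range a b k)) \<le> real k * (b - a) + 1" using ab k by (intro card_frac_range_le) auto
    also have "\<dots> \<le> 2 ^ j * (b - a) + 2 ^ j" using ab k2 by (intro add_mono mult_right_mono) auto
    finally show "real (card (frac_range a b k)) \<le> (b - a + 1) * 2 ^ j" by (simp add: algebra_simps)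
  qed simp
  finally show ?thesis by (simp add: mult_ac)
qed

section \<open>The recursion between a curve and its dual\<close>

context legendre_pair
begin

text \<open>The arc is cut into cells of length 1/(8 B M). Cells with at most two points give the
  first term. In any other cell all points lie on one line, which by \<open>line_count\<close> is a
  primitive point near the dual curve from a shell i < j and carries O(M^(1 - \<theta>/2) / 2^i)
  points. If the dual count in shell i is O(2^i), then each shell contributes O(M^(1 - \<theta>/2)),
  and even the sum over all i < j is of smaller order than M.\<close>

lemma pts_recursion:
  fixes j :: nat and \<theta> :: real
  defines "M \<equiv> (2::real) ^ j"
  defines "\<Delta> \<equiv> M powr (- 1 - \<theta>)"
  assumes \<theta>: "0 < \<theta>" and ab: "a \<le> b" and large: "48 * B ^ 3 * M powr (- \<theta>) \<le> 1"
  shows "real (card (pts f a b j \<Delta>)) \<le> 2 * ((b - a) * (8 * B * M) + 1)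
    + (\<Sum>i<j. real (card (pts g (fd (a - 1)) (fd (b + 1)) i ((2 ^ i) powr (- 1 - \<theta>)))) * (24 * sqrt B * M powr (1 - \<theta> / 2) / 2 ^ i))"
proof -
  define e where "e = M powr (- \<theta>)"
  define l where "l = sqrt (4 * B * (2 * \<Delta> / M))"
  define G where "G i = pts g (fd (a - 1)) (fd (b + 1)) i ((2 ^ i) powr (- 1 - \<theta>))" for i
  define Ps where "Ps = pts f a b j \<Delta>"
  define Qs where "Qs u = {v \<in> Ps. incident u v}" for u
  have M1: "1 \<le> M" by (simp add: M_def)
  then have M0: "0 < M" by simp
  have e0: "0 < e" using M0 by (simp add: e_def)
  have \<Delta>M: "\<Delta> * M = e"
  proof -
    have "\<Delta> * M = M powr (- 1 - \<theta>) * M powr 1" using M0 by (simp add: \<Delta>_def)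
    also have "\<dots> = e" unfolding powr_add[symmetric] e_def by simp
    finally show ?thesis .
  qed
  have B3: "B \<le> B ^ 3" using power_increasing[of 1 3 B] B by simp
  have eB: "48 * B ^ 3 * e \<le> 1" using large by (simp add: e_def)
  have eB1: "48 * B * e \<le> 1" 
  proof -
    have "48 * B * e \<le> 48 * B ^ 3 * e" using B3 e0 by (intro mult_right_mono) auto
    then show ?thesis using eB by simp
  qed
  have Be: "0 < B * e" using B0 e0 by simp
  have e48: "48 * e \<le> 1" using mult_right_mono[of 1 B "48 * e"] B e0 eB1 by linarith
  have \<Delta>0: "0 < \<Delta>" using M0 by (simp add: \<Delta>_def)
  have small: "2 * \<Delta> * M < 1" using \<Delta>M e48 e0 by simp
  have lM: "l * M \<^sup>2 = sqrt (8 * B) * (M powr (1 - \<theta> / 2))"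
  proof -
    have "l = sqrt (8 * B * e / M\<^sup>2)" unfolding l_def \<Delta>M[symmetric] using M0 by (simp add: power2_eq_square)
    also have "\<dots> = sqrt (8 * B) * sqrt e / M" using M0 by (simp add: real_sqrt_divide real_sqrt_mult)
    finally have "l * M\<^sup>2 = sqrt (8 * B) * (sqrt e * M)" using M0 by (simp add: power2_eq_square)
    also have "sqrt e = M powr (- \<theta> / 2)" using M0 unfolding e_def powr_half_sqrt[symmetric, OF powr_ge_zero] by (simp add: powr_powr)
    also have "M powr (- \<theta> / 2) * M = M powr (- \<theta> / 2) * M powr 1" using M0 by simp
    also have "\<dots> = M powr (1 - \<theta> / 2)" unfolding powr_add[symmetric] by simp
    finally show ?thesis .
  qed
  have l0: "0 \<le> l" using B0 \<Delta>0 M0 by (simp add: l_def)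
  \<comment> \<open>As U \<le> l M^2, this gives U \<le> M/2, so the dual point falls into a
    strictly smaller shell.\<close>
  have lM1: "2 * (l * M\<^sup>2) \<le> M"
  proof -
    have "(2 * (l * M))\<^sup>2 = 4 * (4 * B * (2 * \<Delta> / M)) * M\<^sup>2" using \<Delta>0 M0 B0 by (simp add: l_def power_mult_distrib)
    also have "\<dots> = 32 * B * e" unfolding \<Delta>M[symmetric] using M0 by (simp add: power2_eq_square)
    also have "\<dots> \<le> 1\<^sup>2" using eB1 Be unfolding one_power2 by linarith
    finally have "2 * (l * M) \<le> 1" by (rule power2_le_imp_le) simp
    then have "2 * (l * M) * M \<le> 1 * M" using M0 by (intro mult_right_mono) auto
    then show ?thesis by (simp add: power2_eq_square mult_ac)
  qed
  have s8: "8 * sqrt (8 * B) \<le> 24 * sqrt B"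
  proof -
    have "sqrt (8 * B) \<le> sqrt (9 * B)" using B0 by simp
    also have "\<dots> = 3 * sqrt B" by (simp add: real_sqrt_mult)
    finally show ?thesis by simp
  qed
  have line: "\<exists>i<j. (P, r, U) \<in> G i" and lcount: "\<And>i. (P, r, U) \<in> G i \<Longrightarrow> real (card (Qs (P, r, U))) \<le> 24 * sqrt B * M powr (1 - \<theta> / 2) / 2 ^ i"
    if u: "gcd P (gcd r U) = 1" "0 < U" and c3: "3 \<le> card (Qs (P, r, U))" for P r U
  proof -
    have Qe: "Qs (P, r, U) = {v \<in> pts f a b j \<Delta>. incident (P, r, U) v}" by (simp add: Qs_def Ps_def)
    note LC = line_count[OF u small[unfolded M_def] less_imp_le[OF \<Delta>0] Qe c3, folded M_def, folded l_def]
    define x0 where "x0 = gd (of_int P / of_int U)"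
    have fdx0: "fd x0 = of_int P / of_int U" by (simp add: x0_def fg)
    have U1: "1 \<le> real_of_int U" using u by simp
    have Ul: "of_int U \<le> l * M\<^sup>2" using LC(1) M0 by (simp add: divide_le_eq)
    show "real (card (Qs (P, r, U))) \<le> 24 * sqrt B * M powr (1 - \<theta> / 2) / 2 ^ i" if i: "(P, r, U) \<in> G i" for i
    proof -
      have Ui: "2 ^ i < 2 * real_of_int U" using ptsD(4)[OF i[unfolded G_def]] .
      have "real (card (Qs (P, r, U))) \<le> 4 * (l * M\<^sup>2) / of_int U" using LC(2) by simp
      also have "\<dots> \<le> 4 * (l * M\<^sup>2) / (2 ^ i / 2)"
        using Ui U1 l0 by (intro divide_left_mono mult_pos_pos mult_nonneg_nonneg) auto
      also have "\<dots> = (8 * sqrt (8 * B)) * M powr (1 - \<theta> / 2) / 2 ^ i" unfolding lM by simp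
      also have "\<dots> \<le> (24 * sqrt B) * M powr (1 - \<theta> / 2) / 2 ^ i"
        using s8 by (intro divide_right_mono mult_right_mono) auto
      finally show ?thesis by simp
    qed
    obtain i where i: "2 ^ i < 2 * U" "U \<le> 2 ^ i" using exists_shell[OF u(2)] .
    have i': "2 ^ i < 2 * real_of_int U" "real_of_int U \<le> 2 ^ i"
    proof -
      have "real_of_int (2 ^ i) < real_of_int (2 * U)" "real_of_int U \<le> real_of_int (2 ^ i)" using i by (simp_all only: of_int_less_iff of_int_le_iff)
      then show "2 ^ i < 2 * real_of_int U" "real_of_int U \<le> 2 ^ i" by simp_all
    qed
    have iM: "2 ^ i < M" using i'(1) Ul lM1 by linarith
    then have ij: "i < j" unfolding M_def by simp
    have "(P, r, U) \<in> G i"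
      unfolding G_def pts_def
    proof (clarsimp simp only: mem_Collect_eq case_prod_conv, intro conjI)
      show "gcd P (gcd r U) = 1" "2 ^ i < 2 * U" "U \<le> 2 ^ i" by (fact u i)+
      \<comment> \<open>The point \<open>x0\<close> leaves \<open>{a..b}\<close> by at most 1, hence
        the enlarged window from \<open>fd (a - 1)\<close> to \<open>fd (b + 1)\<close>.\<close>
      obtain z where z: "z \<in> {a..b}" "\<bar>z - x0\<bar> \<le> 4 * B * (\<Delta> * M)" using LC(4) by (auto simp: x0_def)
      have "4 * B * (\<Delta> * M) \<le> 1" unfolding \<Delta>M using eB1 Be by linarith
      then have "a - 1 \<le> x0" "x0 \<le> b + 1" using z by auto
      then have "fd (a - 1) \<le> of_int P / of_int U" "of_int P / of_int U \<le> fd (b + 1)" using fd_mono fdx0 by metis+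
      then show "fd (a - 1) * of_int U \<le> of_int P" "of_int P \<le> fd (b + 1) * of_int U" using u by (simp_all add: field_simps)
      \<comment> \<open>The error is quadratic in e = M^(-\<theta>). One factor \<open>e\<close>
        pays for the constant by the hypothesis \<open>large\<close>; the other is at most
        (2^i)^(-\<theta>) because 2^i < M. So the dual point satisfies the condition with the same
        exponent \<theta>.\<close>
      have "\<bar>of_int U * g (of_int P / of_int U) - of_int r\<bar> \<le> 24 * B ^ 3 * e\<^sup>2 / of_int U" using LC(3) unfolding \<Delta>M .
      also have "\<dots> \<le> 24 * B ^ 3 * e\<^sup>2 / (2 ^ i / 2)" using i'(1) U1 B0 by (intro divide_left_mono mult_pos_pos) auto
      also have "\<dots> = (48 * B ^ 3 * e) * (e / 2 ^ i)" by (simp add: power2_eq_square)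
      also have "\<dots> \<le> 1 * (e / 2 ^ i)" using eB e0 by (intro mult_right_mono) auto
      also have "\<dots> \<le> (2 ^ i) powr (- \<theta>) / 2 ^ i"
      proof -
        have "e \<le> (2 ^ i) powr (- \<theta>)" unfolding e_def using iM \<theta> by (intro powr_mono2') auto
        then show ?thesis by (simp add: divide_right_mono)
      qed
      also have "\<dots> = (2 ^ i) powr (- 1 - \<theta>)"
      proof -
        have "(2 ^ i) powr (- 1 - \<theta>) = (2 ^ i) powr (- 1 :: real) * (2 ^ i) powr (- \<theta>)" unfolding powr_add[symmetric] by simp
        then show ?thesis by (simp add: powr_minus_divide)
      qed
      finally show "\<bar>of_int U * g (of_int P / of_int U) - of_int r\<bar> \<le> (2 ^ i) powr (- 1 - \<theta>)" .
    qed
    then show "\<exists>i<j. (P, r, U) \<in> G i" using ij by blast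
  qed
  \<comment> \<open>The reciprocal of the arc length required by
    \<open>short_arc_collinear\<close>.\<close>
  define W where "W = 8 * B * M"
  have W0: "0 < W" using B0 M0 by (simp add: W_def)
  define cell where "cell v = nat \<lfloor>(slope v - a) * W\<rfloor>" for v
  define N where "N = nat \<lfloor>(b - a) * W\<rfloor>"
  define C where "C i = {v \<in> Ps. cell v = i}" for i
  define Us where "Us i = {u \<in> G i. 3 \<le> card (Qs u)}" for i
  have finP: "finite Ps" unfolding Ps_def by (rule finite_pts)
  have finC: "finite (C i)" for i using finP by (simp add: C_def)
  have finG: "finite (G i)" for i unfolding G_def by (rule finite_pts)
  have finUs: "finite (Us i)" for i using finG by (simp add: Us_def)
  have sl: "a \<le> slope v" "slope v \<le> b" if "v \<in> Ps" for v
  proof -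
    obtain \<nu> m k where e: "v = (\<nu>, m, k)" by (metis prod_cases3)
    show "a \<le> slope v" "slope v \<le> b" using ptsD(5,6)[of \<nu> m k f a b j \<Delta>] that by (auto simp: e Ps_def slope_def)
  qed
  have rich: "\<exists>i<j. \<exists>u\<in>Us i. C c \<subseteq> Qs u" if c: "3 \<le> card (C c)" for c
  proof -
    obtain v1 v2 where v12: "v1 \<in> C c" "v2 \<in> C c" "v1 \<noteq> v2"
      using c by (metis card_le_Suc0_iff_eq finC not_less_eq_eq numeral_3_eq_3 Suc_leD)
    obtain \<nu>1 m1 k1 \<nu>2 m2 k2 where e: "v1 = (\<nu>1, m1, k1)" "v2 = (\<nu>2, m2, k2)" by (metis prod_cases3)
    have p12: "(\<nu>1, m1, k1) \<in> pts f a b j \<Delta>" "(\<nu>2, m2, k2) \<in> pts f a b j \<Delta>" using v12 e by (auto simp: C_def Ps_def)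
    have close: "\<bar>slope v - slope v'\<bar> \<le> 1 / (8 * B * 2 ^ j)" if "v \<in> C c" "v' \<in> C c" for v v'
    proof -
      have "nat \<lfloor>(slope v - a) * W\<rfloor> = nat \<lfloor>(slope v' - a) * W\<rfloor>" using that by (auto simp: C_def cell_def)
      moreover have "0 \<le> (slope v - a) * W" "0 \<le> (slope v' - a) * W" using that sl W0 by (auto simp: C_def)
      ultimately have "\<bar>(slope v - a) * W - (slope v' - a) * W\<bar> \<le> 1" by linarith
      then have "\<bar>slope v - slope v'\<bar> * W \<le> 1" using W0 by (simp add: abs_mult flip: left_diff_distrib)
      then show ?thesis using W0 by (simp add: W_def M_def field_simps)
    qed
    have "slope v1 \<noteq> slope v2" using slope_inj[OF p12 small[unfolded M_def] less_imp_le[OF \<Delta>0]] v12(3) e by metis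
    then have U0: "k1 * \<nu>2 - \<nu>1 * k2 \<noteq> 0"
      using ptsD(2)[OF p12(1)] ptsD(2)[OF p12(2)] unfolding e slope_def
      by (auto simp: field_simps simp flip: of_int_mult)
    \<comment> \<open>The line through \<open>v1\<close> and \<open>v2\<close> in primitive form.
      The minus sign adapts the determinant to the convention U m + k r = P \<nu> of
      \<open>incident\<close>.\<close>
    obtain t P r U where t: "t \<noteq> 0" "- (m1 * k2 - k1 * m2) = t * P" "\<nu>1 * m2 - m1 * \<nu>2 = t * r" "k1 * \<nu>2 - \<nu>1 * k2 = t * U"
      and u: "gcd P (gcd r U) = 1" "0 < U"
      using primitive_multiple[OF U0] .
    have CQ: "C c \<subseteq> Qs (P, r, U)"
    proof
      fix v assume v: "v \<in> C c"
      obtain \<nu>3 m3 k3 where e3: "v = (\<nu>3, m3, k3)" by (metis prod_cases3)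
      have p3: "(\<nu>3, m3, k3) \<in> pts f a b j \<Delta>" using v e3 by (auto simp: C_def Ps_def)
      have "(m1 * k2 - k1 * m2) * \<nu>3 + (k1 * \<nu>2 - \<nu>1 * k2) * m3 + (\<nu>1 * m2 - m1 * \<nu>2) * k3 = 0"
        by (rule short_arc_collinear[OF p12 p3 less_imp_le[OF \<Delta>0] small[unfolded M_def]])
           (use close[OF v12(2,1)] close[OF v v12(1)] in \<open>simp_all add: slope_def e e3\<close>)
      moreover have "m1 * k2 - k1 * m2 = - (t * P)" using t(2) by simp
      ultimately have "- (t * P) * \<nu>3 + (t * U) * m3 + (t * r) * k3 = 0" using t(3,4) by simp
      then have "t * (U * m3 + k3 * r) = t * (P * \<nu>3)" by (simp add: algebra_simps)
      then have "U * m3 + k3 * r = P * \<nu>3" using t(1) by simp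
      then show "v \<in> Qs (P, r, U)" using v by (simp add: Qs_def C_def incident_def e3)
    qed
    have finQ: "finite (Qs (P, r, U))" using finP by (simp add: Qs_def)
    have c3: "3 \<le> card (Qs (P, r, U))" using c card_mono[OF finQ CQ] by simp
    obtain i where "i < j" "(P, r, U) \<in> G i" using line[OF u c3] by blast
    then show ?thesis using c3 CQ by (auto simp: Us_def)
  qed
  define poor where "poor = {c \<in> {..N}. card (C c) < 3}"
  have cover: "Ps \<subseteq> (\<Union>c\<in>poor. C c) \<union> (\<Union>i\<in>{..<j}. \<Union>u\<in>Us i. Qs u)"
  proof
    fix v assume v: "v \<in> Ps"
    have "(slope v - a) * W \<le> (b - a) * W" using sl[OF v] W0 by (intro mult_right_mono) auto
    then have "cell v \<le> N" unfolding cell_def N_def by (intro nat_mono floor_mono)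
    moreover have vC: "v \<in> C (cell v)" using v by (simp add: C_def)
    ultimately show "v \<in> (\<Union>c\<in>poor. C c) \<union> (\<Union>i\<in>{..<j}. \<Union>u\<in>Us i. Qs u)"
      using rich[of "cell v"] by (cases "card (C (cell v)) < 3") (auto simp: poor_def)
  qed
  have finQs: "finite (Qs u)" for u using finP by (simp add: Qs_def)
  have "card Ps \<le> card ((\<Union>c\<in>poor. C c) \<union> (\<Union>i\<in>{..<j}. \<Union>u\<in>Us i. Qs u))"
    by (intro card_mono[OF _ cover]) (auto simp: poor_def finC finUs finQs)
  also have "\<dots> \<le> card (\<Union>c\<in>poor. C c) + card (\<Union>i\<in>{..<j}. \<Union>u\<in>Us i. Qs u)" by (rule card_Un_le)
  also have "card (\<Union>c\<in>poor. C c) \<le> (\<Sum>c\<in>poor. card (C c))" by (intro card_UN_le) (simp add: poor_def)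
  also have "\<dots> \<le> (\<Sum>c\<in>poor. 2)" by (intro sum_mono) (auto simp: poor_def)
  also have "\<dots> \<le> (\<Sum>c\<in>{..N}. 2)" by (intro sum_mono2) (auto simp: poor_def)
  also have "\<dots> = 2 * (N + 1)" by simp
  also have "card (\<Union>i\<in>{..<j}. \<Union>u\<in>Us i. Qs u) \<le> (\<Sum>i<j. card (\<Union>u\<in>Us i. Qs u))" by (intro card_UN_le) simp
  also have "\<dots> \<le> (\<Sum>i<j. \<Sum>u\<in>Us i. card (Qs u))" by (intro sum_mono card_UN_le finUs)
  finally have "real (card Ps) \<le> real (2 * (N + 1) + (\<Sum>i<j. \<Sum>u\<in>Us i. card (Qs u)))" by (simp only: of_nat_le_iff)
  also have "\<dots> = 2 * (real N + 1) + (\<Sum>i<j. \<Sum>u\<in>Us i. real (card (Qs u)))" by simp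
  also have "\<dots> \<le> 2 * ((b - a) * W + 1) + (\<Sum>i<j. real (card (G i)) * (24 * sqrt B * M powr (1 - \<theta> / 2) / 2 ^ i))"
  proof (intro add_mono sum_mono mult_left_mono order_refl)
    show "real N \<le> (b - a) * W" unfolding N_def using ab W0 by simp
    fix i
    have "(\<Sum>u\<in>Us i. real (card (Qs u))) \<le> (\<Sum>u\<in>Us i. 24 * sqrt B * M powr (1 - \<theta> / 2) / 2 ^ i)"
    proof (intro sum_mono)
      fix u assume u: "u \<in> Us i"
      obtain P r U where e: "u = (P, r, U)" by (metis prod_cases3)
      have G: "(P, r, U) \<in> G i" and c3: "3 \<le> card (Qs (P, r, U))" using u by (auto simp: Us_def e)
      show "real (card (Qs u)) \<le> 24 * sqrt B * M powr (1 - \<theta> / 2) / 2 ^ i"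
        unfolding e by (rule lcount[OF _ _ c3 G]) (use ptsD(1,2)[OF G[unfolded G_def]] in auto)
    qed
    also have "\<dots> = real (card (Us i)) * (24 * sqrt B * M powr (1 - \<theta> / 2) / 2 ^ i)" by simp
    also have "\<dots> \<le> real (card (G i)) * (24 * sqrt B * M powr (1 - \<theta> / 2) / 2 ^ i)"
      using card_mono[OF finG, of "Us i"] B0 by (intro mult_right_mono) (auto simp: Us_def)
    finally show "(\<Sum>u\<in>Us i. real (card (Qs u))) \<le> real (card (G i)) * (24 * sqrt B * M powr (1 - \<theta> / 2) / 2 ^ i)" .
  qed simp_all
  finally show ?thesis by (simp add: Ps_def G_def W_def)
qed

end

text \<open>Strong induction on the shell, simultaneously for all Legendre pairs with the given
  \<open>B\<close> and for all windows, since \<open>pts_recursion\<close> exchanges f and g and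
  enlarges the window. From \<open>j0\<close> on the recursive part is at most half of the claimed
  bound, because j 2^(-\<theta> j/2) tends to 0; thus no power of 2^j is lost.\<close>

theorem primitive_count:
  fixes B \<theta> :: real
  assumes B: "1 \<le> B" and \<theta>: "0 < \<theta>"
  obtains C where "0 \<le> C" "\<And>L f fd fdd g gd gdd a b j. legendre_pair B L f fd fdd g gd gdd \<Longrightarrow> a \<le> b \<Longrightarrow>
    real (card (pts f a b j ((2 ^ j) powr (- 1 - \<theta>)))) \<le> C * ((b - a + 1) * 2 ^ j)"
proof -
  have pw: "(2 ^ j) powr x = 2 powr (x * real j)" for j :: nat and x :: real
    by (simp add: powr_powr mult.commute flip: powr_realpow)
  have "(\<lambda>j::nat. 48 * B ^ 3 * 2 powr (- \<theta> * real j)) \<longlonglongrightarrow> 0" using \<theta> by real_asymp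
  then have "\<forall>\<^sub>F j in sequentially. 48 * B ^ 3 * 2 powr (- \<theta> * real j) < 1" by (rule order_tendstoD) simp
  moreover have "(\<lambda>j::nat. 72 * B * sqrt B * (real j * 2 powr (- \<theta> / 2 * real j))) \<longlonglongrightarrow> 0" using \<theta> by real_asymp
  then have "\<forall>\<^sub>F j in sequentially. 72 * B * sqrt B * (real j * 2 powr (- \<theta> / 2 * real j)) < 1/2" by (rule order_tendstoD) simp
  ultimately have "\<forall>\<^sub>F j in sequentially. 48 * B ^ 3 * 2 powr (- \<theta> * real j) < 1 \<and> 72 * B * sqrt B * (real j * 2 powr (- \<theta> / 2 * real j)) < 1/2"
    by (rule eventually_conj)
  then obtain j0 where j0: "\<And>j. j0 \<le> j \<Longrightarrow> 48 * B ^ 3 * 2 powr (- \<theta> * real j) < 1"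
    "\<And>j. j0 \<le> j \<Longrightarrow> 72 * B * sqrt B * (real j * 2 powr (- \<theta> / 2 * real j)) < 1/2"
    unfolding eventually_sequentially by blast
  \<comment> \<open>\<open>36 * B\<close> makes the contribution \<open>18 * B * S\<close> of the
    poor cells at most half of the bound; \<open>3 * 2 ^ j0\<close> covers the trivial estimate for
    j < j0.\<close>
  define C where "C = max (36 * B) (3 * 2 ^ j0)"
  have C0: "0 \<le> C" using B by (simp add: C_def)
  have "real (card (pts f a b j ((2 ^ j) powr (- 1 - \<theta>)))) \<le> C * ((b - a + 1) * 2 ^ j)"
    if "legendre_pair B L f fd fdd g gd gdd" "a \<le> b" for L f fd fdd g gd gdd a b j
    using that
  proof (induction j arbitrary: L f fd fdd g gd gdd a b rule: less_induct)
    case (less j)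
    interpret legendre_pair B L f fd fdd g gd gdd by (rule less.prems)
    note ab = less.prems(2)
    show ?case
    proof (cases "j < j0")
      case True
      have "real (card (pts f a b j ((2 ^ j) powr (- 1 - \<theta>)))) \<le> 3 * 2 ^ j * ((b - a + 1) * 2 ^ j)"
      proof (rule card_pts_trivial[OF ab])
        show "(2 ^ j) powr (- 1 - \<theta>) \<le> 1" unfolding pw using \<theta> powr_mono[of "(-1 - \<theta>) * real j" 0 "2::real"]
          by (simp add: mult_nonpos_nonneg)
      qed simp
      also have "\<dots> \<le> C * ((b - a + 1) * 2 ^ j)"
      proof (rule mult_right_mono)
        have "3 * (2::real) ^ j \<le> 3 * 2 ^ j0" using True by (intro mult_left_mono power_increasing) auto
        then show "3 * 2 ^ j \<le> C" unfolding C_def by (rule max.coboundedI2)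
      qed (use ab in simp)
      finally show ?thesis .
    next
      case False
      define S where "S = (b - a + 1) * 2 ^ j"
      define p where "p = 2 powr (- \<theta> / 2 * real j)"
      have S0: "0 \<le> S" using ab by (simp add: S_def)
      have l1: "48 * B ^ 3 * (2 ^ j) powr (- \<theta>) \<le> 1" using j0(1)[of j] False unfolding pw by simp
      have l2: "72 * B * sqrt B * (real j * p) \<le> 1/2" using j0(2)[of j] False unfolding p_def by simp
      have pow: "(2 ^ j) powr (1 - \<theta> / 2) = 2 ^ j * p"
      proof -
        have "(2 ^ j) powr (1 - \<theta> / 2) = (2 ^ j) powr 1 * (2 ^ j) powr (- \<theta> / 2)" unfolding powr_add[symmetric] by simp
        then show ?thesis unfolding p_def pw[of j "- \<theta> / 2"] by simp
      qed
      \<comment> \<open>The window length may grow by the factor \<open>3 * B\<close> in each step.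
        As the bound is linear in this length, the factor only enters the smallness condition
        \<open>l2\<close>, where 72 = 24 * 3.\<close>
      have len: "fd (b + 1) - fd (a - 1) + 1 \<le> 3 * B * (b - a + 1)"
      proof -
        have "fd (b + 1) - fd (a - 1) \<le> B * (b + 1 - (a - 1))" using ab by (intro fd_diff) auto
        moreover have "0 \<le> B * (b - a)" using ab B0 by simp
        moreover have "B * (b + 1 - (a - 1)) = B * (b - a) + 2 * B" "3 * B * (b - a + 1) = 3 * (B * (b - a)) + 3 * B"
          by (simp_all add: algebra_simps)
        ultimately show ?thesis using B by linarith
      qed
      have le: "fd (a - 1) \<le> fd (b + 1)" using ab by (intro fd_mono) auto
      have "real (card (pts f a b j ((2 ^ j) powr (- 1 - \<theta>)))) \<le> 2 * ((b - a) * (8 * B * 2 ^ j) + 1)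
        + (\<Sum>i<j. real (card (pts g (fd (a - 1)) (fd (b + 1)) i ((2 ^ i) powr (- 1 - \<theta>)))) * (24 * sqrt B * (2 ^ j) powr (1 - \<theta> / 2) / 2 ^ i))"
        by (rule pts_recursion[OF \<theta> ab l1])
      also have "\<dots> \<le> 18 * B * S + (\<Sum>i<j. C * (3 * B * (b - a + 1) * 2 ^ i) * (24 * sqrt B * (2 ^ j) powr (1 - \<theta> / 2) / 2 ^ i))"
      proof (intro add_mono sum_mono mult_right_mono)
        have "0 \<le> B * ((b - a) * 2 ^ j)" "1 \<le> B * 2 ^ j" using ab B mult_mono[of 1 B 1 "2 ^ j"] by auto
        then show "2 * ((b - a) * (8 * B * 2 ^ j) + 1) \<le> 18 * B * S" by (simp add: S_def algebra_simps)
        fix i assume i: "i \<in> {..<j}"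
        have "real (card (pts g (fd (a - 1)) (fd (b + 1)) i ((2 ^ i) powr (- 1 - \<theta>)))) \<le> C * ((fd (b + 1) - fd (a - 1) + 1) * 2 ^ i)"
          using i by (intro less.IH[OF _ swap le]) auto
        also have "\<dots> \<le> C * (3 * B * (b - a + 1) * 2 ^ i)"
          using len C0 by (intro mult_left_mono mult_right_mono) auto
        finally show "real (card (pts g (fd (a - 1)) (fd (b + 1)) i ((2 ^ i) powr (- 1 - \<theta>)))) \<le> C * (3 * B * (b - a + 1) * 2 ^ i)" .
      qed (use B0 in simp)
      also have "(\<Sum>i<j. C * (3 * B * (b - a + 1) * 2 ^ i) * (24 * sqrt B * (2 ^ j) powr (1 - \<theta> / 2) / 2 ^ i)) = (C * S) * (72 * B * sqrt B * (real j * p))"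
        unfolding pow by (simp add: S_def)
      also have "\<dots> \<le> (C * S) * (1/2)" using C0 S0 by (intro mult_left_mono[OF l2]) simp
      also have "18 * B * S + (C * S) * (1/2) \<le> C * S"
      proof -
        have "36 * B * S \<le> C * S" using S0 by (intro mult_right_mono) (auto simp: C_def)
        then show ?thesis by simp
      qed
      finally show ?thesis by (simp add: S_def)
    qed
  qed
  then show ?thesis using that C0 by blast
qed

section \<open>From primitive points to all fractions near the curve\<close>

definition near_set :: "(real \<Rightarrow> real) \<Rightarrow> real \<Rightarrow> real \<Rightarrow> nat \<Rightarrow> real \<Rightarrow> (nat \<times> int) set" where
  "near_set f a b n \<delta> = {(k, \<nu>). k \<in> {1..n} \<and> \<nu> \<in> frac_range a b k \<and> int_dist (real k * f (of_int \<nu> / real k)) \<le> \<delta>}"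

definition frac_set :: "real \<Rightarrow> real \<Rightarrow> nat \<Rightarrow> (nat \<times> int) set" where
  "frac_set a b n = (SIGMA k:{1..n}. frac_range a b k)"

lemma finite_frac_set [simp]: "finite (frac_set a b n)"
  by (simp add: frac_set_def)

lemma near_set_subset: "near_set f a b n \<delta> \<subseteq> frac_set a b n"
  by (auto simp: near_set_def frac_set_def)

lemma finite_near_set [simp]: "finite (near_set f a b n \<delta>)"
  using near_set_subset by (rule finite_subset) simp

lemma near_set_mono: "\<delta> \<le> \<delta>' \<Longrightarrow> near_set f a b n \<delta> \<subseteq> near_set f a b n \<delta>'"
  by (auto simp: near_set_def)

lemma card_frac_set_le:
  assumes "a \<le> b"
  shows "real (card (frac_set a b n)) \<le> (b - a + 1) * (real n)\<^sup>2"
proof -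
  have "real (card (frac_set a b n)) = (\<Sum>k=1..n. real (card (frac_range a b k)))"
    by (simp add: frac_set_def)
  also have "\<dots> \<le> (\<Sum>k=1..n. (b - a + 1) * real n)"
  proof (intro sum_mono)
    fix k assume k: "k \<in> {1..n}"
    have "real (card (frac_range a b k)) \<le> real k * (b - a) + 1" using assms k by (intro card_frac_range_le) auto
    also have "\<dots> \<le> real n * (b - a) + real n" using assms k by (intro add_mono mult_right_mono) auto
    finally show "real (card (frac_range a b k)) \<le> (b - a + 1) * real n" by (simp add: algebra_simps)
  qed
  finally show ?thesis by (simp add: power2_eq_square mult_ac)
qed

lemma sum_powers_two_le:
  fixes Y :: real
  assumes fin: "finite I" and Y: "0 \<le> Y" and I: "\<And>i. i \<in> I \<Longrightarrow> 2 ^ i \<le> Y"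
  shows "(\<Sum>i\<in>I. 2 ^ i) \<le> 2 * Y"
proof (cases "I = {}")
  case False
  define m where "m = Max I"
  have "m \<in> I" "I \<subseteq> {..m}" using fin False by (auto simp: m_def)
  then have "(\<Sum>i\<in>I. (2::real) ^ i) \<le> (\<Sum>i\<in>{..m}. 2 ^ i)" by (intro sum_mono2) auto
  also have "\<dots> = 2 * 2 ^ m - 1" by (induction m) auto
  also have "\<dots> \<le> 2 * Y" using I[OF \<open>m \<in> I\<close>] by simp
  finally show ?thesis .
qed (use Y in simp)

text \<open>With m the nearest integer, dividing (\<nu>, m, k) by its gcd d gives a primitive point.
  Its error is smaller by the factor d, and it lies in a shell with 2^i d < 2 n.\<close>

lemma near_set_pts:
  assumes kv: "(k, \<nu>) \<in> near_set f a b n \<delta>"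
    and small: "\<And>i. 2 ^ i < 2 * real n \<Longrightarrow> \<delta> \<le> (2 ^ i) powr (- 1 - \<theta>)"
  obtains d i \<nu>' m' k' where "d \<in> {1..n}" "2 ^ i * real d < 2 * real n" "(\<nu>', m', k') \<in> pts f a b i ((2 ^ i) powr (- 1 - \<theta>))"
    "k = nat (int d * k')" "\<nu> = int d * \<nu>'"
proof -
  have k: "1 \<le> k" "k \<le> n" and \<nu>: "real k * a \<le> of_int \<nu>" "of_int \<nu> \<le> real k * b"
    and near: "int_dist (real k * f (of_int \<nu> / real k)) \<le> \<delta>"
    using kv by (auto simp: near_set_def mem_frac_range)
  define m where "m = round (real k * f (of_int \<nu> / real k))"
  have k0: "int k \<noteq> 0" using k by simp
  obtain c \<nu>' m' k' where c: "c \<noteq> 0" "\<nu> = c * \<nu>'" "m = c * m'" "int k = c * k'" "gcd \<nu>' (gcd m' k') = 1" "0 < k'"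
    using primitive_multiple[OF k0, of \<nu> m] by blast
  have c0: "0 < c" using c(4,6) k by (smt (verit) of_nat_0_less_iff zero_less_mult_pos2 less_le_trans zero_less_one)
  define d where "d = nat c"
  have cd: "c = int d" "1 \<le> d" using c0 by (auto simp: d_def)
  have kd: "real k = real d * of_int k'"
  proof -
    have "real_of_int (int k) = real_of_int (int d * k')" using c(4) cd by simp
    then show ?thesis by simp
  qed
  have k'1: "1 \<le> real_of_int k'" using c(6) by simp
  have dk: "real d \<le> real k" using mult_left_mono[OF k'1, of "real d"] kd by simp
  have frac: "of_int \<nu> / real k = of_int \<nu>' / of_int k'" using cd c(2) kd by simp
  obtain i where i: "2 ^ i < 2 * k'" "k' \<le> 2 ^ i" using exists_shell[OF c(6)] .
  have i': "2 ^ i < 2 * real_of_int k'"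
  proof -
    have "real_of_int (2 ^ i) < real_of_int (2 * k')" using i(1) by (simp only: of_int_less_iff)
    then show ?thesis by simp
  qed
  have i1: "2 ^ i * real d < 2 * real n"
  proof -
    have "2 ^ i * real d < 2 * of_int k' * real d" using i' cd by (intro mult_strict_right_mono) auto
    also have "\<dots> = 2 * real k" by (simp add: kd)
    also have "\<dots> \<le> 2 * real n" using k by simp
    finally show ?thesis .
  qed
  have "2 ^ i * 1 \<le> 2 ^ i * real d" using cd by (intro mult_left_mono) auto
  then have i2: "2 ^ i < 2 * real n" using i1 by linarith
  have "\<bar>of_int k' * f (of_int \<nu>' / of_int k') - of_int m'\<bar> \<le> (2 ^ i) powr (- 1 - \<theta>)"
  proof -
    have "real d * \<bar>of_int k' * f (of_int \<nu>' / of_int k') - of_int m'\<bar> = \<bar>real k * f (of_int \<nu> / real k) - of_int m\<bar>"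
    proof -
      have "real k * f (of_int \<nu> / real k) - of_int m = real d * (of_int k' * f (of_int \<nu>' / of_int k') - of_int m')"
        unfolding frac by (simp add: c(3) cd(1) kd algebra_simps)
      then show ?thesis by (simp add: abs_mult)
    qed
    also have "\<dots> \<le> \<delta>" using near by (simp add: int_dist_def m_def)
    finally have "1 * \<bar>of_int k' * f (of_int \<nu>' / of_int k') - of_int m'\<bar> \<le> \<delta>"
      by (rule order_trans[rotated]) (use cd in \<open>intro mult_right_mono; simp\<close>)
    then show ?thesis using small[OF i2] by simp
  qed
  moreover have "a * of_int k' \<le> of_int \<nu>'" "of_int \<nu>' \<le> b * of_int k'"
  proof -
    have "real d * (a * of_int k') \<le> real d * of_int \<nu>'" "real d * of_int \<nu>' \<le> real d * (b * of_int k')"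
      using \<nu> unfolding kd c(2) cd(1) by (simp_all add: mult_ac)
    then show "a * of_int k' \<le> of_int \<nu>'" "of_int \<nu>' \<le> b * of_int k'" using cd by auto
  qed
  ultimately have "(\<nu>', m', k') \<in> pts f a b i ((2 ^ i) powr (- 1 - \<theta>))" using c(5) i by (simp add: pts_def)
  moreover have "d \<in> {1..n}" using cd dk k by simp
  moreover have "k = nat (int d * k')" using c(4) cd by (metis nat_int)
  ultimately show ?thesis using that i1 c(2) cd by blast
qed

text \<open>Each fraction is d times a primitive point from a shell with 2^i < 2 n/d. For fixed d
  these shells contribute O(n/d), and the sum over d produces the logarithm.\<close>

theorem near_count:
  fixes B \<kappa> :: real
  assumes B: "1 \<le> B" and \<kappa>: "0 < \<kappa>"
  obtains C where "0 \<le> C" "\<And>L f fd fdd g gd gdd a b n. legendre_pair B L f fd fdd g gd gdd \<Longrightarrow> a \<le> b \<Longrightarrow> 1 \<le> n \<Longrightarrow>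
    real (card (near_set f a b n (real n powr (- 1 - \<kappa>)))) \<le> C * ((b - a + 1) * (real n * (1 + ln (real n))))"
proof -
  \<comment> \<open>Halving the exponent leaves a spare factor n^(-\<theta>), which for n \<ge> n0
    absorbs the constant caused by shells reaching up to 2 n.\<close>
  define \<theta> where "\<theta> = \<kappa> / 2"
  have \<theta>: "0 < \<theta>" using \<kappa> by (simp add: \<theta>_def)
  obtain C1 where C1: "0 \<le> C1" "\<And>L f fd fdd g gd gdd a b j. legendre_pair B L f fd fdd g gd gdd \<Longrightarrow> a \<le> b \<Longrightarrow>
    real (card (pts f a b j ((2 ^ j) powr (- 1 - \<theta>)))) \<le> C1 * ((b - a + 1) * 2 ^ j)"
    using primitive_count[OF B \<theta>] by metis
  have "(\<lambda>n::nat. 2 powr (1 + \<theta>) * real n powr (- \<theta>)) \<longlonglongrightarrow> 0" using \<theta> by real_asymp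
  then have "\<forall>\<^sub>F n in sequentially. 2 powr (1 + \<theta>) * real n powr (- \<theta>) < 1" by (rule order_tendstoD) simp
  then obtain n0 where n0: "\<And>n. n0 \<le> n \<Longrightarrow> 2 powr (1 + \<theta>) * real n powr (- \<theta>) < 1"
    unfolding eventually_sequentially by blast
  define C where "C = max (real n0) (4 * C1)"
  have "real (card (near_set f a b n (real n powr (- 1 - \<kappa>)))) \<le> C * ((b - a + 1) * (real n * (1 + ln (real n))))"
    if pair: "legendre_pair B L f fd fdd g gd gdd" and ab: "a \<le> b" and n: "1 \<le> n" for L f fd fdd g gd gdd a b n
  proof (cases "n < n0")
    case True
    have "real (card (near_set f a b n (real n powr (- 1 - \<kappa>)))) \<le> real (card (frac_set a b n))"
      using near_set_subset by (simp add: card_mono)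
    also have "\<dots> \<le> (b - a + 1) * (real n)\<^sup>2" by (rule card_frac_set_le[OF ab])
    also have "\<dots> = real n * ((b - a + 1) * (real n * 1))" by (simp add: power2_eq_square)
    also have "\<dots> \<le> C * ((b - a + 1) * (real n * (1 + ln (real n))))"
      using True ab n by (intro mult_mono mult_left_mono) (auto simp: C_def)
    finally show ?thesis .
  next
    case False
    define \<delta> where "\<delta> = real n powr (- 1 - \<kappa>)"
    have small: "\<delta> \<le> (2 ^ i) powr (- 1 - \<theta>)" if i: "2 ^ i < 2 * real n" for i :: nat
    proof -
      have "\<delta> = real n powr (- 1 - \<theta>) * real n powr (- \<theta>)" unfolding \<delta>_def powr_add[symmetric] by (rule arg_cong[where f = "\<lambda>x. real n powr x"]) (simp add: \<theta>_def)
      also have "\<dots> \<le> real n powr (- 1 - \<theta>) * 2 powr (- 1 - \<theta>)"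
      proof (rule mult_left_mono)
        have "2 powr (- 1 - \<theta>) * (2 powr (1 + \<theta>) * real n powr (- \<theta>)) \<le> 2 powr (- 1 - \<theta>) * 1"
          using n0[of n] False by (intro mult_left_mono) auto
        moreover have "2 powr (- 1 - \<theta>) * 2 powr (1 + \<theta>) = 1" unfolding powr_add[symmetric] by simp
        ultimately show "real n powr (- \<theta>) \<le> 2 powr (- 1 - \<theta>)" by (simp add: mult.assoc[symmetric])
      qed simp
      also have "\<dots> = (2 * real n) powr (- 1 - \<theta>)" by (simp add: powr_mult mult.commute)
      also have "\<dots> \<le> (2 ^ i) powr (- 1 - \<theta>)" using i \<theta> by (intro powr_mono2') auto
      finally show ?thesis .
    qed
    define I where "I d = {i::nat. 2 ^ i * real d < 2 * real n}" for d :: nat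
    define V where "V i = pts f a b i ((2 ^ i) powr (- 1 - \<theta>))" for i
    define \<phi> where "\<phi> d v = (case v of (\<nu>', m', k') \<Rightarrow> (nat (int d * k'), int d * \<nu>'))" for d and v :: "int \<times> int \<times> int"
    have finI: "finite (I d)" "(\<Sum>i\<in>I d. 2 ^ i) \<le> 4 * real n / real d" if d: "d \<in> {1..n}" for d
    proof -
      have le: "2 ^ i \<le> 2 * real n / real d" if "i \<in> I d" for i using that d by (simp add: I_def field_simps)
      have "I d \<subseteq> {..2 * n}"
      proof
        fix i assume "i \<in> I d"
        then have "2 ^ i \<le> 2 * real n / real d" by (rule le)
        also have "\<dots> \<le> 2 * real n / 1" using d by (intro divide_left_mono) auto
        finally have "2 ^ i \<le> 2 * real n" by simp
        moreover have "real i < (2::real) ^ i" by (rule of_nat_less_two_power)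
        ultimately have "real i < 2 * real n" by linarith
        then have "real i < real (2 * n)" by simp
        then show "i \<in> {..2 * n}" by simp
      qed
      then show fin: "finite (I d)" by (rule finite_subset) simp
      have "(\<Sum>i\<in>I d. 2 ^ i) \<le> 2 * (2 * real n / real d)" using fin le by (intro sum_powers_two_le) auto
      then show "(\<Sum>i\<in>I d. 2 ^ i) \<le> 4 * real n / real d" by simp
    qed
    have finV: "finite (V i)" for i unfolding V_def by (rule finite_pts)
    have "near_set f a b n \<delta> \<subseteq> (\<Union>d\<in>{1..n}. \<Union>i\<in>I d. \<phi> d ` V i)"
    proof
      fix x assume x: "x \<in> near_set f a b n \<delta>"
      obtain k \<nu> where e: "x = (k, \<nu>)" by (cases x)
      obtain d i \<nu>' m' k' where "d \<in> {1..n}" "2 ^ i * real d < 2 * real n" "(\<nu>', m', k') \<in> V i" "k = nat (int d * k')" "\<nu> = int d * \<nu>'"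
        using near_set_pts[OF x[unfolded e] small] unfolding V_def by blast
      then show "x \<in> (\<Union>d\<in>{1..n}. \<Union>i\<in>I d. \<phi> d ` V i)"
        unfolding e I_def by (intro UN_I[of d] UN_I[of i] image_eqI[of _ _ "(\<nu>', m', k')"]) (auto simp: \<phi>_def)
    qed
    then have "card (near_set f a b n \<delta>) \<le> card (\<Union>d\<in>{1..n}. \<Union>i\<in>I d. \<phi> d ` V i)"
      using finI finV by (intro card_mono) auto
    also have "\<dots> \<le> (\<Sum>d\<in>{1..n}. card (\<Union>i\<in>I d. \<phi> d ` V i))" by (intro card_UN_le) simp
    also have "\<dots> \<le> (\<Sum>d\<in>{1..n}. \<Sum>i\<in>I d. card (\<phi> d ` V i))" by (intro sum_mono card_UN_le finI)
    also have "\<dots> \<le> (\<Sum>d\<in>{1..n}. \<Sum>i\<in>I d. card (V i))" by (intro sum_mono card_image_le finV)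
    finally have "real (card (near_set f a b n \<delta>)) \<le> real (\<Sum>d\<in>{1..n}. \<Sum>i\<in>I d. card (V i))" by (simp only: of_nat_le_iff)
    also have "\<dots> = (\<Sum>d\<in>{1..n}. \<Sum>i\<in>I d. real (card (V i)))" by simp
    also have "\<dots> \<le> (\<Sum>d\<in>{1..n}. \<Sum>i\<in>I d. C1 * ((b - a + 1) * 2 ^ i))"
      unfolding V_def by (intro sum_mono C1(2)[OF pair ab])
    also have "\<dots> = (\<Sum>d\<in>{1..n}. C1 * ((b - a + 1) * (\<Sum>i\<in>I d. 2 ^ i)))" by (simp add: sum_distrib_left)
    also have "\<dots> \<le> (\<Sum>d\<in>{1..n}. C1 * ((b - a + 1) * (4 * real n / real d)))"
      using ab C1(1) finI(2) by (intro sum_mono mult_left_mono) auto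
    also have "\<dots> = (4 * C1) * ((b - a + 1) * (real n * (\<Sum>d=1..n. 1 / real d)))"
      by (simp add: sum_distrib_left mult_ac)
    also have "\<dots> \<le> C * ((b - a + 1) * (real n * (1 + ln (real n))))"
      using C1(1) ab n sum_inverse_le_ln[OF n] by (intro mult_mono mult_left_mono) (auto simp: C_def sum_nonneg)
    finally show ?thesis by (simp add: \<delta>_def)
  qed
  moreover have "0 \<le> C" by (simp add: C_def)
  ultimately show ?thesis using that by blast
qed

subsection \<open>Erdos-Turan type inequalities\<close>

lemma fejer_shift_int: "fejer m (x + of_int k) = fejer m x"
proof -
  have "ee (of_nat j * (x + of_int k)) = ee (of_nat j * x)" for j :: nat
  proof -
    have "ee (of_nat j * (x + of_int k)) = ee (of_nat j * x + of_int (int j * k))" by (simp add: distrib_left)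
    also have "\<dots> = ee (of_nat j * x)" unfolding ee_add ee_of_int by simp
    finally show ?thesis .
  qed
  then show ?thesis by (simp add: fejer_def)
qed

lemma fejer_minus: "fejer m (- x) = fejer m x"
proof -
  have "(\<Sum>j<m. ee (of_nat j * (- x))) = cnj (\<Sum>j<m. ee (of_nat j * x))" by (simp add: cnj_ee)
  then show ?thesis unfolding fejer_def by (simp only: complex_mod_cnj)
qed

lemma fejer_lower:
  assumes m: "0 < m" and t: "\<bar>t\<bar> \<le> 1 / (2 * real m)"
  shows "(real m)\<^sup>2 / 4 \<le> fejer m t"
proof (cases "t = 0")
  case False
  have "\<bar>real m * t\<bar> \<le> 1/2" using m t by (simp add: abs_mult field_simps)
  then have "2 * \<bar>real m * t\<bar> \<le> \<bar>sin (pi * (real m * t))\<bar>" by (rule sin_ge_Jordan)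
  then have "(2 * \<bar>real m * t\<bar>)\<^sup>2 \<le> \<bar>sin (pi * (real m * t))\<bar>\<^sup>2" by (intro power_mono) auto
  also have "\<dots> = fejer m t * (sin (pi * t))\<^sup>2" by (simp add: fejer_sin)
  also have "\<dots> \<le> fejer m t * (4 * t)\<^sup>2"
  proof (intro mult_left_mono)
    have "\<bar>sin (pi * t)\<bar> \<le> \<bar>pi * t\<bar>" by (rule abs_sin_x_le_abs_x)
    also have "\<dots> \<le> \<bar>4 * t\<bar>" using pi_less_4 by (simp add: abs_mult mult_right_mono)
    finally show "(sin (pi * t))\<^sup>2 \<le> (4 * t)\<^sup>2" by (simp only: abs_le_square_iff)
  qed simp
  finally have "((real m)\<^sup>2 / 4) * (16 * t\<^sup>2) \<le> fejer m t * (16 * t\<^sup>2)" by (simp add: power_mult_distrib)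
  then show ?thesis by (rule mult_right_le_imp_le) (use False in simp)
qed (simp add: fejer_def power2_eq_square)

lemma fejer_upper:
  assumes "\<bar>u\<bar> \<le> 1/2" "u \<noteq> 0"
  shows "fejer m u \<le> 1 / (4 * u\<^sup>2)"
proof -
  have "(2 * \<bar>u\<bar>)\<^sup>2 \<le> \<bar>sin (pi * u)\<bar>\<^sup>2" using sin_ge_Jordan[OF assms(1)] by (intro power_mono) auto
  then have "fejer m u * (2 * \<bar>u\<bar>)\<^sup>2 \<le> fejer m u * \<bar>sin (pi * u)\<bar>\<^sup>2" by (intro mult_left_mono) auto
  also have "\<dots> \<le> 1" by (simp add: fejer_sin abs_square_le_1)
  finally show ?thesis using assms(2) by (simp add: field_simps power_mult_distrib)
qed

lemma fejer_square_upper: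
  assumes "0 < u" "u < 1"
  shows "(fejer m u)\<^sup>2 \<le> (1 / 16) * (1 / u ^ 4) + (1 / 16) * (1 / (1 - u) ^ 4)"
proof (cases "u \<le> 1/2")
  case True
  have "(fejer m u)\<^sup>2 \<le> (1 / (4 * u\<^sup>2))\<^sup>2" using fejer_upper[of u m] True assms by (intro power_mono) auto
  also have "\<dots> = (1 / 16) * (1 / u ^ 4)" by (simp add: power_divide power_mult_distrib flip: power_mult)
  finally show ?thesis using assms by (smt (verit) divide_nonneg_nonneg mult_nonneg_nonneg zero_le_power)
next
  case False
  have "fejer m u = fejer m (1 - u)" using fejer_shift_int[of m "- u" 1] fejer_minus[of m u] by simp
  then have "(fejer m u)\<^sup>2 \<le> (1 / (4 * (1 - u)\<^sup>2))\<^sup>2" using fejer_upper[of "1 - u" m] False assms by (simp only:) (intro power_mono, auto)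
  also have "\<dots> = (1 / 16) * (1 / (1 - u) ^ 4)" by (simp add: power_divide power_mult_distrib flip: power_mult)
  finally show ?thesis using assms by (smt (verit) divide_nonneg_nonneg mult_nonneg_nonneg zero_le_power)
qed

text \<open>The two sines are a quarter period apart, so the two kernels have no common zero.\<close>

lemma fejer_pair_lower:
  assumes m: "0 < m"
  shows "1 / (16 * (\<bar>t\<bar> + 1 / (2 * real m))\<^sup>2) \<le> fejer m t + fejer m (t - 1 / (2 * real m))"
proof -
  define s where "s = 4 * (\<bar>t\<bar> + 1 / (2 * real m))"
  define t' where "t' = t - 1 / (2 * real m)"
  have s0: "0 < s" using m by (simp add: s_def add_nonneg_pos)
  have sb: "\<bar>sin (pi * x)\<bar> \<le> 4 * \<bar>x\<bar>" for x
  proof -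
    have "\<bar>sin (pi * x)\<bar> \<le> \<bar>pi * x\<bar>" by (rule abs_sin_x_le_abs_x)
    also have "\<dots> \<le> 4 * \<bar>x\<bar>" using pi_less_4 by (simp add: abs_mult mult_right_mono)
    finally show ?thesis .
  qed
  have "\<bar>t'\<bar> \<le> \<bar>t\<bar> + 1 / (2 * real m)" unfolding t'_def by (rule order_trans[OF abs_triangle_ineq4]) simp
  then have "\<bar>sin (pi * t)\<bar> \<le> s" "\<bar>sin (pi * t')\<bar> \<le> s" using sb[of t] sb[of t'] m unfolding s_def
    by (smt (verit) divide_nonneg_nonneg of_nat_0_le_iff)+
  then have "(sin (pi * t))\<^sup>2 \<le> s\<^sup>2" "(sin (pi * t'))\<^sup>2 \<le> s\<^sup>2"
    using s0 by (auto simp: abs_le_square_iff[symmetric])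
  then have 1: "fejer m t * (sin (pi * t))\<^sup>2 \<le> fejer m t * s\<^sup>2" "fejer m t' * (sin (pi * t'))\<^sup>2 \<le> fejer m t' * s\<^sup>2"
    by (auto intro: mult_left_mono)
  have "pi * (real m * t') = pi * (real m * t) - pi / 2" using m by (simp add: t'_def algebra_simps)
  then have "sin (pi * (real m * t')) = - cos (pi * (real m * t))" by (simp add: sin_diff)
  then have "1 = (sin (pi * (real m * t)))\<^sup>2 + (sin (pi * (real m * t')))\<^sup>2" by simp
  also have "\<dots> \<le> (fejer m t + fejer m t') * s\<^sup>2" using 1 by (simp add: fejer_sin distrib_right)
  finally have "1 / s\<^sup>2 \<le> fejer m t + fejer m t'" using s0 by (simp add: divide_le_eq)
  moreover have "s\<^sup>2 = 16 * (\<bar>t\<bar> + 1 / (2 * real m))\<^sup>2" unfolding s_def power_mult_distrib by simp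
  ultimately show ?thesis by (simp only: t'_def)
qed

section \<open>The squared Fejer kernel\<close>

definition quads :: "nat \<Rightarrow> ((nat \<times> nat) \<times> (nat \<times> nat)) set" where
  "quads m = ({..<m} \<times> {..<m}) \<times> ({..<m} \<times> {..<m})"

definition qfreq :: "(nat \<times> nat) \<times> (nat \<times> nat) \<Rightarrow> int" where
  "qfreq q = (case q of ((i, j), (k, l)) \<Rightarrow> int i - int j + (int k - int l))"

lemma finite_quads [simp]: "finite (quads m)"
  by (simp add: quads_def)

lemma of_real_fejer_square: "complex_of_real ((fejer m x)\<^sup>2) = (\<Sum>q\<in>quads m. ee (of_int (qfreq q) * x))"
proof -
  have f: "complex_of_real (fejer m x) = (\<Sum>p\<in>{..<m} \<times> {..<m}. ee (of_int (int (fst p) - int (snd p)) * x))"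
    unfolding of_real_fejer by (simp add: sum.cartesian_product split_def)
  have "complex_of_real ((fejer m x)\<^sup>2) = (\<Sum>p\<in>{..<m} \<times> {..<m}. \<Sum>p'\<in>{..<m} \<times> {..<m}. ee (of_int (int (fst p) - int (snd p)) * x) * ee (of_int (int (fst p') - int (snd p')) * x))"
    by (simp only: power2_eq_square of_real_mult f sum_product)
  also have "\<dots> = (\<Sum>p\<in>{..<m} \<times> {..<m}. \<Sum>p'\<in>{..<m} \<times> {..<m}. ee (of_int (qfreq (p, p')) * x))"
    by (intro sum.cong refl) (simp add: qfreq_def split_def distrib_right flip: ee_add)
  also have "\<dots> = (\<Sum>q\<in>quads m. ee (of_int (qfreq q) * x))"
    by (simp add: quads_def sum.cartesian_product split_def)
  finally show ?thesis .
qed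

text \<open>The additive energy of {0, ..., m - 1}, that is the number of solutions of i + k = j +
  l. As the integral of the squared kernel over a period it is the normalising factor below.\<close>

definition energy :: "nat \<Rightarrow> real" where
  "energy m = real (card {q \<in> quads m. qfreq q = 0})"

lemma integral_fejer_square: "integral {c..c + 1} (\<lambda>x. (fejer m x)\<^sup>2) = energy m"
proof -
  have "(\<lambda>x. (fejer m x)\<^sup>2) integrable_on {c..c + 1}"
    by (intro integrable_continuous_interval continuous_intros continuous_on_fejer)
  then have "complex_of_real (integral {c..c + 1} (\<lambda>x. (fejer m x)\<^sup>2)) = integral {c..c + 1} (\<lambda>x. complex_of_real ((fejer m x)\<^sup>2))"
    by (metis has_integral_of_real integrable_integral integral_unique)
  also have "\<dots> = (\<Sum>q\<in>quads m. integral {c..c + 1} (\<lambda>x. ee (of_int (qfreq q) * x)))"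
    unfolding of_real_fejer_square
    by (intro integral_sum integrable_continuous_interval continuous_intros) auto
  also have "\<dots> = (\<Sum>q\<in>quads m. if qfreq q = 0 then 1 else 0)" by (simp only: integral_ee_int)
  also have "\<dots> = complex_of_real (energy m)" by (simp add: energy_def sum.If_cases Int_def)
  finally show ?thesis by (simp only: of_real_eq_iff)
qed

text \<open>On the peak, an interval of length 1/m, the squared kernel is at least
  (m^2/4)^2.\<close>

lemma energy_ge:
  assumes m: "0 < m"
  shows "(real m) ^ 3 / 16 \<le> energy m"
proof -
  define r where "r = 1 / (2 * real m)"
  have r: "0 < r" "r \<le> 1/2" using m by (auto simp: r_def field_simps)
  have int: "(\<lambda>x. (fejer m x)\<^sup>2) integrable_on {u..v}" for u v
    by (intro integrable_continuous_interval continuous_intros continuous_on_fejer)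
  have "(real m) ^ 3 / 16 = integral {-r..r} (\<lambda>x. ((real m)\<^sup>2 / 4)\<^sup>2)"
    using m r by (simp add: r_def power2_eq_square power3_eq_cube field_simps)
  also have "\<dots> \<le> integral {-r..r} (\<lambda>x. (fejer m x)\<^sup>2)"
    using fejer_lower[OF m] by (intro integral_le int) (auto simp: r_def intro!: power_mono)
  also have "\<dots> \<le> integral {- (1/2)..- (1/2) + 1} (\<lambda>x. (fejer m x)\<^sup>2)"
    using r by (intro integral_subset_le int) auto
  also have "\<dots> = energy m" by (rule integral_fejer_square)
  finally show ?thesis .
qed

text \<open>Three of the four indices determine the fourth. Together with \<open>energy_ge\<close>
  this bounds every Fourier coefficient of the normalised squared kernel by 16.\<close>

lemma card_qfreq_le: "card {q \<in> quads m. qfreq q = h} \<le> m ^ 3"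
proof -
  have "inj_on (\<lambda>((i, j), (k, l)). (i, j, k)) {q \<in> quads m. qfreq q = h}"
    by (auto simp: inj_on_def qfreq_def)
  moreover have "(\<lambda>((i, j), (k, l)). (i, j, k)) ` {q \<in> quads m. qfreq q = h} \<subseteq> {..<m} \<times> {..<m} \<times> {..<m}"
    by (auto simp: quads_def)
  ultimately have "card {q \<in> quads m. qfreq q = h} \<le> card ({..<m} \<times> {..<m} \<times> {..<m})"
    by (rule card_inj_on_le) simp
  then show ?thesis by (simp add: power3_eq_cube)
qed

text \<open>The interval is a period with its peak removed: \<open>a\<close> and \<open>b\<close>
  are the distances to the copies of the peak at 0 and 1. \<open>fejer_square_upper\<close> is
  integrated explicitly.\<close>

lemma fejer_square_tail_one:
  assumes ab: "0 < a" "0 < b" "a + b \<le> 1"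
  shows "integral {a..1 - b} (\<lambda>x. (fejer m x)\<^sup>2) \<le> 1 / (48 * a ^ 3) + 1 / (48 * b ^ 3)"
proof -
  define G where "G x = - (1 / (48 * x ^ 3)) + 1 / (48 * (1 - x) ^ 3)" for x :: real
  have le: "a \<le> 1 - b" using ab by simp
  have "((\<lambda>u. (1 / 16) * (1 / u ^ 4) + (1 / 16) * (1 / (1 - u) ^ 4)) has_integral (G (1 - b) - G a)) {a..1 - b}"
  proof (rule fundamental_theorem_of_calculus[OF le])
    fix x assume x: "x \<in> {a..1 - b}"
    have x0: "x \<noteq> 0" "1 - x \<noteq> 0" using x ab by auto
    have "(G has_real_derivative (1 / 16) * (1 / x ^ 4) + (1 / 16) * (1 / (1 - x) ^ 4)) (at x within {a..1 - b})"
    proof -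
      have F: "((\<lambda>y. 1 / (48 * y ^ 3)) has_real_derivative - ((1 / 16) * (1 / y ^ 4))) (at y)" if "y \<noteq> 0" for y :: real
        using that by (auto intro!: derivative_eq_intros simp: field_simps eval_nat_numeral)
      have "((\<lambda>x. 1 - x) has_real_derivative -1) (at x)" by (auto intro!: derivative_eq_intros)
      from DERIV_chain2[OF F[OF x0(2)] this] DERIV_minus[OF F[OF x0(1)]]
      have "((\<lambda>x. - (1 / (48 * x ^ 3)) + 1 / (48 * (1 - x) ^ 3)) has_real_derivative - (- ((1 / 16) * (1 / x ^ 4))) + (- ((1 / 16) * (1 / (1 - x) ^ 4))) * (- 1)) (at x)"
        by (rule DERIV_add[rotated])
      moreover have "G = (\<lambda>x. - (1 / (48 * x ^ 3)) + 1 / (48 * (1 - x) ^ 3))" by (rule ext) (rule G_def)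
      ultimately have "(G has_real_derivative (1 / 16) * (1 / x ^ 4) + (1 / 16) * (1 / (1 - x) ^ 4)) (at x)"
        by (simp only: minus_minus mult_minus1_right)
      then show ?thesis by (rule has_field_derivative_at_within)
    qed
    then show "(G has_vector_derivative (1 / 16) * (1 / x ^ 4) + (1 / 16) * (1 / (1 - x) ^ 4)) (at x within {a..1 - b})"
      by (simp only: has_real_derivative_iff_has_vector_derivative)
  qed
  then have "integral {a..1 - b} (\<lambda>x. (fejer m x)\<^sup>2) \<le> G (1 - b) - G a"
  proof (rule has_integral_le[OF integrable_integral, rotated])
    show "(\<lambda>x. (fejer m x)\<^sup>2) integrable_on {a..1 - b}"
      by (intro integrable_continuous_interval continuous_intros continuous_on_fejer)
    show "(fejer m x)\<^sup>2 \<le> (1 / 16) * (1 / x ^ 4) + (1 / 16) * (1 / (1 - x) ^ 4)" if "x \<in> {a..1 - b}" for x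
      using that ab by (intro fejer_square_upper) auto
  qed
  also have "\<dots> \<le> 1 / (48 * a ^ 3) + 1 / (48 * b ^ 3)"
  proof -
    have "0 \<le> 1 / (48 * (1 - b) ^ 3)" "0 \<le> 1 / (48 * (1 - a) ^ 3)" using ab by auto
    moreover have "G (1 - b) - G a = (1 / (48 * a ^ 3) + 1 / (48 * b ^ 3)) - 1 / (48 * (1 - b) ^ 3) - 1 / (48 * (1 - a) ^ 3)"
      by (simp add: G_def)
    ultimately show ?thesis by linarith
  qed
  finally show ?thesis .
qed

text \<open>This equals 48/m^2 times the lower bound of \<open>fejer_pair_lower\<close> at |t| = a,
  so that the tail of the squared kernel can be traded for two Fejer kernels.\<close>

definition tail_fun :: "nat \<Rightarrow> real \<Rightarrow> real" where
  "tail_fun m a = 3 / (real m * a + 1/2)\<^sup>2"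

text \<open>The squared kernel decays like the fourth power, so smoothing with it costs only an error that
  is itself dominated by a Fejer kernel.\<close>

lemma fejer_square_tail:
  assumes m: "0 < m" and ab: "0 \<le> a" "0 \<le> b" "a + b \<le> 1"
  shows "integral {a..1 - b} (\<lambda>x. (fejer m x)\<^sup>2) / energy m \<le> tail_fun m a + tail_fun m b"
proof -
  have m3: "0 < (real m) ^ 3" using m by simp
  have E: "0 < energy m" using energy_ge[OF m] m3 by linarith
  have t0: "0 \<le> tail_fun m x" for x by (simp add: tail_fun_def)
  have one: "1 \<le> tail_fun m x" if "0 \<le> x" "real m * x < 1" for x
  proof -
    have "(real m * x + 1/2)\<^sup>2 \<le> (3/2)\<^sup>2" using that by (intro power_mono) auto
    also have "\<dots> \<le> 3" by (simp add: power2_eq_square)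
    finally have "(real m * x + 1/2)\<^sup>2 \<le> 3" .
    moreover have "0 < (real m * x + 1/2)\<^sup>2" using that by (intro zero_less_power add_nonneg_pos) auto
    ultimately show ?thesis unfolding tail_fun_def by (simp only: le_divide_eq) simp
  qed
  show ?thesis
  \<comment> \<open>If one end is within 1/m of the peak, the trivial bound 1 for the normalised
    integral suffices, since \<open>tail_fun\<close> is at least 1 there.\<close>
  proof (cases "real m * a < 1 \<or> real m * b < 1")
    case True
    have "integral {a..1 - b} (\<lambda>x. (fejer m x)\<^sup>2) \<le> integral {0..0 + 1} (\<lambda>x. (fejer m x)\<^sup>2)"
      using ab by (intro integral_subset_le integrable_continuous_interval continuous_intros continuous_on_fejer) auto
    also have "\<dots> = energy m" by (rule integral_fejer_square)
    finally have "integral {a..1 - b} (\<lambda>x. (fejer m x)\<^sup>2) / energy m \<le> 1" using E by simp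
    moreover have "1 \<le> tail_fun m a + tail_fun m b" using True one[of a] one[of b] t0[of a] t0[of b] ab by linarith
    ultimately show ?thesis by linarith
  next
    case False
    have big: "1 / (48 * x ^ 3) / ((real m) ^ 3 / 16) \<le> tail_fun m x" if x: "1 \<le> real m * x" "0 < x" for x
    proof -
      define z where "z = real m * x"
      have z: "1 \<le> z" using x by (simp add: z_def)
      have "1 / (48 * x ^ 3) / ((real m) ^ 3 / 16) = 1 / (3 * z ^ 3)" using x m by (simp add: z_def power_mult_distrib)
      also have "\<dots> \<le> 1 / (3 * z\<^sup>2)"
        using z power_increasing[of 2 3 z] by (intro divide_left_mono mult_pos_pos) auto
      also have "\<dots> \<le> 3 / (z + 1/2)\<^sup>2"
      proof -
        have "(z + 1/2)\<^sup>2 \<le> (3 * z)\<^sup>2" using z by (intro power_mono) auto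
        then show ?thesis using z by (simp add: field_simps power_mult_distrib)
      qed
      finally show ?thesis by (simp add: tail_fun_def z_def)
    qed
    have pos: "0 < a" "0 < b" using False ab m by (auto simp: le_less)
    have "integral {a..1 - b} (\<lambda>x. (fejer m x)\<^sup>2) / energy m \<le> (1 / (48 * a ^ 3) + 1 / (48 * b ^ 3)) / ((real m) ^ 3 / 16)"
      using fejer_square_tail_one[OF pos ab(3), of m] energy_ge[OF m] m3 pos by (intro frac_le) auto
    also have "\<dots> \<le> tail_fun m a + tail_fun m b"
      unfolding add_divide_distrib[of _ _ "(real m) ^ 3 / 16"] using False pos by (intro add_mono big) auto
    finally show ?thesis .
  qed
qed

lemma integral_fejer_square_shift:
  "integral {u..v} (\<lambda>t. (fejer m (y - t))\<^sup>2) = integral {u - y..v - y} (\<lambda>x. (fejer m x)\<^sup>2)"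
proof -
  have "fejer m (y - t) = fejer m (t + (- y))" for t using fejer_minus[of m "t - y"] by simp
  then show ?thesis
    using Henstock_Kurzweil_Integration.integral_shift_real_ivl[of "u - y" "- y" "v - y" "\<lambda>x. (fejer m x)\<^sup>2"] by simp
qed

definition smooth_ind :: "nat \<Rightarrow> real \<Rightarrow> real \<Rightarrow> real \<Rightarrow> real" where
  "smooth_ind m \<alpha> \<beta> y = integral {\<alpha>..\<beta>} (\<lambda>t. (fejer m (y - t))\<^sup>2) / energy m"

definition fejer_pair :: "nat \<Rightarrow> real \<Rightarrow> real" where
  "fejer_pair m t = fejer m t + fejer m (t - 1 / (2 * real m))"

lemma energy_pos:
  assumes "0 < m"
  shows "0 < energy m"
proof -
  have "0 < (real m) ^ 3" using assms by simp
  then show ?thesis using energy_ge[OF assms] by linarith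
qed

lemma smooth_ind_shift: "smooth_ind m \<alpha> \<beta> (y + of_int k) = smooth_ind m \<alpha> \<beta> y"
proof -
  have "fejer m (y + of_int k - t) = fejer m (y - t)" for t
    using fejer_shift_int[of m "y - t" k] by (simp add: algebra_simps)
  then show ?thesis by (simp add: smooth_ind_def)
qed

lemma fejer_pair_shift: "fejer_pair m (y + of_int k - c) = fejer_pair m (y - c)"
  using fejer_shift_int[of m "y - c" k] fejer_shift_int[of m "y - c - 1 / (2 * real m)" k]
  by (simp add: fejer_pair_def algebra_simps)

lemma tail_fun_le:
  assumes m: "0 < m" and a: "a = \<bar>t\<bar>"
  shows "tail_fun m a \<le> 48 / (real m)\<^sup>2 * fejer_pair m t"
proof -
  have "tail_fun m a = 48 / (real m)\<^sup>2 * (1 / (16 * (\<bar>t\<bar> + 1 / (2 * real m))\<^sup>2))"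
  proof -
    have "real m * a + 1/2 = real m * (\<bar>t\<bar> + 1 / (2 * real m))" using m by (simp add: a distrib_left)
    then show ?thesis by (simp add: tail_fun_def power_mult_distrib)
  qed
  also have "\<dots> \<le> 48 / (real m)\<^sup>2 * fejer_pair m t"
    unfolding fejer_pair_def by (intro mult_left_mono fejer_pair_lower m) simp
  finally show ?thesis .
qed

text \<open>The error is the normalised kernel mass on an arc that avoids the peak. Whether the
  point is inside or outside the interval, after an integer shift the arc has the form [a, 1 - b]
  with a and b the distances to the two end points.\<close>

lemma smooth_ind_error:
  assumes m: "0 < m" and ab: "\<alpha> < \<beta>" "\<beta> < \<alpha> + 1"
  shows "\<bar>(if in_interval_mod1 \<alpha> \<beta> x then 1 else 0) - smooth_ind m \<alpha> \<beta> x\<bar>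
    \<le> 48 / (real m)\<^sup>2 * (fejer_pair m (x - \<alpha>) + fejer_pair m (x - \<beta>))"
proof -
  have E: "0 < energy m" using m by (rule energy_pos)
  have int: "(\<lambda>x. (fejer m x)\<^sup>2) integrable_on {u..v}" for u v
    by (intro integrable_continuous_interval continuous_intros continuous_on_fejer)
  have nn: "0 \<le> integral {u..v} (\<lambda>x. (fejer m x)\<^sup>2)" for u v by (intro integral_nonneg int) simp
  show ?thesis
  proof (cases "in_interval_mod1 \<alpha> \<beta> x")
    case True
    then obtain k :: int where k: "\<alpha> < x + of_int k" "x + of_int k < \<beta>" by (auto simp: in_interval_mod1_def)
    define y where "y = x + of_int k"
    define a b where "a = \<beta> - y" and "b = y - \<alpha>"
    have pos: "0 \<le> a" "0 \<le> b" "a + b \<le> 1" using k ab by (auto simp: a_def b_def y_def)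
    have "integral {\<alpha> - y..\<beta> - y} (\<lambda>x. (fejer m x)\<^sup>2) + integral {\<beta> - y..\<alpha> - y + 1} (\<lambda>x. (fejer m x)\<^sup>2) = integral {\<alpha> - y..\<alpha> - y + 1} (\<lambda>x. (fejer m x)\<^sup>2)"
      using ab by (intro Henstock_Kurzweil_Integration.integral_combine int) auto
    also have "\<dots> = energy m" by (rule integral_fejer_square)
    finally have "1 - smooth_ind m \<alpha> \<beta> y = integral {\<beta> - y..\<alpha> - y + 1} (\<lambda>x. (fejer m x)\<^sup>2) / energy m"
      using E unfolding smooth_ind_def integral_fejer_square_shift by (simp add: field_simps)
    also have "{\<beta> - y..\<alpha> - y + 1} = {a..1 - b}" by (auto simp: a_def b_def)
    finally have e: "1 - smooth_ind m \<alpha> \<beta> x = integral {a..1 - b} (\<lambda>x. (fejer m x)\<^sup>2) / energy m"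
      by (simp add: y_def smooth_ind_shift)
    have "\<bar>1 - smooth_ind m \<alpha> \<beta> x\<bar> = integral {a..1 - b} (\<lambda>x. (fejer m x)\<^sup>2) / energy m" unfolding e using E nn by simp
    also have "\<dots> \<le> tail_fun m a + tail_fun m b" by (rule fejer_square_tail[OF m pos])
    also have "\<dots> \<le> 48 / (real m)\<^sup>2 * fejer_pair m (y - \<beta>) + 48 / (real m)\<^sup>2 * fejer_pair m (y - \<alpha>)"
      using pos by (intro add_mono tail_fun_le m) (auto simp: a_def b_def)
    finally show ?thesis using True unfolding y_def fejer_pair_shift by (simp add: distrib_left)
  next
    case False
    \<comment> \<open>The shift puts y into (\<alpha> - 1, \<alpha>]. As y + 1 lies outside the open
      interval and beyond \<alpha>, it is at least \<beta>.\<close>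
    define y where "y = x + of_int (- \<lceil>x - \<alpha>\<rceil>)"
    define a b where "a = \<alpha> - y" and "b = y + 1 - \<beta>"
    have y: "\<alpha> - 1 < y" "y \<le> \<alpha>" unfolding y_def by linarith+
    have "\<not> (\<alpha> < x + of_int (1 - \<lceil>x - \<alpha>\<rceil>) \<and> x + of_int (1 - \<lceil>x - \<alpha>\<rceil>) < \<beta>)" using False unfolding in_interval_mod1_def greaterThanLessThan_iff by blast
    then have "\<beta> \<le> y + 1" using y unfolding y_def by auto
    then have pos: "0 \<le> a" "0 \<le> b" "a + b \<le> 1" using y ab by (auto simp: a_def b_def)
    have "smooth_ind m \<alpha> \<beta> y = integral {\<alpha> - y..\<beta> - y} (\<lambda>x. (fejer m x)\<^sup>2) / energy m"
      unfolding smooth_ind_def integral_fejer_square_shift ..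
    also have "{\<alpha> - y..\<beta> - y} = {a..1 - b}" by (auto simp: a_def b_def)
    finally have e: "smooth_ind m \<alpha> \<beta> x = integral {a..1 - b} (\<lambda>x. (fejer m x)\<^sup>2) / energy m"
      unfolding y_def smooth_ind_shift .
    have "\<bar>0 - smooth_ind m \<alpha> \<beta> x\<bar> = integral {a..1 - b} (\<lambda>x. (fejer m x)\<^sup>2) / energy m" unfolding e using E nn by simp
    also have "\<dots> \<le> tail_fun m a + tail_fun m b" by (rule fejer_square_tail[OF m pos])
    also have "\<dots> \<le> 48 / (real m)\<^sup>2 * fejer_pair m (y - \<alpha>) + 48 / (real m)\<^sup>2 * fejer_pair m (y + of_int 1 - \<beta>)"
      using pos by (intro add_mono tail_fun_le m) (auto simp: a_def b_def)
    finally show ?thesis using False unfolding fejer_pair_shift unfolding y_def fejer_pair_shift by (simp add: distrib_left)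
  qed
qed

section \<open>Weyl sums of a finite family and the discrepancy bound\<close>

locale finite_points =
  fixes P :: "'i set" and x :: "'i \<Rightarrow> real"
  assumes fin: "finite P"
begin

definition weyl :: "nat \<Rightarrow> real" where
  "weyl h = norm (\<Sum>p\<in>P. ee (real h * x p))"

lemma weyl_nonneg [simp]: "0 \<le> weyl h"
  by (simp add: weyl_def)

lemma weyl_0: "weyl 0 = real (card P)"
  by (simp add: weyl_def)

lemma norm_int_freq: "norm (\<Sum>p\<in>P. ee (of_int h * x p)) = weyl (nat \<bar>h\<bar>)"
proof (cases "0 \<le> h")
  case True
  then show ?thesis by (simp add: weyl_def)
next
  case False
  have "(\<Sum>p\<in>P. ee (of_int h * x p)) = cnj (\<Sum>p\<in>P. ee (real (nat \<bar>h\<bar>) * x p))"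
    using False by (simp add: cnj_ee)
  then show ?thesis unfolding weyl_def by (simp only: complex_mod_cnj)
qed

text \<open>For fixed i each difference h = |i - j| > 0 occurs for at most two values of j, and the
  difference 0 yields the number of points.\<close>

lemma sum_fejer_le:
  assumes m: "0 < m"
  shows "(\<Sum>p\<in>P. fejer m (x p - c)) \<le> real m * real (card P) + 2 * real m * (\<Sum>h\<in>{1..<m}. weyl h)"
proof -
  have "complex_of_real (\<Sum>p\<in>P. fejer m (x p - c)) = (\<Sum>p\<in>P. \<Sum>i<m. \<Sum>j<m. ee (of_int (int i - int j) * (x p - c)))"
    by (simp only: of_real_sum of_real_fejer)
  also have "\<dots> = (\<Sum>i<m. \<Sum>p\<in>P. \<Sum>j<m. ee (of_int (int i - int j) * (x p - c)))"
    by (rule sum.swap)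
  also have "\<dots> = (\<Sum>i<m. \<Sum>j<m. \<Sum>p\<in>P. ee (of_int (int i - int j) * (x p - c)))"
    by (intro sum.cong refl sum.swap)
  also have "\<dots> = (\<Sum>i<m. \<Sum>j<m. ee (- (of_int (int i - int j) * c)) * (\<Sum>p\<in>P. ee (of_int (int i - int j) * x p)))"
    by (intro sum.cong refl) (simp add: sum_distrib_left right_diff_distrib flip: ee_add)
  finally have "norm (complex_of_real (\<Sum>p\<in>P. fejer m (x p - c))) = norm (\<Sum>i<m. \<Sum>j<m. ee (- (of_int (int i - int j) * c)) * (\<Sum>p\<in>P. ee (of_int (int i - int j) * x p)))"
    by simp
  also have "\<dots> \<le> (\<Sum>i<m. \<Sum>j<m. weyl (nat \<bar>int i - int j\<bar>))"
    by (intro sum_norm_le) (simp only: norm_mult norm_ee mult_1_left norm_int_freq order_refl)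
  also have "\<dots> \<le> (\<Sum>i<m. real (card P) + 2 * (\<Sum>h\<in>{1..<m}. weyl h))"
  proof (intro sum_mono)
    fix i assume i: "i \<in> {..<m}"
    have "(\<Sum>j<m. weyl (nat \<bar>int i - int j\<bar>)) = weyl 0 + (\<Sum>j\<in>{..<m} - {i}. weyl (nat \<bar>int i - int j\<bar>))"
      using i by (subst sum.remove[of _ i]) auto
    also have "(\<Sum>j\<in>{..<m} - {i}. weyl (nat \<bar>int i - int j\<bar>)) = (\<Sum>h\<in>{1..<m}. \<Sum>j\<in>{j \<in> {..<m} - {i}. nat \<bar>int i - int j\<bar> = h}. weyl (nat \<bar>int i - int j\<bar>))"
      using i by (intro sum.group[symmetric]) auto
    also have "\<dots> \<le> (\<Sum>h\<in>{1..<m}. 2 * weyl h)"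
    proof (intro sum_mono)
      fix h
      have "(\<Sum>j\<in>{j \<in> {..<m} - {i}. nat \<bar>int i - int j\<bar> = h}. weyl (nat \<bar>int i - int j\<bar>)) = real (card {j \<in> {..<m} - {i}. nat \<bar>int i - int j\<bar> = h}) * weyl h"
        by simp
      also have "\<dots> \<le> 2 * weyl h"
      proof (rule mult_right_mono)
        have "{j \<in> {..<m} - {i}. nat \<bar>int i - int j\<bar> = h} \<subseteq> {i - h, i + h}" by auto
        then have "card {j \<in> {..<m} - {i}. nat \<bar>int i - int j\<bar> = h} \<le> card {i - h, i + h}" by (intro card_mono) auto
        also have "\<dots> \<le> 2" by (simp add: card_insert_if)
        finally show "real (card {j \<in> {..<m} - {i}. nat \<bar>int i - int j\<bar> = h}) \<le> 2" by simp
      qed simp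
      finally show "(\<Sum>j\<in>{j \<in> {..<m} - {i}. nat \<bar>int i - int j\<bar> = h}. weyl (nat \<bar>int i - int j\<bar>)) \<le> 2 * weyl h" .
    qed
    finally show "(\<Sum>j<m. weyl (nat \<bar>int i - int j\<bar>)) \<le> real (card P) + 2 * (\<Sum>h\<in>{1..<m}. weyl h)"
      by (simp add: weyl_0 sum_distrib_left)
  qed
  also have "\<dots> = real m * real (card P) + 2 * real m * (\<Sum>h\<in>{1..<m}. weyl h)"
    by (simp add: algebra_simps)
  finally show ?thesis unfolding norm_of_real by (rule order_trans[OF abs_ge_self])
qed

text \<open>Points within 1/(2 m) of an integer sit on the peak of the kernel, where it is at least
  m^2/4, so the Fejer sum over all points dominates their number.\<close>

lemma near_zero_count:
  assumes m: "0 < m"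
  shows "real (card {p \<in> P. int_dist (x p) \<le> 1 / (2 * real m)}) \<le> 4 / real m * (real (card P) + 2 * (\<Sum>h\<in>{1..<m}. weyl h))"
proof -
  define A where "A = {p \<in> P. int_dist (x p) \<le> 1 / (2 * real m)}"
  have "real (card A) * ((real m)\<^sup>2 / 4) = (\<Sum>p\<in>A. (real m)\<^sup>2 / 4)" by simp
  also have "\<dots> \<le> (\<Sum>p\<in>A. fejer m (x p - 0))"
  proof (intro sum_mono)
    fix p assume p: "p \<in> A"
    have "(real m)\<^sup>2 / 4 \<le> fejer m (x p + of_int (- round (x p)))"
      using p by (intro fejer_lower m) (simp add: A_def int_dist_def)
    then show "(real m)\<^sup>2 / 4 \<le> fejer m (x p - 0)" unfolding fejer_shift_int by simp
  qed
  also have "\<dots> \<le> (\<Sum>p\<in>P. fejer m (x p - 0))" using fin by (intro sum_mono2) (auto simp: A_def)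
  also have "\<dots> \<le> real m * real (card P) + 2 * real m * (\<Sum>h\<in>{1..<m}. weyl h)" by (rule sum_fejer_le[OF m])
  finally have "real (card A) \<le> (real m * real (card P) + 2 * real m * (\<Sum>h\<in>{1..<m}. weyl h)) / ((real m)\<^sup>2 / 4)"
    using m by (simp add: le_divide_eq)
  also have "\<dots> = 4 / real m * (real (card P) + 2 * (\<Sum>h\<in>{1..<m}. weyl h))"
    using m by (simp add: field_simps power2_eq_square)
  finally show ?thesis by (simp add: A_def)
qed

text \<open>A frequency h carries the integral of e(-h t) over the interval, at most min(\<beta> -
  \<alpha>, 1/|h|) in modulus, times the number of quadruples with that frequency. This number is at
  most m^3 against an energy of at least m^3/16; the two signs of h double the quotient to
  32.\<close>

lemma sum_smooth_ind:
  assumes m: "0 < m" and ab: "\<alpha> < \<beta>"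
  shows "\<bar>(\<Sum>p\<in>P. smooth_ind m \<alpha> \<beta> (x p)) - (\<beta> - \<alpha>) * real (card P)\<bar>
    \<le> 32 * (\<Sum>h\<in>{1..<2 * m}. min (\<beta> - \<alpha>) (1 / real h) * weyl h)"
proof -
  define c where "c h = integral {\<alpha>..\<beta>} (\<lambda>t. ee (of_int (- h) * t))" for h
  define S where "S h = (\<Sum>p\<in>P. ee (of_int h * x p))" for h
  define w where "w h = min (\<beta> - \<alpha>) (1 / real h) * weyl h" for h
  have E: "0 < energy m" using m by (rule energy_pos)
  have w0: "0 \<le> w h" for h using ab by (simp add: w_def)
  have int: "(\<lambda>t. ee (of_int h * t)) integrable_on {\<alpha>..\<beta>}" for h
    by (intro integrable_continuous_interval continuous_intros)
  have c0: "c 0 = complex_of_real (\<beta> - \<alpha>)" using ab by (simp add: c_def scaleR_conv_of_real)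
  have c1: "norm (c h) \<le> \<beta> - \<alpha>" for h
    using norm_integral_le_length[OF less_imp_le[OF ab] int[of "- h"], of 1] by (simp add: c_def)
  have c2: "norm (c h) \<le> 1 / real (nat \<bar>h\<bar>)" if "h \<noteq> 0" for h
  proof -
    have "norm (c h) \<le> 1 / (pi * of_int \<bar>h\<bar>)"
      unfolding c_def
    proof (rule first_derivative_test[where F' = "\<lambda>_. of_int (- h)" and F'' = "\<lambda>_. 0"])
      show "((\<lambda>t. of_int (- h) * t) has_real_derivative of_int (- h)) (at y)" for y by (rule DERIV_cmult_Id)
    qed (use ab that in auto)
    also have "\<dots> \<le> 1 / (1 * of_int \<bar>h\<bar>)"
      using that pi_ge_two by (intro divide_left_mono mult_right_mono mult_pos_pos) auto
    finally show ?thesis by simp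
  qed
  have cw: "norm (c h * S h) \<le> w (nat \<bar>h\<bar>)" if "h \<noteq> 0" for h
    unfolding norm_mult S_def norm_int_freq w_def using c1[of h] c2[OF that] by (intro mult_right_mono) auto
  have "complex_of_real (energy m * (\<Sum>p\<in>P. smooth_ind m \<alpha> \<beta> (x p))) = (\<Sum>p\<in>P. complex_of_real (integral {\<alpha>..\<beta>} (\<lambda>t. (fejer m (x p - t))\<^sup>2)))"
    using E by (simp add: smooth_ind_def sum_distrib_left)
  also have "\<dots> = (\<Sum>p\<in>P. \<Sum>q\<in>quads m. c (qfreq q) * ee (of_int (qfreq q) * x p))"
  proof (intro sum.cong refl)
    fix p
    have "(\<lambda>t. (fejer m (x p - t))\<^sup>2) integrable_on {\<alpha>..\<beta>}"
      by (intro integrable_continuous_interval continuous_intros continuous_on_compose2[OF continuous_on_fejer[of UNIV]]) auto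
    then have "complex_of_real (integral {\<alpha>..\<beta>} (\<lambda>t. (fejer m (x p - t))\<^sup>2)) = integral {\<alpha>..\<beta>} (\<lambda>t. complex_of_real ((fejer m (x p - t))\<^sup>2))"
      by (metis has_integral_of_real integrable_integral integral_unique)
    also have "\<dots> = integral {\<alpha>..\<beta>} (\<lambda>t. \<Sum>q\<in>quads m. ee (of_int (- qfreq q) * t) * ee (of_int (qfreq q) * x p))"
      unfolding of_real_fejer_square ee_add[symmetric] by (simp add: algebra_simps)
    also have "\<dots> = (\<Sum>q\<in>quads m. integral {\<alpha>..\<beta>} (\<lambda>t. ee (of_int (- qfreq q) * t) * ee (of_int (qfreq q) * x p)))"
      by (intro integral_sum integrable_continuous_interval continuous_intros) auto
    also have "\<dots> = (\<Sum>q\<in>quads m. c (qfreq q) * ee (of_int (qfreq q) * x p))"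
      unfolding c_def by (intro sum.cong refl Henstock_Kurzweil_Integration.integral_mult_left)
    finally show "complex_of_real (integral {\<alpha>..\<beta>} (\<lambda>t. (fejer m (x p - t))\<^sup>2)) = (\<Sum>q\<in>quads m. c (qfreq q) * ee (of_int (qfreq q) * x p))" .
  qed
  also have "\<dots> = (\<Sum>q\<in>quads m. c (qfreq q) * S (qfreq q))"
    by (subst sum.swap) (simp add: S_def sum_distrib_left)
  also have "\<dots> = (\<Sum>q\<in>{q \<in> quads m. qfreq q = 0}. c (qfreq q) * S (qfreq q)) + (\<Sum>q\<in>{q \<in> quads m. qfreq q \<noteq> 0}. c (qfreq q) * S (qfreq q))"
    by (subst sum.union_disjoint[symmetric]) (auto intro!: sum.cong)
  also have "(\<Sum>q\<in>{q \<in> quads m. qfreq q = 0}. c (qfreq q) * S (qfreq q)) = complex_of_real (energy m * ((\<beta> - \<alpha>) * real (card P)))"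
    by (simp add: c0 S_def energy_def)
  finally have eq: "complex_of_real (energy m * (\<Sum>p\<in>P. smooth_ind m \<alpha> \<beta> (x p))) = complex_of_real (energy m * ((\<beta> - \<alpha>) * real (card P)))
     + (\<Sum>q\<in>{q \<in> quads m. qfreq q \<noteq> 0}. c (qfreq q) * S (qfreq q))" .
  have "complex_of_real (energy m * ((\<Sum>p\<in>P. smooth_ind m \<alpha> \<beta> (x p)) - (\<beta> - \<alpha>) * real (card P)))
     = complex_of_real (energy m * (\<Sum>p\<in>P. smooth_ind m \<alpha> \<beta> (x p))) - complex_of_real (energy m * ((\<beta> - \<alpha>) * real (card P)))"
    by (simp only: right_diff_distrib of_real_diff)
  also have "\<dots> = (\<Sum>q\<in>{q \<in> quads m. qfreq q \<noteq> 0}. c (qfreq q) * S (qfreq q))" unfolding eq by simp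
  finally have "norm (complex_of_real (energy m * ((\<Sum>p\<in>P. smooth_ind m \<alpha> \<beta> (x p)) - (\<beta> - \<alpha>) * real (card P)))) = norm (\<Sum>q\<in>{q \<in> quads m. qfreq q \<noteq> 0}. c (qfreq q) * S (qfreq q))"
    by simp
  then have "energy m * \<bar>(\<Sum>p\<in>P. smooth_ind m \<alpha> \<beta> (x p)) - (\<beta> - \<alpha>) * real (card P)\<bar> = norm (\<Sum>q\<in>{q \<in> quads m. qfreq q \<noteq> 0}. c (qfreq q) * S (qfreq q))"
    using E by (simp only: norm_of_real abs_mult abs_of_pos)
  also have "\<dots> \<le> (\<Sum>q\<in>{q \<in> quads m. qfreq q \<noteq> 0}. w (nat \<bar>qfreq q\<bar>))"
    by (intro sum_norm_le cw) auto
  also have "\<dots> = (\<Sum>h\<in>{1..<2 * m}. \<Sum>q\<in>{q \<in> {q \<in> quads m. qfreq q \<noteq> 0}. nat \<bar>qfreq q\<bar> = h}. w (nat \<bar>qfreq q\<bar>))"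
    by (intro sum.group[symmetric]) (auto simp: quads_def qfreq_def)
  also have "\<dots> \<le> (\<Sum>h\<in>{1..<2 * m}. 2 * (real m) ^ 3 * w h)"
  proof (intro sum_mono)
    fix h
    have "(\<Sum>q\<in>{q \<in> {q \<in> quads m. qfreq q \<noteq> 0}. nat \<bar>qfreq q\<bar> = h}. w (nat \<bar>qfreq q\<bar>)) = real (card {q \<in> {q \<in> quads m. qfreq q \<noteq> 0}. nat \<bar>qfreq q\<bar> = h}) * w h"
      by simp
    also have "\<dots> \<le> (2 * (real m) ^ 3) * w h"
    proof (rule mult_right_mono[OF _ w0])
      have "{q \<in> {q \<in> quads m. qfreq q \<noteq> 0}. nat \<bar>qfreq q\<bar> = h} \<subseteq> {q \<in> quads m. qfreq q = int h} \<union> {q \<in> quads m. qfreq q = - int h}"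
        by auto
      then have "card {q \<in> {q \<in> quads m. qfreq q \<noteq> 0}. nat \<bar>qfreq q\<bar> = h} \<le> card ({q \<in> quads m. qfreq q = int h} \<union> {q \<in> quads m. qfreq q = - int h})"
        by (intro card_mono) auto
      also have "\<dots> \<le> card {q \<in> quads m. qfreq q = int h} + card {q \<in> quads m. qfreq q = - int h}" by (rule card_Un_le)
      also have "\<dots> \<le> m ^ 3 + m ^ 3" by (intro add_mono card_qfreq_le)
      finally have "real (card {q \<in> {q \<in> quads m. qfreq q \<noteq> 0}. nat \<bar>qfreq q\<bar> = h}) \<le> real (m ^ 3 + m ^ 3)" by (simp only: of_nat_le_iff)
      then show "real (card {q \<in> {q \<in> quads m. qfreq q \<noteq> 0}. nat \<bar>qfreq q\<bar> = h}) \<le> 2 * (real m) ^ 3" by simp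
    qed
    finally show "(\<Sum>q\<in>{q \<in> {q \<in> quads m. qfreq q \<noteq> 0}. nat \<bar>qfreq q\<bar> = h}. w (nat \<bar>qfreq q\<bar>)) \<le> 2 * (real m) ^ 3 * w h" .
  qed
  also have "\<dots> = ((real m) ^ 3 / 16) * (32 * (\<Sum>h\<in>{1..<2 * m}. w h))" by (simp add: sum_distrib_left mult_ac)
  also have "\<dots> \<le> energy m * (32 * (\<Sum>h\<in>{1..<2 * m}. w h))"
    using w0 by (intro mult_right_mono energy_ge m) (simp add: sum_nonneg)
  finally show ?thesis using E by (simp add: w_def)
qed

text \<open>The smoothed count is compared with the expected one, and the smoothing error is bounded
  by four Fejer sums with weight 48/m^2. Keeping the minimum with \<beta> - \<alpha> in the weights
  is what later produces the factor sqrt (\<beta> - \<alpha>).\<close>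

theorem discrepancy_le:
  assumes m: "0 < m" and ab: "\<alpha> < \<beta>" "\<beta> < \<alpha> + 1"
  shows "\<bar>real (card {p \<in> P. in_interval_mod1 \<alpha> \<beta> (x p)}) - (\<beta> - \<alpha>) * real (card P)\<bar>
    \<le> 400 * (real (card P) / real m + (\<Sum>h\<in>{1..<2 * m}. (min (\<beta> - \<alpha>) (1 / real h) + 1 / real m) * weyl h))"
proof -
  define ind where "ind y = (if in_interval_mod1 \<alpha> \<beta> y then 1 else 0 :: real)" for y
  define A where "A = (\<Sum>h\<in>{1..<2 * m}. weyl h)"
  define A' where "A' = (\<Sum>h\<in>{1..<2 * m}. min (\<beta> - \<alpha>) (1 / real h) * weyl h)"
  define N where "N = real (card P)"
  have nn: "0 \<le> A" "0 \<le> A'" "0 \<le> N" using ab by (auto simp: A_def A'_def N_def sum_nonneg)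
  have m1: "(\<Sum>h\<in>{1..<m}. weyl h) \<le> A" unfolding A_def by (intro sum_mono2) auto
  have card_eq: "real (card {p \<in> P. in_interval_mod1 \<alpha> \<beta> (x p)}) = (\<Sum>p\<in>P. ind (x p))"
    using fin by (simp add: ind_def sum.If_cases Int_def)
  have "\<bar>(\<Sum>p\<in>P. ind (x p)) - (\<Sum>p\<in>P. smooth_ind m \<alpha> \<beta> (x p))\<bar> \<le> (\<Sum>p\<in>P. 48 / (real m)\<^sup>2 * (fejer_pair m (x p - \<alpha>) + fejer_pair m (x p - \<beta>)))"
    unfolding sum_subtractf[symmetric] ind_def by (intro sum_abs[THEN order_trans] sum_mono smooth_ind_error m ab)
  also have "\<dots> = 48 / (real m)\<^sup>2 * ((\<Sum>p\<in>P. fejer m (x p - \<alpha>)) + (\<Sum>p\<in>P. fejer m (x p - (\<alpha> + 1 / (2 * real m)))) + ((\<Sum>p\<in>P. fejer m (x p - \<beta>)) + (\<Sum>p\<in>P. fejer m (x p - (\<beta> + 1 / (2 * real m))))))"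
    by (simp only: fejer_pair_def diff_diff_eq sum_distrib_left[symmetric] sum.distrib)
  also have "\<dots> \<le> 48 / (real m)\<^sup>2 * ((real m * N + 2 * real m * A) + (real m * N + 2 * real m * A) + ((real m * N + 2 * real m * A) + (real m * N + 2 * real m * A)))"
  proof (intro mult_left_mono add_mono)
    have "(\<Sum>p\<in>P. fejer m (x p - c)) \<le> real m * N + 2 * real m * A" for c
      using sum_fejer_le[OF m, of c] mult_left_mono[OF m1, of "2 * real m"] by (simp add: N_def)
    then show "(\<Sum>p\<in>P. fejer m (x p - \<alpha>)) \<le> real m * N + 2 * real m * A" "(\<Sum>p\<in>P. fejer m (x p - (\<alpha> + 1 / (2 * real m)))) \<le> real m * N + 2 * real m * A"
      "(\<Sum>p\<in>P. fejer m (x p - \<beta>)) \<le> real m * N + 2 * real m * A" "(\<Sum>p\<in>P. fejer m (x p - (\<beta> + 1 / (2 * real m)))) \<le> real m * N + 2 * real m * A" by blast+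
  qed simp
  also have "\<dots> = 192 * (N / real m) + 384 * (A / real m)" using m by (simp add: field_simps power2_eq_square)
  finally have 1: "\<bar>(\<Sum>p\<in>P. ind (x p)) - (\<Sum>p\<in>P. smooth_ind m \<alpha> \<beta> (x p))\<bar> \<le> 192 * (N / real m) + 384 * (A / real m)" .
  have 2: "\<bar>(\<Sum>p\<in>P. smooth_ind m \<alpha> \<beta> (x p)) - (\<beta> - \<alpha>) * N\<bar> \<le> 32 * A'"
    using sum_smooth_ind[OF m ab(1)] by (simp add: N_def A'_def)
  have "\<bar>(\<Sum>p\<in>P. ind (x p)) - (\<beta> - \<alpha>) * N\<bar> \<le> 400 * (N / real m + (A' + A / real m))"
 
  proof -
    have gen: "\<bar>a - d\<bar> \<le> 400 * (u + (w + v))" if "\<bar>a - c\<bar> \<le> 192 * u + 384 * v" "\<bar>c - d\<bar> \<le> 32 * w" "0 \<le> u" "0 \<le> v" "0 \<le> w"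
      for a c d u v w :: real
    proof -
      have "\<bar>a - d\<bar> \<le> \<bar>a - c\<bar> + \<bar>c - d\<bar>" using abs_triangle_ineq[of "a - c" "c - d"] by simp
      then show ?thesis using that by (simp add: distrib_left)
    qed
    show ?thesis by (rule gen[OF 1 2]) (use nn in auto)
  qed
  moreover have "A' + A / real m = (\<Sum>h\<in>{1..<2 * m}. (min (\<beta> - \<alpha>) (1 / real h) + 1 / real m) * weyl h)"
    by (simp add: A'_def A_def sum.distrib distrib_right sum_divide_distrib)
  ultimately show ?thesis unfolding card_eq by (simp add: N_def)
qed

end

subsection \<open>Rational points near a curve\<close>

lemma trunc_recip_le: "0 \<le> Q \<Longrightarrow> 0 \<le> d \<Longrightarrow> trunc_recip Q d \<le> Q"
proof (cases "Q * d \<le> 1")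
  case False
  assume "0 \<le> Q" "0 \<le> d"
  then have "0 < d" using False by (cases "d = 0") auto
  then show ?thesis using False by (simp add: trunc_recip_def field_simps)
qed (simp add: trunc_recip_def)

lemma trunc_recip_le': "0 < d \<Longrightarrow> trunc_recip Q d \<le> 1 / d"
  by (simp add: trunc_recip_def field_simps)

text \<open>On the block from 2^i to 2^(i+1) the weight is at most its value at 2^i. The block is
  then enlarged to the whole initial segment, because the available bounds are cumulative.\<close>

lemma dyadic_sum_le:
  fixes a w :: "nat \<Rightarrow> real"
  assumes a: "\<And>h. 0 \<le> a h" and w: "\<And>h. 0 \<le> w h" "\<And>h h'. 1 \<le> h \<Longrightarrow> h \<le> h' \<Longrightarrow> w h' \<le> w h"
  shows "(\<Sum>h\<in>{1..<2 ^ I}. w h * a h) \<le> (\<Sum>i<I. w (2 ^ i) * (\<Sum>h\<in>{1..<2 ^ Suc i}. a h))"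
proof (induction I)
  case (Suc I)
  have split: "{1..<(2::nat) ^ Suc I} = {1..<2 ^ I} \<union> {2 ^ I..<2 ^ Suc I}" by (auto simp: ivl_disj_un)
  have "(\<Sum>h\<in>{1..<2 ^ Suc I}. w h * a h) = (\<Sum>h\<in>{1..<2 ^ I}. w h * a h) + (\<Sum>h\<in>{2 ^ I..<2 ^ Suc I}. w h * a h)"
    unfolding split by (intro sum.union_disjoint) auto
  also have "(\<Sum>h\<in>{2 ^ I..<2 ^ Suc I}. w h * a h) \<le> (\<Sum>h\<in>{2 ^ I..<2 ^ Suc I}. w (2 ^ I) * a h)"
    using a w by (intro sum_mono mult_right_mono) auto
  also have "\<dots> \<le> (\<Sum>h\<in>{1..<2 ^ Suc I}. w (2 ^ I) * a h)"
    using a w by (intro sum_mono2) (auto intro: Suc_leI order_trans[of "Suc 0" "2 ^ I"])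
  also have "\<dots> = w (2 ^ I) * (\<Sum>h\<in>{1..<2 ^ Suc I}. a h)" by (simp add: sum_distrib_left)
  finally show ?case using Suc by simp
qed simp

text \<open>The constant 4 passes the induction because 4 + 1 \<le> 4 sqrt 2, that is 5/4 \<le> sqrt
  2.\<close>

lemma sum_sqrt_powers_le: "(\<Sum>i<I. sqrt (2 ^ i)) \<le> 4 * sqrt (2 ^ I)"
proof (induction I)
  case (Suc I)
  have "sqrt ((5/4)\<^sup>2) \<le> sqrt 2" by (intro real_sqrt_le_mono) (simp add: power2_eq_square)
  then have "5/4 \<le> sqrt 2" by simp
  then have "5/4 * sqrt (2 ^ I) \<le> sqrt 2 * sqrt (2 ^ I)" by (intro mult_right_mono) auto
  moreover have "sqrt (2 ^ Suc I) = sqrt 2 * sqrt (2 ^ I)" by (simp add: real_sqrt_mult)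
  moreover have "(\<Sum>i<Suc I. sqrt (2 ^ i)) = (\<Sum>i<I. sqrt (2 ^ i)) + sqrt (2 ^ I)" by (rule sum.lessThan_Suc)
  ultimately show ?case using Suc by linarith
qed simp

text \<open>Fractions within n^(-1-\<kappa>) of an integer get the full weight \<open>Q\<close> and
  are counted by the separate bound \<open>X\<close>. The others are sorted into dyadic shells of
  distance about 2^i \<delta>0, with weight 1/(2^i \<delta>0) and the count \<open>h2\<close>; the
  number of shells is logarithmic in n and absorbed into n^\<kappa>.\<close>

lemma recip_sum_le:
  fixes n :: nat
  assumes \<kappa>: "0 < \<kappa>" and n: "1 \<le> n" and Q: "0 \<le> Q" and Y: "0 \<le> Y"
    and h1: "real (card (near_set f a b n (real n powr (- 1 - \<kappa>)))) \<le> X"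
    and h2: "\<And>\<delta>. 0 < \<delta> \<Longrightarrow> real (card (near_set f a b n \<delta>)) \<le> Y * (\<delta> * (real n)\<^sup>2 + real n)"
  shows "(\<Sum>(k, \<nu>)\<in>frac_set a b n. trunc_recip Q (int_dist (real k * f (of_int \<nu> / real k))))
    \<le> Q * X + Y * (6 + 4 * (1 + \<kappa>) / \<kappa>) * real n powr (2 + \<kappa>)"
proof -
  define \<delta>0 where "\<delta>0 = real n powr (- 1 - \<kappa>)"
  define d where "d p = (case p of (k, \<nu>) \<Rightarrow> int_dist (real k * f (of_int \<nu> / real k)))" for p :: "nat \<times> int"
  define S where "S = frac_set a b n"
  \<comment> \<open>The shells below \<open>I\<close> reach distance 1, beyond the largest possible
    distance 1/2.\<close>
  define I where "I = nat \<lceil>log 2 (1 / \<delta>0)\<rceil> + 1"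
  define nr where "nr i = near_set f a b n (2 ^ Suc i * \<delta>0)" for i :: nat
  have n0: "0 < real n" using n by simp
  have \<delta>0: "0 < \<delta>0" using n by (simp add: \<delta>0_def)
  have d0: "0 \<le> d p" "d p \<le> 1/2" for p
    by (cases p; simp only: d_def prod.case int_dist_nonneg int_dist_le_half)+
  have near: "p \<in> near_set f a b n \<delta> \<longleftrightarrow> p \<in> S \<and> d p \<le> \<delta>" for p \<delta>
    by (auto simp: near_set_def S_def frac_set_def d_def)
  have finS: "finite S" by (simp add: S_def)
  have fin_near: "finite (near_set f a b n \<delta>)" for \<delta> by simp
  have inv: "1 / \<delta>0 = real n powr (1 + \<kappa>)" using n0 by (simp add: \<delta>0_def powr_minus_divide[symmetric] algebra_simps)
  have I2: "1 / \<delta>0 \<le> 2 ^ I"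
  proof -
    have "1 / \<delta>0 = 2 powr (log 2 (1 / \<delta>0))" using \<delta>0 by simp
    also have "\<dots> \<le> 2 powr (real I)" unfolding I_def by (intro powr_mono) linarith+
    also have "\<dots> = 2 ^ I" by (simp add: powr_realpow)
    finally show ?thesis .
  qed
  have nk1: "1 \<le> real n powr \<kappa>" using n \<kappa> by (simp add: ge_one_powr_ge_zero)
  have Ib: "real I \<le> (2 + 2 * (1 + \<kappa>) / \<kappa>) * real n powr \<kappa>"
  proof -
    have l2: "1/2 \<le> ln (2::real)" using ln2_ge_two_thirds by simp
    have lnn: "0 \<le> ln (real n)" using n by simp
    have lg: "log 2 (1 / \<delta>0) = (1 + \<kappa>) * (ln (real n) / ln 2)" using n0 unfolding inv by (simp add: log_def ln_powr)
    have "0 \<le> log 2 (1 / \<delta>0)" unfolding lg using \<kappa> lnn by simp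
    then have "real I \<le> log 2 (1 / \<delta>0) + 2" unfolding I_def by linarith
    moreover have "ln (real n) / ln 2 \<le> 2 * (real n powr \<kappa> / \<kappa>)"
    proof -
      have "ln (real n) / ln 2 \<le> ln (real n) / (1/2)" using l2 lnn by (intro divide_left_mono) auto
      also have "\<dots> = 2 * ln (real n)" by simp
      also have "\<dots> \<le> 2 * (real n powr \<kappa> / \<kappa>)" using n \<kappa> by (intro mult_left_mono ln_powr_bound) auto
      finally show ?thesis .
    qed
    then have "log 2 (1 / \<delta>0) \<le> (1 + \<kappa>) * (2 * (real n powr \<kappa> / \<kappa>))" unfolding lg using \<kappa> by (intro mult_left_mono) auto
    ultimately have "real I \<le> (1 + \<kappa>) * (2 * (real n powr \<kappa> / \<kappa>)) + 2 * real n powr \<kappa>" using nk1 by linarith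
    also have "\<dots> = (2 + 2 * (1 + \<kappa>) / \<kappa>) * real n powr \<kappa>" using \<kappa> by (simp add: field_simps)
    finally show ?thesis .
  qed
  have pointwise: "trunc_recip Q (d p) \<le> (if p \<in> near_set f a b n \<delta>0 then Q else 0) + (\<Sum>i<I. if p \<in> nr i then 1 / (2 ^ i * \<delta>0) else 0)"
    if p: "p \<in> S" for p
  proof (cases "p \<in> near_set f a b n \<delta>0")
    case True
    have "0 \<le> (\<Sum>i<I. if p \<in> nr i then 1 / (2 ^ i * \<delta>0) else 0)" using \<delta>0 by (intro sum_nonneg) auto
    then show ?thesis using True trunc_recip_le[OF Q d0(1), of p] by simp
  next
    case False
    then have big: "\<delta>0 < d p" using p near by auto
    have ex: "d p \<le> 2 ^ Suc (I - 1) * \<delta>0"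
    proof -
      have "d p \<le> 1" using d0(2)[of p] by simp
      also have "\<dots> \<le> 2 ^ I * \<delta>0" using I2 \<delta>0 by (simp add: field_simps)
      finally show ?thesis by (simp add: I_def)
    qed
    define i where "i = (LEAST i. d p \<le> 2 ^ Suc i * \<delta>0)"
    have i1: "d p \<le> 2 ^ Suc i * \<delta>0" unfolding i_def using ex by (rule LeastI)
    have "i \<le> I - 1" unfolding i_def using ex by (rule Least_le)
    then have iI: "i < I" by (simp add: I_def)
    have i2: "2 ^ i * \<delta>0 < d p"
    proof (cases i)
      case (Suc j)
      then show ?thesis using not_less_Least[of j "\<lambda>i. d p \<le> 2 ^ Suc i * \<delta>0"] unfolding i_def by force
    qed (use big in simp)
    have "trunc_recip Q (d p) \<le> 1 / d p" using big \<delta>0 by (intro trunc_recip_le') auto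
    also have "\<dots> \<le> 1 / (2 ^ i * \<delta>0)" using i2 \<delta>0 big by (intro divide_left_mono mult_pos_pos) auto
    also have "\<dots> = (if p \<in> nr i then 1 / (2 ^ i * \<delta>0) else 0)" using p i1 near by (simp add: nr_def)
    also have "\<dots> \<le> (\<Sum>i<I. if p \<in> nr i then 1 / (2 ^ i * \<delta>0) else 0)"
      using iI \<delta>0 by (intro member_le_sum) auto
    finally show ?thesis using False by simp
  qed
  have "(\<Sum>p\<in>S. trunc_recip Q (d p)) \<le> (\<Sum>p\<in>S. (if p \<in> near_set f a b n \<delta>0 then Q else 0) + (\<Sum>i<I. if p \<in> nr i then 1 / (2 ^ i * \<delta>0) else 0))"
    by (intro sum_mono pointwise)
  also have "\<dots> = (\<Sum>p\<in>S. if p \<in> near_set f a b n \<delta>0 then Q else 0) + (\<Sum>i<I. \<Sum>p\<in>S. if p \<in> nr i then 1 / (2 ^ i * \<delta>0) else 0)"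
    unfolding sum.distrib by (subst sum.swap) (rule refl)
  also have "(\<Sum>p\<in>S. if p \<in> near_set f a b n \<delta>0 then Q else 0) = real (card (near_set f a b n \<delta>0)) * Q"
  proof -
    have "S \<inter> near_set f a b n \<delta>0 = near_set f a b n \<delta>0" using near by auto
    then show ?thesis by (simp only: sum.inter_restrict[symmetric, OF finS] sum_constant)
  qed
  also have "(\<Sum>i<I. \<Sum>p\<in>S. if p \<in> nr i then 1 / (2 ^ i * \<delta>0) else 0) = (\<Sum>i<I. real (card (nr i)) * (1 / (2 ^ i * \<delta>0)))"
  proof (intro sum.cong refl)
    fix i
    have "S \<inter> nr i = nr i" using near by (auto simp: nr_def)
    then show "(\<Sum>p\<in>S. if p \<in> nr i then 1 / (2 ^ i * \<delta>0) else 0) = real (card (nr i)) * (1 / (2 ^ i * \<delta>0))"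
      by (simp only: sum.inter_restrict[symmetric, OF finS] sum_constant)
  qed
  also have "\<dots> \<le> (\<Sum>i<I. Y * (2 * (real n)\<^sup>2 + real n / \<delta>0 * (1/2) ^ i))"
  proof (intro sum_mono)
    fix i
    have "real (card (nr i)) * (1 / (2 ^ i * \<delta>0)) \<le> (Y * (2 ^ Suc i * \<delta>0 * (real n)\<^sup>2 + real n)) * (1 / (2 ^ i * \<delta>0))"
      unfolding nr_def using \<delta>0 by (intro mult_right_mono h2) auto
    also have "\<dots> = Y * (2 * (real n)\<^sup>2 + real n / \<delta>0 * (1/2) ^ i)"
      using \<delta>0 by (simp add: field_simps power_divide)
    finally show "real (card (nr i)) * (1 / (2 ^ i * \<delta>0)) \<le> Y * (2 * (real n)\<^sup>2 + real n / \<delta>0 * (1/2) ^ i)" .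
  qed
  also have "\<dots> = Y * (2 * (real n)\<^sup>2 * real I + real n / \<delta>0 * (\<Sum>i<I. (1/2) ^ i))"
    by (simp only: sum_distrib_left[symmetric] sum.distrib sum_constant card_lessThan) simp
  also have "\<dots> \<le> Y * ((4 + 4 * (1 + \<kappa>) / \<kappa>) * real n powr (2 + \<kappa>) + real n powr (2 + \<kappa>) * 2)"
  proof (intro mult_left_mono[OF _ Y] add_mono)
    have n2k: "(real n)\<^sup>2 * real n powr \<kappa> = real n powr (2 + \<kappa>)" using n0 by (simp add: powr_add powr_numeral)
    have "2 * (real n)\<^sup>2 * real I \<le> 2 * (real n)\<^sup>2 * ((2 + 2 * (1 + \<kappa>) / \<kappa>) * real n powr \<kappa>)" using Ib by (intro mult_left_mono) auto
    also have "\<dots> = (4 + 4 * (1 + \<kappa>) / \<kappa>) * ((real n)\<^sup>2 * real n powr \<kappa>)" using \<kappa> by (simp add: field_simps)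
    finally show "2 * (real n)\<^sup>2 * real I \<le> (4 + 4 * (1 + \<kappa>) / \<kappa>) * real n powr (2 + \<kappa>)" unfolding n2k .
    have "real n / \<delta>0 = real n powr 1 * (1 / \<delta>0)" using n0 by simp
    also have "\<dots> = real n powr 1 * real n powr (1 + \<kappa>)" unfolding inv ..
    also have "\<dots> = real n powr (2 + \<kappa>)" unfolding powr_add[symmetric] by simp
    finally have e: "real n / \<delta>0 = real n powr (2 + \<kappa>)" .
    have "(\<Sum>i<I. (1/2::real) ^ i) \<le> 2" by (simp add: sum_gp_strict)
    then show "real n / \<delta>0 * (\<Sum>i<I. (1/2) ^ i) \<le> real n powr (2 + \<kappa>) * 2" unfolding e by (intro mult_left_mono) auto
  qed
  also have "\<dots> = Y * (6 + 4 * (1 + \<kappa>) / \<kappa>) * real n powr (2 + \<kappa>)" by (simp add: algebra_simps)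
  also have "real (card (near_set f a b n \<delta>0)) * Q \<le> X * Q" using h1 Q by (intro mult_right_mono) (auto simp: \<delta>0_def)
  finally have "(\<Sum>p\<in>S. trunc_recip Q (d p)) \<le> X * Q + Y * (6 + 4 * (1 + \<kappa>) / \<kappa>) * real n powr (2 + \<kappa>)" by simp
  moreover have "(\<Sum>p\<in>S. trunc_recip Q (d p)) = (\<Sum>(k, \<nu>)\<in>frac_set a b n. trunc_recip Q (int_dist (real k * f (of_int \<nu> / real k))))"
    unfolding S_def d_def by (intro sum.cong refl) auto
  ultimately show ?thesis by (simp add: mult.commute)
qed

definition dual_recip :: "(real \<Rightarrow> real) \<Rightarrow> real \<Rightarrow> real \<Rightarrow> real \<Rightarrow> nat \<Rightarrow> real" where
  "dual_recip g a b Q h = (\<Sum>\<nu>\<in>frac_range a b h. trunc_recip Q (int_dist (real h * g (of_int \<nu> / real h))))"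

lemma dual_recip_nonneg: "0 \<le> Q \<Longrightarrow> 0 \<le> dual_recip g a b Q h"
  by (simp add: dual_recip_def sum_nonneg trunc_recip_nonneg)

lemma sum_dual_recip:
  "(\<Sum>h\<in>{1..<Suc J}. dual_recip g a b Q h) = (\<Sum>(k, \<nu>)\<in>frac_set a b J. trunc_recip Q (int_dist (real k * g (of_int \<nu> / real k))))"
  unfolding dual_recip_def frac_set_def by (simp add: sum.Sigma atLeastLessThanSuc_atLeastAtMost)

text \<open>Dyadic summation against 1/sqrt h. Multiplied with a cumulative bound of order 2^i, the
  weight of block i leaves sqrt (2^i), and these form a geometric sum dominated by its end. The
  cumulative bound is used only below 2^I, which is less than 2 M.\<close>

lemma weighted_dual_sum_le:
  fixes A :: "nat \<Rightarrow> real"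
  assumes a: "\<And>h. 0 \<le> a h" and s: "0 \<le> s" "s \<le> 3" and C: "0 \<le> C1" "0 \<le> C2" and M: "1 \<le> M"
    and cum: "\<And>J. 1 \<le> J \<Longrightarrow> J < 2 * M \<Longrightarrow> (\<Sum>h\<in>{1..<Suc J}. a h) \<le> C1 * real J + C2 * real J powr (1 + s)"
  shows "(\<Sum>h\<in>{1..<M}. a h / sqrt (real h)) \<le> 16 * C1 * sqrt (real M) + 1024 * C2 * (real M powr s * sqrt (real M))"
proof -
  obtain I :: nat where I: "2 ^ I < 2 * int M" "int M \<le> 2 ^ I" using exists_shell[of "int M"] M by auto
  have I': "2 ^ I < 2 * M" "M \<le> 2 ^ I"
  proof -
    have "int (2 ^ I) < int (2 * M)" "int M \<le> int (2 ^ I)" using I by simp_all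
    then show "2 ^ I < 2 * M" "M \<le> 2 ^ I" by (simp_all only: of_nat_less_iff of_nat_le_iff)
  qed
  have IM: "2 ^ I \<le> 2 * real M"
  proof -
    have "real (2 ^ I) \<le> real (2 * M)" using I'(1) by (simp only: of_nat_le_iff less_imp_le)
    then show ?thesis by simp
  qed
  define w where "w h = 1 / sqrt (real h)" for h :: nat
  have w: "0 \<le> w h" "1 \<le> h \<Longrightarrow> h \<le> h' \<Longrightarrow> w h' \<le> w h" for h h'
    by (auto simp: w_def intro!: divide_left_mono mult_pos_pos)
  have "(\<Sum>h\<in>{1..<M}. a h / sqrt (real h)) = (\<Sum>h\<in>{1..<M}. w h * a h)" by (simp add: w_def)
  also have "\<dots> \<le> (\<Sum>h\<in>{1..<2 ^ I}. w h * a h)" using I'(2) a w by (intro sum_mono2) auto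
  also have "\<dots> \<le> (\<Sum>i<I. w (2 ^ i) * (\<Sum>h\<in>{1..<2 ^ Suc i}. a h))" using a w by (intro dyadic_sum_le)
  also have "\<dots> \<le> (\<Sum>i<I. (2 * C1 + 16 * C2 * (2 ^ I) powr s) * sqrt (2 ^ i))"
  proof (intro sum_mono)
    fix i assume i: "i \<in> {..<I}"
    define J where "J = 2 ^ Suc i - (1::nat)"
    have "(1::nat) \<le> 2 ^ i" by simp
    then have J: "Suc J = 2 ^ Suc i" "1 \<le> J" unfolding J_def power_Suc by linarith+
    have "(2::nat) ^ Suc i \<le> 2 ^ I" using i by (intro power_increasing) auto
    then have JM: "J < 2 * M" using I'(1) J by linarith
    have rJ: "real J \<le> 2 * 2 ^ i"
    proof -
      have "real (Suc J) = 2 * 2 ^ i" unfolding J(1) by simp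
      then show ?thesis by simp
    qed
    have "(\<Sum>h\<in>{1..<2 ^ Suc i}. a h) \<le> C1 * real J + C2 * real J powr (1 + s)"
      using cum[OF J(2) JM] unfolding J(1) .
    also have "\<dots> \<le> C1 * (2 * 2 ^ i) + C2 * (2 * 2 ^ i) powr (1 + s)"
      using rJ C s J by (intro add_mono mult_left_mono powr_mono2) auto
    also have "(2 * 2 ^ i) powr (1 + s) = 2 powr (1 + s) * (2 ^ i * (2 ^ i) powr s)"
      by (simp add: powr_mult powr_add)
    also have "C2 * (2 powr (1 + s) * (2 ^ i * (2 ^ i) powr s)) \<le> C2 * (16 * (2 ^ i * (2 ^ I) powr s))"
    proof (intro mult_left_mono mult_mono C)
      have "2 powr (1 + s) \<le> (2::real) powr 4" using s by (intro powr_mono) auto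
      then show "2 powr (1 + s) \<le> (16::real)" by (simp add: powr_numeral)
      show "(2 ^ i) powr s \<le> (2 ^ I) powr s" using i s by (intro powr_mono2 power_increasing) auto
    qed auto
    finally have "w (2 ^ i) * (\<Sum>h\<in>{1..<2 ^ Suc i}. a h) \<le> w (2 ^ i) * (C1 * (2 * 2 ^ i) + C2 * (16 * (2 ^ i * (2 ^ I) powr s)))"
      using w by (intro mult_left_mono) auto
    also have "\<dots> = (2 * C1 + 16 * C2 * (2 ^ I) powr s) * (2 ^ i / sqrt (2 ^ i))"
      by (simp add: w_def algebra_simps)
    also have "2 ^ i / sqrt (2 ^ i) = sqrt (2 ^ i)" by (simp add: real_div_sqrt)
    finally show "w (2 ^ i) * (\<Sum>h\<in>{1..<2 ^ Suc i}. a h) \<le> (2 * C1 + 16 * C2 * (2 ^ I) powr s) * sqrt (2 ^ i)" .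
  qed
  also have "\<dots> = (2 * C1 + 16 * C2 * (2 ^ I) powr s) * (\<Sum>i<I. sqrt (2 ^ i))" by (simp add: sum_distrib_left)
  also have "\<dots> \<le> (2 * C1 + 16 * C2 * (8 * real M powr s)) * (8 * sqrt (real M))"
  proof (intro mult_mono add_mono mult_left_mono order_refl)
    have "(2 ^ I) powr s \<le> (2 * real M) powr s" using IM s by (intro powr_mono2) auto
    also have "\<dots> = 2 powr s * real M powr s" by (simp add: powr_mult)
    also have "\<dots> \<le> 2 powr 3 * real M powr s" using s by (intro mult_right_mono powr_mono) auto
    finally show "(2 ^ I) powr s \<le> 8 * real M powr s" by (simp add: powr_numeral)
    have "(\<Sum>i<I. sqrt (2 ^ i)) \<le> 4 * sqrt (2 ^ I)" by (rule sum_sqrt_powers_le)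
    also have "\<dots> \<le> 4 * sqrt (4 * real M)" using IM by (intro mult_left_mono real_sqrt_le_mono) auto
    also have "\<dots> = 8 * sqrt (real M)" by (simp add: real_sqrt_mult)
    finally show "(\<Sum>i<I. sqrt (2 ^ i)) \<le> 8 * sqrt (real M)" .
  qed (use C in \<open>auto simp: sum_nonneg\<close>)
  finally show ?thesis by (simp add: algebra_simps)
qed

definition frac_values :: "(real \<Rightarrow> real) \<Rightarrow> nat \<times> int \<Rightarrow> real" where
  "frac_values f = (\<lambda>(k, \<nu>). real k * f (of_int \<nu> / real k))"

lemma near_set_eq: "near_set f a b n \<delta> = {p \<in> frac_set a b n. int_dist (frac_values f p) \<le> \<delta>}"
  by (auto simp: near_set_def frac_set_def frac_values_def)

context legendre_pair
begin

lemma weyl_frac_set_le: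
  assumes h: "0 < h" "h \<le> n" and ab: "a0 \<le> b0" "b0 - a0 \<le> R"
  shows "finite_points.weyl (frac_set a0 b0 n) (frac_values f) h
    \<le> const_sum B L R * (sqrt (real n / real h) * (dual_recip g (fd a0) (fd b0) (real n) h + real n) + real n * (1 + ln (real n)))"
proof -
  interpret finite_points "frac_set a0 b0 n" "frac_values f" by unfold_locales simp
  have "(\<Sum>p\<in>frac_set a0 b0 n. ee (real h * frac_values f p)) = (\<Sum>q=1..n. \<Sum>a\<in>frac_range a0 b0 q. ee (real h * real q * f (of_int a / real q)))"
    unfolding frac_set_def by (subst sum.Sigma) (auto simp: frac_values_def mult.assoc intro!: sum.cong)
  then show ?thesis unfolding weyl_def dual_recip_def using exp_sum_bound[OF h ab] by simp
qed

lemma gd_fd_window: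
  assumes "a0 \<le> b0" "fd b0 - fd a0 \<le> R"
  shows "fd a0 \<le> fd b0" "0 \<le> R"
  using fd_mono[OF assms(1)] assms(2) by auto

text \<open>\<open>recip_sum_le\<close> for the dual function, with \<open>near\<close> applied to g
  through \<open>swap\<close>. The summand \<open>real n\<close> in each term is one of the errors
  of \<open>exp_sum_bound\<close>, carried along so that both are summed by the same partial
  summation.\<close>

lemma sum_dual_recip_le:
  assumes ab: "a0 \<le> b0" "fd b0 - fd a0 \<le> R" and \<kappa>: "0 < \<kappa>" and J: "1 \<le> J" and C: "0 \<le> C" and Y: "0 \<le> Y"
    and near: "\<And>L f fd fdd g gd gdd a b n. legendre_pair B L f fd fdd g gd gdd \<Longrightarrow> a \<le> b \<Longrightarrow> 1 \<le> n \<Longrightarrow>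
      real (card (near_set f a b n (real n powr (- 1 - \<kappa>)))) \<le> C * ((b - a + 1) * (real n * (1 + ln (real n))))"
    and near': "\<And>\<delta>. 0 < \<delta> \<Longrightarrow> real (card (near_set g (fd a0) (fd b0) J \<delta>)) \<le> Y * (\<delta> * (real J)\<^sup>2 + real J)"
  shows "(\<Sum>h\<in>{1..<Suc J}. dual_recip g (fd a0) (fd b0) (real n) h + real n)
    \<le> real n * ((C * (R + 1) + 1) * (real J * (1 + ln (real J)))) + Y * (6 + 4 * (1 + \<kappa>) / \<kappa>) * real J powr (2 + \<kappa>)"
proof -
  note w = gd_fd_window[OF ab]
  define l where "l = real J * (1 + ln (real J))"
  have l: "real J \<le> l" using J by (simp add: l_def)
  have X: "real (card (near_set g (fd a0) (fd b0) J (real J powr (- 1 - \<kappa>)))) \<le> C * ((R + 1) * l)"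
  proof -
    have "C * ((fd b0 - fd a0 + 1) * l) \<le> C * ((R + 1) * l)" using ab l J C by (intro mult_left_mono mult_right_mono) auto
    then show ?thesis using near[OF swap w(1) J] unfolding l_def by linarith
  qed
  have "(\<Sum>h\<in>{1..<Suc J}. dual_recip g (fd a0) (fd b0) (real n) h)
    \<le> real n * (C * ((R + 1) * l)) + Y * (6 + 4 * (1 + \<kappa>) / \<kappa>) * real J powr (2 + \<kappa>)"
    unfolding sum_dual_recip by (rule recip_sum_le[OF \<kappa> J _ Y X near']) auto
  moreover have "(\<Sum>h\<in>{1..<Suc J}. real n) = real n * real J" by simp
  moreover have "real n * real J \<le> real n * l" using l by (intro mult_left_mono) auto
  ultimately have "(\<Sum>h\<in>{1..<Suc J}. dual_recip g (fd a0) (fd b0) (real n) h + real n)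
    \<le> real n * (C * ((R + 1) * l)) + Y * (6 + 4 * (1 + \<kappa>) / \<kappa>) * real J powr (2 + \<kappa>) + real n * l"
    unfolding sum.distrib by linarith
  also have "\<dots> = real n * ((C * (R + 1) + 1) * l) + Y * (6 + 4 * (1 + \<kappa>) / \<kappa>) * real J powr (2 + \<kappa>)"
    by (simp add: algebra_simps)
  finally show ?thesis unfolding l_def .
qed

text \<open>The dual fractions that occur have denominators below \<open>2 m\<close>, about \<open>1/\<delta>\<close>, which is a power of \<open>n\<close>
  smaller than \<open>n\<close>; this is the source of the gain \<open>n powr (- \<epsilon>/8)\<close> in front of the inductive constant.\<close>

lemma near_step:
  assumes ab: "a0 \<le> b0" "b0 - a0 \<le> R" "fd b0 - fd a0 \<le> R" and \<epsilon>: "0 < \<epsilon>" "\<epsilon> \<le> 1" and \<kappa>: "0 < \<kappa>" "\<kappa> = \<epsilon> / 8"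
    and C: "0 \<le> C" and E: "0 \<le> E" and n: "1 \<le> n"
    and near: "\<And>L f fd fdd g gd gdd a b n. legendre_pair B L f fd fdd g gd gdd \<Longrightarrow> a \<le> b \<Longrightarrow> 1 \<le> n \<Longrightarrow>
      real (card (near_set f a b n (real n powr (- 1 - \<kappa>)))) \<le> C * ((b - a + 1) * (real n * (1 + ln (real n))))"
    and IH: "\<And>J \<delta>. 1 \<le> J \<Longrightarrow> J < n \<Longrightarrow> 0 < \<delta> \<Longrightarrow>
      real (card (near_set g (fd a0) (fd b0) J \<delta>)) \<le> E * real J powr \<epsilon> * (\<delta> * (real J)\<^sup>2 + real J)"
    and \<delta>: "real n powr (- 1 + \<epsilon> / 2) \<le> \<delta>" "\<delta> \<le> 1/4"
    and K: "K = const_sum B L R" and c: "c = 6 + 4 * (1 + \<kappa>) / \<kappa>"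
  shows "real (card (near_set f a0 b0 n \<delta>)) \<le> (16 * (R + 1) + 256 * K * (C * (R + 1) + 1) + 8 * K) * (1 + ln (real n)) * (\<delta> * (real n)\<^sup>2 + real n)
     + 8192 * K * c * E * real n powr (1 + \<epsilon> - \<epsilon> / 8)"
proof -
  interpret finite_points "frac_set a0 b0 n" "frac_values f" by unfold_locales simp
  have R: "0 \<le> R" using ab by linarith
  have K0: "0 \<le> K" unfolding K by (rule const_sum_nonneg[OF R])
  have c0: "0 \<le> c" using \<kappa> by (simp add: c)
  have n0: "0 < real n" "1 \<le> real n" using n by simp_all
  have \<delta>0: "0 < \<delta>" using \<delta>(1) n0 by (smt (verit) powr_gt_zero)
  have inv: "1 / \<delta> \<le> real n powr (1 - \<epsilon> / 2)"
  proof -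
    have "1 / \<delta> \<le> 1 / real n powr (- 1 + \<epsilon> / 2)" using \<delta>(1) \<delta>0 n0 by (intro divide_left_mono) auto
    also have "\<dots> = real n powr (- (- 1 + \<epsilon> / 2))" by (rule powr_minus_divide[symmetric])
    finally show ?thesis by simp
  qed
  \<comment> \<open>The largest integer with \<delta> \<le> 1/(2 m): \<open>near_zero_count\<close>
    then catches all of \<open>near_set\<close>, and only frequencies below \<open>m\<close>
    occur.\<close>
  define m where "m = nat \<lfloor>1 / (2 * \<delta>)\<rfloor>"
  have x2: "2 \<le> 1 / (2 * \<delta>)" using \<delta>0 \<delta>(2) by (simp add: field_simps)
  then have m: "real m \<le> 1 / (2 * \<delta>)" "1 / (2 * \<delta>) \<le> 2 * real m" "1 \<le> m" unfolding m_def by linarith+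
  have m0: "0 < real m" using m(3) by simp
  have m\<delta>: "2 * real m * \<delta> \<le> 1" "1 \<le> 4 * real m * \<delta>" using m \<delta>0 by (simp_all add: field_simps)
  have mp: "2 * real m \<le> real n powr (1 - \<epsilon> / 2)"
  proof -
    have "2 * real m \<le> 1 / \<delta>" using m\<delta>(1) \<delta>0 by (simp add: field_simps)
    then show ?thesis using inv by linarith
  qed
  have "real n powr (1 - \<epsilon> / 2) \<le> real n powr 1" using n0 \<epsilon> by (intro powr_mono) auto
  then have "2 * real m \<le> real n" using mp n0 by simp
  then have mn: "2 * m \<le> n" by linarith
  define l where "l = 1 + ln (real n)"
  have l: "1 \<le> l" using n0 by (simp add: l_def)
  define a where "a h = dual_recip g (fd a0) (fd b0) (real n) h + real n" for h
  have a0: "0 \<le> a h" for h unfolding a_def using dual_recip_nonneg[of "real n"] by simp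
  define C1 where "C1 = real n * ((C * (R + 1) + 1) * l)"
  have CR: "0 \<le> C * (R + 1) + 1" using C R by simp
  have C10: "0 \<le> C1" unfolding C1_def using CR l by simp
  have cum: "(\<Sum>h\<in>{1..<Suc J}. a h) \<le> C1 * real J + (E * c) * real J powr (1 + (1 + \<epsilon> + \<kappa>))" if J: "1 \<le> J" "J < 2 * m" for J
  proof -
    have Jn: "J < n" using J mn by linarith
    have Y: "0 \<le> E * real J powr \<epsilon>" using E by simp
    have "(\<Sum>h\<in>{1..<Suc J}. a h) \<le> real n * ((C * (R + 1) + 1) * (real J * (1 + ln (real J)))) + E * real J powr \<epsilon> * c * real J powr (2 + \<kappa>)"
      unfolding a_def c using sum_dual_recip_le[OF ab(1,3) \<kappa>(1) J(1) C Y near IH[OF J(1) Jn]] .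
    also have "real n * ((C * (R + 1) + 1) * (real J * (1 + ln (real J)))) \<le> real n * ((C * (R + 1) + 1) * (real J * l))"
      using CR J Jn unfolding l_def by (intro mult_left_mono) auto
    also have "\<dots> = C1 * real J" by (simp add: C1_def)
    also have "E * real J powr \<epsilon> * c * real J powr (2 + \<kappa>) = (E * c) * (real J powr \<epsilon> * real J powr (2 + \<kappa>))" by simp
    also have "\<dots> = (E * c) * real J powr (1 + (1 + \<epsilon> + \<kappa>))" unfolding powr_add[symmetric] by (simp add: algebra_simps)
    finally show ?thesis by simp
  qed
  have s: "0 \<le> 1 + \<epsilon> + \<kappa>" "1 + \<epsilon> + \<kappa> \<le> 3" using \<epsilon> \<kappa> by auto
  have Ec: "0 \<le> E * c" using E c0 by simp
  have wd: "(\<Sum>h\<in>{1..<m}. a h / sqrt (real h)) \<le> 16 * C1 * sqrt (real m) + 1024 * (E * c) * (real m powr (1 + \<epsilon> + \<kappa>) * sqrt (real m))"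
    by (rule weighted_dual_sum_le[OF a0 s C10 Ec m(3) cum])
  have weyl: "weyl h \<le> K * (sqrt (real n) * (a h / sqrt (real h)) + real n * l)" if "h \<in> {1..<m}" for h
    using weyl_frac_set_le[of h n, OF _ _ ab(1,2)] that mn unfolding K a_def l_def by (auto simp: real_sqrt_divide)
  have "(\<Sum>h\<in>{1..<m}. weyl h) \<le> (\<Sum>h\<in>{1..<m}. K * (sqrt (real n) * (a h / sqrt (real h)) + real n * l))"
    by (intro sum_mono weyl)
  also have "\<dots> = K * (sqrt (real n) * (\<Sum>h\<in>{1..<m}. a h / sqrt (real h)) + real (m - 1) * (real n * l))"
    by (simp only: sum_distrib_left[symmetric] sum.distrib sum_constant card_atLeastLessThan) (simp add: algebra_simps)
  also have "\<dots> \<le> K * (sqrt (real n) * (16 * C1 * sqrt (real m) + 1024 * (E * c) * (real m powr (1 + \<epsilon> + \<kappa>) * sqrt (real m))) + real m * (real n * l))"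
    using l by (intro mult_left_mono[OF _ K0] add_mono mult_left_mono[OF wd] mult_right_mono) auto
  finally have W: "(\<Sum>h\<in>{1..<m}. weyl h) \<le> \<dots>" .
  have card: "real (card (frac_set a0 b0 n)) \<le> (R + 1) * (real n)\<^sup>2"
  proof -
    have "(b0 - a0 + 1) * (real n)\<^sup>2 \<le> (R + 1) * (real n)\<^sup>2" using ab by (intro mult_right_mono) auto
    then show ?thesis using card_frac_set_le[OF ab(1), of n] by linarith
  qed
  have "near_set f a0 b0 n \<delta> \<subseteq> {p \<in> frac_set a0 b0 n. int_dist (frac_values f p) \<le> 1 / (2 * real m)}"
  proof -
    have "\<delta> \<le> 1 / (2 * real m)" using m\<delta>(1) m0 by (simp add: field_simps)
    then show ?thesis by (auto simp: near_set_eq)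
  qed
  then have "real (card (near_set f a0 b0 n \<delta>)) \<le> real (card {p \<in> frac_set a0 b0 n. int_dist (frac_values f p) \<le> 1 / (2 * real m)})"
    by (intro of_nat_mono card_mono) auto
  also have "\<dots> \<le> 4 / real m * (real (card (frac_set a0 b0 n)) + 2 * (\<Sum>h\<in>{1..<m}. weyl h))"
    using m by (intro near_zero_count) simp
  also have "\<dots> \<le> 4 / real m * ((R + 1) * (real n)\<^sup>2 + 2 * (K * (sqrt (real n) * (16 * C1 * sqrt (real m) + 1024 * (E * c) * (real m powr (1 + \<epsilon> + \<kappa>) * sqrt (real m))) + real m * (real n * l))))"
    using card W by (intro mult_left_mono add_mono) auto
  also have "\<dots> = 4 * (R + 1) * ((real n)\<^sup>2 * (1 / real m)) + 128 * K * (C * (R + 1) + 1) * l * (real n * (sqrt (real n) * (sqrt (real m) / real m)))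
      + 8192 * K * (E * c) * (sqrt (real n) * (real m powr (1 + \<epsilon> + \<kappa>) * (sqrt (real m) / real m))) + 8 * K * l * real n"
    using m0 by (simp add: C1_def field_simps)
  also have "\<dots> \<le> 4 * (R + 1) * (l * (4 * (\<delta> * (real n)\<^sup>2 + real n))) + 128 * K * (C * (R + 1) + 1) * l * (2 * (\<delta> * (real n)\<^sup>2 + real n))
      + 8192 * K * (E * c) * real n powr (1 + \<epsilon> - \<epsilon> / 8) + 8 * K * l * (\<delta> * (real n)\<^sup>2 + real n)"
  proof (intro add_mono mult_left_mono)
    have im: "1 / real m \<le> 4 * \<delta>" using m\<delta>(2) m0 by (simp add: field_simps)
    have "(real n)\<^sup>2 * (1 / real m) \<le> (real n)\<^sup>2 * (4 * \<delta>)" using im by (intro mult_left_mono) auto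
    also have "\<dots> \<le> 1 * (4 * (\<delta> * (real n)\<^sup>2 + real n))" by simp
    also have "\<dots> \<le> l * (4 * (\<delta> * (real n)\<^sup>2 + real n))" using l \<delta>0 by (intro mult_right_mono) auto
    finally show "(real n)\<^sup>2 * (1 / real m) \<le> l * (4 * (\<delta> * (real n)\<^sup>2 + real n))" .
    have sm: "sqrt (real m) / real m = 1 / sqrt (real m)" using m0 by (simp add: real_div_sqrt field_simps)
    have "sqrt (real n) * (sqrt (real m) / real m) = sqrt (real n * (1 / real m))" unfolding sm by (simp add: real_sqrt_mult real_sqrt_divide)
    also have "\<dots> \<le> sqrt (real n * (4 * \<delta>))" using im by (intro real_sqrt_le_mono mult_left_mono) auto
    also have "\<dots> = 2 * sqrt (\<delta> * real n)" by (simp add: real_sqrt_mult)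
    also have "\<dots> \<le> 2 * (\<delta> * real n + 1)"
    proof -
      have "sqrt (\<delta> * real n) \<le> sqrt ((\<delta> * real n + 1)\<^sup>2)"
        using \<delta>0 by (intro real_sqrt_le_mono) (simp add: power2_eq_square algebra_simps)
      then show ?thesis using \<delta>0 by simp
    qed
    finally have "real n * (sqrt (real n) * (sqrt (real m) / real m)) \<le> real n * (2 * (\<delta> * real n + 1))" by (intro mult_left_mono) auto
    also have "\<dots> = 2 * (\<delta> * (real n)\<^sup>2 + real n)" by (simp add: power2_eq_square algebra_simps)
    finally show "real n * (sqrt (real n) * (sqrt (real m) / real m)) \<le> 2 * (\<delta> * (real n)\<^sup>2 + real n)" .
    have "sqrt (real m) / real m = real m powr (- (1/2))" unfolding sm using m0 by (simp add: powr_half_sqrt[symmetric] powr_minus_divide)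
    then have "real m powr (1 + \<epsilon> + \<kappa>) * (sqrt (real m) / real m) = real m powr (1 / 2 + \<epsilon> + \<kappa>)"
      by (simp add: powr_add[symmetric] add.assoc)
    also have "\<dots> \<le> (real n powr (1 - \<epsilon> / 2)) powr (1 / 2 + \<epsilon> + \<kappa>)" using mp m0 \<epsilon> \<kappa> by (intro powr_mono2) auto
    also have "\<dots> = real n powr ((1 - \<epsilon> / 2) * (1 / 2 + \<epsilon> + \<kappa>))" by (rule powr_powr)
    finally have "sqrt (real n) * (real m powr (1 + \<epsilon> + \<kappa>) * (sqrt (real m) / real m)) \<le> sqrt (real n) * real n powr ((1 - \<epsilon> / 2) * (1 / 2 + \<epsilon> + \<kappa>))"
      by (intro mult_left_mono) auto
    also have "\<dots> = real n powr (1/2 + (1 - \<epsilon> / 2) * (1 / 2 + \<epsilon> + \<kappa>))" using n0 by (simp add: powr_half_sqrt[symmetric] powr_add)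
    \<comment> \<open>The loss \<kappa> = \<epsilon>/8 in the exponent is outweighed by m being at
      most of order n^(1 - \<epsilon>/2), which saves \<epsilon>/4: to first order the exponent is 1
      + 9\<epsilon>/8 - \<epsilon>/4 = 1 + 7\<epsilon>/8.\<close>
    also have "\<dots> \<le> real n powr (1 + \<epsilon> - \<epsilon> / 8)"
    proof (intro powr_mono)
      have "0 \<le> \<epsilon> * \<epsilon>" by simp
      then show "1/2 + (1 - \<epsilon> / 2) * (1 / 2 + \<epsilon> + \<kappa>) \<le> 1 + \<epsilon> - \<epsilon> / 8" unfolding \<kappa>(2) by (simp add: algebra_simps)
    qed (use n0 in auto)
    finally show "sqrt (real n) * (real m powr (1 + \<epsilon> + \<kappa>) * (sqrt (real m) / real m)) \<le> real n powr (1 + \<epsilon> - \<epsilon> / 8)" .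
  qed (use R K0 CR l Ec \<delta>0 in auto)
  also have "\<dots> = (16 * (R + 1) + 256 * K * (C * (R + 1) + 1) + 8 * K) * l * (\<delta> * (real n)\<^sup>2 + real n)
     + 8192 * K * c * E * real n powr (1 + \<epsilon> - \<epsilon> / 8)"
    by (simp add: algebra_simps)
  finally show ?thesis unfolding l_def .
qed

end

text \<open>Strong induction on n over all Legendre pairs with the same constants, alternating
  between f and g. \<open>near_step\<close> applies for \<delta> between n^(-1+\<epsilon>/2) and
  1/4; larger \<delta> and small n are trivial, and smaller \<delta> are raised to the threshold.
  The inductive constant returns with a factor O(n^(-\<epsilon>/8)), which is at most 1/4 from
  \<open>n0\<close> on.\<close>

theorem near_bound:
  fixes B L R \<epsilon> :: real
  assumes B: "1 \<le> B" and L: "0 \<le> L" and R: "0 \<le> R" and \<epsilon>: "0 < \<epsilon>" "\<epsilon> \<le> 1"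
  obtains E where "0 \<le> E" "\<And>f fd fdd g gd gdd a b n \<delta>. legendre_pair B L f fd fdd g gd gdd \<Longrightarrow> a \<le> b \<Longrightarrow> b - a \<le> R \<Longrightarrow> fd b - fd a \<le> R
     \<Longrightarrow> 1 \<le> n \<Longrightarrow> 0 < \<delta> \<Longrightarrow> real (card (near_set f a b n \<delta>)) \<le> E * real n powr \<epsilon> * (\<delta> * (real n)\<^sup>2 + real n)"
proof -
  define \<kappa> where "\<kappa> = \<epsilon> / 8"
  have \<kappa>: "0 < \<kappa>" using \<epsilon> by (simp add: \<kappa>_def)
  obtain C where C: "0 \<le> C" and near: "\<And>L f fd fdd g gd gdd a b n. legendre_pair B L f fd fdd g gd gdd \<Longrightarrow> a \<le> b \<Longrightarrow> 1 \<le> n \<Longrightarrow>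
    real (card (near_set f a b n (real n powr (- 1 - \<kappa>)))) \<le> C * ((b - a + 1) * (real n * (1 + ln (real n))))"
    by (rule near_count[OF B \<kappa>]) blast
  \<comment> \<open>The absolute value is taken because nonnegativity of \<open>const_sum\<close> is
    established only inside the locale, and no Legendre pair is fixed yet.\<close>
  define K where "K = \<bar>const_sum B L R\<bar>"
  define c where "c = 6 + 4 * (1 + \<kappa>) / \<kappa>"
  define D where "D = 16 * (R + 1) + 256 * K * (C * (R + 1) + 1) + 8 * K"
  have K0: "0 \<le> K" by (simp add: K_def)
  have c0: "0 \<le> c" using \<kappa> by (simp add: c_def)
  have D0: "0 \<le> D" using K0 C R by (simp add: D_def)
  \<comment> \<open>The power makes 32768 K c = 4 * 8192 K c at most n^(\<epsilon>/8), so the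
    inductive term takes a quarter of the bound; the summand 16 makes the threshold
    \<open>\<delta>1\<close> at most 1/4.\<close>
  define n0 where "n0 = nat \<lceil>(32768 * K * c) powr (8 / \<epsilon>)\<rceil> + 16"
  \<comment> \<open>The three summands serve the logarithmic term of \<open>near_step\<close>, the
    range n < n0, and \<delta> > 1/4.\<close>
  define E where "E = 4 * D * (1 + 2 / \<epsilon>) + real n0 * (R + 1) + 4 * (R + 1)"
  have E0: "0 \<le> E" using D0 \<epsilon> R by (simp add: E_def)
  have Ege: "4 * D * (1 + 2 / \<epsilon>) \<le> E" "real n0 * (R + 1) \<le> E" "4 * (R + 1) \<le> E"
    using D0 \<epsilon> R by (simp_all add: E_def)
  have bound: "\<forall>f fd fdd g gd gdd a b \<delta>. legendre_pair B L f fd fdd g gd gdd \<longrightarrow> a \<le> b \<longrightarrow> b - a \<le> R \<longrightarrow> fd b - fd a \<le> R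
     \<longrightarrow> 1 \<le> n \<longrightarrow> 0 < \<delta> \<longrightarrow> real (card (near_set f a b n \<delta>)) \<le> E * real n powr \<epsilon> * (\<delta> * (real n)\<^sup>2 + real n)" for n
  proof (induction n rule: less_induct)
    case (less n)
    show ?case
    proof (intro allI impI)
      fix f fd fdd g gd gdd :: "real \<Rightarrow> real" and a b \<delta> :: real
      assume pair: "legendre_pair B L f fd fdd g gd gdd" and ab: "a \<le> b" "b - a \<le> R" "fd b - fd a \<le> R" and n: "1 \<le> n" and \<delta>: "0 < \<delta>"
      interpret legendre_pair B L f fd fdd g gd gdd by (rule pair)
      have KK: "K = const_sum B L R" unfolding K_def using const_sum_nonneg[OF R] by simp
      have rn: "0 < real n" "1 \<le> real n" using n by simp_all
      have ne: "1 \<le> real n powr \<epsilon>" using rn \<epsilon> by (simp add: ge_one_powr_ge_zero)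
      define G where "G = \<delta> * (real n)\<^sup>2 + real n"
      have G: "\<delta> * (real n)\<^sup>2 \<le> G" "real n \<le> G" "0 \<le> G" using \<delta> by (simp_all add: G_def)
      have card: "real (card (near_set f a b n \<delta>)) \<le> (R + 1) * (real n)\<^sup>2"
      proof -
        have "card (near_set f a b n \<delta>) \<le> card (frac_set a b n)" by (intro card_mono near_set_subset) simp
        moreover have "(b - a + 1) * (real n)\<^sup>2 \<le> (R + 1) * (real n)\<^sup>2" using ab by (intro mult_right_mono) auto
        ultimately show ?thesis using card_frac_set_le[OF ab(1), of n] by linarith
      qed
      have EG: "E * G \<le> E * real n powr \<epsilon> * G"
        using mult_right_mono[OF mult_left_mono[OF ne E0] G(3)] by simp
      show "real (card (near_set f a b n \<delta>)) \<le> E * real n powr \<epsilon> * (\<delta> * (real n)\<^sup>2 + real n)"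
      proof (cases "n < n0 \<or> 1/4 < \<delta>")
        case True
        have "(R + 1) * (real n)\<^sup>2 \<le> E * G"
        proof (cases "n < n0")
          case True
          have "(R + 1) * (real n)\<^sup>2 = real n * (R + 1) * real n" by (simp add: power2_eq_square)
          also have "\<dots> \<le> real n0 * (R + 1) * G" using True R G by (intro mult_mono) auto
          also have "\<dots> \<le> E * G" using Ege(2) G(3) by (rule mult_right_mono)
          finally show ?thesis .
        next
          case False
          then have "1/4 < \<delta>" using True by simp
          then have "1 * (real n)\<^sup>2 \<le> (4 * \<delta>) * (real n)\<^sup>2" by (intro mult_right_mono) auto
          then have "(real n)\<^sup>2 \<le> 4 * G" using G(1) by simp
          then have "(R + 1) * (real n)\<^sup>2 \<le> (R + 1) * (4 * G)" using R by (intro mult_left_mono) auto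
          also have "\<dots> = 4 * (R + 1) * G" by simp
          also have "\<dots> \<le> E * G" using Ege(3) G(3) by (rule mult_right_mono)
          finally show ?thesis .
        qed
        then show ?thesis using card EG unfolding G_def by linarith
      next
        case False
        then have nn0: "n0 \<le> n" and \<delta>4: "\<delta> \<le> 1/4" by auto
        \<comment> \<open>Below this threshold the count at \<open>\<delta>1\<close> is used. The
          replacement costs a factor n^(\<epsilon>/2), which the claimed n^\<epsilon> can afford
          even after the logarithm.\<close>
        define \<delta>1 where "\<delta>1 = real n powr (- 1 + \<epsilon> / 2)"
        have \<delta>10: "0 < \<delta>1" using rn by (simp add: \<delta>1_def)
        have n16: "16 \<le> real n" using nn0 unfolding n0_def by linarith
        have \<delta>14: "\<delta>1 \<le> 1/4"
        proof -
          have "\<delta>1 \<le> real n powr (- (1/2))" unfolding \<delta>1_def using rn \<epsilon> by (intro powr_mono) auto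
          also have "\<dots> = 1 / sqrt (real n)" using rn by (simp add: powr_minus_divide powr_half_sqrt)
          also have "\<dots> \<le> 1 / 4"
          proof -
            have "sqrt (4\<^sup>2) \<le> sqrt (real n)" using n16 by (intro real_sqrt_le_mono) simp
            then have "4 \<le> sqrt (real n)" by simp
            then show ?thesis using rn by (intro divide_left_mono) auto
          qed
          finally show ?thesis .
        qed
        have small: "32768 * K * c \<le> real n powr (\<epsilon> / 8)"
        proof -
          have "(32768 * K * c) powr (8 / \<epsilon>) \<le> real n" using nn0 unfolding n0_def by linarith
          then have "((32768 * K * c) powr (8 / \<epsilon>)) powr (\<epsilon> / 8) \<le> real n powr (\<epsilon> / 8)" using \<epsilon> by (intro powr_mono2) auto
          then show ?thesis using \<epsilon> K0 c0 by (simp add: powr_powr)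
        qed
        define l where "l = 1 + ln (real n)"
        have l0: "0 \<le> l" using rn by (simp add: l_def)
        have lb: "4 * (D * l) \<le> E * real n powr (\<epsilon> / 2)"
        proof -
          have "ln (real n) \<le> real n powr (\<epsilon> / 2) / (\<epsilon> / 2)" using rn \<epsilon> by (intro ln_powr_bound) auto
          moreover have "1 \<le> real n powr (\<epsilon> / 2)" using rn \<epsilon> by (simp add: ge_one_powr_ge_zero)
          ultimately have "l \<le> real n powr (\<epsilon> / 2) + real n powr (\<epsilon> / 2) / (\<epsilon> / 2)" unfolding l_def by linarith
          also have "\<dots> = (1 + 2 / \<epsilon>) * real n powr (\<epsilon> / 2)" by (simp add: field_simps)
          finally have "4 * D * l \<le> 4 * D * ((1 + 2 / \<epsilon>) * real n powr (\<epsilon> / 2))" using D0 by (intro mult_left_mono) auto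
          also have "\<dots> = (4 * D * (1 + 2 / \<epsilon>)) * real n powr (\<epsilon> / 2)" by simp
          also have "\<dots> \<le> E * real n powr (\<epsilon> / 2)" using Ege(1) by (intro mult_right_mono) auto
          finally show ?thesis by simp
        qed
        have half: "8192 * K * c * E * real n powr (1 + \<epsilon> - \<epsilon> / 8) \<le> E / 4 * (real n powr \<epsilon> * real n)"
        proof -
          have "(32768 * K * c) * (E / 4 * real n powr (1 + \<epsilon> - \<epsilon> / 8)) \<le> real n powr (\<epsilon> / 8) * (E / 4 * real n powr (1 + \<epsilon> - \<epsilon> / 8))"
            using small E0 by (intro mult_right_mono) auto
          also have "\<dots> = E / 4 * (real n powr (\<epsilon> / 8) * real n powr (1 + \<epsilon> - \<epsilon> / 8))" by simp
          also have "real n powr (\<epsilon> / 8) * real n powr (1 + \<epsilon> - \<epsilon> / 8) = real n powr (\<epsilon> + 1)"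
            unfolding powr_add[symmetric] by (simp add: algebra_simps)
          also have "\<dots> = real n powr \<epsilon> * real n" using rn by (simp add: powr_add)
          finally show ?thesis by (simp add: algebra_simps)
        qed
        \<comment> \<open>The two conditions on the window are interchanged by duality: g has the
          window from \<open>fd a\<close> to \<open>fd b\<close>, and by \<open>gf\<close> its image
          under \<open>gd\<close> is again the interval from \<open>a\<close> to \<open>b\<close>.
          So the windows do not grow in this induction.\<close>
        have IH: "real (card (near_set g (fd a) (fd b) J \<delta>)) \<le> E * real J powr \<epsilon> * (\<delta> * (real J)\<^sup>2 + real J)"
          if "1 \<le> J" "J < n" "0 < \<delta>" for J \<delta>
          using less[rule_format, OF that(2) swap fd_mono[OF ab(1)] ab(3) _ that(1,3)] ab(2) unfolding gf by blast
        define \<delta>2 where "\<delta>2 = max \<delta> \<delta>1"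
        have step: "real (card (near_set f a b n \<delta>2)) \<le> D * l * (\<delta>2 * (real n)\<^sup>2 + real n) + 8192 * K * c * E * real n powr (1 + \<epsilon> - \<epsilon> / 8)"
          unfolding D_def l_def
          by (rule near_step[OF ab \<epsilon> \<kappa> \<kappa>_def C E0 n near IH _ _ KK c_def]) (use \<delta>4 \<delta>14 in \<open>auto simp: \<delta>2_def \<delta>1_def\<close>)
        have n\<delta>1: "\<delta>1 * (real n)\<^sup>2 = real n powr (\<epsilon> / 2) * real n"
        proof -
          have "\<delta>1 * (real n)\<^sup>2 = real n powr (- 1 + \<epsilon> / 2) * real n powr 2" unfolding \<delta>1_def using rn by (simp add: powr_numeral)
          also have "\<dots> = real n powr (\<epsilon> / 2 + 1)" unfolding powr_add[symmetric] by (simp add: algebra_simps)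
          also have "\<dots> = real n powr (\<epsilon> / 2) * real n" using rn by (simp add: powr_add)
          finally show ?thesis .
        qed
        have ne2: "1 \<le> real n powr (\<epsilon> / 2)" using rn \<epsilon> by (simp add: ge_one_powr_ge_zero)
        have "\<delta>2 * (real n)\<^sup>2 + real n \<le> 2 * (real n powr (\<epsilon> / 2) * G)"
        proof -
          have "\<delta>2 * (real n)\<^sup>2 \<le> \<delta> * (real n)\<^sup>2 + \<delta>1 * (real n)\<^sup>2" using \<delta> \<delta>10 by (auto simp: \<delta>2_def max_def)
          then have "\<delta>2 * (real n)\<^sup>2 + real n \<le> G + real n powr (\<epsilon> / 2) * real n" unfolding n\<delta>1 G_def by linarith
          moreover have "real n powr (\<epsilon> / 2) * real n \<le> real n powr (\<epsilon> / 2) * G" using G by (intro mult_left_mono) auto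
          moreover have "1 * G \<le> real n powr (\<epsilon> / 2) * G" using ne2 G(3) by (rule mult_right_mono)
          ultimately show ?thesis by linarith
        qed
        then have "D * l * (\<delta>2 * (real n)\<^sup>2 + real n) \<le> D * l * (2 * (real n powr (\<epsilon> / 2) * G))" using D0 l0 by (intro mult_left_mono) auto
        also have "\<dots> = 4 * (D * l) * (real n powr (\<epsilon> / 2) * G / 2)" by simp
        also have "\<dots> \<le> E * real n powr (\<epsilon> / 2) * (real n powr (\<epsilon> / 2) * G / 2)" using lb G(3) by (intro mult_right_mono) auto
        also have "\<dots> = E / 2 * ((real n powr (\<epsilon> / 2) * real n powr (\<epsilon> / 2)) * G)" by simp
        also have "real n powr (\<epsilon> / 2) * real n powr (\<epsilon> / 2) = real n powr \<epsilon>" unfolding powr_add[symmetric] by simp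
        finally have 1: "D * l * (\<delta>2 * (real n)\<^sup>2 + real n) \<le> E / 2 * (real n powr \<epsilon> * G)" .
        have "E / 4 * (real n powr \<epsilon> * real n) \<le> E / 4 * (real n powr \<epsilon> * G)" using E0 G by (intro mult_left_mono) auto
        moreover have "0 \<le> E * (real n powr \<epsilon> * G)" using E0 G by simp
        ultimately have "real (card (near_set f a b n \<delta>2)) \<le> E * (real n powr \<epsilon> * G)" using step 1 half by linarith
        moreover have "card (near_set f a b n \<delta>) \<le> card (near_set f a b n \<delta>2)"
          by (intro card_mono near_set_mono) (auto simp: \<delta>2_def)
        ultimately show ?thesis unfolding G_def by simp
      qed
    qed
  qed
  show thesis by (rule that[OF E0]) (use bound in blast)
qed

subsection \<open>The discrepancy for a Legendre pair\<close>

text \<open>Because 1/sqrt 2 \<le> 3/4, the quantity 4 (5 + i)/sqrt (2^i) drops in each step by at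
  least (2 + i)/sqrt (2^i): its constants are such that 4 (5 + i) - 3 (6 + i) = 2 + i.\<close>

lemma sum_linear_over_sqrt_powers:
  assumes "T \<le> I"
  shows "(\<Sum>i\<in>{T..<I}. (2 + real i) / sqrt (2 ^ i)) \<le> 4 * ((5 + real T) / sqrt (2 ^ T)) - 4 * ((5 + real I) / sqrt (2 ^ I))"
  using assms
proof (induction I rule: dec_induct)
  case (step i)
  define s :: real where "s = sqrt (2 ^ i)"
  have s: "0 < s" by (simp add: s_def)
  have s2: "1 / sqrt 2 \<le> (3/4 :: real)"
  proof -
    have "sqrt ((4/3)\<^sup>2) \<le> sqrt 2" by (intro real_sqrt_le_mono) (simp add: power2_eq_square)
    then have "4/3 \<le> sqrt 2" by simp
    then show ?thesis by (simp add: field_simps)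
  qed
  define P where "P = (5 + real (Suc i)) * (1 / sqrt 2)"
  have "P \<le> (5 + real (Suc i)) * (3/4)" unfolding P_def using s2 by (intro mult_left_mono) auto
  then have "2 + real i \<le> 4 * (5 + real i) - 4 * ((5 + real (Suc i)) * (1 / sqrt 2))" unfolding P_def[symmetric] by simp
  then have "(2 + real i) / s \<le> (4 * (5 + real i) - 4 * ((5 + real (Suc i)) * (1 / sqrt 2))) / s"
    using s by (intro divide_right_mono) auto
  also have "\<dots> = 4 * ((5 + real i) / s) - 4 * ((5 + real (Suc i)) / sqrt (2 ^ Suc i))"
    by (simp add: s_def real_sqrt_mult diff_divide_distrib)
  finally have "(2 + real i) / s \<le> 4 * ((5 + real i) / s) - 4 * ((5 + real (Suc i)) / sqrt (2 ^ Suc i))" .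
  then show ?case using step unfolding s_def by (simp only: sum.atLeastLessThan_Suc)
qed simp

text \<open>Here the factor sqrt \<delta> log(1/\<delta>) of the final bound arises. The sum is cut
  at 2^T between 1/\<delta> and 2/\<delta>. Below, the minimum is at most \<delta> and sqrt (2^i)
  grows geometrically; above, the terms are at most (2 + i)/sqrt (2^i) and decay. Both parts have
  size sqrt \<delta> (2 + T).\<close>

lemma sum_min_sqrt_powers_le:
  assumes \<delta>: "0 < \<delta>" "\<delta> < 1"
  shows "(\<Sum>i<I. min \<delta> (1 / 2 ^ i) * sqrt (2 ^ i) * (2 + real i)) \<le> 90 * (sqrt \<delta> * log_bound \<delta>)"
proof -
  define T where "T = nat \<lfloor>log 2 (1 / \<delta>)\<rfloor> + 1"
  have l0: "0 \<le> log 2 (1 / \<delta>)" using \<delta> by (intro zero_le_log_cancel_iff[THEN iffD2]) auto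
  have T: "log 2 (1 / \<delta>) \<le> real T" "real T - 1 \<le> log 2 (1 / \<delta>)" using l0 unfolding T_def by linarith+
  have p: "2 powr (log 2 (1 / \<delta>)) = 1 / \<delta>" using \<delta> by simp
  have T1: "1 / \<delta> \<le> 2 ^ T"
    using powr_mono[OF T(1), of 2] unfolding p by (simp add: powr_realpow)
  have T2: "2 ^ T \<le> 2 / \<delta>"
    using powr_mono[OF T(2), of 2] unfolding p powr_diff by (simp add: powr_realpow field_simps)
  have s1: "1 / sqrt (2 ^ T) \<le> sqrt \<delta>"
  proof -
    have "1 / 2 ^ T \<le> \<delta>" using T1 \<delta> by (simp add: field_simps)
    then have "sqrt (1 / 2 ^ T) \<le> sqrt \<delta>" by (rule real_sqrt_le_mono)
    then show ?thesis by (simp add: real_sqrt_divide)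
  qed
  have s2: "\<delta> * sqrt (2 ^ T) \<le> 2 * sqrt \<delta>"
  proof -
    have "\<delta>\<^sup>2 * 2 ^ T \<le> \<delta>\<^sup>2 * (2 / \<delta>)" using T2 by (intro mult_left_mono) auto
    also have "\<dots> \<le> 4 * \<delta>" using \<delta> by (simp add: power2_eq_square)
    finally have "sqrt (\<delta>\<^sup>2 * 2 ^ T) \<le> sqrt (4 * \<delta>)" by (rule real_sqrt_le_mono)
    then show ?thesis using \<delta> by (simp add: real_sqrt_mult)
  qed
  have TL: "2 + real T \<le> 5 * log_bound \<delta>"
  proof -
    have l2: "1/2 \<le> ln (2::real)" using ln2_ge_two_thirds by simp
    have ln0: "0 \<le> ln (1 / \<delta>)" using \<delta> by (intro ln_ge_zero) simp
    have "log 2 (1 / \<delta>) = ln (1 / \<delta>) / ln 2" by (simp add: log_def)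
    also have "\<dots> \<le> ln (1 / \<delta>) / (1/2)" using l2 ln0 by (intro divide_left_mono) auto
    finally have "log 2 (1 / \<delta>) \<le> 2 * ln (1 / \<delta>)" by simp
    then have "2 + real T \<le> 3 + 2 * ln (1 / \<delta>)" using T(2) by linarith
    also have "\<dots> \<le> 5 * log_bound \<delta>" unfolding log_bound_def by (simp add: max_def)
    finally show ?thesis .
  qed
  define F where "F i = min \<delta> (1 / 2 ^ i) * sqrt (2 ^ i) * (2 + real i)" for i :: nat
  have F0: "0 \<le> F i" for i unfolding F_def using \<delta> by simp
  have "(\<Sum>i<I. F i) \<le> (\<Sum>i\<in>{..<T} \<union> {T..<max T I}. F i)" using F0 by (intro sum_mono2) auto
  also have "\<dots> = (\<Sum>i<T. F i) + (\<Sum>i\<in>{T..<max T I}. F i)" by (intro sum.union_disjoint) auto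
  also have "(\<Sum>i<T. F i) \<le> (\<Sum>i<T. \<delta> * (2 + real T) * sqrt (2 ^ i))"
  proof (intro sum_mono)
    fix i assume "i \<in> {..<T}"
    then have "\<delta> * sqrt (2 ^ i) * (2 + real i) \<le> \<delta> * sqrt (2 ^ i) * (2 + real T)" using \<delta> by (intro mult_left_mono) auto
    moreover have "F i \<le> \<delta> * sqrt (2 ^ i) * (2 + real i)" unfolding F_def by (intro mult_right_mono) auto
    ultimately show "F i \<le> \<delta> * (2 + real T) * sqrt (2 ^ i)" by (simp add: algebra_simps)
  qed
  also have "\<dots> = \<delta> * (2 + real T) * (\<Sum>i<T. sqrt (2 ^ i))" by (simp add: sum_distrib_left)
  also have "\<dots> \<le> \<delta> * (2 + real T) * (4 * sqrt (2 ^ T))" using \<delta> by (intro mult_left_mono sum_sqrt_powers_le) auto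
  also have "\<dots> = 4 * (2 + real T) * (\<delta> * sqrt (2 ^ T))" by simp
  also have "\<dots> \<le> 4 * (2 + real T) * (2 * sqrt \<delta>)" using s2 by (intro mult_left_mono) auto
  also have "(\<Sum>i\<in>{T..<max T I}. F i) \<le> (\<Sum>i\<in>{T..<max T I}. (2 + real i) / sqrt (2 ^ i))"
  proof (intro sum_mono)
    fix i
    have "F i \<le> 1 / 2 ^ i * sqrt (2 ^ i) * (2 + real i)" unfolding F_def by (intro mult_right_mono) auto
    also have "1 / 2 ^ i * sqrt (2 ^ i) = 1 / sqrt (2 ^ i :: real)" by (simp add: real_div_sqrt field_simps)
    finally show "F i \<le> (2 + real i) / sqrt (2 ^ i)" by simp
  qed
  also have "\<dots> \<le> 4 * ((5 + real T) / sqrt (2 ^ T))"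
  proof -
    have "0 \<le> 4 * ((5 + real (max T I)) / sqrt (2 ^ max T I))" by simp
    then show ?thesis using sum_linear_over_sqrt_powers[of T "max T I"] by linarith
  qed
  also have "\<dots> = 4 * (5 + real T) * (1 / sqrt (2 ^ T))" by simp
  also have "\<dots> \<le> 10 * (2 + real T) * sqrt \<delta>" by (rule mult_mono[OF _ s1]) auto
  finally have "(\<Sum>i<I. F i) \<le> 18 * sqrt \<delta> * (2 + real T)" by (simp add: algebra_simps)
  also have "\<dots> \<le> 18 * sqrt \<delta> * (5 * log_bound \<delta>)" using TL \<delta> by (intro mult_left_mono) auto
  finally show ?thesis by (simp add: F_def algebra_simps)
qed

text \<open>As in \<open>weighted_dual_sum_le\<close>, but for the \<open>C1\<close> part the
  minimum is kept and the logarithm becomes 2 + i on block i, which leads to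
  \<open>sum_min_sqrt_powers_le\<close>. In the \<open>C2\<close> part the minimum is replaced by
  the reciprocal.\<close>

lemma weighted_min_sum_le:
  fixes a :: "nat \<Rightarrow> real"
  assumes a: "\<And>h. 0 \<le> a h" and s: "0 \<le> s" "s \<le> 1" and C: "0 \<le> C1" "0 \<le> C2" and M: "1 \<le> M" and \<delta>: "0 < \<delta>" "\<delta> < 1"
    and cum: "\<And>J. 1 \<le> J \<Longrightarrow> (\<Sum>h\<in>{1..<Suc J}. a h) \<le> C1 * (real J * (1 + ln (real J))) + C2 * real J powr (2 + s)"
  shows "(\<Sum>h\<in>{1..<M}. min \<delta> (1 / real h) * (a h / sqrt (real h)))
    \<le> 180 * C1 * (sqrt \<delta> * log_bound \<delta>) + 128 * C2 * (real M powr s * sqrt (real M))"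
proof -
  obtain I :: nat where I: "2 ^ I < 2 * int M" "int M \<le> 2 ^ I" using exists_shell[of "int M"] M by auto
  have I': "2 ^ I < 2 * M" "M \<le> 2 ^ I"
  proof -
    have "int (2 ^ I) < int (2 * M)" "int M \<le> int (2 ^ I)" using I by simp_all
    then show "2 ^ I < 2 * M" "M \<le> 2 ^ I" by (simp_all only: of_nat_less_iff of_nat_le_iff)
  qed
  have IM: "2 ^ I \<le> 2 * real M"
  proof -
    have "real (2 ^ I) \<le> real (2 * M)" using I'(1) by (simp only: of_nat_le_iff less_imp_le)
    then show ?thesis by simp
  qed
  define w where "w h = min \<delta> (1 / real h) * (1 / sqrt (real h))" for h :: nat
  have w: "0 \<le> w h" for h using \<delta> by (simp add: w_def)
  have w': "w h' \<le> w h" if "1 \<le> h" "h \<le> h'" for h h'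
  proof -
    have "1 / real h' \<le> 1 / real h" "1 / sqrt (real h') \<le> 1 / sqrt (real h)"
      using that by (auto intro!: divide_left_mono mult_pos_pos)
    then show ?thesis unfolding w_def using \<delta> by (intro mult_mono) auto
  qed
  have p2: "(2 ^ I) powr s \<le> 2 * real M powr s"
  proof -
    have "(2 ^ I) powr s \<le> (2 * real M) powr s" using IM s by (intro powr_mono2) auto
    also have "\<dots> = 2 powr s * real M powr s" by (simp add: powr_mult)
    also have "\<dots> \<le> 2 powr 1 * real M powr s" using s by (intro mult_right_mono powr_mono) auto
    finally show ?thesis by simp
  qed
  define W where "W = real M powr s"
  have "(\<Sum>h\<in>{1..<M}. min \<delta> (1 / real h) * (a h / sqrt (real h))) = (\<Sum>h\<in>{1..<M}. w h * a h)" by (simp add: w_def)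
  also have "\<dots> \<le> (\<Sum>h\<in>{1..<2 ^ I}. w h * a h)" using I'(2) a w by (intro sum_mono2) auto
  also have "\<dots> \<le> (\<Sum>i<I. w (2 ^ i) * (\<Sum>h\<in>{1..<2 ^ Suc i}. a h))" using a w w' by (intro dyadic_sum_le)
  also have "\<dots> \<le> (\<Sum>i<I. 2 * C1 * (min \<delta> (1 / 2 ^ i) * sqrt (2 ^ i) * (2 + real i)) + 16 * C2 * W * sqrt (2 ^ i))"
  proof (intro sum_mono)
    fix i assume i: "i \<in> {..<I}"
    define y :: real where "y = 2 ^ i"
    have y: "1 \<le> y" "y powr s \<le> 2 * W"
    proof -
      show "1 \<le> y" by (simp add: y_def)
      have "y powr s \<le> (2 ^ I) powr s" unfolding y_def using i s by (intro powr_mono2 power_increasing) auto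
      then show "y powr s \<le> 2 * W" using p2 unfolding W_def by linarith
    qed
    define J where "J = 2 ^ Suc i - (1::nat)"
    have "(1::nat) \<le> 2 ^ i" by simp
    then have J: "Suc J = 2 ^ Suc i" "1 \<le> J" unfolding J_def power_Suc by linarith+
    have rJ: "real J \<le> 2 * y"
    proof -
      have "real (Suc J) = 2 * y" unfolding J(1) y_def by simp
      then show ?thesis by simp
    qed
    have lnJ: "1 + ln (real J) \<le> 2 + real i"
    proof -
      have "ln (real J) \<le> ln (2 ^ Suc i)" using rJ J(2) unfolding y_def by simp
      also have "\<dots> = real (Suc i) * ln 2" by (rule ln_realpow)
      also have "\<dots> \<le> real (Suc i) * 1" using ln_le_minus_one[of "2::real"] by (intro mult_left_mono) auto
      finally show ?thesis by simp
    qed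
    have "(\<Sum>h\<in>{1..<2 ^ Suc i}. a h) \<le> C1 * (real J * (1 + ln (real J))) + C2 * real J powr (2 + s)"
      using cum[OF J(2)] unfolding J(1) .
    also have "\<dots> \<le> C1 * ((2 * y) * (2 + real i)) + C2 * (2 * y) powr (2 + s)"
    proof (rule add_mono)
      have "real J * (1 + ln (real J)) \<le> 2 * y * (2 + real i)" by (rule mult_mono[OF rJ lnJ]) (use y J in auto)
      then show "C1 * (real J * (1 + ln (real J))) \<le> C1 * ((2 * y) * (2 + real i))" using C by (intro mult_left_mono)
      show "C2 * real J powr (2 + s) \<le> C2 * (2 * y) powr (2 + s)" using rJ C s by (intro mult_left_mono powr_mono2) auto
    qed
    also have "(2 * y) powr (2 + s) = 2 powr (2 + s) * (y\<^sup>2 * y powr s)"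
      using y by (simp add: powr_mult powr_add powr_numeral)
    also have "C2 * (2 powr (2 + s) * (y\<^sup>2 * y powr s)) \<le> C2 * (8 * (y\<^sup>2 * (2 * W)))"
    proof (intro mult_left_mono mult_mono C)
      have "2 powr (2 + s) \<le> (2::real) powr 3" using s by (intro powr_mono) auto
      then show "2 powr (2 + s) \<le> (8::real)" by (simp add: powr_numeral)
    qed (use y in auto)
    finally have "w (2 ^ i) * (\<Sum>h\<in>{1..<2 ^ Suc i}. a h) \<le> w (2 ^ i) * (C1 * ((2 * y) * (2 + real i)) + C2 * (8 * (y\<^sup>2 * (2 * W))))"
      using w by (intro mult_left_mono) auto
    also have "\<dots> = 2 * C1 * (min \<delta> (1 / y) * (y / sqrt y) * (2 + real i)) + 16 * C2 * W * (min \<delta> (1 / y) * y * (y / sqrt y))"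
    proof -
      have gen: "u * r * (C1 * ((2 * y) * (2 + real i)) + C2 * (8 * (y\<^sup>2 * (2 * W))))
        = 2 * C1 * (u * (y * r) * (2 + real i)) + 16 * C2 * W * (u * y * (y * r))" for u r :: real
        by (simp add: power2_eq_square algebra_simps)
      have "w (2 ^ i) = min \<delta> (1 / y) * (1 / sqrt y)" by (simp add: w_def y_def)
      then show ?thesis using gen[of "min \<delta> (1 / y)" "1 / sqrt y"] by simp
    qed
    also have "y / sqrt y = sqrt y" using y by (simp add: real_div_sqrt)
    also have "16 * C2 * W * (min \<delta> (1 / y) * y * sqrt y) \<le> 16 * C2 * W * (1 * sqrt y)"
    proof (intro mult_left_mono mult_right_mono)
      have "min \<delta> (1 / y) * y \<le> 1 / y * y" using y by (intro mult_right_mono) auto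
      then show "min \<delta> (1 / y) * y \<le> 1" using y by simp
    qed (use C y in \<open>auto simp: W_def\<close>)
    finally show "w (2 ^ i) * (\<Sum>h\<in>{1..<2 ^ Suc i}. a h)
      \<le> 2 * C1 * (min \<delta> (1 / 2 ^ i) * sqrt (2 ^ i) * (2 + real i)) + 16 * C2 * W * sqrt (2 ^ i)" unfolding y_def by simp
  qed
  also have "\<dots> = 2 * C1 * (\<Sum>i<I. min \<delta> (1 / 2 ^ i) * sqrt (2 ^ i) * (2 + real i)) + 16 * C2 * W * (\<Sum>i<I. sqrt (2 ^ i))"
    by (simp only: sum.distrib sum_distrib_left)
  also have "\<dots> \<le> 2 * C1 * (90 * (sqrt \<delta> * log_bound \<delta>)) + 16 * C2 * W * (8 * sqrt (real M))"
  proof (intro add_mono mult_left_mono sum_min_sqrt_powers_le \<delta>)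
    have "(\<Sum>i<I. sqrt (2 ^ i)) \<le> 4 * sqrt (2 ^ I)" by (rule sum_sqrt_powers_le)
    also have "\<dots> \<le> 4 * sqrt (4 * real M)" using IM by (intro mult_left_mono real_sqrt_le_mono) auto
    also have "\<dots> = 8 * sqrt (real M)" by (simp add: real_sqrt_mult)
    finally show "(\<Sum>i<I. sqrt (2 ^ i)) \<le> 8 * sqrt (real M)" .
  qed (use C in \<open>auto simp: W_def\<close>)
  finally show ?thesis by (simp add: W_def algebra_simps)
qed

section \<open>Application of the Erdos-Turan inequality\<close>

context legendre_pair
begin

text \<open>The weights min(\<delta>, 1/h) give the main term through
  \<open>weighted_min_sum_le\<close>. The weights 1/m contribute only O(n log n) and
  O(n^(1+2\<kappa>)) through \<open>weighted_dual_sum_le\<close>, and the error n log n of each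
  exponential sum adds up to n log^2 n.\<close>

lemma discrepancy_step:
  assumes ab: "a0 \<le> b0" "b0 - a0 \<le> R" "fd b0 - fd a0 \<le> R" and \<kappa>: "0 < \<kappa>" "\<kappa> \<le> 1/4"
    and C: "0 \<le> C" and E: "0 \<le> E" and n: "2 \<le> n" and \<delta>: "\<alpha> < \<beta>" "\<beta> < \<alpha> + 1"
    and near: "\<And>L f fd fdd g gd gdd a b n. legendre_pair B L f fd fdd g gd gdd \<Longrightarrow> a \<le> b \<Longrightarrow> 1 \<le> n \<Longrightarrow>
      real (card (near_set f a b n (real n powr (- 1 - \<kappa>)))) \<le> C * ((b - a + 1) * (real n * (1 + ln (real n))))"
    and near': "\<And>J \<delta>. 1 \<le> J \<Longrightarrow> 0 < \<delta> \<Longrightarrow>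
      real (card (near_set g (fd a0) (fd b0) J \<delta>)) \<le> E * real J powr \<kappa> * (\<delta> * (real J)\<^sup>2 + real J)"
    and K: "K = const_sum B L R" and c: "c = 6 + 4 * (1 + \<kappa>) / \<kappa>" and C': "C' = C * (R + 1) + 1" and l: "l = 1 + ln (real n)"
  shows "\<bar>real (card {p \<in> frac_set a0 b0 n. in_interval_mod1 \<alpha> \<beta> (frac_values f p)}) - (\<beta> - \<alpha>) * real (card (frac_set a0 b0 n))\<bar>
    \<le> 400 * (180 * K * C' * (sqrt (\<beta> - \<alpha>) * log_bound (\<beta> - \<alpha>) * (real n * sqrt (real n)))
        + (3 * (R + 1) + 96 * K * C' + 3 * K) * (real n * l\<^sup>2) + 3200 * K * E * c * real n powr (1 + 2 * \<kappa>))"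
proof -
  interpret finite_points "frac_set a0 b0 n" "frac_values f" by unfold_locales simp
  define \<delta> where "\<delta> = \<beta> - \<alpha>"
  have d: "0 < \<delta>" "\<delta> < 1" using \<delta> by (simp_all add: \<delta>_def)
  have R: "0 \<le> R" using ab by linarith
  have K0: "0 \<le> K" unfolding K by (rule const_sum_nonneg[OF R])
  have c0: "0 \<le> c" using \<kappa> by (simp add: c)
  have C'0: "0 \<le> C'" using C R by (simp add: C')
  \<comment> \<open>All frequencies h < 2 m then satisfy h \<le> n, as \<open>exp_sum_bound\<close>
    requires, while 1/m is still O(1/n).\<close>
  define m where "m = n div 2"
  have m: "1 \<le> m" "2 * m \<le> n" "n \<le> 3 * m" using n unfolding m_def by linarith+
  define N where "N = real n"
  have N: "0 < N" "1 \<le> N" using n by (simp_all add: N_def)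
  have im: "1 / real m \<le> 3 / N"
  proof -
    have "N \<le> 3 * real m" using m(3) unfolding N_def by linarith
    then show ?thesis using m N by (simp add: field_simps)
  qed
  have l1: "1 \<le> l" using N by (simp add: l N_def)
  define a where "a h = dual_recip g (fd a0) (fd b0) N h + N" for h
  have a0: "0 \<le> a h" for h unfolding a_def using dual_recip_nonneg[of N] N by simp
  have cum: "(\<Sum>h\<in>{1..<Suc J}. a h) \<le> N * C' * (real J * (1 + ln (real J))) + E * c * real J powr (2 + 2 * \<kappa>)" if J: "1 \<le> J" for J
  proof -
    have Y: "0 \<le> E * real J powr \<kappa>" using E by simp
    have "(\<Sum>h\<in>{1..<Suc J}. a h) \<le> N * (C' * (real J * (1 + ln (real J)))) + E * real J powr \<kappa> * c * real J powr (2 + \<kappa>)"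
      unfolding a_def c C' N_def using sum_dual_recip_le[OF ab(1,3) \<kappa>(1) J C Y near near'[OF J]] .
    also have "E * real J powr \<kappa> * c * real J powr (2 + \<kappa>) = (E * c) * (real J powr \<kappa> * real J powr (2 + \<kappa>))" by simp
    also have "\<dots> = (E * c) * real J powr (2 + 2 * \<kappa>)" unfolding powr_add[symmetric] by (simp add: algebra_simps)
    finally show ?thesis by simp
  qed
  have Ec: "0 \<le> E * c" using E c0 by simp
  define M where "M = 2 * m"
  have M: "1 \<le> M" "M \<le> n" using m by (simp_all add: M_def)
  have MN: "real M \<le> N" using M by (simp add: N_def)
  define pw where "pw = N powr (2 * \<kappa>)"
  have Mpw: "real M powr (2 * \<kappa>) * sqrt (real M) \<le> pw * sqrt N" unfolding pw_def using MN \<kappa> by (intro mult_mono powr_mono2) auto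
  have S1: "(\<Sum>h\<in>{1..<M}. min \<delta> (1 / real h) * (a h / sqrt (real h)))
    \<le> 180 * (N * C') * (sqrt \<delta> * log_bound \<delta>) + 128 * (E * c) * (pw * sqrt N)"
  proof -
    have "(\<Sum>h\<in>{1..<M}. min \<delta> (1 / real h) * (a h / sqrt (real h)))
      \<le> 180 * (N * C') * (sqrt \<delta> * log_bound \<delta>) + 128 * (E * c) * (real M powr (2 * \<kappa>) * sqrt (real M))"
      by (rule weighted_min_sum_le[OF a0 _ _ _ Ec M(1) d cum]) (use \<kappa> N C'0 in auto)
    moreover have "128 * (E * c) * (real M powr (2 * \<kappa>) * sqrt (real M)) \<le> 128 * (E * c) * (pw * sqrt N)"
      using Mpw Ec by (intro mult_left_mono) auto
    ultimately show ?thesis by linarith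
  qed
  have S2: "(\<Sum>h\<in>{1..<M}. a h / sqrt (real h)) \<le> 32 * (N * C' * l) * sqrt N + 1024 * (E * c) * (N * (pw * sqrt N))"
  proof -
    have "(\<Sum>h\<in>{1..<M}. a h / sqrt (real h)) \<le> 16 * (N * C' * (2 * l)) * sqrt (real M) + 1024 * (E * c) * (real M powr (1 + 2 * \<kappa>) * sqrt (real M))"
    proof (rule weighted_dual_sum_le[OF a0 _ _ _ Ec M(1)])
      fix J assume J: "1 \<le> J" "J < 2 * M"
      have "real J \<le> 2 * N" using J MN by linarith
      then have "ln (real J) \<le> ln (2 * N)" using J N by simp
      also have "\<dots> \<le> 1 + ln N" using N ln_le_minus_one[of "2::real"] by (simp add: ln_mult)
      finally have "ln (real J) \<le> 1 + ln N" .
      moreover have "l = 1 + ln N" by (simp add: l N_def)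
      ultimately have "1 + ln (real J) \<le> 2 * l" using l1 by linarith
      then have "N * C' * (real J * (1 + ln (real J))) \<le> N * C' * (real J * (2 * l))" using N C'0 by (intro mult_left_mono) auto
      also have "\<dots> = N * C' * (2 * l) * real J" by simp
      finally show "(\<Sum>h\<in>{1..<Suc J}. a h) \<le> N * C' * (2 * l) * real J + E * c * real J powr (1 + (1 + 2 * \<kappa>))"
        using cum[OF J(1)] by (simp add: algebra_simps)
    qed (use \<kappa> N C'0 l1 in auto)
    also have "\<dots> \<le> 16 * (N * C' * (2 * l)) * sqrt N + 1024 * (E * c) * (N * (pw * sqrt N))"
    proof (intro add_mono mult_left_mono)
      have "real M powr (1 + 2 * \<kappa>) * sqrt (real M) = real M * (real M powr (2 * \<kappa>) * sqrt (real M))" using M by (simp add: powr_add)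
      also have "\<dots> \<le> N * (pw * sqrt N)" by (rule mult_mono[OF MN Mpw]) (use N in auto)
      finally show "real M powr (1 + 2 * \<kappa>) * sqrt (real M) \<le> N * (pw * sqrt N)" .
    qed (use MN N C'0 l1 Ec in auto)
    finally show ?thesis by (simp add: algebra_simps)
  qed
  have S3: "(\<Sum>h\<in>{1..<M}. min \<delta> (1 / real h) + 1 / real m) \<le> l + 2"
  proof -
    have "(\<Sum>h\<in>{1..<M}. min \<delta> (1 / real h)) \<le> (\<Sum>h\<in>{1..<M}. 1 / real h)" by (intro sum_mono) simp
    also have "\<dots> \<le> (\<Sum>h=1..n. 1 / real h)" using M by (intro sum_mono2) auto
    also have "\<dots> \<le> l" unfolding l using n by (intro sum_inverse_le_ln) simp
    finally have "(\<Sum>h\<in>{1..<M}. min \<delta> (1 / real h)) \<le> l" .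
    moreover have "(\<Sum>h\<in>{1..<M}. 1 / real m) \<le> 2"
    proof -
      have "(\<Sum>h\<in>{1..<M}. 1 / real m) = real (M - 1) / real m" by simp
      also have "\<dots> \<le> real M / real m" by (intro divide_right_mono) auto
      also have "\<dots> = 2" using m by (simp add: M_def)
      finally show ?thesis .
    qed
    ultimately show ?thesis unfolding sum.distrib by linarith
  qed
  define u where "u h = min \<delta> (1 / real h) + 1 / real m" for h
  have u0: "0 \<le> u h" for h using d by (simp add: u_def)
  have weyl: "weyl h \<le> K * (sqrt N * (a h / sqrt (real h)) + N * l)" if "h \<in> {1..<M}" for h
    using weyl_frac_set_le[of h n, OF _ _ ab(1,2)] that M unfolding K a_def l N_def by (auto simp: real_sqrt_divide)
  have "(\<Sum>h\<in>{1..<M}. u h * weyl h) \<le> (\<Sum>h\<in>{1..<M}. K * (sqrt N * (u h * (a h / sqrt (real h)))) + K * (N * l) * u h)"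
  proof (intro sum_mono)
    fix h assume "h \<in> {1..<M}"
    then have "u h * weyl h \<le> u h * (K * (sqrt N * (a h / sqrt (real h)) + N * l))" using u0 by (intro mult_left_mono weyl) auto
    then show "u h * weyl h \<le> K * (sqrt N * (u h * (a h / sqrt (real h)))) + K * (N * l) * u h" by (simp add: algebra_simps)
  qed
  also have "\<dots> = K * (sqrt N * (\<Sum>h\<in>{1..<M}. u h * (a h / sqrt (real h)))) + K * (N * l) * (\<Sum>h\<in>{1..<M}. u h)"
    by (simp only: sum.distrib sum_distrib_left)
  also have "(\<Sum>h\<in>{1..<M}. u h * (a h / sqrt (real h))) = (\<Sum>h\<in>{1..<M}. min \<delta> (1 / real h) * (a h / sqrt (real h))) + 1 / real m * (\<Sum>h\<in>{1..<M}. a h / sqrt (real h))"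
    by (simp only: u_def distrib_right sum.distrib sum_distrib_left)
  also have "K * (sqrt N * \<dots>) + K * (N * l) * (\<Sum>h\<in>{1..<M}. u h)
    \<le> K * (sqrt N * ((180 * (N * C') * (sqrt \<delta> * log_bound \<delta>) + 128 * (E * c) * (pw * sqrt N))
        + 3 / N * (32 * (N * C' * l) * sqrt N + 1024 * (E * c) * (N * (pw * sqrt N))))) + K * (N * l) * (l + 2)"
  proof (intro add_mono mult_left_mono S1 K0)
    have "1 / real m * (\<Sum>h\<in>{1..<M}. a h / sqrt (real h)) \<le> 3 / N * (\<Sum>h\<in>{1..<M}. a h / sqrt (real h))"
      using im a0 by (intro mult_right_mono sum_nonneg divide_nonneg_nonneg) auto
    also have "\<dots> \<le> 3 / N * (32 * (N * C' * l) * sqrt N + 1024 * (E * c) * (N * (pw * sqrt N)))"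
      using S2 N by (intro mult_left_mono) auto
    finally show "1 / real m * (\<Sum>h\<in>{1..<M}. a h / sqrt (real h)) \<le> 3 / N * (32 * (N * C' * l) * sqrt N + 1024 * (E * c) * (N * (pw * sqrt N)))" .
    show "(\<Sum>h\<in>{1..<M}. u h) \<le> l + 2" unfolding u_def by (rule S3)
  qed (use N K0 l1 in auto)
  also have "\<dots> = 180 * K * C' * (sqrt \<delta> * log_bound \<delta> * (N * sqrt N)) + 128 * (K * E * c) * (pw * (sqrt N * sqrt N))
      + 96 * K * C' * (l * (sqrt N * sqrt N)) + 3072 * (K * E * c) * (pw * (sqrt N * sqrt N)) + K * (N * l) * (l + 2)"
  proof -
    have "K * (s * ((180 * (N * C') * x + 128 * (E * c) * (pw * s)) + 3 / N * (32 * (N * C' * l) * s + 1024 * (E * c) * (N * (pw * s)))))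
      = 180 * K * C' * (x * (N * s)) + 128 * (K * E * c) * (pw * (s * s)) + 96 * K * C' * (l * (s * s)) + 3072 * (K * E * c) * (pw * (s * s))" for s x
      using N by (simp add: field_simps)
    then show ?thesis by simp
  qed
  also have "sqrt N * sqrt N = N" using N by simp
  finally have W: "(\<Sum>h\<in>{1..<M}. u h * weyl h) \<le> 180 * K * C' * (sqrt \<delta> * log_bound \<delta> * (N * sqrt N)) + 128 * (K * E * c) * (pw * N)
      + 96 * K * C' * (l * N) + 3072 * (K * E * c) * (pw * N) + K * (N * l) * (l + 2)" .
  have card: "real (card (frac_set a0 b0 n)) / real m \<le> 3 * (R + 1) * N"
  proof -
    have "(b0 - a0 + 1) * N\<^sup>2 \<le> (R + 1) * N\<^sup>2" using ab by (intro mult_right_mono) auto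
    then have "real (card (frac_set a0 b0 n)) \<le> (R + 1) * N\<^sup>2" using card_frac_set_le[OF ab(1), of n] unfolding N_def by linarith
    then have "real (card (frac_set a0 b0 n)) * (1 / real m) \<le> (R + 1) * N\<^sup>2 * (3 / N)" using im R by (intro mult_mono) auto
    also have "\<dots> = 3 * (R + 1) * N" using N by (simp add: power2_eq_square)
    finally show ?thesis by simp
  qed
  have ll: "l \<le> l\<^sup>2" "1 \<le> l\<^sup>2" using l1 by (simp add: power2_eq_square) (rule one_le_power[OF l1])
  have e1: "96 * K * C' * (l * N) \<le> 96 * K * C' * (N * l\<^sup>2)"
    using mult_right_mono[OF ll(1), of N] N K0 C'0 by (intro mult_left_mono) (auto simp: mult.commute)
  have e2: "K * (N * l) * (l + 2) \<le> 3 * K * (N * l\<^sup>2)"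
  proof -
    have "K * (N * l) * (l + 2) \<le> K * (N * l) * (3 * l)" using K0 N l1 by (intro mult_left_mono) auto
    then show ?thesis by (simp add: power2_eq_square algebra_simps)
  qed
  have e3: "3 * (R + 1) * N \<le> 3 * (R + 1) * (N * l\<^sup>2)"
    using mult_left_mono[OF ll(2), of N] N R by (intro mult_left_mono) auto
  have pwN: "pw * N = N powr (1 + 2 * \<kappa>)" using N by (simp add: pw_def powr_add)
  have "\<bar>real (card {p \<in> frac_set a0 b0 n. in_interval_mod1 \<alpha> \<beta> (frac_values f p)}) - (\<beta> - \<alpha>) * real (card (frac_set a0 b0 n))\<bar>
    \<le> 400 * (real (card (frac_set a0 b0 n)) / real m + (\<Sum>h\<in>{1..<M}. u h * weyl h))"
    unfolding u_def M_def \<delta>_def using m \<delta> by (intro discrepancy_le) auto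
  also have "\<dots> \<le> 400 * (180 * K * C' * (sqrt \<delta> * log_bound \<delta> * (N * sqrt N))
      + (3 * (R + 1) + 96 * K * C' + 3 * K) * (N * l\<^sup>2) + 3200 * K * E * c * (pw * N))"
  proof -
    have "3 * (R + 1) * (N * l\<^sup>2) + 96 * K * C' * (N * l\<^sup>2) + 3 * K * (N * l\<^sup>2) = (3 * (R + 1) + 96 * K * C' + 3 * K) * (N * l\<^sup>2)"
      by (simp only: distrib_right)
    moreover have "128 * (K * E * c) * (pw * N) + 3072 * (K * E * c) * (pw * N) = 3200 * K * E * c * (pw * N)" by simp
    ultimately show ?thesis using card W e1 e2 e3 by (intro mult_left_mono) linarith+
  qed
  finally show ?thesis unfolding pwN unfolding \<delta>_def N_def .
qed

end

text \<open>With \<kappa> = \<epsilon>/4 the loss n^(2\<kappa>) is n^(\<epsilon>/2), and the squared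
  logarithm is absorbed into n^\<epsilon>. The constant is fixed before the Legendre pair and before
  the window, of which only the length bound \<open>R\<close> is known.\<close>

theorem discrepancy_frac_set:
  fixes B L R \<epsilon> :: real
  assumes B: "1 \<le> B" and L: "0 \<le> L" and R: "0 \<le> R" and \<epsilon>: "0 < \<epsilon>" "\<epsilon> \<le> 1"
  obtains D where "0 \<le> D" "\<And>f fd fdd g gd gdd a b n \<alpha> \<beta>. legendre_pair B L f fd fdd g gd gdd \<Longrightarrow> a \<le> b \<Longrightarrow> b - a \<le> R \<Longrightarrow> fd b - fd a \<le> R
     \<Longrightarrow> 2 \<le> n \<Longrightarrow> \<alpha> < \<beta> \<Longrightarrow> \<beta> < \<alpha> + 1 \<Longrightarrow>
     \<bar>real (card {p \<in> frac_set a b n. in_interval_mod1 \<alpha> \<beta> (frac_values f p)}) - (\<beta> - \<alpha>) * real (card (frac_set a b n))\<bar>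
     \<le> D * (sqrt (\<beta> - \<alpha>) * log_bound (\<beta> - \<alpha>) * (real n * sqrt (real n)) + real n powr (1 + \<epsilon>))"
proof -
  define \<kappa> where "\<kappa> = \<epsilon> / 4"
  have \<kappa>: "0 < \<kappa>" "\<kappa> \<le> 1/4" "\<kappa> \<le> 1" using \<epsilon> by (simp_all add: \<kappa>_def)
  obtain C where C: "0 \<le> C" and near: "\<And>L f fd fdd g gd gdd a b n. legendre_pair B L f fd fdd g gd gdd \<Longrightarrow> a \<le> b \<Longrightarrow> 1 \<le> n \<Longrightarrow>
    real (card (near_set f a b n (real n powr (- 1 - \<kappa>)))) \<le> C * ((b - a + 1) * (real n * (1 + ln (real n))))"
    by (rule near_count[OF B \<kappa>(1)]) blast
  obtain E where E: "0 \<le> E" and near': "\<And>f fd fdd g gd gdd a b n \<delta>. legendre_pair B L f fd fdd g gd gdd \<Longrightarrow> a \<le> b \<Longrightarrow> b - a \<le> R \<Longrightarrow> fd b - fd a \<le> R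
     \<Longrightarrow> 1 \<le> n \<Longrightarrow> 0 < \<delta> \<Longrightarrow> real (card (near_set f a b n \<delta>)) \<le> E * real n powr \<kappa> * (\<delta> * (real n)\<^sup>2 + real n)"
    by (rule near_bound[OF B L R \<kappa>(1,3)]) blast
  define K where "K = \<bar>const_sum B L R\<bar>"
  define c where "c = 6 + 4 * (1 + \<kappa>) / \<kappa>"
  define C' where "C' = C * (R + 1) + 1"
  define A where "A = 3 * (R + 1) + 96 * K * C' + 3 * K"
  define c2 where "c2 = 1 + 2 / \<epsilon>"
  define D where "D = 400 * (180 * K * C' + A * c2\<^sup>2 + 3200 * K * E * c)"
  have K0: "0 \<le> K" by (simp add: K_def)
  have c0: "0 \<le> c" using \<kappa> by (simp add: c_def)
  have C'0: "0 \<le> C'" using C R by (simp add: C'_def)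
  have A0: "0 \<le> A" using K0 C'0 R by (simp add: A_def)
  have parts: "0 \<le> 180 * K * C'" "0 \<le> A * c2\<^sup>2" "0 \<le> 3200 * K * E * c" using K0 C'0 A0 E c0 by simp_all
  have D0: "0 \<le> D" using parts by (simp add: D_def)
  have main: "\<bar>real (card {p \<in> frac_set a b n. in_interval_mod1 \<alpha> \<beta> (frac_values f p)}) - (\<beta> - \<alpha>) * real (card (frac_set a b n))\<bar>
     \<le> D * (sqrt (\<beta> - \<alpha>) * log_bound (\<beta> - \<alpha>) * (real n * sqrt (real n)) + real n powr (1 + \<epsilon>))"
    if pair: "legendre_pair B L f fd fdd g gd gdd" and ab: "a \<le> b" "b - a \<le> R" "fd b - fd a \<le> R" and n: "2 \<le> n" and \<delta>: "\<alpha> < \<beta>" "\<beta> < \<alpha> + 1"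
    for f fd fdd g gd gdd a b n \<alpha> \<beta>
  proof -
    interpret legendre_pair B L f fd fdd g gd gdd by (rule pair)
    have KK: "K = const_sum B L R" unfolding K_def using const_sum_nonneg[OF R] by simp
    define l where "l = 1 + ln (real n)"
    define X where "X = sqrt (\<beta> - \<alpha>) * log_bound (\<beta> - \<alpha>) * (real n * sqrt (real n))"
    define Y where "Y = real n powr (1 + \<epsilon>)"
    have X0: "0 \<le> X" unfolding X_def log_bound_def using \<delta> by (intro mult_nonneg_nonneg) auto
    have Y0: "0 \<le> Y" by (simp add: Y_def)
    have rn: "0 < real n" "1 \<le> real n" using n by simp_all
    have nd: "real (card (near_set g (fd a) (fd b) J \<delta>')) \<le> E * real J powr \<kappa> * (\<delta>' * (real J)\<^sup>2 + real J)" if "1 \<le> J" "0 < \<delta>'" for J \<delta>'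
      using near'[OF swap fd_mono[OF ab(1)] ab(3) _ that] ab(2) unfolding gf by blast
    have "l \<le> c2 * real n powr (\<epsilon> / 2)"
    proof -
      have "ln (real n) \<le> real n powr (\<epsilon> / 2) / (\<epsilon> / 2)" using rn \<epsilon> by (intro ln_powr_bound) auto
      moreover have "1 \<le> real n powr (\<epsilon> / 2)" using rn \<epsilon> by (simp add: ge_one_powr_ge_zero)
      ultimately have "l \<le> real n powr (\<epsilon> / 2) + real n powr (\<epsilon> / 2) / (\<epsilon> / 2)" unfolding l_def by linarith
      also have "\<dots> = c2 * real n powr (\<epsilon> / 2)" by (simp add: c2_def field_simps)
      finally show ?thesis .
    qed
    then have "l\<^sup>2 \<le> (c2 * real n powr (\<epsilon> / 2))\<^sup>2" using rn by (intro power_mono) (auto simp: l_def)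
    also have "\<dots> = c2\<^sup>2 * (real n powr (\<epsilon> / 2) * real n powr (\<epsilon> / 2))" by (simp add: power2_eq_square)
    also have "real n powr (\<epsilon> / 2) * real n powr (\<epsilon> / 2) = real n powr \<epsilon>" unfolding powr_add[symmetric] by simp
    finally have "real n * l\<^sup>2 \<le> real n * (c2\<^sup>2 * real n powr \<epsilon>)" by (intro mult_left_mono) auto
    also have "\<dots> = c2\<^sup>2 * Y" using rn by (simp add: Y_def powr_add)
    finally have 1: "A * (real n * l\<^sup>2) \<le> A * c2\<^sup>2 * Y" using A0 by (simp add: mult_left_mono mult.assoc)
    have 2: "3200 * K * E * c * real n powr (1 + 2 * \<kappa>) \<le> 3200 * K * E * c * Y"
      unfolding Y_def using parts(3) rn \<epsilon> by (intro mult_left_mono powr_mono) (auto simp: \<kappa>_def)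
    have "\<bar>real (card {p \<in> frac_set a b n. in_interval_mod1 \<alpha> \<beta> (frac_values f p)}) - (\<beta> - \<alpha>) * real (card (frac_set a b n))\<bar>
      \<le> 400 * (180 * K * C' * X + A * (real n * l\<^sup>2) + 3200 * K * E * c * real n powr (1 + 2 * \<kappa>))"
      unfolding X_def A_def by (rule discrepancy_step[OF ab \<kappa>(1,2) C E n \<delta> near nd KK c_def C'_def l_def])
    also have "\<dots> \<le> 400 * (180 * K * C' * X + A * c2\<^sup>2 * Y + 3200 * K * E * c * Y)" using 1 2 by simp
    also have "\<dots> \<le> 400 * ((180 * K * C' + A * c2\<^sup>2 + 3200 * K * E * c) * (X + Y))"
    proof -
      have gen: "p * X + q * Y + r * Y \<le> (p + q + r) * (X + Y)" if "0 \<le> p" "0 \<le> q" "0 \<le> r" for p q r :: real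
      proof -
        have "0 \<le> p * Y" "0 \<le> q * X" "0 \<le> r * X" using that X0 Y0 by simp_all
        then show ?thesis by (simp add: algebra_simps)
      qed
      show ?thesis using gen[OF parts] by simp
    qed
    finally show ?thesis unfolding X_def[symmetric] Y_def[symmetric] D_def by (simp only: mult.assoc)
  qed
  show thesis by (rule that[OF D0 main])
qed

subsection \<open>Extension of the function and conclusion\<close>

text \<open>An antiderivative of the extended derivative exists on the whole line and differs from
  \<open>u\<close> by a constant on the interval.\<close>

lemma antiderivative_extension:
  fixes u \<phi> :: "real \<Rightarrow> real"
  assumes u: "\<And>x. x \<in> {\<eta>..\<xi>} \<Longrightarrow> (u has_vector_derivative \<phi> x) (at x within {\<eta>..\<xi>})" and \<phi>: "\<And>x. isCont \<phi> x"
  obtains U where "\<And>x. (U has_real_derivative \<phi> x) (at x)" "\<And>x. x \<in> {\<eta>..\<xi>} \<Longrightarrow> U x = u x"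
proof -
  have "\<exists>F. \<forall>x::real. -\<infinity> < ereal x \<longrightarrow> ereal x < \<infinity> \<longrightarrow> (F has_vector_derivative \<phi> x) (at x)"
    by (rule einterval_antiderivative) (use \<phi> in auto)
  then obtain F where F: "(F has_vector_derivative \<phi> x) (at x)" for x by auto
  have "((\<lambda>x. u x - F x) has_vector_derivative 0) (at x within {\<eta>..\<xi>})" if "x \<in> {\<eta>..\<xi>}" for x
    using has_vector_derivative_diff[OF u[OF that] has_vector_derivative_at_within[OF F]] by simp
  then obtain c where c: "\<And>x. x \<in> {\<eta>..\<xi>} \<Longrightarrow> u x - F x = c"
    using has_vector_derivative_zero_constant[of "{\<eta>..\<xi>}" "\<lambda>x. u x - F x"] by (metis convex_real_interval(5))
  show thesis
  proof (rule that[of "\<lambda>x. F x + c"])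
    show "((\<lambda>x. F x + c) has_real_derivative \<phi> x) (at x)" for x
      using DERIV_add[OF F[of x, folded has_real_derivative_iff_has_vector_derivative] DERIV_const[of c]] by simp
    show "F x + c = u x" if "x \<in> {\<eta>..\<xi>}" for x using c[OF that] by simp
  qed
qed

text \<open>\<open>gd\<close> is the inverse of the strictly increasing surjection
  \<open>hd\<close>, so \<open>gdd\<close> is the reciprocal of \<open>hdd\<close> at
  \<open>gd\<close> and lies between 1/c2 and 1/c1. The constant L/c1^3 comes from |1/u - 1/v| = |u
  - v|/(u v), where u - v is Lipschitz with constant L/c1.\<close>

lemma legendre_pair_exists:
  fixes h hd hdd :: "real \<Rightarrow> real"
  assumes h1: "\<And>x. (h has_real_derivative hd x) (at x)" and h2: "\<And>x. (hd has_real_derivative hdd x) (at x)"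
    and c: "0 < c1" and h3: "\<And>x. c1 \<le> hdd x" and h4: "\<And>x. hdd x \<le> c2"
    and L: "0 \<le> L" and h5: "\<And>x y. \<bar>hdd x - hdd y\<bar> \<le> L * \<bar>x - y\<bar>"
  obtains g gd gdd where "legendre_pair (max 1 (max c2 (1 / c1))) (max L (L / c1 ^ 3)) h hd hdd g gd gdd"
proof -
  have lower: "c1 * (y - x) \<le> hd y - hd x" if "x \<le> y" for x y
  proof -
    have "((\<lambda>x. hd x - c1 * x) has_real_derivative hdd x - c1) (at x)" for x
      using DERIV_diff[OF h2 DERIV_cmult_Id[of c1]] by simp
    then have "hd x - c1 * x \<le> hd y - c1 * y"
      by (intro DERIV_nonneg_imp_nondecreasing[OF that, where f = "\<lambda>x. hd x - c1 * x"]) (use h3 in \<open>auto intro!: exI\<close>)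
    then show ?thesis by (simp add: algebra_simps)
  qed
  have lower': "c1 * \<bar>x - y\<bar> \<le> \<bar>hd x - hd y\<bar>" for x y
    using lower[of x y] lower[of y x] by (cases "x \<le> y") (auto simp: abs_if)
  have inj: "inj hd"
  proof (rule injI)
    fix x y assume "hd x = hd y"
    then have "c1 * \<bar>x - y\<bar> \<le> 0" using lower'[of x y] by simp
    then show "x = y" using c by (simp add: mult_le_0_iff)
  qed
  have cont: "isCont hd x" for x using h2 by (rule DERIV_isCont)
  have ex: "\<exists>x. hd x = p" for p
  proof -
    define t where "t = \<bar>p - hd 0\<bar> / c1"
    have t: "0 \<le> t" "c1 * t = \<bar>p - hd 0\<bar>" using c by (simp_all add: t_def)
    have "hd (- t) \<le> p" using lower[of "- t" 0] t by auto
    moreover have "p \<le> hd t" using lower[of 0 t] t by auto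
    moreover have "- t \<le> t" using t by simp
    ultimately show ?thesis using IVT[of hd "- t" p t] cont by auto
  qed
  define gd where "gd = inv hd"
  have "surj hd" unfolding surj_def using ex by metis
  then have fg: "hd (gd p) = p" for p unfolding gd_def by (rule surj_f_inv_f)
  have gf: "gd (hd x) = x" for x unfolding gd_def using inj by simp
  define gdd where "gdd p = 1 / hdd (gd p)" for p
  define g where "g p = p * gd p - h (gd p)" for p
  have pos: "0 < hdd x" for x using h3[of x] c by linarith
  have lipg: "\<bar>gd p - gd q\<bar> \<le> \<bar>p - q\<bar> / c1" for p q
    using lower'[of "gd p" "gd q"] c unfolding fg by (simp add: field_simps)
  have contg: "isCont gd p" for p
  proof -
    have "(1 / c1)-lipschitz_on UNIV gd" using c lipg by (intro lipschitz_onI) (auto simp: dist_real_def)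
    then have "continuous_on UNIV gd" by (rule lipschitz_on_continuous_on)
    then show ?thesis by (simp add: continuous_on_eq_continuous_at)
  qed
  have g2: "(gd has_real_derivative gdd p) (at p)" for p
  proof -
    have "(gd has_real_derivative inverse (hdd (gd p))) (at p)"
      by (rule DERIV_inverse_function[where f = hd and a = "p - 1" and b = "p + 1"])
        (use h2 pos[of "gd p"] fg contg in auto)
    then show ?thesis by (simp add: gdd_def inverse_eq_divide)
  qed
  have g1: "(g has_real_derivative gd p) (at p)" for p
  proof -
    have "((\<lambda>p. p * gd p - h (gd p)) has_real_derivative (1 * gd p + gdd p * p) - hd (gd p) * gdd p) (at p)"
      by (rule DERIV_diff[OF DERIV_mult[OF DERIV_ident g2] DERIV_chain2[OF h1 g2]])
    then show ?thesis unfolding g_def[abs_def] fg by (simp add: mult.commute)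
  qed
  define B where "B = max 1 (max c2 (1 / c1))"
  have c12: "c1 \<le> c2" using h3[of 0] h4[of 0] by linarith
  have B: "1 \<le> B" "c2 \<le> B" "1 / c1 \<le> B" by (simp_all add: B_def)
  have B1: "1 / B \<le> c1" using B(1,3) c by (simp add: field_simps)
  have B2: "1 / B \<le> 1 / c2" using B c c12 by (intro divide_left_mono) auto
  have "legendre_pair B (max L (L / c1 ^ 3)) h hd hdd g gd gdd"
  proof
    show "1 \<le> B" by (rule B)
    show "0 \<le> max L (L / c1 ^ 3)" using L by simp
    fix x y p q :: real
    show "1 / B \<le> hdd x" "hdd x \<le> B" using h3[of x] h4[of x] B B1 by linarith+
    have "L * \<bar>x - y\<bar> \<le> max L (L / c1 ^ 3) * \<bar>x - y\<bar>" by (intro mult_right_mono) auto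
    then show "\<bar>hdd x - hdd y\<bar> \<le> max L (L / c1 ^ 3) * \<bar>x - y\<bar>" using h5[of x y] by linarith
    have "1 / c2 \<le> gdd x" unfolding gdd_def using h4 pos c c12 by (intro divide_left_mono) auto
    then show "1 / B \<le> gdd x" using B2 by linarith
    have "gdd x \<le> 1 / c1" unfolding gdd_def using h3 pos c by (intro divide_left_mono mult_pos_pos) auto
    then show "gdd x \<le> B" using B by linarith
    define u v where "u = hdd (gd x)" and "v = hdd (gd y)"
    have uv: "0 < u" "0 < v" "c1 \<le> u" "c1 \<le> v" using pos h3 by (simp_all add: u_def v_def)
    have "\<bar>gdd x - gdd y\<bar> = \<bar>v - u\<bar> / (u * v)" unfolding gdd_def u_def[symmetric] v_def[symmetric]
      using uv by (simp add: diff_frac_eq abs_divide abs_mult)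
    also have "\<dots> \<le> (L * (\<bar>x - y\<bar> / c1)) / (c1 * c1)"
    proof (intro frac_le mult_mono)
      have "\<bar>v - u\<bar> \<le> L * \<bar>gd x - gd y\<bar>" using h5[of "gd y" "gd x"] unfolding u_def v_def by (simp add: abs_minus_commute)
      also have "\<dots> \<le> L * (\<bar>x - y\<bar> / c1)" using L lipg by (intro mult_left_mono) auto
      finally show "\<bar>v - u\<bar> \<le> L * (\<bar>x - y\<bar> / c1)" .
    qed (use uv c L in auto)
    also have "\<dots> = L / c1 ^ 3 * \<bar>x - y\<bar>" using c by (simp add: power3_eq_cube)
    also have "\<dots> \<le> max L (L / c1 ^ 3) * \<bar>x - y\<bar>" by (intro mult_right_mono) auto
    finally show "\<bar>gdd x - gdd y\<bar> \<le> max L (L / c1 ^ 3) * \<bar>x - y\<bar>" .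
    show "g x = x * gd x - h (gd x)" by (simp add: g_def)
  qed (use h1 h2 g1 g2 fg gf in auto)
  then show thesis unfolding B_def by (rule that)
qed

text \<open>The second derivative is continuous and bounded away from 0, hence of constant sign on
  the interval. After multiplication by this sign it is extended by constants, which preserves its
  bounds and its Lipschitz constant, and integrated twice.\<close>

lemma F_class_extension:
  assumes \<eta>\<xi>: "\<eta> < \<xi>" and c: "0 < c1" and f: "f \<in> F_class {\<eta>..\<xi>} c1 c2" and lip: "L-lipschitz_on {\<eta>..\<xi>} (second_deriv_on {\<eta>..\<xi>} f)"
  obtains s h hd hdd g gd gdd where "s = 1 \<or> s = -1" "\<And>x. x \<in> {\<eta>..\<xi>} \<Longrightarrow> h x = s * f x"
    "legendre_pair (max 1 (max c2 (1 / c1))) (max L (L / c1 ^ 3)) h hd hdd g gd gdd"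
proof -
  define I where "I = {\<eta>..\<xi>}"
  define f1 where "f1 = deriv_on I f"
  define f2 where "f2 = deriv_on I f1"
  have f': "C2_on I f" "\<And>x. x \<in> I \<Longrightarrow> c1 \<le> \<bar>f2 x\<bar> \<and> \<bar>f2 x\<bar> \<le> c2"
    using f unfolding F_class_def I_def[symmetric] f1_def f2_def by auto
  have d: "(f has_vector_derivative f1 x) (at x within I)" "(f1 has_vector_derivative f2 x) (at x within I)" if "x \<in> I" for x
    using f'(1) that unfolding C2_on_def differentiable_on_def
    by (auto simp: f1_def f2_def deriv_on_def[of I f] deriv_on_def[of I f1] deriv_on_def vector_derivative_works[symmetric])
  have cont: "continuous_on I f2" using f'(1) by (simp add: C2_on_def f1_def f2_def)
  have lip': "\<bar>f2 x - f2 y\<bar> \<le> L * \<bar>x - y\<bar>" if "x \<in> I" "y \<in> I" for x y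
    using lipschitz_onD[OF lip[folded I_def f1_def f2_def] that] by (simp add: dist_real_def)
  have L0: "0 \<le> L" using lip by (rule lipschitz_on_nonneg)
  have conn: "is_interval (f2 ` I)"
    unfolding is_interval_connected_1 by (intro connected_continuous_image cont) (simp add: I_def)
  have "\<exists>s. (s = 1 \<or> s = -1) \<and> (\<forall>x\<in>I. c1 \<le> s * f2 x \<and> s * f2 x \<le> c2)"
  proof (cases "\<forall>x\<in>I. 0 \<le> f2 x")
    case True
    then show ?thesis using f'(2) by (intro exI[of _ 1]) fastforce
  next
    case False
    then obtain x0 where x0: "x0 \<in> I" "f2 x0 < 0" by force
    have "f2 x < 0" if "x \<in> I" for x
    proof (rule ccontr)
      assume "\<not> f2 x < 0"
      then have "f2 x0 \<le> 0" "0 \<le> f2 x" using x0 by linarith+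
      then have "0 \<in> f2 ` I" using conn[unfolded is_interval_1, rule_format, OF imageI[OF x0(1)] imageI[OF that], of 0] by blast
      then obtain y where "y \<in> I" "f2 y = 0" by auto
      then show False using f'(2)[of y] c by simp
    qed
    then show ?thesis using f'(2) by (intro exI[of _ "-1"]) force
  qed
  then obtain s where s: "s = 1 \<or> s = -1" "\<And>x. x \<in> I \<Longrightarrow> c1 \<le> s * f2 x \<and> s * f2 x \<le> c2" by blast
  \<comment> \<open>The nearest-point projection onto the interval, which is 1-Lipschitz.\<close>
  define clip where "clip x = max \<eta> (min \<xi> x)" for x
  have clip: "clip x \<in> I" "x \<in> I \<Longrightarrow> clip x = x" "\<bar>clip x - clip y\<bar> \<le> \<bar>x - y\<bar>" for x y
    using \<eta>\<xi> by (auto simp: clip_def I_def max_def min_def)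
  define hdd where "hdd x = s * f2 (clip x)" for x
  have h5: "\<bar>hdd x - hdd y\<bar> \<le> L * \<bar>x - y\<bar>" for x y
  proof -
    have "\<bar>hdd x - hdd y\<bar> = \<bar>f2 (clip x) - f2 (clip y)\<bar>" unfolding hdd_def using s(1) by auto
    also have "\<dots> \<le> L * \<bar>clip x - clip y\<bar>" by (intro lip' clip)
    also have "\<dots> \<le> L * \<bar>x - y\<bar>" using L0 clip(3) by (intro mult_left_mono)
    finally show ?thesis .
  qed
  have conth: "isCont hdd x" for x
  proof -
    have "L-lipschitz_on UNIV hdd" using L0 h5 by (intro lipschitz_onI) (auto simp: dist_real_def)
    then have "continuous_on UNIV hdd" by (rule lipschitz_on_continuous_on)
    then show ?thesis by (simp add: continuous_on_eq_continuous_at)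
  qed
  have "((\<lambda>x. s * f1 x) has_vector_derivative hdd x) (at x within {\<eta>..\<xi>})" if "x \<in> {\<eta>..\<xi>}" for x
    using has_vector_derivative_mult_right[OF d(2)[of x], of s] that clip(2)[of x] unfolding hdd_def I_def by simp
  then obtain hd where hd: "\<And>x. (hd has_real_derivative hdd x) (at x)" "\<And>x. x \<in> {\<eta>..\<xi>} \<Longrightarrow> hd x = s * f1 x"
    by (rule antiderivative_extension[OF _ conth]) blast+
  have "((\<lambda>x. s * f x) has_vector_derivative hd x) (at x within {\<eta>..\<xi>})" if "x \<in> {\<eta>..\<xi>}" for x
    using has_vector_derivative_mult_right[OF d(1)[of x], of s] that hd(2)[of x] unfolding I_def by simp
  then obtain h where h: "\<And>x. (h has_real_derivative hd x) (at x)" "\<And>x. x \<in> {\<eta>..\<xi>} \<Longrightarrow> h x = s * f x"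
    by (rule antiderivative_extension[OF _ DERIV_isCont[OF hd(1)]]) blast+
  have b: "c1 \<le> hdd x" "hdd x \<le> c2" for x using s(2)[OF clip(1)[of x]] by (simp_all add: hdd_def)
  obtain g gd gdd where "legendre_pair (max 1 (max c2 (1 / c1))) (max L (L / c1 ^ 3)) h hd hdd g gd gdd"
    by (rule legendre_pair_exists[OF h(1) hd(1) c b L0 h5]) blast
  then show thesis using that[of s h hd hdd g gd gdd] s(1) h(2) by blast
qed

text \<open>Needed when the function has been replaced by its negative to make it convex: the
  interval is then reflected.\<close>

lemma in_interval_mod1_uminus: "in_interval_mod1 (- \<beta>) (- \<alpha>) (- u) \<longleftrightarrow> in_interval_mod1 \<alpha> \<beta> u"
proof
  assume "in_interval_mod1 (- \<beta>) (- \<alpha>) (- u)"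
  then obtain k :: int where "- u + of_int k \<in> {- \<beta><..<- \<alpha>}" by (auto simp: in_interval_mod1_def)
  then have "u + of_int (- k) \<in> {\<alpha><..<\<beta>}" by auto
  then show "in_interval_mod1 \<alpha> \<beta> u" unfolding in_interval_mod1_def by blast
next
  assume "in_interval_mod1 \<alpha> \<beta> u"
  then obtain k :: int where "u + of_int k \<in> {\<alpha><..<\<beta>}" by (auto simp: in_interval_mod1_def)
  then have "- u + of_int (- k) \<in> {- \<beta><..<- \<alpha>}" by auto
  then show "in_interval_mod1 (- \<beta>) (- \<alpha>) (- u)" unfolding in_interval_mod1_def by blast
qed

lemma frac_pairs_eq: "frac_pairs {\<eta>..\<xi>} Q = prod.swap ` frac_set \<eta> \<xi> (nat \<lfloor>Q\<rfloor>)"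
proof -
  have "(a, q) \<in> frac_pairs {\<eta>..\<xi>} Q \<longleftrightarrow> (q, a) \<in> frac_set \<eta> \<xi> (nat \<lfloor>Q\<rfloor>)" for a q
  proof (cases "1 \<le> q")
    case True
    then have "real q \<le> Q \<longleftrightarrow> q \<le> nat \<lfloor>Q\<rfloor>" by linarith
    moreover have "of_int a / real q \<in> {\<eta>..\<xi>} \<longleftrightarrow> a \<in> frac_range \<eta> \<xi> q" using True by (simp add: mem_frac_range field_simps)
    ultimately show ?thesis using True by (simp add: frac_pairs_def frac_set_def)
  qed (simp add: frac_pairs_def frac_set_def)
  then show ?thesis by (simp add: set_eq_iff)
qed

lemma N_pairs_eq: "N_pairs {\<eta>..\<xi>} Q = card (frac_set \<eta> \<xi> (nat \<lfloor>Q\<rfloor>))"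
  unfolding N_pairs_def frac_pairs_eq by (intro card_image) simp

lemma Z_count_eq:
  assumes P: "\<And>q a. (q, a) \<in> frac_set \<eta> \<xi> (nat \<lfloor>Q\<rfloor>) \<Longrightarrow> in_interval_mod1 \<alpha> \<beta> (real q * f (of_int a / real q)) \<longleftrightarrow> in_interval_mod1 \<alpha>' \<beta>' (frac_values h (q, a))"
  shows "Z_count {\<eta>..\<xi>} f Q \<alpha> \<beta> = card {p \<in> frac_set \<eta> \<xi> (nat \<lfloor>Q\<rfloor>). in_interval_mod1 \<alpha>' \<beta>' (frac_values h p)}"
proof -
  have "{(a, q) \<in> frac_pairs {\<eta>..\<xi>} Q. in_interval_mod1 \<alpha> \<beta> (real q * f (of_int a / real q))}
    = prod.swap ` {p \<in> frac_set \<eta> \<xi> (nat \<lfloor>Q\<rfloor>). in_interval_mod1 \<alpha>' \<beta>' (frac_values h p)}"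
    unfolding frac_pairs_eq using P by (auto simp: set_eq_iff)
  then show ?thesis unfolding Z_count_def by (simp add: card_image)
qed

text \<open>Each denominator q contributes at least q (b - a) - 1 fractions, and for n \<ge> 4/(b -
  a) the total loss n is covered. This converts powers of n into powers of N.\<close>

lemma card_frac_set_ge:
  assumes ab: "a < b" and n: "4 / (b - a) \<le> real n"
  shows "(b - a) / 4 * (real n)\<^sup>2 \<le> real (card (frac_set a b n))"
proof -
  have "real q * (b - a) - 1 \<le> real (card (frac_range a b q))" for q
  proof -
    have "real q * (b - a) - 1 \<le> real_of_int (\<lfloor>real q * b\<rfloor> + 1 - \<lceil>real q * a\<rceil>)"
      unfolding right_diff_distrib of_int_diff of_int_add by linarith
    also have "\<dots> \<le> real (nat (\<lfloor>real q * b\<rfloor> + 1 - \<lceil>real q * a\<rceil>))" by linarith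
    finally show ?thesis unfolding frac_range_def by (simp add: algebra_simps)
  qed
  then have "(\<Sum>q=1..n. real q * (b - a) - 1) \<le> (\<Sum>q=1..n. real (card (frac_range a b q)))" by (intro sum_mono)
  also have "\<dots> = real (card (frac_set a b n))" unfolding frac_set_def by (subst card_SigmaI) auto
  also have "(\<Sum>q=1..n. real q * (b - a) - 1) = (\<Sum>q=1..n. real q) * (b - a) - real n"
    by (simp add: sum_subtractf sum_distrib_right)
  also have "(\<Sum>q=1..n. real q) = real n * (real n + 1) / 2" by (induction n) (auto simp: field_simps)
  finally have 1: "real n * (real n + 1) / 2 * (b - a) - real n \<le> real (card (frac_set a b n))" .
  have "4 \<le> real n * (b - a)" using n ab by (simp add: field_simps)
  then have "real n * 4 \<le> real n * (real n * (b - a))" by (intro mult_left_mono) auto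
  moreover have "0 \<le> real n * (b - a)" using ab by simp
  ultimately show ?thesis using 1 by (simp add: power2_eq_square field_simps)
qed

lemma abs_discr_le: "\<alpha> < \<beta> \<Longrightarrow> \<beta> < \<alpha> + 1 \<Longrightarrow> \<bar>discr {\<eta>..\<xi>} f Q \<alpha> \<beta>\<bar> \<le> real (N_pairs {\<eta>..\<xi>} Q)"
proof -
  assume ab: "\<alpha> < \<beta>" "\<beta> < \<alpha> + 1"
  have "Z_count {\<eta>..\<xi>} f Q \<alpha> \<beta> \<le> N_pairs {\<eta>..\<xi>} Q"
    unfolding Z_count_def N_pairs_def by (intro card_mono finite_frac_pairs) auto
  moreover have "0 \<le> (\<beta> - \<alpha>) * real (N_pairs {\<eta>..\<xi>} Q)" using ab by simp
  moreover have "(\<beta> - \<alpha>) * real (N_pairs {\<eta>..\<xi>} Q) \<le> 1 * real (N_pairs {\<eta>..\<xi>} Q)" using ab by (intro mult_right_mono) auto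
  ultimately show ?thesis unfolding discr_def by linarith
qed

lemma discr_bound:
  fixes \<eta> \<xi> c1 c2 L \<epsilon> :: real
  assumes \<eta>\<xi>: "\<eta> < \<xi>" and c: "0 < c1" and \<epsilon>: "0 < \<epsilon>"
  obtains C where "0 \<le> C" "\<And>f Q \<alpha> \<beta>. f \<in> F_class {\<eta>..\<xi>} c1 c2 \<Longrightarrow> L-lipschitz_on {\<eta>..\<xi>} (second_deriv_on {\<eta>..\<xi>} f) \<Longrightarrow> \<alpha> < \<beta> \<Longrightarrow> \<beta> < \<alpha> + 1 \<Longrightarrow>
     \<bar>discr {\<eta>..\<xi>} f Q \<alpha> \<beta>\<bar> \<le> C * ((\<beta> - \<alpha>) powr (1/2) * log_bound (\<beta> - \<alpha>) * real (N_pairs {\<eta>..\<xi>} Q) powr (3/4)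
                        + real (N_pairs {\<eta>..\<xi>} Q) powr (1/2 + \<epsilon>))"
proof -
  define w where "w = \<xi> - \<eta>"
  have w: "0 < w" using \<eta>\<xi> by (simp add: w_def)
  define B where "B = max 1 (max c2 (1 / c1))"
  \<comment> \<open>The constants have to be chosen before any f is given; that L is nonnegative
    follows only from the Lipschitz condition for some f, hence the absolute values.\<close>
  define L' where "L' = max \<bar>L\<bar> (\<bar>L\<bar> / c1 ^ 3)"
  \<comment> \<open>One bound for both windows: the interval itself and its image under the
    derivative, which is at most B times as long.\<close>
  define R where "R = B * w"
  \<comment> \<open>n^(1+e) corresponds to N^(1/2+e/2), so e may be as large as 2\<epsilon>; the cap
    1 is the range of \<open>discrepancy_frac_set\<close>.\<close>
  define e where "e = min 1 (2 * \<epsilon>)"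
  have B: "1 \<le> B" by (simp add: B_def)
  have L': "0 \<le> L'" by (simp add: L'_def)
  have wR: "w \<le> R" unfolding R_def using mult_right_mono[OF B, of w] w by simp
  have R: "0 \<le> R" using wR w by linarith
  have e: "0 < e" "e \<le> 1" "e \<le> 2 * \<epsilon>" using \<epsilon> by (simp_all add: e_def)
  obtain D where D: "0 \<le> D" "\<And>f fd fdd g gd gdd a b n \<alpha> \<beta>. legendre_pair B L' f fd fdd g gd gdd \<Longrightarrow> a \<le> b \<Longrightarrow> b - a \<le> R \<Longrightarrow> fd b - fd a \<le> R
     \<Longrightarrow> 2 \<le> n \<Longrightarrow> \<alpha> < \<beta> \<Longrightarrow> \<beta> < \<alpha> + 1 \<Longrightarrow>
     \<bar>real (card {p \<in> frac_set a b n. in_interval_mod1 \<alpha> \<beta> (frac_values f p)}) - (\<beta> - \<alpha>) * real (card (frac_set a b n))\<bar>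
     \<le> D * (sqrt (\<beta> - \<alpha>) * log_bound (\<beta> - \<alpha>) * (real n * sqrt (real n)) + real n powr (1 + e))"
    by (rule discrepancy_frac_set[OF B L' R e(1,2)]) blast
  define n0 where "n0 = nat \<lceil>4 / w\<rceil> + 2"
  define M0 where "M0 = (w + 1) * (real n0)\<^sup>2"
  define p where "p = (4 / w) powr (3/4) + (4 / w) powr (1/2 + e / 2)"
  define C where "C = D * p + M0"
  have M0: "0 \<le> M0" using w by (simp add: M0_def)
  have Dp: "0 \<le> D * p" using D(1) by (simp add: p_def)
  have main: "\<bar>discr {\<eta>..\<xi>} f Q \<alpha> \<beta>\<bar> \<le> C * ((\<beta> - \<alpha>) powr (1/2) * log_bound (\<beta> - \<alpha>) * real (N_pairs {\<eta>..\<xi>} Q) powr (3/4)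
                        + real (N_pairs {\<eta>..\<xi>} Q) powr (1/2 + \<epsilon>))"
    if f: "f \<in> F_class {\<eta>..\<xi>} c1 c2" and lip: "L-lipschitz_on {\<eta>..\<xi>} (second_deriv_on {\<eta>..\<xi>} f)" and \<delta>: "\<alpha> < \<beta>" "\<beta> < \<alpha> + 1" for f Q \<alpha> \<beta>
  proof -
    define n where "n = nat \<lfloor>Q\<rfloor>"
    define N where "N = real (N_pairs {\<eta>..\<xi>} Q)"
    define S where "S = sqrt (\<beta> - \<alpha>) * log_bound (\<beta> - \<alpha>)"
    define X where "X = S * N powr (3/4)"
    define Y where "Y = N powr (1/2 + \<epsilon>)"
    have S0: "0 \<le> S" unfolding S_def log_bound_def using \<delta> by (intro mult_nonneg_nonneg) auto
    have X0: "0 \<le> X" "0 \<le> Y" using S0 by (simp_all add: X_def Y_def)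
    have NX: "N = real (card (frac_set \<eta> \<xi> n))" by (simp add: N_def N_pairs_eq n_def)
    have S_eq: "(\<beta> - \<alpha>) powr (1/2) * log_bound (\<beta> - \<alpha>) = S" unfolding S_def using \<delta> by (simp add: powr_half_sqrt)
    have triv: "\<bar>discr {\<eta>..\<xi>} f Q \<alpha> \<beta>\<bar> \<le> N" unfolding N_def by (rule abs_discr_le[OF \<delta>])
    have "\<bar>discr {\<eta>..\<xi>} f Q \<alpha> \<beta>\<bar> \<le> C * (X + Y)"
    proof (cases "N = 0")
      case True
      moreover have "0 \<le> C * (X + Y)" using Dp M0 X0 by (simp add: C_def)
      ultimately show ?thesis using triv by linarith
    next
      case False
      then have N1: "1 \<le> N" unfolding N_def by simp
      have Y1: "1 \<le> Y" unfolding Y_def using N1 \<epsilon> by (intro ge_one_powr_ge_zero) auto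
      show ?thesis
      proof (cases "n < n0")
        case True
        have "N \<le> (w + 1) * (real n)\<^sup>2" unfolding NX w_def using \<eta>\<xi> by (intro card_frac_set_le) simp
        also have "\<dots> \<le> M0" unfolding M0_def using True w by (intro mult_left_mono power_mono) auto
        also have "\<dots> = M0 * 1" by simp
        also have "\<dots> \<le> C * (X + Y)" using Dp M0 X0 Y1 by (intro mult_mono) (auto simp: C_def)
        finally show ?thesis using triv by linarith
      next
        case False
        then have n: "2 \<le> n" "4 / w \<le> real n" unfolding n0_def by linarith+
        have nN: "(real n)\<^sup>2 \<le> 4 / w * N"
          using card_frac_set_ge[OF \<eta>\<xi>, of n] n w unfolding NX w_def[symmetric] by (simp add: field_simps)
        have rn: "0 < real n" using n by simp
        have sq: "real n powr t \<le> (4 / w) powr (t / 2) * N powr (t / 2)" if "0 \<le> t" for t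
        proof -
          have "(real n)\<^sup>2 = real n powr 2" using rn by simp
          then have "real n powr t = ((real n)\<^sup>2) powr (t / 2)" by (simp only: powr_powr) simp
          also have "\<dots> \<le> (4 / w * N) powr (t / 2)" using nN that by (intro powr_mono2) auto
          also have "\<dots> = (4 / w) powr (t / 2) * N powr (t / 2)" using w N1 by (subst powr_mult) auto
          finally show ?thesis .
        qed
        have n1: "real n * sqrt (real n) \<le> p * N powr (3/4)"
        proof -
          have "real n * sqrt (real n) = real n powr 1 * real n powr (1/2)" using rn by (simp add: powr_half_sqrt)
          also have "\<dots> = real n powr (3/2)" unfolding powr_add[symmetric] by simp
          also have "\<dots> \<le> (4 / w) powr (3/4) * N powr (3/4)" using sq[of "3/2"] by simp
          also have "\<dots> \<le> p * N powr (3/4)" unfolding p_def by (intro mult_right_mono) auto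
          finally show ?thesis .
        qed
        have n2: "real n powr (1 + e) \<le> p * Y"
        proof -
          have "real n powr (1 + e) \<le> (4 / w) powr (1/2 + e / 2) * N powr (1/2 + e / 2)" using sq[of "1 + e"] e by (simp add: add_divide_distrib)
          also have "\<dots> \<le> p * Y" unfolding p_def Y_def using e N1 by (intro mult_mono powr_mono) auto
          finally show ?thesis .
        qed
        have "\<bar>L\<bar> = L" using lipschitz_on_nonneg[OF lip] by simp
        then have L'_eq: "max L (L / c1 ^ 3) = L'" by (simp add: L'_def)
        obtain s h hd hdd g gd gdd where h: "s = 1 \<or> s = -1" "\<And>x. x \<in> {\<eta>..\<xi>} \<Longrightarrow> h x = s * f x"
          and pair: "legendre_pair B L' h hd hdd g gd gdd"
          by (rule F_class_extension[OF \<eta>\<xi> c f lip, unfolded L'_eq, folded B_def]) blast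
        interpret legendre_pair B L' h hd hdd g gd gdd by (rule pair)
        have win: "\<xi> - \<eta> \<le> R" "hd \<xi> - hd \<eta> \<le> R" using wR fd_diff(2)[of \<eta> \<xi>] \<eta>\<xi> by (simp_all add: R_def w_def)
        have val: "frac_values h (q, a) = s * (real q * f (of_int a / real q))" if "(q, a) \<in> frac_set \<eta> \<xi> n" for q a
        proof -
          have "0 < q" "a \<in> frac_range \<eta> \<xi> q" using that by (auto simp: frac_set_def)
          then have "of_int a / real q \<in> {\<eta>..\<xi>}" by (simp add: mem_frac_range field_simps)
          then show ?thesis by (simp add: frac_values_def h(2))
        qed
        obtain \<alpha>' \<beta>' where ab': "\<alpha>' < \<beta>'" "\<beta>' < \<alpha>' + 1" "\<beta>' - \<alpha>' = \<beta> - \<alpha>"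
          and Z: "Z_count {\<eta>..\<xi>} f Q \<alpha> \<beta> = card {p \<in> frac_set \<eta> \<xi> n. in_interval_mod1 \<alpha>' \<beta>' (frac_values h p)}"
        proof (cases "s = 1")
          case True
          show thesis
            by (rule that[of \<alpha> \<beta>]) (use \<delta> True val in \<open>auto simp: n_def intro!: Z_count_eq\<close>)
        next
          case False
          then have s: "s = -1" using h(1) by simp
          show thesis
            by (rule that[of "- \<beta>" "- \<alpha>"]) (use \<delta> s val in \<open>auto simp: n_def in_interval_mod1_uminus intro!: Z_count_eq\<close>)
        qed
        have "\<bar>discr {\<eta>..\<xi>} f Q \<alpha> \<beta>\<bar> \<le> D * (S * (real n * sqrt (real n)) + real n powr (1 + e))"
          using D(2)[OF pair less_imp_le[OF \<eta>\<xi>] win n(1) ab'(1,2)] unfolding ab'(3) S_def discr_def Z N_pairs_eq n_def by simp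
        also have "\<dots> \<le> D * (S * (p * N powr (3/4)) + p * Y)" using n1 n2 D(1) S0 by (intro mult_left_mono add_mono) auto
        also have "\<dots> = D * p * (X + Y)" by (simp add: X_def algebra_simps)
        also have "\<dots> \<le> C * (X + Y)" unfolding C_def using M0 X0 by (intro mult_right_mono) auto
        finally show ?thesis .
      qed
    qed
    then show ?thesis unfolding S_eq X_def Y_def N_def .
  qed
  have "0 \<le> C" using Dp M0 by (simp add: C_def)
  then show thesis using main by (rule that)
qed

text \<open>With r = sqrt \<delta> one has ln(1/\<delta>) = 2 ln(1/r) \<le> 2/r. This removes the
  interval from the first bound and so gives the bound for the supremum.\<close>

lemma powr_half_log_bound_le:
  assumes \<delta>: "0 < \<delta>" "\<delta> < 1"
  shows "\<delta> powr (1/2) * log_bound \<delta> \<le> 2"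
proof -
  define r where "r = sqrt \<delta>"
  have r: "0 < r" "r \<le> 1" "\<delta> = r * r" using \<delta> by (simp_all add: r_def)
  have "ln (1 / \<delta>) = 2 * ln (1 / r)" using r(1) unfolding r(3) by (simp add: ln_div ln_mult)
  also have "\<dots> \<le> 2 * (1 / r)" using ln_le_minus_one[of "1 / r"] r by (intro mult_left_mono) (auto simp: field_simps)
  finally have "log_bound \<delta> \<le> 2 * (1 / r)" unfolding log_bound_def using r by (simp add: field_simps)
  then have "r * log_bound \<delta> \<le> r * (2 * (1 / r))" using r by (intro mult_left_mono) auto
  then show ?thesis using r(1) \<delta> by (simp add: powr_half_sqrt r_def)
qed

theorem theorem7:
  fixes \<eta> \<xi> c1 c2 L :: real
  assumes "\<eta> < \<xi>" and "0 < c1" and "c1 \<le> c2"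
  shows "(\<forall>\<epsilon>>0. \<exists>C. \<forall>f \<in> F_class {\<eta>..\<xi>} c1 c2.
            L-lipschitz_on {\<eta>..\<xi>} (second_deriv_on {\<eta>..\<xi>} f) \<longrightarrow>
            (\<forall>Q>1. \<forall>\<alpha> \<beta>. \<alpha> < \<beta> \<and> \<beta> < \<alpha> + 1 \<longrightarrow>
               \<bar>discr {\<eta>..\<xi>} f Q \<alpha> \<beta>\<bar>
                 \<le> C * ((\<beta> - \<alpha>) powr (1/2) * log_bound (\<beta> - \<alpha>) * real (N_pairs {\<eta>..\<xi>} Q) powr (3/4)
                        + real (N_pairs {\<eta>..\<xi>} Q) powr (1/2 + \<epsilon>))))
       \<and> (\<exists>C. \<forall>f \<in> F_class {\<eta>..\<xi>} c1 c2.
            L-lipschitz_on {\<eta>..\<xi>} (second_deriv_on {\<eta>..\<xi>} f) \<longrightarrow>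
            (\<forall>Q>1. discr_sup {\<eta>..\<xi>} f Q \<le> C * real (N_pairs {\<eta>..\<xi>} Q) powr (3/4)))"
proof (intro conjI allI impI)
  fix \<epsilon> :: real assume \<epsilon>: "0 < \<epsilon>"
  obtain C where C: "\<And>f Q \<alpha> \<beta>. f \<in> F_class {\<eta>..\<xi>} c1 c2 \<Longrightarrow> L-lipschitz_on {\<eta>..\<xi>} (second_deriv_on {\<eta>..\<xi>} f) \<Longrightarrow> \<alpha> < \<beta> \<Longrightarrow> \<beta> < \<alpha> + 1 \<Longrightarrow>
     \<bar>discr {\<eta>..\<xi>} f Q \<alpha> \<beta>\<bar> \<le> C * ((\<beta> - \<alpha>) powr (1/2) * log_bound (\<beta> - \<alpha>) * real (N_pairs {\<eta>..\<xi>} Q) powr (3/4)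
                        + real (N_pairs {\<eta>..\<xi>} Q) powr (1/2 + \<epsilon>))"
    using discr_bound[OF assms(1,2) \<epsilon>, of c2 L] by metis
  show "\<exists>C. \<forall>f \<in> F_class {\<eta>..\<xi>} c1 c2.
            L-lipschitz_on {\<eta>..\<xi>} (second_deriv_on {\<eta>..\<xi>} f) \<longrightarrow>
            (\<forall>Q>1. \<forall>\<alpha> \<beta>. \<alpha> < \<beta> \<and> \<beta> < \<alpha> + 1 \<longrightarrow>
               \<bar>discr {\<eta>..\<xi>} f Q \<alpha> \<beta>\<bar>
                 \<le> C * ((\<beta> - \<alpha>) powr (1/2) * log_bound (\<beta> - \<alpha>) * real (N_pairs {\<eta>..\<xi>} Q) powr (3/4)
                        + real (N_pairs {\<eta>..\<xi>} Q) powr (1/2 + \<epsilon>)))"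
    by (intro exI[of _ C] ballI impI allI) (elim conjE, rule C)
next
  \<comment> \<open>For \<epsilon> = 1/4 both terms of the first bound have the exponent
    3/4.\<close>
  obtain C where C: "0 \<le> C" "\<And>f Q \<alpha> \<beta>. f \<in> F_class {\<eta>..\<xi>} c1 c2 \<Longrightarrow> L-lipschitz_on {\<eta>..\<xi>} (second_deriv_on {\<eta>..\<xi>} f) \<Longrightarrow> \<alpha> < \<beta> \<Longrightarrow> \<beta> < \<alpha> + 1 \<Longrightarrow>
     \<bar>discr {\<eta>..\<xi>} f Q \<alpha> \<beta>\<bar> \<le> C * ((\<beta> - \<alpha>) powr (1/2) * log_bound (\<beta> - \<alpha>) * real (N_pairs {\<eta>..\<xi>} Q) powr (3/4)
                        + real (N_pairs {\<eta>..\<xi>} Q) powr (1/2 + 1/4))"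
    by (rule discr_bound[OF assms(1,2), of "1/4" c2 L]) auto
  have "discr_sup {\<eta>..\<xi>} f Q \<le> 3 * C * real (N_pairs {\<eta>..\<xi>} Q) powr (3/4)"
    if f: "f \<in> F_class {\<eta>..\<xi>} c1 c2" "L-lipschitz_on {\<eta>..\<xi>} (second_deriv_on {\<eta>..\<xi>} f)" for f Q
    unfolding discr_sup_def
  proof (rule cSUP_least)
    show "{(\<alpha>, \<beta>). \<alpha> < \<beta> \<and> \<beta> < \<alpha> + 1} \<noteq> ({} :: (real \<times> real) set)"
    proof -
      have "(0, 1/2) \<in> {(\<alpha>, \<beta>). \<alpha> < \<beta> \<and> \<beta> < \<alpha> + (1::real)}" by simp
      then show ?thesis by blast
    qed
    fix ab :: "real \<times> real" assume "ab \<in> {(\<alpha>, \<beta>). \<alpha> < \<beta> \<and> \<beta> < \<alpha> + 1}"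
    then obtain \<alpha> \<beta> where ab: "ab = (\<alpha>, \<beta>)" "\<alpha> < \<beta>" "\<beta> < \<alpha> + 1" by auto
    define M where "M = real (N_pairs {\<eta>..\<xi>} Q) powr (3/4)"
    have M: "0 \<le> M" by (simp add: M_def)
    have "\<bar>discr {\<eta>..\<xi>} f Q \<alpha> \<beta>\<bar> \<le> C * ((\<beta> - \<alpha>) powr (1/2) * log_bound (\<beta> - \<alpha>) * M + M)"
      using C(2)[OF f ab(2,3), of Q] by (simp add: M_def)
    also have "\<dots> \<le> C * (2 * M + M)"
      using ab C(1) M by (intro mult_left_mono add_mono mult_right_mono powr_half_log_bound_le) auto
    finally show "(case ab of (\<alpha>, \<beta>) \<Rightarrow> \<bar>discr {\<eta>..\<xi>} f Q \<alpha> \<beta>\<bar>) \<le> 3 * C * real (N_pairs {\<eta>..\<xi>} Q) powr (3/4)"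
      unfolding ab(1) M_def by simp
  qed
  then show "\<exists>C. \<forall>f \<in> F_class {\<eta>..\<xi>} c1 c2.
            L-lipschitz_on {\<eta>..\<xi>} (second_deriv_on {\<eta>..\<xi>} f) \<longrightarrow>
            (\<forall>Q>1. discr_sup {\<eta>..\<xi>} f Q \<le> C * real (N_pairs {\<eta>..\<xi>} Q) powr (3/4))"
    by (intro exI[of _ "3 * C"] ballI impI allI)
qed

end
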